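(* Let $(X,g,\mu_g)$ be a $2$-parabolic (Riemannian) pseudomanifold (with $\partial X=\emptyset$). Let $f\in W^{1,2}_{\mathrm{loc}}(X)$ be a continuous, weakly subharmonic function such that $\|\nabla f\|_{L^1}$ and $\|\nabla f\|_{L^2}$ are finite. Then $f$ is constant.
   Context: Riemannian polyhedra. A polyhedron is a connected locally compact separable Hausdorff space $X$ homeomorphic, via some $\theta:|K|\to X$, to the space $|K|$ of a countable, locally finite simplicial complex $K$ of finite dimension; $(K,\theta)$ is a triangulation. $|K|$ carries the barycentric distance $\rho(\alpha,\beta)=(\sum_v(\alpha(v)-\beta(v))^2)^{1/2}$ and is affinely Lipschitz-homeomorphically embedded as a closed subset of a Euclidean space. $X$ is a Lipschitz polyhedron if it is a metric space and $\theta$ is a Lipschitz homeomorphism. A Riemannian polyhedron is a Lipschitz polyhedron $X$ such that, for some triangulation, each maximal simplex $s$ (viewed in the Euclidean space) carries a measurable Riemannian metric $g^s=g_{ij}dx^idx^j$ with $\Lambda^{-2}\|\xi\|^2\le g_{ij}(x)\xi^i\xi^j\le\Lambda^2\|\xi\|^2$ for a.e. $x\in s$, with $\Lambda$ independent of $s$. $d_X=d_X^g$ is the associated intrinsic distance: $d_X^g(x,y)$ is the supremum, over null sets $Z$, of the infimum of $g$-lengths of Lipschitz paths from $x$ to $y$ meeting $Z$ only on a parameter set of measure zero. The volume measure $\mu_g$ is given simplexwise by $d\mu_g=\sqrt{\det(g_{ij})}\,dx_1\cdots dx_n$. $X^{k}$ denotes the $k$-skeleton. Admissible: in some (hence any)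 triangulation, all maximal simplexes have the same dimension $n=\dim X$, and for every connected open $U\subset X$ the set $U\setminus X^{n-2}$ is connected. $\partial X$ is the union of all non-maximal simplexes contained in only one maximal simplex; it is always assumed that $\partial X=\emptyset$. An $n$-circuit is a polyhedron of homogeneous dimension $n$ such that every $(n-1)$-simplex is a face of at most two $n$-simplexes (exactly two if $\partial X=\emptyset$) and $X\setminus X^{n-2}$ is connected. A pseudomanifold is an admissible circuit. Sobolev spaces. $W^{1,2}(X)$ is the completion of the space of Lipschitz functions $u:(X,d_X)\to\mathbb R$ with finite norm $\|u\|_{1,2}^2=\int_X(u^2+|\nabla u|^2)\,d\mu_g$, where $\nabla u$ is the Riemannian gradient, defined a.e. on each $n$-simplex. $\mathrm{Lip}_c(X)$: Lipschitz functions with compact support. $W_0^{1,2}(X)$: closure of $\mathrm{Lip}_c(X)$ in $W^{1,2}(X)$ (similarly for domains). $W^{1,2}_{\mathrm{loc}}(X)$: all $u\in L^2_{\mathrm{loc}}(X)$ with $u\in W^{1,2}(U)$ for all relatively compact subdomains $U\subset X$. $\|\nabla f\|_{L^p}=(\int_X|\nabla f|^p\,d\mu_g)^{1/p}$. $f\in W^{1,2}_{\mathrm{loc}}(X)$ is weakly subharmonic if $\int_X\langle\nabla f,\nabla\rho\rangle\,d\mu_g\le 0$ for every non-negative $\rho\in\mathrm{Lip}_c(X)$. $2$-parabolicity. For $E\subset\Omega$, $\mathrm{cap}(E,\Omega)=\inf\int_\Omega|\nabla u|^2\,d\mu_g$ over $u\in W^{1,2}_0(\Omega)$ with $u\ge1$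 on $E$ (equivalently, over such $u$ with $u\le1$ and $u=1$ on a neighborhood of $E$). A domain (connected open set) $\Omega\subset X$ is $2$-parabolic if $\mathrm{cap}(D,\Omega)=0$ for every compact $D\subset\Omega$; $X$ is $2$-parabolic if this holds with $\Omega=X$. *)

theory Defs
  imports "HOL-Analysis.Analysis" "HOL-Combinatorics.Permutations"
begin

section \<open>Simplicial complexes and Lipschitz polyhedra\<close>

text \<open>Countable, locally finite, finite-dimensional complexes.\<close>

definition lf_complex :: "'v set set \<Rightarrow> bool" where
  "lf_complex K \<longleftrightarrow>
     (\<forall>s\<in>K. finite s \<and> s \<noteq> {}) \<and>
     (\<forall>s\<in>K. \<forall>t. t \<subseteq> s \<and> t \<noteq> {} \<longrightarrow> t \<in> K) \<and>
     countable K \<and>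
     (\<forall>v. finite {s\<in>K. v \<in> s}) \<and>
     (\<exists>N. \<forall>s\<in>K. card s \<le> N)"

definition supp :: "('v \<Rightarrow> real) \<Rightarrow> 'v set" where
  "supp \<alpha> = {v. \<alpha> v \<noteq> 0}"

definition geom_space :: "'v set set \<Rightarrow> ('v \<Rightarrow> real) set" where
  "geom_space K = {\<alpha>. (\<forall>v. 0 \<le> \<alpha> v) \<and> supp \<alpha> \<in> K \<and> (\<Sum>v\<in>supp \<alpha>. \<alpha> v) = 1}"

definition bary_dist :: "('v \<Rightarrow> real) \<Rightarrow> ('v \<Rightarrow> real) \<Rightarrow> real" where
  "bary_dist \<alpha> \<beta> = sqrt (\<Sum>v\<in>supp \<alpha> \<union> supp \<beta>. (\<alpha> v - \<beta> v)\<^sup>2)"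

text \<open>The barycentric distance is bounded, so on a noncompact polyhedron a Lipschitz
  homeomorphism can only be required to be Lipschitz locally (equivalently, on compact sets),
  in both directions.\<close>

definition loc_lipschitz ::
  "'p set \<Rightarrow> ('p \<Rightarrow> 'p \<Rightarrow> real) \<Rightarrow> ('q \<Rightarrow> 'q \<Rightarrow> real) \<Rightarrow> ('p \<Rightarrow> 'q) \<Rightarrow> bool" where
  "loc_lipschitz S d d' f \<longleftrightarrow>
     (\<forall>x\<in>S. \<exists>r>0. \<exists>L. \<forall>y\<in>S. \<forall>z\<in>S.
        d x y < r \<and> d x z < r \<longrightarrow> d' (f y) (f z) \<le> L * d y z)"

definition lipschitz_homeo ::
  "'p set \<Rightarrow> ('p \<Rightarrow> 'p \<Rightarrow> real) \<Rightarrow> 'q set \<Rightarrow> ('q \<Rightarrow> 'q \<Rightarrow> real) \<Rightarrow> ('p \<Rightarrow> 'q) \<Rightarrow> bool" where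
  "lipschitz_homeo S d T d' f \<longleftrightarrow>
     bij_betw f S T \<and> loc_lipschitz S d d' f \<and> loc_lipschitz T d' d (inv_into S f)"

text \<open>The data of a Riemannian polyhedron modelled on the metric space type \<^typ>\<open>'a\<close>: a
  complex, a triangulation, the positions of the vertices under the affine embedding of the
  complex in the Euclidean space \<^typ>\<open>'e\<close>, and for each maximal simplex \<open>s\<close> and each point
  \<open>y\<close> of the embedded simplex a bilinear form on \<^typ>\<open>'e\<close>. Only the restriction of this form
  to the directions parallel to \<open>s\<close> is ever used.\<close>

record ('v, 'e, 'a) rpoly =
  simplices :: "'v set set"
  triang :: "('v \<Rightarrow> real) \<Rightarrow> 'a"
  vpos :: "'v \<Rightarrow> 'e"
  gform :: "'v set \<Rightarrow> 'e \<Rightarrow> 'e \<Rightarrow> 'e \<Rightarrow> real"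

definition space_of :: "('v, 'e, 'a) rpoly \<Rightarrow> ('v \<Rightarrow> real) set" where
  "space_of X = geom_space (simplices X)"

definition embed :: "('v, 'e::euclidean_space, 'a) rpoly \<Rightarrow> ('v \<Rightarrow> real) \<Rightarrow> 'e" where
  "embed X \<alpha> = (\<Sum>v\<in>supp \<alpha>. \<alpha> v *\<^sub>R vpos X v)"

definition lipschitz_polyhedron ::
  "('v, 'e::euclidean_space, 'a::metric_space) rpoly \<Rightarrow> bool" where
  "lipschitz_polyhedron X \<longleftrightarrow>
     connected (UNIV :: 'a set) \<and> locally compact (UNIV :: 'a set) \<and>
     (\<exists>C :: 'a set. countable C \<and> closure C = UNIV) \<and>
     lf_complex (simplices X) \<and>
     lipschitz_homeo (space_of X) bary_dist (UNIV :: 'a set) dist (triang X) \<and>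
     lipschitz_homeo (space_of X) bary_dist (embed X ` space_of X) dist (embed X) \<and>
     closed (embed X ` space_of X)"

definition max_simplices :: "('v, 'e, 'a) rpoly \<Rightarrow> 'v set set" where
  "max_simplices X = {s \<in> simplices X. \<forall>t\<in>simplices X. s \<subseteq> t \<longrightarrow> t = s}"

text \<open>\<open>bary\<close>, \<open>flat\<close> and \<open>chart\<close> identify a point of the space with its barycentric coordinates
  and with its image in the Euclidean space; \<open>simplex_at X x\<close> is the simplex whose open
  simplex contains \<open>x\<close>.\<close>

definition bary :: "('v, 'e, 'a) rpoly \<Rightarrow> 'a \<Rightarrow> 'v \<Rightarrow> real" where
  "bary X x = inv_into (space_of X) (triang X) x"

definition flat :: "('v, 'e::euclidean_space, 'a) rpoly \<Rightarrow> 'a \<Rightarrow> 'e" where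
  "flat X x = embed X (bary X x)"

definition chart :: "('v, 'e::euclidean_space, 'a) rpoly \<Rightarrow> 'e \<Rightarrow> 'a" where
  "chart X y = triang X (inv_into (space_of X) (embed X) y)"

definition simplex_at :: "('v, 'e, 'a) rpoly \<Rightarrow> 'a \<Rightarrow> 'v set" where
  "simplex_at X x = supp (bary X x)"

definition cell :: "('v, 'e, 'a) rpoly \<Rightarrow> 'v set \<Rightarrow> 'a set" where
  "cell X s = triang X ` {\<alpha> \<in> space_of X. supp \<alpha> \<subseteq> s}"

definition flat_cell :: "('v, 'e::euclidean_space, 'a) rpoly \<Rightarrow> 'v set \<Rightarrow> 'e set" where
  "flat_cell X s = convex hull (vpos X ` s)"

definition directions :: "('v, 'e::euclidean_space, 'a) rpoly \<Rightarrow> 'v set \<Rightarrow> 'e set" where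
  "directions X s = span {vpos X v - vpos X w | v w. v \<in> s \<and> w \<in> s}"

section \<open>Measurable Riemannian metric and volume\<close>

text \<open>Euclidean coordinates on a simplex are taken with respect to an orthonormal basis of its
  directions and a vertex as origin; nothing below depends on the choice.\<close>

definition frame :: "('v, 'e::euclidean_space, 'a) rpoly \<Rightarrow> 'v set \<Rightarrow> 'e set" where
  "frame X s = (SOME B. B \<subseteq> directions X s \<and> pairwise orthogonal B \<and>
                        (\<forall>b\<in>B. norm b = 1) \<and> span B = directions X s)"

definition origin :: "('v, 'e, 'a) rpoly \<Rightarrow> 'v set \<Rightarrow> 'e" where
  "origin X s = vpos X (SOME v. v \<in> s)"

text \<open>Lebesgue measure (complete) on the embedded simplex \<open>s\<close>, of the dimension of \<open>s\<close>.\<close>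

definition simplex_lebesgue ::
  "('v, 'e::euclidean_space, 'a) rpoly \<Rightarrow> 'v set \<Rightarrow> 'e measure" where
  "simplex_lebesgue X s =
     completion (restrict_space
       (distr (\<Pi>\<^sub>M b\<in>frame X s. (lborel :: real measure)) borel
              (\<lambda>c. origin X s + (\<Sum>b\<in>frame X s. c b *\<^sub>R b)))
       (flat_cell X s))"

text \<open>Leibniz formula for a determinant whose rows and columns are indexed by a finite set.\<close>

definition det_on :: "'i set \<Rightarrow> ('i \<Rightarrow> 'i \<Rightarrow> real) \<Rightarrow> real" where
  "det_on I A = (\<Sum>\<pi> | \<pi> permutes I. of_int (sign \<pi>) * (\<Prod>i\<in>I. A i (\<pi> i)))"

definition riemannian_polyhedron ::
  "('v, 'e::euclidean_space, 'a::metric_space) rpoly \<Rightarrow> bool" where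
  "riemannian_polyhedron X \<longleftrightarrow>
     lipschitz_polyhedron X \<and>
     (\<forall>s\<in>max_simplices X. \<forall>\<xi>\<in>directions X s. \<forall>\<eta>\<in>directions X s.
        (\<lambda>y. gform X s y \<xi> \<eta>) \<in> borel_measurable (simplex_lebesgue X s)) \<and>
     (\<exists>\<Lambda>>0. \<forall>s\<in>max_simplices X. AE y in simplex_lebesgue X s.
        bilinear (gform X s y) \<and>
        (\<forall>\<xi> \<eta>. gform X s y \<xi> \<eta> = gform X s y \<eta> \<xi>) \<and>
        (\<forall>\<xi>\<in>directions X s. (norm \<xi>)\<^sup>2 / \<Lambda>\<^sup>2 \<le> gform X s y \<xi> \<xi> \<and>
                             gform X s y \<xi> \<xi> \<le> \<Lambda>\<^sup>2 * (norm \<xi>)\<^sup>2))"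

definition vol :: "('v, 'e::euclidean_space, 'a::metric_space) rpoly \<Rightarrow> 'a measure" where
  "vol X = completion (measure_of UNIV (sets borel)
     (\<lambda>A. \<integral>\<^sup>+ s. (\<integral>\<^sup>+ y. indicator A (chart X y) *
                       ennreal (sqrt (det_on (frame X s) (gform X s y))) \<partial>simplex_lebesgue X s)
          \<partial>count_space (max_simplices X)))"

text \<open>A tangent vector at a point \<open>x\<close> in the interior of a maximal simplex is a vector of
  \<^typ>\<open>'e\<close> in \<open>directions X (simplex_at X x)\<close>; almost every point is of this kind.\<close>

definition ginner ::
  "('v, 'e::euclidean_space, 'a) rpoly \<Rightarrow> 'a \<Rightarrow> 'e \<Rightarrow> 'e \<Rightarrow> real" where
  "ginner X x \<xi> \<eta> = gform X (simplex_at X x) (flat X x) \<xi> \<eta>"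

definition gnorm :: "('v, 'e::euclidean_space, 'a) rpoly \<Rightarrow> 'a \<Rightarrow> 'e \<Rightarrow> real" where
  "gnorm X x \<xi> = sqrt (ginner X x \<xi> \<xi>)"

section \<open>Intrinsic distance\<close>

definition glength ::
  "('v, 'e::euclidean_space, 'a) rpoly \<Rightarrow> (real \<Rightarrow> 'a) \<Rightarrow> ennreal" where
  "glength X \<gamma> = (\<integral>\<^sup>+ t. indicator {0..1} t *
      ennreal (gnorm X (\<gamma> t) (vector_derivative (\<lambda>\<tau>. flat X (\<gamma> \<tau>)) (at t))) \<partial>lebesgue)"

text \<open>The integrand of \<open>glength\<close> is meaningless where the path runs inside the set of points not
  interior to a maximal simplex. That set is null, so such paths play no role in the supremum.\<close>

definition gdist ::
  "('v, 'e::euclidean_space, 'a::metric_space) rpoly \<Rightarrow> 'a \<Rightarrow> 'a \<Rightarrow> ennreal" where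
  "gdist X x y =
     (SUP Z \<in> null_sets (vol X).
        INF \<gamma> \<in> {\<gamma>. (\<exists>L. L-lipschitz_on {0..1} \<gamma>) \<and> \<gamma> 0 = x \<and> \<gamma> 1 = y \<and>
                     {t\<in>{0..1}. \<gamma> t \<in> Z} \<in> null_sets lebesgue}.
          glength X \<gamma>)"

definition g_lipschitz_on ::
  "('v, 'e::euclidean_space, 'a::metric_space) rpoly \<Rightarrow> 'a set \<Rightarrow> ('a \<Rightarrow> real) \<Rightarrow> bool" where
  "g_lipschitz_on X U u \<longleftrightarrow>
     (\<exists>L\<ge>0. \<forall>x\<in>U. \<forall>y\<in>U. ennreal \<bar>u x - u y\<bar> \<le> ennreal L * gdist X x y)"

section \<open>Admissibility, circuits, pseudomanifolds\<close>

definition skeleton :: "('v, 'e, 'a) rpoly \<Rightarrow> int \<Rightarrow> 'a set" where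
  "skeleton X k = (\<Union>s \<in> {s\<in>simplices X. int (card s) \<le> k + 1}. cell X s)"

definition homogeneous_dim :: "nat \<Rightarrow> ('v, 'e, 'a) rpoly \<Rightarrow> bool" where
  "homogeneous_dim n X \<longleftrightarrow> (\<forall>s\<in>max_simplices X. card s = n + 1)"

definition boundary :: "('v, 'e, 'a) rpoly \<Rightarrow> 'a set" where
  "boundary X = (\<Union>s \<in> {s \<in> simplices X - max_simplices X.
                          \<exists>!t. t \<in> max_simplices X \<and> s \<subseteq> t}. cell X s)"

definition admissible :: "nat \<Rightarrow> ('v, 'e, 'a::metric_space) rpoly \<Rightarrow> bool" where
  "admissible n X \<longleftrightarrow> homogeneous_dim n X \<and>
     (\<forall>U. open U \<and> connected U \<longrightarrow> connected (U - skeleton X (int n - 2)))"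

definition circuit :: "nat \<Rightarrow> ('v, 'e, 'a::metric_space) rpoly \<Rightarrow> bool" where
  "circuit n X \<longleftrightarrow> homogeneous_dim n X \<and>
     (\<forall>s\<in>simplices X. card s = n \<longrightarrow>
        card {t\<in>simplices X. card t = n + 1 \<and> s \<subseteq> t} \<le> 2) \<and>
     connected (UNIV - skeleton X (int n - 2))"

definition riemannian_pseudomanifold ::
  "nat \<Rightarrow> ('v, 'e::euclidean_space, 'a::metric_space) rpoly \<Rightarrow> bool" where
  "riemannian_pseudomanifold n X \<longleftrightarrow> riemannian_polyhedron X \<and> admissible n X \<and> circuit n X"

section \<open>Sobolev spaces\<close>

text \<open>Riemannian gradient of a function at a point interior to a maximal simplex, read in the
  embedded simplex. It exists at almost every point if the function is locally Lipschitz.\<close>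

definition has_rgrad ::
  "('v, 'e::euclidean_space, 'a) rpoly \<Rightarrow> ('a \<Rightarrow> real) \<Rightarrow> 'a \<Rightarrow> 'e \<Rightarrow> bool" where
  "has_rgrad X u x \<xi> \<longleftrightarrow>
     (let s = simplex_at X x in
       s \<in> max_simplices X \<and> \<xi> \<in> directions X s \<and>
       (\<exists>D. ((\<lambda>y. u (chart X y)) has_derivative D) (at (flat X x) within flat_cell X s) \<and>
            (\<forall>\<eta>\<in>directions X s. ginner X x \<xi> \<eta> = D \<eta>)))"

definition rgrad ::
  "('v, 'e::euclidean_space, 'a) rpoly \<Rightarrow> ('a \<Rightarrow> real) \<Rightarrow> 'a \<Rightarrow> 'e" where
  "rgrad X u x = (THE \<xi>. has_rgrad X u x \<xi>)"

definition lip_finite ::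
  "('v, 'e::euclidean_space, 'a::metric_space) rpoly \<Rightarrow> 'a set \<Rightarrow> ('a \<Rightarrow> real) set" where
  "lip_finite X U = {u. g_lipschitz_on X U u \<and>
     (\<integral>\<^sup>+ x. indicator U x * ennreal ((u x)\<^sup>2 + (gnorm X x (rgrad X u x))\<^sup>2) \<partial>vol X) < \<infinity>}"

definition lip_c ::
  "('v, 'e::euclidean_space, 'a::metric_space) rpoly \<Rightarrow> 'a set \<Rightarrow> ('a \<Rightarrow> real) set" where
  "lip_c X U = {u. g_lipschitz_on X UNIV u \<and>
     compact (closure {x. u x \<noteq> 0}) \<and> closure {x. u x \<noteq> 0} \<subseteq> U}"

text \<open>Completions and closures with respect to the norm of \<open>W\<^sup>1\<^sup>,\<^sup>2(U)\<close> are taken concretely: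
  an element is a function \<open>u\<close> together with a vector field \<open>V\<close>, its gradient, such that
  \<open>(u, V)\<close> is an \<open>L\<^sup>2\<close> limit of pairs \<open>(u\<^sub>k, \<nabla>u\<^sub>k)\<close> with \<open>u\<^sub>k\<close> in the class \<open>F\<close>.
  Only the values on \<open>U\<close>, up to null sets, matter.\<close>

definition sobolev_limit ::
  "('v, 'e::euclidean_space, 'a::metric_space) rpoly \<Rightarrow> 'a set \<Rightarrow> ('a \<Rightarrow> real) set
     \<Rightarrow> ('a \<Rightarrow> real) \<Rightarrow> ('a \<Rightarrow> 'e) \<Rightarrow> bool" where
  "sobolev_limit X U F u V \<longleftrightarrow>
     u \<in> borel_measurable (restrict_space (vol X) U) \<and>
     V \<in> borel_measurable (restrict_space (vol X) U) \<and>
     (AE x in vol X. x \<in> U \<longrightarrow> V x \<in> directions X (simplex_at X x)) \<and>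
     (\<exists>w :: nat \<Rightarrow> 'a \<Rightarrow> real. (\<forall>k. w k \<in> F) \<and>
        (\<lambda>k. \<integral>\<^sup>+ x. indicator U x *
               ennreal ((w k x - u x)\<^sup>2 + (gnorm X x (rgrad X (w k) x - V x))\<^sup>2) \<partial>vol X)
        \<longlonglongrightarrow> 0)"

definition W12_grad ::
  "('v, 'e::euclidean_space, 'a::metric_space) rpoly \<Rightarrow> 'a set
     \<Rightarrow> ('a \<Rightarrow> real) \<Rightarrow> ('a \<Rightarrow> 'e) \<Rightarrow> bool" where
  "W12_grad X U u V \<longleftrightarrow> sobolev_limit X U (lip_finite X U) u V"

definition W12_0_grad ::
  "('v, 'e::euclidean_space, 'a::metric_space) rpoly \<Rightarrow> 'a set
     \<Rightarrow> ('a \<Rightarrow> real) \<Rightarrow> ('a \<Rightarrow> 'e) \<Rightarrow> bool" where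
  "W12_0_grad X U u V \<longleftrightarrow> sobolev_limit X U (lip_c X U) u V"

definition W12 ::
  "('v, 'e::euclidean_space, 'a::metric_space) rpoly \<Rightarrow> 'a set \<Rightarrow> ('a \<Rightarrow> real) set" where
  "W12 X U = {u. \<exists>V. W12_grad X U u V}"

definition rel_compact_domain :: "'a::metric_space set \<Rightarrow> bool" where
  "rel_compact_domain U \<longleftrightarrow> open U \<and> connected U \<and> compact (closure U)"

definition L2_loc ::
  "('v, 'e::euclidean_space, 'a::metric_space) rpoly \<Rightarrow> ('a \<Rightarrow> real) set" where
  "L2_loc X = {u \<in> borel_measurable (vol X).
     \<forall>C. compact C \<longrightarrow> (\<integral>\<^sup>+ x. indicator C x * ennreal ((u x)\<^sup>2) \<partial>vol X) < \<infinity>}"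

definition W12_loc ::
  "('v, 'e::euclidean_space, 'a::metric_space) rpoly \<Rightarrow> ('a \<Rightarrow> real) set" where
  "W12_loc X = {u \<in> L2_loc X. \<forall>U. rel_compact_domain U \<longrightarrow> u \<in> W12 X U}"

text \<open>\<open>V\<close> is the gradient of \<open>u \<in> W\<^sup>1\<^sup>,\<^sup>2\<^sub>l\<^sub>o\<^sub>c(X)\<close>. It is unique up to null sets.\<close>

definition W12_loc_grad ::
  "('v, 'e::euclidean_space, 'a::metric_space) rpoly
     \<Rightarrow> ('a \<Rightarrow> real) \<Rightarrow> ('a \<Rightarrow> 'e) \<Rightarrow> bool" where
  "W12_loc_grad X u V \<longleftrightarrow> u \<in> W12_loc X \<and>
     V \<in> borel_measurable (vol X) \<and> (\<forall>U. rel_compact_domain U \<longrightarrow> W12_grad X U u V)"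

text \<open>The \<open>p\<close>-th power of the \<open>L\<^sup>p\<close> norm of a vector field.\<close>

definition Lp_norm_pow ::
  "('v, 'e::euclidean_space, 'a::metric_space) rpoly \<Rightarrow> real \<Rightarrow> ('a \<Rightarrow> 'e) \<Rightarrow> ennreal" where
  "Lp_norm_pow X p V = (\<integral>\<^sup>+ x. ennreal (gnorm X x (V x) powr p) \<partial>vol X)"

definition weakly_subharmonic ::
  "('v, 'e::euclidean_space, 'a::metric_space) rpoly
     \<Rightarrow> ('a \<Rightarrow> real) \<Rightarrow> ('a \<Rightarrow> 'e) \<Rightarrow> bool" where
  "weakly_subharmonic X u V \<longleftrightarrow> W12_loc_grad X u V \<and>
     (\<forall>\<phi>\<in>lip_c X UNIV. (\<forall>x. 0 \<le> \<phi> x) \<longrightarrow>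
        (\<integral>x. ginner X x (V x) (rgrad X \<phi> x) \<partial>vol X) \<le> 0)"

section \<open>Capacity and parabolicity\<close>

text \<open>Elements of the Sobolev space are defined up to null sets, so the constraint on \<open>E\<close> is
  stated on a neighbourhood of \<open>E\<close>: \<open>u \<le> 1\<close>, and \<open>u = 1\<close> near \<open>E\<close>.\<close>

definition cap ::
  "('v, 'e::euclidean_space, 'a::metric_space) rpoly \<Rightarrow> 'a set \<Rightarrow> 'a set \<Rightarrow> ennreal" where
  "cap X E \<Omega> =
     (INF (u, V) \<in> {(u, V). W12_0_grad X \<Omega> u V \<and>
                      (AE x in vol X. x \<in> \<Omega> \<longrightarrow> u x \<le> 1) \<and>
                      (\<exists>N. open N \<and> E \<subseteq> N \<and> N \<subseteq> \<Omega> \<and> (AE x in vol X. x \<in> N \<longrightarrow> u x = 1))}.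
        \<integral>\<^sup>+ x. indicator \<Omega> x * ennreal ((gnorm X x (V x))\<^sup>2) \<partial>vol X)"

definition two_parabolic ::
  "('v, 'e::euclidean_space, 'a::metric_space) rpoly \<Rightarrow> 'a set \<Rightarrow> bool" where
  "two_parabolic X \<Omega> \<longleftrightarrow> open \<Omega> \<and> connected \<Omega> \<and>
     (\<forall>D. compact D \<and> D \<subseteq> \<Omega> \<longrightarrow> cap X D \<Omega> = 0)"

end

theory Submission
  imports Defs
begin

text \<open>By 2-parabolicity there are cutoffs \<open>\<phi>\<close> with \<open>\<phi> \<ge> 1\<close> on a given compact set and arbitrarily small
  energy. Test subharmonicity of \<open>f\<close> with \<open>\<chi>(\<phi>) \<psi>(f)\<close>, where \<open>\<chi>(t) = t\<^sup>2 / (1 + t\<^sup>2)\<close> vanishes to second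
  order at \<open>0\<close> and \<open>\<psi> = arctan + 2\<close> is positive, bounded and increasing. This bounds \<open>\<integral> \<chi>(\<phi>) \<psi>'(f) |\<nabla>f|\<^sup>2\<close>
  by a multiple of \<open>\<parallel>\<nabla>\<phi>\<parallel> \<parallel>\<nabla>f\<parallel>\<close> (norms in \<open>L\<^sup>2\<close>), which can be made arbitrarily small, hence \<open>\<nabla>f = 0\<close>. In
  the interior of a maximal simplex the metric is comparable to the Euclidean one, so by Rademacher's
  theorem and Lipschitz approximation the translates of \<open>f\<close> agree with \<open>f\<close> almost everywhere. Thus \<open>f\<close> is
  constant on every maximal simplex, hence on every open star, and \<open>X\<close> is connected.

  The simplexes are not coordinatized: Rademacher's theorem is proved for a measure on the
  ambient Euclidean space that is invariant only under translations along a subspace.\<close>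

section \<open>Differentiability of Lipschitz functions on the line\<close>

text \<open>The competitor for the capacity, the function \<open>f\<close> and its gradient are
  given only as limits, so the test function is built from Lipschitz approximants. Those of the
  competitor need not lie between 0 and 1 and those of \<open>f\<close> need not be bounded. Hence
  both are composed with bounded functions of bounded derivative, and the approximation error of the
  gradient enters the energy estimate. The approximants of \<open>f\<close> are Lipschitz only on a
  relatively compact domain, which is chosen around the support of the cutoff. They are Lipschitz
  for the intrinsic distance, a supremum over null sets. A Euclidean Lipschitz bound inside a cell
  therefore needs curves that avoid a prescribed null set and are not much longer than the segment.
  The metric is merely measurable. Only its pinching constant \<open>Lam\<close> is available, both
  for the lower bound on the volume density and for the Riesz representative that defines the
  gradient. Energies of order 4^-m are balanced against a Young weight 2^-m. All errors are then
  summable, and limits hold almost everywhere without passing to subsequences.\<close>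

definition slope_set :: "(real \<Rightarrow> real) \<Rightarrow> (real \<Rightarrow> bool) \<Rightarrow> nat \<Rightarrow> real set" where
  "slope_set F P m = \<Union>{{u<..<v} | u v. u < v \<and> v - u < 1 / real (Suc m) \<and> P ((F v - F u) / (v - u))}"

text \<open>The intervals have the point in their interior instead of ending at it. This makes the
  set open for arbitrary F and P, so the exceptional sets built from it are Borel without any
  measurability argument.\<close>

lemma open_slope_set: "open (slope_set F P m)"
  unfolding slope_set_def by auto

lemma mono_emeasure_interval:
  assumes "mono F" "continuous_on UNIV F" "a \<le> b"
  shows "emeasure (interval_measure F) {a..b} = ennreal (F b - F a)"
  using assms by (intro emeasure_interval_measure_Icc) (auto simp: mono_def)

text \<open>Vitali's covering theorem for balls, read on the line. The endpoints of countably many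
  intervals form a null set, so the open intervals cover as well; their union is the open set inside
  which a second application can choose its intervals.\<close>

lemma vitali_intervals:
  fixes E :: "real set" and Q :: "real \<Rightarrow> real \<Rightarrow> bool"
  assumes "\<And>x d. x \<in> E \<Longrightarrow> d > 0 \<Longrightarrow> \<exists>u v. u < x \<and> x < v \<and> v - u < d \<and> Q u v"
  obtains C where "countable C" "\<And>u v. (u, v) \<in> C \<Longrightarrow> u < v \<and> Q u v"
    "disjoint_family_on (\<lambda>(u, v). {u..v}) C" "negligible (E - (\<Union>(u, v)\<in>C. {u..v}))"
    "negligible (E - (\<Union>(u, v)\<in>C. {u<..<v}))"
proof -
  let ?K = "{(u::real, v). u < v \<and> Q u v}"
  have cb: "cball ((fst i + snd i) / 2) ((snd i - fst i) / 2) = {fst i..snd i}" for i :: "real \<times> real"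
    by (auto simp: cball_eq_atLeastAtMost field_simps)
  obtain C where C: "countable C" "C \<subseteq> ?K"
    "pairwise (\<lambda>i j. disjnt (cball ((fst i + snd i) / 2) ((snd i - fst i) / 2))
        (cball ((fst j + snd j) / 2) ((snd j - fst j) / 2))) C"
    "negligible (E - (\<Union>i\<in>C. cball ((fst i + snd i) / 2) ((snd i - fst i) / 2)))"
  proof (rule Vitali_covering_theorem_cballs[of ?K "\<lambda>i. (snd i - fst i) / 2" E "\<lambda>i. (fst i + snd i) / 2"])
    fix x d :: real assume "x \<in> E" "0 < d"
    from assms[OF this] obtain u v where "u < x" "x < v" "v - u < d" "Q u v" by blast
    then show "\<exists>i. i \<in> ?K \<and> x \<in> cball ((fst i + snd i) / 2) ((snd i - fst i) / 2) \<and> (snd i - fst i) / 2 < d"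
      unfolding cb by (intro exI[of _ "(u, v)"]) auto
  next
    fix i assume "i \<in> ?K" then show "0 < (snd i - fst i) / 2" by (auto simp: case_prod_beta)
  next
    fix C
    assume "countable C" "C \<subseteq> ?K"
      "pairwise (\<lambda>i j. disjnt (cball ((fst i + snd i) / 2) ((snd i - fst i) / 2))
        (cball ((fst j + snd j) / 2) ((snd j - fst j) / 2))) C"
      "negligible (E - (\<Union>i\<in>C. cball ((fst i + snd i) / 2) ((snd i - fst i) / 2)))"
    then show thesis by (rule that)
  qed
  have neg: "negligible (E - (\<Union>(u, v)\<in>C. {u..v}))"
    using C(4) unfolding cb by (simp add: case_prod_beta')
  have "negligible (fst ` C \<union> snd ` C)"
    unfolding negligible_iff_null_sets
    by (intro null_sets_completionI countable_imp_null_set_lborel countable_Un countable_image C(1))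
  from negligible_Un[OF neg this]
  have "negligible (E - (\<Union>(u, v)\<in>C. {u<..<v}))"
  proof (rule negligible_subset, safe)
    fix x u v assume "x \<in> E" "x \<notin> snd ` C" "x \<notin> fst ` C" "(u, v) \<in> C" "x \<notin> (\<Union>(u, v)\<in>C. {u<..<v})" "x \<in> {u..v}"
    moreover then have "x \<noteq> u" "x \<noteq> v" by force+
    ultimately show False by force
  qed
  moreover have "disjoint_family_on (\<lambda>(u, v). {u..v}) C"
    using C(3) unfolding cb disjoint_family_on_def pairwise_def disjnt_def case_prod_beta by blast
  ultimately show thesis using that[OF C(1)] C(2) neg by blast
qed

text \<open>Vitali twice: first with the flat intervals inside an almost minimal open superset of the
  exceptional set, then with the steep intervals inside the interiors of the flat ones.\<close>

lemma negligible_slope_gap: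
  fixes F :: "real \<Rightarrow> real"
  assumes F: "mono F" "continuous_on UNIV F" and "0 \<le> r" "r < q"
  shows "negligible ((\<Inter>m. slope_set F (\<lambda>s. s < r) m) \<inter> (\<Inter>m. slope_set F (\<lambda>s. s > q) m))"
    (is "negligible ?E")
proof -
  have "emeasure lborel (?E \<inter> ball 0 (real k)) = 0" for k
  proof -
    define E where "E = ?E \<inter> ball 0 (real k)"
    have E[measurable]: "E \<in> sets borel"
      unfolding E_def by (intro sets.Int sets.countable_INT) (auto intro!: borel_open open_slope_set)
    have fin: "emeasure lborel E < \<infinity>"
      using emeasure_mono[of E "ball 0 (real k)" lborel] emeasure_lborel_ball_finite[of 0 "real k"]
      by (auto simp: E_def intro: le_less_trans)
    have key: "ennreal q * emeasure lborel E \<le> ennreal r * (emeasure lborel E + ennreal \<epsilon>)" if eps: "\<epsilon> > 0" for \<epsilon>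
    proof -
      obtain O' where O': "open O'" "E \<subseteq> O'" "emeasure lborel (O' - E) < ennreal \<epsilon>"
        by (rule outer_regular_lborel[OF E eps])
      have steep: "\<exists>u v. u < x \<and> x < v \<and> v - u < d \<and> {u..v} \<subseteq> S \<and> P ((F v - F u) / (v - u))"
        if asm: "x \<in> (\<Inter>m. slope_set F P m)" "open S" "x \<in> S" "d > 0" for x d S P
      proof -
        obtain e where e: "e > 0" "ball x e \<subseteq> S" using openE[OF asm(2,3)] by metis
        obtain m where m: "1 / real (Suc m) < min d e"
          using e \<open>d > 0\<close> reals_Archimedean[of "min d e"] by (auto simp: inverse_eq_divide)
        from asm(1) have "x \<in> slope_set F P m" by auto
        then obtain u v where uv: "u < x" "x < v" "v - u < 1 / real (Suc m)" "P ((F v - F u) / (v - u))"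
          unfolding slope_set_def by auto
        moreover have "{u..v} \<subseteq> ball x e" using uv m by (auto simp: dist_real_def)
        ultimately show ?thesis using m e by (intro exI[of _ u] exI[of _ v]) auto
      qed
      have steep1: "\<exists>u v. u < x \<and> x < v \<and> v - u < d \<and> {u..v} \<subseteq> O' \<and> (F v - F u) / (v - u) < r"
        if "x \<in> E" "d > 0" for x d
        by (rule steep) (use that O' in \<open>auto simp: E_def\<close>)
      obtain C where C: "countable C" "\<And>u v. (u, v) \<in> C \<Longrightarrow> u < v \<and> {u..v} \<subseteq> O' \<and> (F v - F u) / (v - u) < r"
        "disjoint_family_on (\<lambda>(u, v). {u..v}) C" "negligible (E - (\<Union>(u, v)\<in>C. {u..v}))"
        "negligible (E - (\<Union>(u, v)\<in>C. {u<..<v}))"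
        by (rule vitali_intervals[of E "\<lambda>u v. {u..v} \<subseteq> O' \<and> (F v - F u) / (v - u) < r"], rule steep1, assumption, assumption, rule that)
      define G where "G = (\<Union>(u, v)\<in>C. {u<..<v})"
      have "open G" unfolding G_def by auto
      have steep2: "\<exists>u v. u < x \<and> x < v \<and> v - u < d \<and> {u..v} \<subseteq> G \<and> (F v - F u) / (v - u) > q"
        if "x \<in> E \<inter> G" "d > 0" for x d
        by (rule steep) (use that \<open>open G\<close> in \<open>auto simp: E_def\<close>)
      obtain D where D: "countable D" "\<And>u v. (u, v) \<in> D \<Longrightarrow> u < v \<and> {u..v} \<subseteq> G \<and> (F v - F u) / (v - u) > q"
        "disjoint_family_on (\<lambda>(u, v). {u..v}) D" "negligible ((E \<inter> G) - (\<Union>(u, v)\<in>D. {u..v}))"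
        "negligible (E \<inter> G - (\<Union>(u, v)\<in>D. {u<..<v}))"
        by (rule vitali_intervals[of "E \<inter> G" "\<lambda>u v. {u..v} \<subseteq> G \<and> (F v - F u) / (v - u) > q"], rule steep2, assumption, assumption, rule that)
      \<comment> \<open>The Stieltjes measure of F mediates: an interval of D has mass at least q
        times its length, one of C at most r times its length, and the intervals of D lie inside
        those of C.\<close>
      let ?\<mu> = "interval_measure F"
      have dj: "disjoint_family_on (\<lambda>i. {fst i..snd i}) C" "disjoint_family_on (\<lambda>i. {fst i..snd i}) D"
        using C(3) D(3) by (simp_all add: case_prod_beta')
      have D_un: "(\<Union>(u, v)\<in>D. {u..v}) \<in> sets borel" and C_un: "(\<Union>(u, v)\<in>C. {u..v}) \<in> sets borel"
        using C(1) D(1) by (auto intro!: sets.countable_UN')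
      have "emeasure lborel E \<le> emeasure lborel (\<Union>(u, v)\<in>D. {u..v})"
      proof (rule emeasure_mono_AE)
        have "negligible (E - (\<Union>(u, v)\<in>D. {u..v}))"
          by (rule negligible_subset[OF negligible_Un[OF C(5) D(4)]]) (auto simp: G_def)
        then have "AE x in lebesgue. x \<in> E \<longrightarrow> x \<in> (\<Union>(u, v)\<in>D. {u..v})"
          unfolding negligible_iff_null_sets by (rule AE_I') auto
        then show "AE x in lborel. x \<in> E \<longrightarrow> x \<in> (\<Union>(u, v)\<in>D. {u..v})"
          by (simp add: AE_completion_iff)
      qed (use D_un in simp)
      also have "\<dots> = (\<integral>\<^sup>+ i. emeasure lborel (case i of (u, v) \<Rightarrow> {u..v}) \<partial>count_space D)"
        using D(1) dj by (simp add: case_prod_beta' emeasure_UN_countable)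
      finally have "ennreal q * emeasure lborel E \<le> (\<integral>\<^sup>+ i. ennreal q * emeasure lborel (case i of (u, v) \<Rightarrow> {u..v}) \<partial>count_space D)"
        by (subst nn_integral_cmult) (auto intro: mult_left_mono)
      also have "\<dots> \<le> (\<integral>\<^sup>+ i. emeasure ?\<mu> (case i of (u, v) \<Rightarrow> {u..v}) \<partial>count_space D)"
      proof (rule nn_integral_mono)
        fix i assume "i \<in> space (count_space D)"
        then obtain u v where i: "i = (u, v)" "u < v" "(F v - F u) / (v - u) > q" using D(2) by (cases i) auto
        then have "q * (v - u) \<le> F v - F u" by (simp add: field_simps)
        then show "ennreal q * emeasure lborel (case i of (u, v) \<Rightarrow> {u..v}) \<le> emeasure ?\<mu> (case i of (u, v) \<Rightarrow> {u..v})"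
          using i assms by (simp add: mono_emeasure_interval ennreal_mult[symmetric] ennreal_leI)
      qed
      also have "\<dots> = emeasure ?\<mu> (\<Union>(u, v)\<in>D. {u..v})"
        using D(1) dj by (simp add: case_prod_beta' emeasure_UN_countable)
      also have "\<dots> \<le> emeasure ?\<mu> (\<Union>(u, v)\<in>C. {u..v})"
      proof (rule emeasure_mono)
        have "{u..v} \<subseteq> G" if "(u, v) \<in> D" for u v using D(2)[OF that] by simp
        then have "(\<Union>(u, v)\<in>D. {u..v}) \<subseteq> G" by blast
        also have "G \<subseteq> (\<Union>(u, v)\<in>C. {u..v})"
          unfolding G_def by (rule UN_mono) auto
        finally show "(\<Union>(u, v)\<in>D. {u..v}) \<subseteq> (\<Union>(u, v)\<in>C. {u..v})" .
      qed (use C_un in simp)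
      also have "\<dots> = (\<integral>\<^sup>+ i. emeasure ?\<mu> (case i of (u, v) \<Rightarrow> {u..v}) \<partial>count_space C)"
        using C(1) dj by (simp add: case_prod_beta' emeasure_UN_countable)
      also have "\<dots> \<le> (\<integral>\<^sup>+ i. ennreal r * emeasure lborel (case i of (u, v) \<Rightarrow> {u..v}) \<partial>count_space C)"
      proof (rule nn_integral_mono)
        fix i assume "i \<in> space (count_space C)"
        then obtain u v where i: "i = (u, v)" "u < v" "(F v - F u) / (v - u) < r" using C(2) by (cases i) auto
        then have "F v - F u \<le> r * (v - u)" by (simp add: field_simps)
        then show "emeasure ?\<mu> (case i of (u, v) \<Rightarrow> {u..v}) \<le> ennreal r * emeasure lborel (case i of (u, v) \<Rightarrow> {u..v})"
          using i assms by (simp add: mono_emeasure_interval ennreal_mult[symmetric] ennreal_leI)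
      qed
      also have "\<dots> = ennreal r * emeasure lborel (\<Union>(u, v)\<in>C. {u..v})"
        using C(1) dj by (simp add: case_prod_beta' emeasure_UN_countable nn_integral_cmult)
      also have "\<dots> \<le> ennreal r * emeasure lborel O'"
        using C(2) O'(1) by (intro mult_left_mono emeasure_mono) auto
      also have "emeasure lborel O' = emeasure lborel E + emeasure lborel (O' - E)"
        using O' by (subst plus_emeasure) (auto intro!: arg_cong[where f="emeasure lborel"])
      also have "ennreal r * \<dots> \<le> ennreal r * (emeasure lborel E + ennreal \<epsilon>)"
        using O' by (intro mult_left_mono add_left_mono) auto
      finally show ?thesis .
    qed
    obtain e where e: "emeasure lborel E = ennreal e" "e \<ge> 0"
      using fin by (cases "emeasure lborel E") auto
    have *: "q * e \<le> r * (e + \<epsilon>)" if "\<epsilon> > 0" for \<epsilon>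
      using key[OF that] e that assms by (simp add: ennreal_mult[symmetric] ennreal_plus[symmetric] del: ennreal_plus)
    have "q * e \<le> r * e + \<epsilon>" if "\<epsilon> > 0" for \<epsilon>
    proof (cases "r = 0")
      case True
      then show ?thesis using *[of 1] that by simp
    next
      case False
      then show ?thesis using *[of "\<epsilon> / r"] that \<open>0 \<le> r\<close> by (simp add: distrib_left)
    qed
    then have "q * e \<le> r * e" by (rule field_le_epsilon)
    then have "e = 0" using e assms by (simp add: mult_le_cancel_right)
    then show ?thesis using e E_def by simp
  qed
  then have "?E \<inter> ball 0 (real k) \<in> null_sets lborel" for k
    by (intro null_setsI) (simp, intro sets.Int sets.countable_INT, auto intro!: borel_open open_slope_set)
  then have "(\<Union>k. ?E \<inter> ball 0 (real k)) \<in> null_sets lborel" by blast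
  also have "(\<Union>k. ?E \<inter> ball 0 (real k)) = ?E"
    by (auto simp: real_arch_simple intro: reals_Archimedean2)
  finally show ?thesis by (simp add: negligible_iff_null_sets null_sets_completionI)
qed

text \<open>Outside the gap sets of all rational pairs r < q the slopes of shrinking intervals
  around the point converge. Their limit l is the infimum of the rational eventual upper bounds; if
  slopes below l - e recurred, rationals r < q between l - e and l would put the point into a
  gap.\<close>

lemma mono_lipschitz_differentiable:
  fixes F :: "real \<Rightarrow> real"
  assumes F: "mono F" and L: "L-lipschitz_on UNIV F"
  shows "AE x in lborel. \<exists>d. (F has_real_derivative d) (at x)"
proof -
  have cont: "continuous_on UNIV F" using L by (rule lipschitz_on_continuous_on)
  define N where "N = (\<Union>r\<in>{r\<in>\<rat>. 0 \<le> r}. \<Union>q\<in>{q\<in>\<rat>. r < q}.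
      (\<Inter>m. slope_set F (\<lambda>s. s < r) m) \<inter> (\<Inter>m. slope_set F (\<lambda>s. s > q) m))"
  have "negligible N"
    unfolding N_def negligible_iff_null_sets
    by (intro null_sets_UN') (auto simp: countable_rat negligible_iff_null_sets[symmetric] intro!: negligible_slope_gap[OF F cont] countable_subset[OF _ countable_rat])
  moreover have "\<exists>d. (F has_real_derivative d) (at x)" if "x \<notin> N" for x
  proof -
    define S where "S m u v \<longleftrightarrow> u < x \<and> x < v \<and> v - u < 1 / real (Suc m)" for m u v
    have S0: "0 \<le> (F v - F u) / (v - u)" "(F v - F u) / (v - u) \<le> L" if "S m u v" for m u v
    proof -
      have "u < v" using that by (auto simp: S_def)
      moreover have "F u \<le> F v" using F \<open>u < v\<close> by (simp add: mono_def)
      moreover have "\<bar>F v - F u\<bar> \<le> L * \<bar>v - u\<bar>"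
        using L by (auto simp: lipschitz_on_def dist_real_def)
      ultimately show "0 \<le> (F v - F u) / (v - u)" "(F v - F u) / (v - u) \<le> L" by (auto simp: field_simps)
    qed
    define A where "A = {q\<in>\<rat>. \<exists>m. \<forall>u v. S m u v \<longrightarrow> (F v - F u) / (v - u) \<le> q}"
    have notin: "x \<notin> slope_set F P m \<longleftrightarrow> (\<forall>u v. S m u v \<longrightarrow> \<not> P ((F v - F u) / (v - u)))" for P m
    proof -
      have "x \<in> slope_set F P m \<longleftrightarrow> (\<exists>u v. S m u v \<and> P ((F v - F u) / (v - u)))"
      proof
        assume "x \<in> slope_set F P m"
        then obtain u v where "x \<in> {u<..<v}" "u < v \<and> v - u < 1 / real (Suc m) \<and> P ((F v - F u) / (v - u))"
          unfolding slope_set_def by blast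
        then show "\<exists>u v. S m u v \<and> P ((F v - F u) / (v - u))" unfolding S_def by auto
      next
        assume "\<exists>u v. S m u v \<and> P ((F v - F u) / (v - u))"
        then obtain u v where "x \<in> {u<..<v}" "u < v \<and> v - u < 1 / real (Suc m) \<and> P ((F v - F u) / (v - u))"
          unfolding S_def by force
        then show "x \<in> slope_set F P m" unfolding slope_set_def by blast
      qed
      then show ?thesis by blast
    qed
    have Ange: "A \<noteq> {}"
    proof -
      obtain q where "q \<in> \<rat>" "L < q" using Rats_dense_in_real[of L "L+1"] by auto
      then show ?thesis using S0 unfolding A_def by force
    qed
    have bdd: "0 \<le> q" if "q \<in> A" for q
    proof -
      from that obtain m where m: "\<And>u v. S m u v \<Longrightarrow> (F v - F u) / (v - u) \<le> q" by (auto simp: A_def)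
      define h where "h = 1 / (3 * real (Suc m))"
      have h: "0 < h" "1 / real (Suc m) = 3 * h"
        unfolding h_def by (simp_all del: of_nat_Suc)
      then have "S m (x - h) (x + h)" unfolding S_def h(2) by auto
      from m[OF this] S0(1)[OF this] show ?thesis by linarith
    qed
    have bb: "bdd_below A" using bdd by (rule bdd_belowI)
    define l where "l = Inf A"
    have "0 \<le> l" unfolding l_def using Ange bdd by (rule cInf_greatest)
    have up: "\<exists>m. \<forall>u v. S m u v \<longrightarrow> (F v - F u) / (v - u) \<le> l + e" if "e > 0" for e
    proof -
      have "Inf A < l + e" using that l_def by simp
      then obtain q where "q \<in> A" "q < l + e" using cInf_lessD[OF Ange] by blast
      then show ?thesis unfolding A_def by fastforce
    qed
    have low: "\<exists>m. \<forall>u v. S m u v \<longrightarrow> l - e \<le> (F v - F u) / (v - u)" if "e > 0" for e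
    proof (cases "l - e \<le> 0")
      case True then show ?thesis using S0 by (meson dual_order.trans)
    next
      case False
      obtain r where r: "r \<in> \<rat>" "l - e < r" "r < l" using Rats_dense_in_real[of "l - e" l] \<open>e > 0\<close> by auto
      obtain q where q: "q \<in> \<rat>" "r < q" "q < l" using Rats_dense_in_real[of r l] r by auto
      have "q \<notin> A" using q bb cInf_lower[of q A] unfolding l_def by auto
      then have steep: "x \<in> (\<Inter>m. slope_set F (\<lambda>s. s > q) m)"
        using notin[of "\<lambda>s. s > q"] q(1) unfolding A_def by (auto simp: not_less)
      have "x \<notin> (\<Inter>m. slope_set F (\<lambda>s. s < r) m)"
      proof (rule notI)
        assume *: "x \<in> (\<Inter>m. slope_set F (\<lambda>s. s < r) m)"
        have "0 \<le> r" using r(2) False by linarith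
        then show False using \<open>x \<notin> N\<close> r(1) q(1,2) * steep
          unfolding N_def by blast
      qed
      then obtain m where "x \<notin> slope_set F (\<lambda>s. s < r) m" by auto
      then have "\<forall>u v. S m u v \<longrightarrow> r \<le> (F v - F u) / (v - u)" using notin by (auto simp: not_less)
      then show ?thesis using r by (intro exI[of _ m]) force
    qed
    \<comment> \<open>A difference quotient at x has x as an endpoint, whereas
      \<open>slope_set\<close> knows only intervals with x inside. Widening the interval on both
      sides and using continuity places its slope in any closed set that contains the
      others.\<close>
    have ends: "(F v - F u) / (v - u) \<in> T"
      if "u \<le> x" "x \<le> v" "u < v" "v - u < 1 / real (Suc m)" "closed T"
        "\<And>u v. S m u v \<Longrightarrow> (F v - F u) / (v - u) \<in> T" for u v m T
    proof -
      let ?u = "\<lambda>n. u - 1 / real (Suc n)" and ?v = "\<lambda>n. v + 1 / real (Suc n)"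
      have iF: "isCont F y" for y using cont by (simp add: continuous_on_eq_continuous_at)
      have z: "(\<lambda>n. 1 / real (Suc n)) \<longlonglongrightarrow> 0" using LIMSEQ_inverse_real_of_nat by (simp add: inverse_eq_divide)
      have lu: "?u \<longlonglongrightarrow> u" using tendsto_diff[OF tendsto_const[of u] z] by simp
      have lv: "?v \<longlonglongrightarrow> v" using tendsto_add[OF tendsto_const[of v] z] by simp
      have lim: "(\<lambda>n. (F (?v n) - F (?u n)) / (?v n - ?u n)) \<longlonglongrightarrow> (F v - F u) / (v - u)"
        using that(3) by (intro tendsto_intros lu lv isCont_tendsto_compose[OF iF]) auto
      have "(\<lambda>n. ?v n - ?u n) \<longlonglongrightarrow> v - u" by (intro tendsto_intros lu lv)
      then have "eventually (\<lambda>n. ?v n - ?u n < 1 / real (Suc m)) sequentially"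
        using that(4) by (rule order_tendstoD)
      then have "eventually (\<lambda>n. (F (?v n) - F (?u n)) / (?v n - ?u n) \<in> T) sequentially"
      proof eventually_elim
        case (elim n)
        have "0 < 1 / real (Suc n)" by simp
        then have "S m (?u n) (?v n)" using that(1,2) elim unfolding S_def by (intro conjI; linarith)
        then show ?case by (rule that(6))
      qed
      from Lim_in_closed_set[OF \<open>closed T\<close> this _ lim] show ?thesis by simp
    qed
    have "(F has_real_derivative l) (at x)"
      unfolding has_field_derivative_iff
    proof (rule tendstoI)
      fix e :: real assume "e > 0"
      obtain m1 where m1: "\<And>u v. S m1 u v \<Longrightarrow> (F v - F u) / (v - u) \<le> l + e / 2" using up[of "e/2"] \<open>e > 0\<close> by auto
      obtain m2 where m2: "\<And>u v. S m2 u v \<Longrightarrow> l - e / 2 \<le> (F v - F u) / (v - u)" using low[of "e/2"] \<open>e > 0\<close> by auto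
      define m where "m = max m1 m2"
      have m: "(F v - F u) / (v - u) \<in> {l - e/2..l + e/2}" if "S m u v" for u v
      proof -
        have "1 / real (Suc m) \<le> 1 / real (Suc m1)" "1 / real (Suc m) \<le> 1 / real (Suc m2)"
          unfolding m_def by (auto intro!: divide_left_mono)
        then have "S m1 u v" "S m2 u v" using that unfolding S_def by auto
        then show ?thesis using m1 m2 by auto
      qed
      have "dist ((F y - F x) / (y - x)) l < e" if "y \<noteq> x" "dist y x < 1 / real (Suc m)" for y
      proof -
        have "(F y - F x) / (y - x) \<in> {l - e/2..l + e/2}"
        proof (cases "y < x")
          case True
          have "(F x - F y) / (x - y) \<in> {l - e/2..l + e/2}"
            by (rule ends[of y x m, OF _ _ _ _ _ m]) (use True that in \<open>auto simp: dist_real_def\<close>)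
          moreover have "(F x - F y) / (x - y) = (F y - F x) / (y - x)"
            using minus_divide_divide[of "F y - F x" "y - x"] by simp
          ultimately show ?thesis by simp
        next
          case False
          show ?thesis
            by (rule ends[of x y m, OF _ _ _ _ _ m]) (use False that in \<open>auto simp: dist_real_def\<close>)
        qed
        then show ?thesis using \<open>e > 0\<close> by (auto simp: dist_real_def abs_less_iff)
      qed
      then show "\<forall>\<^sub>F y in at x. dist ((F y - F x) / (y - x)) l < e"
        unfolding eventually_at by (intro exI[of _ "1 / real (Suc m)"]) auto
    qed
    then show ?thesis by blast
  qed
  ultimately have "AE x in lebesgue. \<exists>d. (F has_real_derivative d) (at x)"
    by (intro AE_I'[of N]) (auto simp: negligible_iff_null_sets)
  then show ?thesis by (simp add: AE_completion_iff)
qed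

theorem lipschitz_real_differentiable_AE:
  fixes F :: "real \<Rightarrow> real"
  assumes L: "L-lipschitz_on UNIV F"
  shows "AE x in lborel. \<exists>d. (F has_real_derivative d) (at x)"
proof -
  have L0: "0 \<le> L" using L by (auto simp: lipschitz_on_def)
  \<comment> \<open>The added linear term compensates any decrease of F and is differentiable, so it
    can be subtracted again.\<close>
  let ?G = "\<lambda>x. F x + L * x"
  have "mono ?G"
  proof (rule monoI)
    fix x y :: real assume "x \<le> y"
    moreover have "\<bar>F x - F y\<bar> \<le> L * \<bar>x - y\<bar>" using L by (auto simp: lipschitz_on_def dist_real_def)
    ultimately show "?G x \<le> ?G y" by (auto simp: algebra_simps)
  qed
  moreover have "(L + L * 1)-lipschitz_on UNIV ?G"
    by (intro lipschitz_on_add L) (use L0 in \<open>auto simp: lipschitz_on_def dist_real_def abs_mult right_diff_distrib[symmetric]\<close>)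
  ultimately have "AE x in lborel. \<exists>d. (?G has_real_derivative d) (at x)"
    by (rule mono_lipschitz_differentiable)
  then show ?thesis
  proof eventually_elim
    case (elim x)
    then obtain d where "(?G has_real_derivative d) (at x)" by blast
    from DERIV_diff[OF this DERIV_cmult_Id[of L]]
    have "((\<lambda>x. ?G x - L * x) has_real_derivative d - L) (at x)" by simp
    then show ?case by auto
  qed
qed

section \<open>Measures invariant along a subspace\<close>

text \<open>The limit is replaced by countable quantifiers and a non-strict inequality. For a
  quotient depending continuously on a point, this exhibits the set of points with a limit as a
  countable intersection of countable unions of closed sets.\<close>

lemma limit_at_0_iff_Cauchy:
  fixes q :: "real \<Rightarrow> real"
  shows "(\<exists>l. (q \<longlongrightarrow> l) (at 0)) \<longleftrightarrow>
    (\<forall>k. \<exists>m. \<forall>s t. s \<noteq> 0 \<and> t \<noteq> 0 \<and> \<bar>s\<bar> < 1 / real (Suc m) \<and> \<bar>t\<bar> < 1 / real (Suc m) \<longrightarrow>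
      \<bar>q s - q t\<bar> \<le> 1 / real (Suc k))" (is "?L \<longleftrightarrow> ?R")
proof
  assume ?L
  then obtain l where l: "(q \<longlongrightarrow> l) (at 0)" by blast
  show ?R
  proof
    fix k
    have "0 < 1 / (2 * real (Suc k))" by simp
    from tendstoD[OF l this] obtain d where d: "d > 0" "\<And>x. x \<noteq> 0 \<Longrightarrow> \<bar>x\<bar> < d \<Longrightarrow> \<bar>q x - l\<bar> < 1 / (2 * real (Suc k))"
      unfolding eventually_at by (auto simp: dist_real_def)
    obtain m where m: "1 / real (Suc m) < d"
      using reals_Archimedean[OF \<open>d > 0\<close>] by (auto simp: inverse_eq_divide)
    have "\<bar>q s - q t\<bar> \<le> 1 / real (Suc k)"
      if "s \<noteq> 0" "t \<noteq> 0" "\<bar>s\<bar> < 1 / real (Suc m)" "\<bar>t\<bar> < 1 / real (Suc m)" for s t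
    proof -
      define c where "c = 1 / (2 * real (Suc k))"
      have "\<bar>q s - l\<bar> < c" "\<bar>q t - l\<bar> < c"
        using d m that unfolding c_def by auto
      moreover have "1 / real (Suc k) = 2 * c" by (simp add: c_def del: of_nat_Suc)
      ultimately show ?thesis by linarith
    qed
    then show "\<exists>m. \<forall>s t. s \<noteq> 0 \<and> t \<noteq> 0 \<and> \<bar>s\<bar> < 1 / real (Suc m) \<and> \<bar>t\<bar> < 1 / real (Suc m) \<longrightarrow>
      \<bar>q s - q t\<bar> \<le> 1 / real (Suc k)" by blast
  qed
next
  assume R: ?R
  \<comment> \<open>The second \<open>Suc\<close> makes \<open>a n\<close> strictly smaller than
    \<open>1 / real (Suc m)\<close> already at n = m.\<close>
  define a where "a n = 1 / real (Suc (Suc n))" for n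
  have a0: "a n \<noteq> 0" "0 < a n" for n by (auto simp: a_def)
  have a_less: "\<bar>a n\<bar> < 1 / real (Suc m)" if "n \<ge> m" for n m
    using that by (simp add: a_def field_simps)
  have "Cauchy (\<lambda>n. q (a n))"
    unfolding Cauchy_def dist_real_def
  proof (intro allI impI)
    fix e :: real assume "e > 0"
    then obtain k where k: "1 / real (Suc k) < e" using reals_Archimedean by (auto simp: inverse_eq_divide)
    obtain m where "\<forall>s t. s \<noteq> 0 \<and> t \<noteq> 0 \<and> \<bar>s\<bar> < 1 / real (Suc m) \<and> \<bar>t\<bar> < 1 / real (Suc m) \<longrightarrow>
      \<bar>q s - q t\<bar> \<le> 1 / real (Suc k)" using R by blast
    then have "\<bar>q (a i) - q (a j)\<bar> < e" if "i \<ge> m" "j \<ge> m" for i j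
      using a_less[OF that(1)] a_less[OF that(2)] a0 k by (meson le_less_trans)
    then show "\<exists>M. \<forall>m\<ge>M. \<forall>n\<ge>M. \<bar>q (a m) - q (a n)\<bar> < e" by blast
  qed
  then obtain l where l: "(\<lambda>n. q (a n)) \<longlonglongrightarrow> l" using Cauchy_convergent convergent_def by blast
  have "(q \<longlongrightarrow> l) (at 0)"
  proof (rule tendstoI)
    fix e :: real assume "e > 0"
    then obtain k where k: "1 / real (Suc k) < e" using reals_Archimedean by (auto simp: inverse_eq_divide)
    obtain m where m: "\<And>s t. s \<noteq> 0 \<Longrightarrow> t \<noteq> 0 \<Longrightarrow> \<bar>s\<bar> < 1 / real (Suc m) \<Longrightarrow> \<bar>t\<bar> < 1 / real (Suc m) \<Longrightarrow>
      \<bar>q s - q t\<bar> \<le> 1 / real (Suc k)" using R by blast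
    have "\<bar>q t - l\<bar> \<le> 1 / real (Suc k)" if t: "t \<noteq> 0" "\<bar>t\<bar> < 1 / real (Suc m)" for t
    proof (rule LIMSEQ_le_const2)
      show "(\<lambda>n. \<bar>q t - q (a n)\<bar>) \<longlonglongrightarrow> \<bar>q t - l\<bar>" by (intro tendsto_intros l)
      show "\<exists>N. \<forall>n\<ge>N. \<bar>q t - q (a n)\<bar> \<le> 1 / real (Suc k)"
        using m[OF t(1) a0(1) t(2) a_less] by blast
    qed
    then show "\<forall>\<^sub>F x in at 0. dist (q x) l < e"
      unfolding eventually_at dist_real_def using k
      by (intro exI[of _ "1 / real (Suc m)"]) (auto intro: le_less_trans)
  qed
  then show ?L by blast
qed

text \<open>The model is Lebesgue measure on an affine subspace parallel to W, seen as a Borel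
  measure on the ambient space. Finiteness on bounded sets supplies sigma-finiteness for Tonelli and
  the dominating functions for limits under the integral.\<close>

locale invariant_measure =
  fixes M :: "'e::euclidean_space measure" and W :: "'e set"
  assumes sets_M [measurable_cong]: "sets M = sets borel"
    and W: "subspace W"
    and translation: "\<And>w. w \<in> W \<Longrightarrow> distr M borel (\<lambda>x. x + w) = M"
    and finite_bounded: "\<And>A. bounded A \<Longrightarrow> A \<in> sets borel \<Longrightarrow> emeasure M A < \<infinity>"
begin

lemma space_M [simp]: "space M = UNIV"
  using sets_eq_imp_space_eq[OF sets_M] by simp

sublocale sigma_finite_measure M
proof
  have "emeasure M (ball 0 (real n)) \<noteq> \<infinity>" for n
    using finite_bounded[of "ball 0 (real n)"] by simp
  moreover have "(\<Union>n. ball 0 (real n)) = (UNIV :: 'e set)"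
    by (auto intro: reals_Archimedean2)
  ultimately show "\<exists>A. countable A \<and> A \<subseteq> sets M \<and> \<Union> A = space M \<and> (\<forall>a\<in>A. emeasure M a \<noteq> \<infinity>)"
    by (intro exI[of _ "range (\<lambda>n. ball 0 (real n))"]) (auto simp: sets_M)
qed

lemma nn_integral_translate:
  assumes "w \<in> W" and f [measurable]: "f \<in> borel_measurable borel"
  shows "(\<integral>\<^sup>+ x. f (x + w) \<partial>M) = (\<integral>\<^sup>+ x. f x \<partial>M)"
  by (subst (2) translation[OF assms(1), symmetric]) (simp add: nn_integral_distr)

lemma integral_translate:
  fixes f :: "'e \<Rightarrow> real"
  assumes "w \<in> W" and f [measurable]: "f \<in> borel_measurable borel"
  shows "(\<integral>x. f (x + w) \<partial>M) = (\<integral>x. f x \<partial>M)"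
  by (subst (2) translation[OF assms(1), symmetric]) (simp add: integral_distr)

text \<open>Tonelli along the direction \<open>w\<close>; averaging the translates of \<open>N\<close> replaces a choice of
  coordinates containing \<open>w\<close>.\<close>

lemma null_set_along_lines:
  assumes w: "w \<in> W" and N [measurable]: "N \<in> sets borel"
    and line: "\<And>x. AE t in lborel. x + t *\<^sub>R w \<notin> N"
  shows "N \<in> null_sets M"
proof -
  interpret pair_sigma_finite M "lborel :: real measure" ..
  have tw: "t *\<^sub>R w \<in> W" for t using w W by (simp add: subspace_mul)
  have "emeasure M N = (\<integral>\<^sup>+ t. indicator {0..1::real} t * emeasure M N \<partial>lborel)"
    by (simp add: nn_integral_multc)
  also have "\<dots> = (\<integral>\<^sup>+ t. (\<integral>\<^sup>+ x. indicator {0..1::real} t * indicator N (x + t *\<^sub>R w) \<partial>M) \<partial>lborel)"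
  proof (rule nn_integral_cong)
    fix t :: real
    have "emeasure M N = (\<integral>\<^sup>+ x. indicator N (x + t *\<^sub>R w) \<partial>M)"
      using nn_integral_translate[OF tw, of "indicator N" t] by (simp add: sets_M)
    then show "indicator {0..1} t * emeasure M N = (\<integral>\<^sup>+ x. indicator {0..1::real} t * indicator N (x + t *\<^sub>R w) \<partial>M)"
      by (simp add: nn_integral_cmult)
  qed
  also have "\<dots> = (\<integral>\<^sup>+ x. (\<integral>\<^sup>+ t. indicator {0..1::real} t * indicator N (x + t *\<^sub>R w) \<partial>lborel) \<partial>M)"
    by (rule Fubini') measurable
  also have "\<dots> = (\<integral>\<^sup>+ x. 0 \<partial>M)"
  proof (rule nn_integral_cong)
    fix x
    have "AE t in lborel. indicator {0..1::real} t * indicator N (x + t *\<^sub>R w) = (0 :: ennreal)"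
      using line[of x] by eventually_elim simp
    then show "(\<integral>\<^sup>+ t. indicator {0..1::real} t * indicator N (x + t *\<^sub>R w) \<partial>lborel) = 0"
      by (subst nn_integral_0_iff_AE) auto
  qed
  finally show ?thesis by (auto simp: null_sets_def sets_M)
qed

text \<open>If g exceeded a positive constant on a set of positive measure, a compact subset of
  positive measure would give a nonzero integral. Inner regularity is applied to the restriction of
  M to a ball, which is finite; the factor c treats both signs at once.\<close>

lemma AE_zero_if_integral_compact_zero:
  fixes g :: "'e \<Rightarrow> real"
  assumes g [measurable]: "g \<in> borel_measurable borel" and bound: "\<And>x. \<bar>g x\<bar> \<le> C"
    and zero: "\<And>K. compact K \<Longrightarrow> (\<integral>x. indicator K x * g x \<partial>M) = 0"
  shows "AE x in M. g x = 0"
proof -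
  have pos: "AE x in M. \<not> c * g x > 0" if c: "c = 1 \<or> c = -1" for c :: real
  proof -
    have "AE x in M. \<not> (x \<in> ball 0 (real n) \<and> c * g x > 1 / real (Suc n))" for n
    proof -
      define A where "A = {x \<in> ball 0 (real n). c * g x > 1 / real (Suc n)}"
      have A [measurable]: "A \<in> sets borel" unfolding A_def by measurable
      define N where "N = density M (indicator (ball 0 (real n)))"
      have N: "sets N = sets borel" by (simp add: N_def sets_M)
      have [measurable]: "indicator (ball 0 (real n)) \<in> borel_measurable M"
        by (rule borel_measurable_indicator) (simp add: sets_M)
      have NM: "emeasure N B = emeasure M (ball 0 (real n) \<inter> B)" if "B \<in> sets borel" for B
        using that unfolding N_def
        by (subst emeasure_density) (auto simp: sets_M nn_integral_indicator[symmetric] indicator_inter_arith[symmetric] simp del: nn_integral_indicator intro!: nn_integral_cong)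
      have "emeasure N A = 0"
      proof (rule ccontr)
        assume "emeasure N A \<noteq> 0"
        moreover have "emeasure N A = (SUP K\<in>{K. K \<subseteq> A \<and> compact K}. emeasure N K)"
          using inner_regular[OF N _ A] NM[of "space N"] finite_bounded[of "ball 0 (real n)"]
          by (simp add: N_def)
        ultimately obtain K where K: "K \<subseteq> A" "compact K" "emeasure N K \<noteq> 0"
          by (metis (mono_tags, lifting) SUP_bot_conv(1) bot_ennreal mem_Collect_eq)
        have Kb [measurable]: "K \<in> sets borel" using K(2) by (simp add: borel_compact)
        have mK: "emeasure M K \<noteq> 0" "emeasure M K < \<infinity>"
          using K NM[OF Kb] finite_bounded[OF compact_imp_bounded Kb] by (auto simp: A_def inf.absorb2 Int_absorb1 subset_iff)
        have int: "integrable M (\<lambda>x. indicator K x * (c * g x))"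
        proof (rule integrableI_bounded_set[where A=K and B=C])
          show "AE x in M. x \<in> K \<longrightarrow> norm (indicator K x * (c * g x)) \<le> C"
            using bound c by (auto simp: abs_mult)
        qed (use mK in \<open>auto simp: sets_M\<close>)
        have "measure M K * (1 / real (Suc n)) = (\<integral>x. indicator K x * (1 / real (Suc n)) \<partial>M)"
          by (simp add: sets_M)
        also have "\<dots> \<le> (\<integral>x. indicator K x * (c * g x) \<partial>M)"
          using K(1) mK by (intro integral_mono int integrable_mult_left) (auto simp: A_def sets_M split: split_indicator)
        also have "\<dots> = c * (\<integral>x. indicator K x * g x \<partial>M)"
          by (subst integral_mult_right_zero[symmetric]) (simp add: ac_simps)
        also have "\<dots> = 0" using zero[OF K(2)] by simp
        finally have "measure M K \<le> 0" by (simp add: mult_le_0_iff divide_le_0_iff)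
        moreover have "0 < measure M K"
          using mK by (simp add: measure_def enn2real_positive_iff zero_less_iff_neq_zero)
        ultimately show False by simp
      qed
      then have "A \<in> null_sets M" using NM[OF A] by (auto simp: null_sets_def sets_M A_def Int_absorb1 inf.absorb2 subset_iff)
      then show ?thesis by (rule AE_I') (auto simp: A_def)
    qed
    then have "AE x in M. \<forall>n. \<not> (x \<in> ball 0 (real n) \<and> c * g x > 1 / real (Suc n))"
      by (simp add: AE_all_countable)
    then show ?thesis
    proof eventually_elim
      case (elim x)
      show ?case
      proof
        assume "c * g x > 0"
        then obtain k where k: "1 / real (Suc k) < c * g x" using reals_Archimedean by (auto simp: inverse_eq_divide)
        obtain n where n: "norm x < real n" using reals_Archimedean2 by blast
        have "1 / real (Suc (max k n)) \<le> 1 / real (Suc k)" by (intro divide_left_mono) auto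
        then show False using elim[rule_format, of "max k n"] k n by auto
      qed
    qed
  qed
  have "AE x in M. \<not> 1 * g x > 0" "AE x in M. \<not> (-1) * g x > 0" by (rule pos; simp)+
  then show ?thesis by eventually_elim simp
qed

section \<open>Directional derivatives of a Lipschitz function and Rademacher's theorem\<close>

definition dquot :: "('e \<Rightarrow> real) \<Rightarrow> 'e \<Rightarrow> 'e \<Rightarrow> real \<Rightarrow> real" where
  "dquot h w x t = (h (x + t *\<^sub>R w) - h x) / t"

definition dgood :: "('e \<Rightarrow> real) \<Rightarrow> 'e \<Rightarrow> 'e set" where
  "dgood h w = {x. \<exists>l. (dquot h w x \<longlongrightarrow> l) (at 0)}"

text \<open>The value 0 off \<open>dgood\<close> keeps the function bounded and Borel on the whole
  space, so that no exceptional set has to be carried through the integrals.\<close>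

definition dderiv :: "('e \<Rightarrow> real) \<Rightarrow> 'e \<Rightarrow> 'e \<Rightarrow> real" where
  "dderiv h w x = (if x \<in> dgood h w then Lim (at 0) (dquot h w x) else 0)"

lemma dderiv_tendsto: "x \<in> dgood h w \<Longrightarrow> (dquot h w x \<longlongrightarrow> dderiv h w x) (at 0)"
  unfolding dderiv_def dgood_def by (auto simp: tendsto_Lim)

lemma dderivI: "(dquot h w x \<longlongrightarrow> l) (at 0) \<Longrightarrow> x \<in> dgood h w \<and> dderiv h w x = l"
  unfolding dderiv_def dgood_def by (auto simp: tendsto_Lim)

context
  fixes h :: "'e \<Rightarrow> real" and L :: real
  assumes h: "L-lipschitz_on UNIV h"
begin

lemma L_nonneg: "0 \<le> L"
  using h by (auto simp: lipschitz_on_def)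

lemma h_bound: "\<bar>h x - h y\<bar> \<le> L * norm (x - y)"
  using h by (auto simp: lipschitz_on_def dist_norm)

lemma continuous_h: "continuous_on A h"
  using lipschitz_on_continuous_on[OF h] by (rule continuous_on_subset) simp

lemma borel_h [measurable]: "h \<in> borel_measurable borel"
  by (rule borel_measurable_continuous_onI) (rule continuous_h)

lemma continuous_dquot: "continuous_on UNIV (\<lambda>x. dquot h w x t)"
  by (cases "t = 0", simp add: dquot_def, unfold dquot_def)
    (intro continuous_intros continuous_on_compose2[OF continuous_h[of UNIV]]; auto)

lemma dquot_bound: "\<bar>dquot h w x t\<bar> \<le> L * norm w"
proof (cases "t = 0")
  case False
  then show ?thesis using h_bound[of "x + t *\<^sub>R w" x] by (simp add: dquot_def field_simps)
qed (simp add: dquot_def L_nonneg)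

lemma borel_dgood [measurable]: "dgood h w \<in> sets borel"
proof -
  have "dgood h w = (\<Inter>k. \<Union>m. {x. \<forall>s t. s \<noteq> 0 \<and> t \<noteq> 0 \<and> \<bar>s\<bar> < 1 / real (Suc m) \<and> \<bar>t\<bar> < 1 / real (Suc m) \<longrightarrow>
      \<bar>dquot h w x s - dquot h w x t\<bar> \<le> 1 / real (Suc k)})"
    unfolding dgood_def limit_at_0_iff_Cauchy by blast
  moreover have "closed {x. \<forall>s t. s \<noteq> 0 \<and> t \<noteq> 0 \<and> \<bar>s\<bar> < 1 / real (Suc m) \<and> \<bar>t\<bar> < 1 / real (Suc m) \<longrightarrow>
      \<bar>dquot h w x s - dquot h w x t\<bar> \<le> 1 / real (Suc k)}" for k m
    by (intro closed_Collect_all closed_Collect_imp closed_Collect_le continuous_intros open_Collect_const)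
      (auto simp: continuous_dquot intro!: continuous_intros)
  ultimately show ?thesis by (auto intro!: borel_closed)
qed

text \<open>Each line in direction w carries a Lipschitz function of one real variable, which is
  differentiable almost everywhere; \<open>null_set_along_lines\<close> turns this into a statement
  about M.\<close>

lemma AE_dgood:
  assumes w: "w \<in> W"
  shows "AE x in M. x \<in> dgood h w"
proof -
  have "- dgood h w \<in> null_sets M"
  proof (rule null_set_along_lines[OF w])
    fix x
    have "(L * norm w)-lipschitz_on UNIV (\<lambda>t. h (x + t *\<^sub>R w))"
    proof (rule lipschitz_onI)
      fix s t
      have "\<bar>h (x + s *\<^sub>R w) - h (x + t *\<^sub>R w)\<bar> \<le> L * norm ((s - t) *\<^sub>R w)"
        using h_bound[of "x + s *\<^sub>R w" "x + t *\<^sub>R w"] by (simp add: algebra_simps)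
      then show "dist (h (x + s *\<^sub>R w)) (h (x + t *\<^sub>R w)) \<le> L * norm w * dist s t"
        by (simp add: dist_real_def ac_simps)
    qed (simp add: L_nonneg)
    from lipschitz_real_differentiable_AE[OF this]
    show "AE t in lborel. x + t *\<^sub>R w \<notin> - dgood h w"
    proof eventually_elim
      case (elim t)
      then obtain d where "((\<lambda>t. h (x + t *\<^sub>R w)) has_real_derivative d) (at t)" by blast
      then have "((\<lambda>s. (h (x + (t + s) *\<^sub>R w) - h (x + t *\<^sub>R w)) / s) \<longlongrightarrow> d) (at 0)"
        by (simp add: DERIV_def)
      then show ?case unfolding dgood_def dquot_def by (auto simp: algebra_simps)
    qed
  qed simp
  then show ?thesis by (rule AE_I') auto
qed

lemma dderiv_bound: "\<bar>dderiv h w x\<bar> \<le> L * norm w"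
proof (cases "x \<in> dgood h w")
  case True
  have "((\<lambda>t. \<bar>dquot h w x t\<bar>) \<longlongrightarrow> \<bar>dderiv h w x\<bar>) (at 0)"
    by (intro tendsto_rabs dderiv_tendsto True)
  then show ?thesis by (rule tendsto_upperbound) (auto simp: dquot_bound)
qed (simp add: dderiv_def L_nonneg)

lemma dderiv_seq:
  "x \<in> dgood h w \<Longrightarrow> (\<lambda>n. dquot h w x (1 / real (Suc n))) \<longlonglongrightarrow> dderiv h w x"
  by (rule filterlim_compose[OF dderiv_tendsto])
    (use LIMSEQ_inverse_real_of_nat in \<open>auto simp: filterlim_at inverse_eq_divide\<close>)

lemma borel_dderiv [measurable]: "dderiv h w \<in> borel_measurable borel"
proof (rule borel_measurable_LIMSEQ_real)
  fix n
  have [measurable]: "(\<lambda>x. dquot h w x (1 / real (Suc n))) \<in> borel_measurable borel"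
    by (intro borel_measurable_continuous_onI continuous_dquot)
  show "(\<lambda>x. if x \<in> dgood h w then dquot h w x (1 / real (Suc n)) else 0) \<in> borel_measurable borel"
    by measurable
next
  fix x
  show "(\<lambda>n. if x \<in> dgood h w then dquot h w x (1 / real (Suc n)) else 0) \<longlonglongrightarrow> dderiv h w x"
    using dderiv_seq[of x w] by (cases "x \<in> dgood h w") (auto simp: dderiv_def)
qed

lemma integral_dderiv:
  fixes \<phi> :: "'e \<Rightarrow> real"
  assumes w: "w \<in> W" and \<phi> [measurable]: "\<phi> \<in> borel_measurable borel"
    and b: "\<And>x. \<bar>\<phi> x\<bar> \<le> C" and supp: "\<And>x. x \<notin> cball 0 R \<Longrightarrow> \<phi> x = 0"
  shows "(\<lambda>n. \<integral>x. dquot h w x (1 / real (Suc n)) * \<phi> x \<partial>M) \<longlonglongrightarrow> (\<integral>x. dderiv h w x * \<phi> x \<partial>M)"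
    "integrable M (\<lambda>x. dderiv h w x * \<phi> x)"
    "integrable M (\<lambda>x. dquot h w x (1 / real (Suc n)) * \<phi> x)"
proof -
  have C: "0 \<le> C" using b[of 0] by linarith
  let ?g = "\<lambda>x. indicator (cball 0 R) x * (L * norm w * C) :: real"
  have g: "integrable M ?g"
    using finite_bounded[of "cball 0 R"] by (intro integrable_mult_left) (auto simp: sets_M)
  have [measurable]: "(\<lambda>x. dquot h w x (1 / real (Suc n))) \<in> borel_measurable borel" for n
    by (intro borel_measurable_continuous_onI continuous_dquot)
  have bd: "norm (dquot h w x (1 / real (Suc n)) * \<phi> x) \<le> ?g x" for x n
    using mult_mono[OF dquot_bound[of w x "1 / real (Suc n)"] b[of x]] supp[of x] L_nonneg
    by (auto simp: abs_mult split: split_indicator)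
  show "(\<lambda>n. \<integral>x. dquot h w x (1 / real (Suc n)) * \<phi> x \<partial>M) \<longlonglongrightarrow> (\<integral>x. dderiv h w x * \<phi> x \<partial>M)"
    "integrable M (\<lambda>x. dderiv h w x * \<phi> x)"
    "integrable M (\<lambda>x. dquot h w x (1 / real (Suc n)) * \<phi> x)"
  proof -
    have lim: "AE x in M. (\<lambda>n. dquot h w x (1 / real (Suc n)) * \<phi> x) \<longlonglongrightarrow> dderiv h w x * \<phi> x"
      using AE_dgood[OF w] by eventually_elim (intro tendsto_intros dderiv_seq)
    show "(\<lambda>n. \<integral>x. dquot h w x (1 / real (Suc n)) * \<phi> x \<partial>M) \<longlonglongrightarrow> (\<integral>x. dderiv h w x * \<phi> x \<partial>M)"
      by (rule integral_dominated_convergence[OF _ _ g lim]) (auto simp only: bd intro!: AE_I2, measurable)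
    show "integrable M (\<lambda>x. dderiv h w x * \<phi> x)"
      by (rule integrable_dominated_convergence[OF _ _ g lim]) (auto simp only: bd intro!: AE_I2, measurable)
    show "integrable M (\<lambda>x. dquot h w x (1 / real (Suc n)) * \<phi> x)"
      by (rule Bochner_Integration.integrable_bound[OF g]) (measurable, intro AE_I2 order_trans[OF bd], simp)
  qed
qed

text \<open>Shifting the integration variable moves the increment in direction \<open>u\<close> from \<open>h\<close> to the
  Lipschitz weight, where it disappears in the limit.\<close>

lemma integral_dderiv_add:
  fixes \<phi> :: "'e \<Rightarrow> real"
  assumes u: "u \<in> W" and v: "v \<in> W" and \<phi>: "K-lipschitz_on UNIV \<phi>"
    and b: "\<And>x. \<bar>\<phi> x\<bar> \<le> C" and supp: "\<And>x. x \<notin> cball 0 R \<Longrightarrow> \<phi> x = 0"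
  shows "(\<integral>x. (dderiv h (u + v) x - dderiv h u x - dderiv h v x) * \<phi> x \<partial>M) = 0"
proof -
  have [measurable]: "\<phi> \<in> borel_measurable borel"
    by (intro borel_measurable_continuous_onI lipschitz_on_continuous_on[OF \<phi>])
  have uv: "u + v \<in> W" using u v W by (simp add: subspace_add)
  have K0: "0 \<le> K" using \<phi> by (auto simp: lipschitz_on_def)
  let ?a = "\<lambda>n. 1 / real (Suc n)"
  let ?I = "\<lambda>w n. \<integral>x. dquot h w x (?a n) * \<phi> x \<partial>M"
  have lim0: "(\<lambda>n. ?I (u + v) n - ?I u n - ?I v n) \<longlonglongrightarrow>
      (\<integral>x. dderiv h (u + v) x * \<phi> x \<partial>M) - (\<integral>x. dderiv h u x * \<phi> x \<partial>M) - (\<integral>x. dderiv h v x * \<phi> x \<partial>M)"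
    by (intro tendsto_diff integral_dderiv(1)[OF _ _ b supp] u v uv) auto
  have lim: "(\<lambda>n. ?I (u + v) n - ?I u n - ?I v n) \<longlonglongrightarrow> (\<integral>x. (dderiv h (u + v) x - dderiv h u x - dderiv h v x) * \<phi> x \<partial>M)"
    using lim0 integral_dderiv(2)[OF u _ b supp] integral_dderiv(2)[OF v _ b supp] integral_dderiv(2)[OF uv _ b supp]
    by (simp add: left_diff_distrib)
  \<comment> \<open>Enlarged by \<open>norm u\<close> because the weight is shifted by
    \<open>a *\<^sub>R u\<close> with a at most 1.\<close>
  define B where "B = cball (0::'e) (R + norm u)"
  have B: "B \<in> sets borel" "emeasure M B < \<infinity>" unfolding B_def using finite_bounded[of "cball 0 (R + norm u)"] by auto
  define c where "c = L * norm v * K * norm u * measure M B"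
  have bound: "norm (?I (u + v) n - ?I u n - ?I v n) \<le> c * ?a n" for n
  proof -
    define a where "a = ?a n"
    have a: "0 < a" "a \<le> 1" by (auto simp: a_def)
    have [measurable]: "(\<lambda>x. dquot h w x a) \<in> borel_measurable borel" for w
      by (intro borel_measurable_continuous_onI continuous_dquot)
    have i: "integrable M (\<lambda>x. dquot h w x a * \<phi> x)" if "w \<in> W" for w
      unfolding a_def by (rule integral_dderiv(3)[OF that _ b supp]) auto
    let ?g = "\<lambda>x. dquot h v x a * \<phi> (x - a *\<^sub>R u)"
    have au: "a *\<^sub>R u \<in> W" "- (a *\<^sub>R u) \<in> W" using u W by (auto simp: subspace_mul subspace_neg)
    \<comment> \<open>The quotient along u + v minus the quotient along u is the quotient along v
      based at x + a u. Translation invariance then moves the shift onto \<phi>.\<close>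
    have eq: "dquot h (u + v) x a * \<phi> x - dquot h u x a * \<phi> x = ?g (x + a *\<^sub>R u)" for x
      by (simp add: dquot_def algebra_simps diff_divide_distrib)
    have ig: "integrable M (\<lambda>x. ?g (x + a *\<^sub>R u))"
      unfolding eq[symmetric] using i u uv by auto
    have "integrable (distr M borel (\<lambda>x. x + a *\<^sub>R u)) ?g"
      by (subst integrable_distr_eq) (use ig in auto)
    then have ig': "integrable M ?g" using translation[OF au(1)] by simp
    have "?I (u + v) n - ?I u n = (\<integral>x. ?g (x + a *\<^sub>R u) \<partial>M)"
      unfolding eq[symmetric] a_def[symmetric] using i u uv by simp
    also have "\<dots> = (\<integral>x. ?g x \<partial>M)"
      by (rule integral_translate[OF au(1)]) measurable
    finally have "?I (u + v) n - ?I u n - ?I v n = (\<integral>x. dquot h v x a * (\<phi> (x - a *\<^sub>R u) - \<phi> x) \<partial>M)"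
      unfolding a_def[symmetric] right_diff_distrib using i[OF v] ig' by simp
    also have "\<bar>\<dots>\<bar> \<le> (\<integral>x. indicator B x * (L * norm v * (K * (a * norm u))) \<partial>M)"
    proof (unfold real_norm_def[symmetric], rule Bochner_Integration.integral_norm_bound_integral)
      show "integrable M (\<lambda>x. dquot h v x a * (\<phi> (x - a *\<^sub>R u) - \<phi> x))"
        unfolding right_diff_distrib using i[OF v] ig' by simp
      show "integrable M (\<lambda>x. indicator B x * (L * norm v * (K * (a * norm u))))"
        using B by (intro integrable_mult_left) (auto simp: sets_M)
      fix x
      show "norm (dquot h v x a * (\<phi> (x - a *\<^sub>R u) - \<phi> x)) \<le> indicator B x * (L * norm v * (K * (a * norm u)))"
      proof (cases "x \<in> B")
        case True
        have "\<bar>\<phi> (x - a *\<^sub>R u) - \<phi> x\<bar> \<le> K * (a * norm u)"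
          using lipschitz_onD[OF \<phi>, of "x - a *\<^sub>R u" x] a by (simp add: dist_norm)
        then show ?thesis using True dquot_bound[of v x a] L_nonneg a
          by (auto simp: abs_mult intro!: mult_mono)
      next
        case False
        have "norm (a *\<^sub>R u) \<le> norm u" using a by (simp add: mult_left_le_one_le)
        moreover have "norm x \<le> norm (x - a *\<^sub>R u) + norm (a *\<^sub>R u)"
          using norm_triangle_ineq[of "x - a *\<^sub>R u" "a *\<^sub>R u"] by simp
        moreover have "norm x > R + norm u" using False by (simp add: B_def)
        ultimately have "norm (x - a *\<^sub>R u) > R" "norm x > R" using norm_ge_zero[of u] by linarith+
        then have "x - a *\<^sub>R u \<notin> cball 0 R" "x \<notin> cball 0 R" by simp_all
        then show ?thesis using supp False by simp
      qed
    qed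
    also have "\<dots> = c * a" using B by (simp add: c_def sets_M)
    finally show ?thesis by (simp only: a_def real_norm_def)
  qed
  have "(\<lambda>n. c * ?a n) \<longlonglongrightarrow> 0"
    using tendsto_mult_right_zero[OF LIMSEQ_inverse_real_of_nat, of c] by (simp add: inverse_eq_divide)
  then have "(\<lambda>n. ?I (u + v) n - ?I u n - ?I v n) \<longlonglongrightarrow> 0"
    by (rule Lim_null_comparison[rotated]) (intro always_eventually allI bound)
  with lim show ?thesis by (rule LIMSEQ_unique)
qed

text \<open>\<open>integral_dderiv_add\<close> handles Lipschitz weights only. The indicator of a
  compact set is the pointwise limit of such weights, decreasing linearly with the distance from the
  set at ever larger slopes, and integrals over compact sets determine the function almost
  everywhere.\<close>

lemma dderiv_add:
  assumes u: "u \<in> W" and v: "v \<in> W"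
  shows "AE x in M. dderiv h (u + v) x = dderiv h u x + dderiv h v x"
proof -
  let ?g = "\<lambda>x. dderiv h (u + v) x - dderiv h u x - dderiv h v x"
  define C where "C = L * norm (u + v) + L * norm u + L * norm v"
  have gC: "\<bar>?g x\<bar> \<le> C" for x
    using dderiv_bound[of "u+v" x] dderiv_bound[of u x] dderiv_bound[of v x] unfolding C_def by linarith
  have "AE x in M. ?g x = 0"
  proof (rule AE_zero_if_integral_compact_zero[OF _ gC])
    fix K :: "'e set" assume K: "compact K"
    show "(\<integral>x. indicator K x * ?g x \<partial>M) = 0"
    proof (cases "K = {}")
      case False
      obtain R where R: "K \<subseteq> cball 0 R" using compact_imp_bounded[OF K] unfolding bounded_iff by (auto simp: subset_iff)
      \<comment> \<open>From slope 1 on the weight vanishes at distance 1 from K, so the family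
        \<open>\<phi> (Suc m)\<close> has a common bounded support.\<close>
      define \<phi> where "\<phi> m x = max 0 (1 - real m * infdist x K)" for m x
      have inf_far: "infdist x K \<ge> norm x - R" for x
      proof -
        obtain k where "k \<in> K" "infdist x K = dist x k"
          using infdist_attains_inf[OF compact_imp_closed[OF K] False] by blast
        then show ?thesis using R norm_triangle_ineq2[of x k] by (force simp: dist_norm)
      qed
      have phi_supp: "\<phi> (Suc m) x = 0" if "x \<notin> cball 0 (R + 1)" for m x
      proof -
        have "1 \<le> infdist x K" using that inf_far[of x] by auto
        then have "1 \<le> real (Suc m) * infdist x K" using mult_mono[of 1 "real (Suc m)" 1 "infdist x K"] by auto
        then show ?thesis by (simp add: \<phi>_def)
      qed
      have phi_b: "\<bar>\<phi> m x\<bar> \<le> 1" for m x by (auto simp: \<phi>_def infdist_nonneg)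
      have phi_lip: "(real m)-lipschitz_on UNIV (\<phi> m)" for m
      proof (rule lipschitz_onI)
        fix x y :: 'e
        have "\<bar>infdist x K - infdist y K\<bar> \<le> dist x y" by (rule infdist_triangle_abs)
        then have "\<bar>real m * infdist x K - real m * infdist y K\<bar> \<le> real m * dist x y"
          by (simp add: right_diff_distrib[symmetric] abs_mult mult_left_mono)
        then show "dist (\<phi> m x) (\<phi> m y) \<le> real m * dist x y"
          unfolding \<phi>_def dist_real_def by linarith
      qed simp
      have [measurable]: "\<phi> m \<in> borel_measurable borel" for m
        by (intro borel_measurable_continuous_onI lipschitz_on_continuous_on[OF phi_lip])
      have Kb [measurable]: "K \<in> sets borel" using K by (simp add: borel_compact)
      have "(\<lambda>m. \<integral>x. ?g x * \<phi> (Suc m) x \<partial>M) \<longlonglongrightarrow> (\<integral>x. indicator K x * ?g x \<partial>M)"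
      proof (rule integral_dominated_convergence)
        show "integrable M (\<lambda>x. indicator (cball 0 (R+1)) x * C)"
          using finite_bounded[of "cball 0 (R+1)"] by (intro integrable_mult_left) (auto simp: sets_M)
        show "AE x in M. norm (?g x * \<phi> (Suc m) x) \<le> indicator (cball 0 (R+1)) x * C" for m
        proof (rule AE_I2)
          fix x
          show "norm (?g x * \<phi> (Suc m) x) \<le> indicator (cball 0 (R+1)) x * C"
            using phi_supp[of x m] mult_mono[OF gC[of x] phi_b[of "Suc m" x]] gC[of x] by (auto simp: abs_mult split: split_indicator)
        qed
        show "AE x in M. (\<lambda>m. ?g x * \<phi> (Suc m) x) \<longlonglongrightarrow> indicator K x * ?g x"
        proof (rule AE_I2)
          fix x
          have "(\<lambda>m. \<phi> (Suc m) x) \<longlonglongrightarrow> indicator K x"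
          proof (cases "x \<in> K")
            case True then show ?thesis by (simp add: \<phi>_def)
          next
            case False
            then have "infdist x K > 0" using compact_imp_closed[OF K] \<open>K \<noteq> {}\<close>
              by (metis in_closed_iff_infdist_zero infdist_nonneg order_le_less)
            then obtain n where "1 < real n * infdist x K" using reals_Archimedean3 by blast
            then have "\<phi> (Suc m) x = 0" if "m \<ge> n" for m
            proof -
              have "real n * infdist x K \<le> real (Suc m) * infdist x K"
                using that by (intro mult_right_mono) (auto simp: infdist_nonneg)
              then show ?thesis using \<open>1 < real n * infdist x K\<close> by (simp add: \<phi>_def)
            qed
            then have "eventually (\<lambda>m. \<phi> (Suc m) x = 0) sequentially"
              by (auto simp: eventually_sequentially)
            then show ?thesis using False by (simp add: tendsto_eventually)
          qed
          then show "(\<lambda>m. ?g x * \<phi> (Suc m) x) \<longlonglongrightarrow> indicator K x * ?g x"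
            by (subst mult.commute) (intro tendsto_intros)
        qed
      qed measurable
      moreover have "(\<integral>x. ?g x * \<phi> (Suc m) x \<partial>M) = 0" for m
        by (rule integral_dderiv_add[OF u v phi_lip phi_b phi_supp])
      ultimately show ?thesis using LIMSEQ_unique[OF _ tendsto_const] by force
    qed simp
  qed measurable
  then show ?thesis by eventually_elim simp
qed

text \<open>At almost every point the directional derivatives along the countably many rational
  combinations of an orthonormal basis exist and add up. They are then the values of a linear map D.
  A finite net of the unit sphere of W, together with the Lipschitz bound, makes the approximation
  uniform in the direction.\<close>

lemma rademacher:
  "AE x in M. \<exists>D. (h has_derivative D) (at x within {x + w | w. w \<in> W})"
proof -
  obtain B where B: "B \<subseteq> W" "pairwise orthogonal B" "\<And>b. b \<in> B \<Longrightarrow> norm b = 1"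
    "independent B" "card B = dim W" "span B = W"
    by (rule orthonormal_basis_subspace[OF W]) (rule that)
  have finB: "finite B" using B(4) by (rule independent_imp_finite)
  have bb: "b \<bullet> c = (if b = c then 1 else 0)" if "b \<in> B" "c \<in> B" for b c
    using that B(2) B(3)[OF that(1)] by (auto simp: pairwise_def orthogonal_def norm_eq_1)
  define comb where "comb q = (\<Sum>b\<in>B. of_rat (q b) *\<^sub>R b)" for q :: "'e \<Rightarrow> rat"
  define Q where "Q = comb ` (B \<rightarrow>\<^sub>E UNIV)"
  have cQ: "countable Q" unfolding Q_def by (intro countable_image countable_PiE finB) auto
  have combQ: "comb q \<in> Q" for q
    unfolding Q_def by (rule image_eqI[of _ _ "restrict q B"]) (auto simp: comb_def)
  have QW: "Q \<subseteq> W"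
    unfolding Q_def comb_def using B(1) W by (auto intro!: subspace_sum subspace_mul)
  have repr: "w = (\<Sum>b\<in>B. (w \<bullet> b) *\<^sub>R b)" if w: "w \<in> W" for w
  proof -
    have "w \<in> span B" using w B by simp
    then obtain c where c: "w = (\<Sum>b\<in>B. c b *\<^sub>R b)" using span_finite[OF finB] by auto
    have "w \<bullet> b = c b" if "b \<in> B" for b
      unfolding c using that finB by (simp add: inner_sum_left bb if_distrib sum.delta cong: if_cong)
    then show ?thesis by (subst c) (intro sum.cong, auto)
  qed
  have dense: "\<exists>q\<in>Q. dist w q < e" if w: "w \<in> W" and e: "e > 0" for w e
  proof -
    define e' where "e' = e / (real (card B) + 1)"
    have "e' > 0" using e by (auto simp: e'_def)
    have "\<exists>r::rat. \<bar>w \<bullet> b - of_rat r\<bar> < e'" for b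
      using of_rat_dense[of "w \<bullet> b" "w \<bullet> b + e'"] \<open>e' > 0\<close> by (metis abs_diff_less_iff abs_minus_commute add.commute less_add_same_cancel1 less_diff_eq diff_add_cancel diff_less_eq less_trans)
    then obtain r where r: "\<And>b. \<bar>w \<bullet> b - of_rat (r b)\<bar> < e'" by metis
    have "dist w (comb r) = norm (\<Sum>b\<in>B. (w \<bullet> b - of_rat (r b)) *\<^sub>R b)"
      by (subst repr[OF w]) (simp add: dist_norm comb_def sum_subtractf scaleR_diff_left)
    also have "\<dots> \<le> (\<Sum>b\<in>B. e')"
      by (intro sum_norm_le) (use r B(3) in \<open>auto simp: less_imp_le\<close>)
    also have "\<dots> < e" using e by (simp add: e'_def field_simps)
    finally show ?thesis using combQ by blast
  qed
  have "AE x in M. \<forall>w\<in>Q. x \<in> dgood h w"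
    using QW by (subst AE_ball_countable[OF cQ]) (auto intro: AE_dgood)
  moreover have "AE x in M. \<forall>u\<in>Q. \<forall>v\<in>Q. dderiv h (u + v) x = dderiv h u x + dderiv h v x"
    using QW by (subst AE_ball_countable[OF cQ], intro ballI, subst AE_ball_countable[OF cQ]) (auto intro!: dderiv_add)
  ultimately show ?thesis
  proof eventually_elim
    case (elim x)
    let ?d = "\<lambda>w. dderiv h w x"
    have lim: "(dquot h w x \<longlongrightarrow> ?d w) (at 0)" if "w \<in> Q" for w using dderiv_tendsto elim(1) that by blast
    have scale: "?d (c *\<^sub>R w) = c * ?d w" if w: "w \<in> Q" for c w
    proof (cases "c = 0")
      case True
      have "dquot h 0 x = (\<lambda>t. 0)" by (simp add: dquot_def fun_eq_iff)
      then have "(dquot h 0 x \<longlongrightarrow> 0) (at 0)" by simp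
      then show ?thesis using dderivI True by simp
    next
      case False
      have "filterlim (\<lambda>t. c * t) (at 0) (at 0)"
        using False by (auto simp: filterlim_at eventually_at intro!: tendsto_eq_intros exI[of _ 1])
      from filterlim_compose[OF lim[OF w] this]
      have "((\<lambda>t. c * dquot h w x (c * t)) \<longlongrightarrow> c * ?d w) (at 0)" by (intro tendsto_intros)
      also have "(\<lambda>t. c * dquot h w x (c * t)) = dquot h (c *\<^sub>R w) x"
        using False by (auto simp: dquot_def fun_eq_iff ac_simps)
      finally show ?thesis using dderivI by blast
    qed
    have BQ: "b \<in> Q" if "b \<in> B" for b
    proof -
      have "comb (\<lambda>c. if c = b then 1 else 0) = (\<Sum>c\<in>B. if c = b then b else 0)"
        unfolding comb_def by (intro sum.cong) auto
      then show ?thesis using that finB combQ[of "\<lambda>c. if c = b then 1 else 0"] by simp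
    qed
    have dsum: "?d (\<Sum>b\<in>F. of_rat (q b) *\<^sub>R b) = (\<Sum>b\<in>F. of_rat (q b) * ?d b)" if "finite F" "F \<subseteq> B" for F and q :: "'e \<Rightarrow> rat"
      using that
    proof (induction F rule: finite_induct)
      case empty
      have "dquot h 0 x = (\<lambda>t. 0)" by (simp add: dquot_def fun_eq_iff)
      then have "(dquot h 0 x \<longlongrightarrow> 0) (at 0)" by simp
      then show ?case using dderivI by simp
    next
      case (insert b F)
      have Qf: "(\<Sum>b\<in>G. of_rat (q b) *\<^sub>R b) \<in> Q" if "G \<subseteq> B" for G
      proof -
        have "(\<Sum>b\<in>G. of_rat (q b) *\<^sub>R b) = comb (\<lambda>b. if b \<in> G then q b else 0)"
          unfolding comb_def using that finB
          by (intro sum.mono_neutral_cong_left) auto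
        then show ?thesis using combQ by simp
      qed
      have "of_rat (q b) *\<^sub>R b \<in> Q" using Qf[of "{b}"] insert.prems by simp
      moreover have "(\<Sum>b\<in>F. of_rat (q b) *\<^sub>R b) \<in> Q" using Qf insert.prems by simp
      ultimately have "?d (of_rat (q b) *\<^sub>R b + (\<Sum>b\<in>F. of_rat (q b) *\<^sub>R b)) = of_rat (q b) * ?d b + (\<Sum>b\<in>F. of_rat (q b) * ?d b)"
        using elim(2) insert scale[OF BQ] by auto
      then show ?case using insert by simp
    qed
    define D where "D w = (\<Sum>b\<in>B. (w \<bullet> b) * ?d b)" for w
    have D: "bounded_linear D" unfolding D_def by (intro bounded_linear_sum bounded_linear_mult_left bounded_linear_inner_left bounded_linear_compose[OF bounded_linear_mult_left])
    then interpret D: bounded_linear D .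
    have DQ: "?d w = D w" if "w \<in> Q" for w
    proof -
      have "\<exists>q. w = comb q" using that by (auto simp: Q_def)
      then obtain q where q: "w = comb q" by blast
      have "w \<bullet> b = of_rat (q b)" if "b \<in> B" for b
        unfolding q comb_def using that finB by (simp add: inner_sum_left bb if_distrib sum.delta cong: if_cong)
      then show ?thesis using dsum[OF finB order_refl, of q] by (simp add: D_def q[unfolded comb_def, symmetric])
    qed
    obtain N where N: "N > 0" "\<And>w. norm (D w) \<le> norm w * N" using D.pos_bounded by blast
    have "(h has_derivative D) (at x within {x + w | w. w \<in> W})"
      unfolding has_derivative_within'
    proof (intro conjI allI impI D)
      fix e :: real assume "e > 0"
      \<comment> \<open>Three errors are proportional to c: moving h from s to a net point q costs L
        c, the difference quotient along q costs c, and moving D from q to s costs N c. The choice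
        makes their sum e / 2.\<close>
      define c where "c = e / (2 * (1 + L + N))"
      have c: "c > 0" "(1 + L + N) * c < e" 
      proof -
        define s where "s = 1 + L + N"
        have "0 < s" using N(1) L_nonneg unfolding s_def by linarith
        moreover from this have "s * c = e / 2" by (simp add: c_def s_def[symmetric])
        moreover have "c = e / (2 * s)" by (simp add: c_def s_def)
        ultimately show "c > 0" "(1 + L + N) * c < e" using \<open>e > 0\<close> by (auto simp: s_def[symmetric])
      qed
      define S where "S = W \<inter> sphere 0 1"
      have "compact S" unfolding S_def using closed_subspace[OF W] by (intro closed_Int_compact) auto
      moreover have "S \<subseteq> (\<Union>q\<in>Q. ball q c)" using dense c(1) by (force simp: S_def dist_commute)
      ultimately obtain F where F: "F \<subseteq> Q" "finite F" "S \<subseteq> (\<Union>q\<in>F. ball q c)"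
        using compactE_image[of S Q "\<lambda>q. ball q c"] by (metis open_ball)
      have "\<forall>q\<in>F. eventually (\<lambda>t. dist (dquot h q x t) (D q) < c) (at 0)"
        using F(1) lim DQ c(1) by (metis subsetD tendstoD)
      then have "eventually (\<lambda>t. \<forall>q\<in>F. dist (dquot h q x t) (D q) < c) (at 0)"
        using F(2) by (simp add: eventually_ball_finite)
      then obtain d where d: "d > 0" "\<And>t q. t \<noteq> 0 \<Longrightarrow> \<bar>t\<bar> < d \<Longrightarrow> q \<in> F \<Longrightarrow> \<bar>dquot h q x t - D q\<bar> < c"
        unfolding eventually_at by (auto simp: dist_real_def)
      have "norm (h y - h x - D (y - x)) / norm (y - x) < e"
        if y: "y \<in> {x + w | w. w \<in> W}" "0 < norm (y - x) \<and> norm (y - x) < d" for y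
      proof -
        define t where "t = norm (y - x)"
        define s where "s = (1 / t) *\<^sub>R (y - x)"
        have t: "t > 0" "t < d" using y by (auto simp: t_def)
        have yx: "y - x \<in> W" "y = x + t *\<^sub>R s" using y t by (auto simp: s_def)
        have "s \<in> S" using yx(1) t W by (auto simp: S_def s_def subspace_mul t_def)
        then obtain q where q: "q \<in> F" "dist s q < c" using F(3) by (force simp: dist_commute)
        have 1: "\<bar>h (x + t *\<^sub>R s) - h (x + t *\<^sub>R q)\<bar> \<le> L * (t * c)"
        proof -
          have "\<bar>h (x + t *\<^sub>R s) - h (x + t *\<^sub>R q)\<bar> \<le> L * norm (t *\<^sub>R (s - q))"
            using h_bound[of "x + t *\<^sub>R s" "x + t *\<^sub>R q"] by (simp add: algebra_simps)
          also have "\<dots> \<le> L * (t * c)" using q(2) t L_nonneg by (intro mult_left_mono) (auto simp: dist_norm)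
          finally show ?thesis .
        qed
        have "\<bar>t * (dquot h q x t - D q)\<bar> \<le> t * c" using d(2)[of t q] t q by (auto simp: abs_mult)
        then have 2: "\<bar>h (x + t *\<^sub>R q) - h x - t * D q\<bar> \<le> t * c"
        proof -
          have "t * dquot h q x t = h (x + t *\<^sub>R q) - h x" using t by (simp add: dquot_def)
          then show ?thesis using \<open>\<bar>t * (dquot h q x t - D q)\<bar> \<le> t * c\<close> by (simp add: right_diff_distrib)
        qed
        have "\<bar>D (q - s)\<bar> \<le> c * N"
        proof -
          have "norm (q - s) \<le> c" using q(2) by (simp add: dist_norm norm_minus_commute[of q s])
          then have "norm (q - s) * N \<le> c * N" using N(1) by (intro mult_right_mono) auto
          then show ?thesis using N(2)[of "q - s"] by simp
        qed
        then have "t * \<bar>D (q - s)\<bar> \<le> t * (c * N)" using t by (intro mult_left_mono) auto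
        then have 3: "\<bar>t * D q - t * D s\<bar> \<le> t * (c * N)"
          using t by (simp add: D.diff abs_mult right_diff_distrib[symmetric])
        have "D (y - x) = t * D s" using yx(2) by (simp add: D.scaleR)
        then have "\<bar>h y - h x - D (y - x)\<bar> \<le> L * (t * c) + t * c + t * (c * N)"
          using 1 2 3 arg_cong[OF yx(2), of h] by linarith
        also have "\<dots> = t * ((1 + L + N) * c)" by (simp add: algebra_simps)
        also have "\<dots> < t * e" using c t by (intro mult_strict_left_mono) auto
        finally show ?thesis using t by (simp add: t_def[symmetric] field_simps)
      qed
      then show "\<exists>d>0. \<forall>y\<in>{x + w | w. w \<in> W}. 0 < norm (y - x) \<and> norm (y - x) < d \<longrightarrow>
          norm (h y - h x - D (y - x)) / norm (y - x) < e" using d(1) by blast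
    qed
    then show ?case by blast
  qed
qed

end

end

section \<open>Quadratic forms on a subspace\<close>

lemma det_on_fun_upd:
  assumes "finite I" "i \<in> I"
  shows "det_on I (A(i := r)) =
    (\<Sum>\<pi> | \<pi> permutes I. of_int (sign \<pi>) * (r (\<pi> i) * (\<Prod>l\<in>I - {i}. A l (\<pi> l))))"
  unfolding det_on_def
proof (rule sum.cong[OF refl])
  fix \<pi> assume "\<pi> \<in> {\<pi>. \<pi> permutes I}"
  have "(\<Prod>l\<in>I. (A(i := r)) l (\<pi> l)) = r (\<pi> i) * (\<Prod>l\<in>I - {i}. (A(i := r)) l (\<pi> l))"
    using prod.remove[OF assms, of "\<lambda>l. (A(i := r)) l (\<pi> l)"] by simp
  also have "(\<Prod>l\<in>I - {i}. (A(i := r)) l (\<pi> l)) = (\<Prod>l\<in>I - {i}. A l (\<pi> l))"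
    by (rule prod.cong) auto
  finally show "of_int (sign \<pi>) * (\<Prod>l\<in>I. (A(i := r)) l (\<pi> l)) =
    of_int (sign \<pi>) * (r (\<pi> i) * (\<Prod>l\<in>I - {i}. A l (\<pi> l)))" by simp
qed

text \<open>Composition with the transposition of i and k reverses the sign of every permutation and
  leaves its product unchanged, so the determinant equals its own negative.\<close>

lemma det_on_equal_rows:
  assumes I: "finite I" "i \<in> I" "k \<in> I" "i \<noteq> k" and eq: "B i = B k"
  shows "det_on I B = 0"
proof -
  let ?t = "Transposition.transpose i k"
  have t: "?t permutes I" using I by (intro permutes_swap_id)
  have Bt: "B (?t l) = B l" for l using eq by (auto simp: Transposition.transpose_def)
  have "det_on I B = (\<Sum>\<pi> | \<pi> permutes I. of_int (sign (\<pi> \<circ> ?t)) * (\<Prod>l\<in>I. B l ((\<pi> \<circ> ?t) l)))"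
    unfolding det_on_def by (rule sum_permutations_compose_right[OF t])
  also have "\<dots> = (\<Sum>\<pi> | \<pi> permutes I. - (of_int (sign \<pi>) * (\<Prod>l\<in>I. B l (\<pi> l))))"
  proof (rule sum.cong[OF refl])
    fix \<pi> assume "\<pi> \<in> {\<pi>. \<pi> permutes I}"
    then have "sign (\<pi> \<circ> ?t) = - sign \<pi>"
      using I by (subst sign_compose) (auto simp: sign_swap_id permutation_swap_id intro: permutation_permutes[THEN iffD2])
    moreover have "(\<Prod>l\<in>I. B l (\<pi> l)) = (\<Prod>l\<in>I. B l ((\<pi> \<circ> ?t) l))"
      using prod.permute[OF t, of "\<lambda>l. B l (\<pi> l)"] by (simp add: o_def Bt)
    ultimately show "of_int (sign (\<pi> \<circ> ?t)) * (\<Prod>l\<in>I. B l ((\<pi> \<circ> ?t) l)) = - (of_int (sign \<pi>) * (\<Prod>l\<in>I. B l (\<pi> l)))"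
      by simp
  qed
  also have "\<dots> = - det_on I B" by (simp add: det_on_def sum_negf)
  finally show ?thesis by simp
qed

lemma det_on_add_row_multiples:
  assumes I: "finite I" "k \<in> I" and "finite J" "J \<subseteq> I - {k}"
  shows "det_on I (\<lambda>i. if i \<in> J then (\<lambda>j. A i j + c i * A k j) else A i) = det_on I A"
  using assms(3,4)
proof (induction J rule: finite_induct)
  case (insert i J)
  let ?A = "\<lambda>J i. if i \<in> J then (\<lambda>j. A i j + c i * A k j) else A i"
  have i: "i \<in> I" "i \<noteq> k" "i \<notin> J" "k \<notin> J" using insert by auto
  have "?A (insert i J) = (?A J)(i := \<lambda>j. A i j + c i * A k j)" using i by auto
  then have "det_on I (?A (insert i J)) = det_on I ((?A J)(i := \<lambda>j. A i j + c i * A k j))" by simp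
  also have "\<dots> = det_on I ((?A J)(i := A i)) + c i * det_on I ((?A J)(i := A k))"
    unfolding det_on_fun_upd[OF I(1) i(1)] sum_distrib_left sum.distrib[symmetric]
    by (rule sum.cong) (auto simp: algebra_simps)
  also have "det_on I ((?A J)(i := A k)) = 0"
    by (rule det_on_equal_rows[OF I(1) i(1) I(2) i(2)]) (use i in auto)
  also have "(?A J)(i := A i) = ?A J" using i by auto
  finally show ?case using insert by auto
qed simp

text \<open>A permutation that moves k sends some row of J to column k and contributes a zero
  product; the remaining ones are the permutations of J.\<close>

lemma det_on_insert_zero_column:
  assumes J: "finite J" "k \<notin> J" and zero: "\<And>l. l \<in> J \<Longrightarrow> A l k = 0"
  shows "det_on (insert k J) A = A k k * det_on J A"
proof -
  let ?f = "\<lambda>\<pi>. of_int (sign \<pi>) * (\<Prod>l\<in>insert k J. A l (\<pi> l))"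
  have "det_on (insert k J) A = sum ?f {\<pi>. \<pi> permutes J}"
    unfolding det_on_def
  proof (rule sum.mono_neutral_right)
    show "finite {\<pi>. \<pi> permutes insert k J}" using J by (intro finite_permutations) auto
    show "{\<pi>. \<pi> permutes J} \<subseteq> {\<pi>. \<pi> permutes insert k J}" by (auto intro: permutes_subset)
    show "\<forall>\<pi>\<in>{\<pi>. \<pi> permutes insert k J} - {\<pi>. \<pi> permutes J}. ?f \<pi> = 0"
    proof
      fix \<pi> assume "\<pi> \<in> {\<pi>. \<pi> permutes insert k J} - {\<pi>. \<pi> permutes J}"
      then have p: "\<pi> permutes insert k J" "\<not> \<pi> permutes J" by auto
      have "\<pi> k \<noteq> k"
      proof
        assume "\<pi> k = k"
        then have "\<pi> permutes J" using p(1) by (intro permutes_superset[OF p(1)]) auto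
        with p(2) show False ..
      qed
      obtain l where l: "\<pi> l = k" using permutes_surj[OF p(1)] by (metis surjD)
      have "l \<in> insert k J" using p(1) l by (metis insertCI permutes_not_in)
      then have "l \<in> J" using l \<open>\<pi> k \<noteq> k\<close> by auto
      then have "(\<Prod>l\<in>insert k J. A l (\<pi> l)) = 0"
        using J l zero by (intro prod_zero) auto
      then show "?f \<pi> = 0" by simp
    qed
  qed
  also have "\<dots> = (\<Sum>\<pi> | \<pi> permutes J. A k k * (of_int (sign \<pi>) * (\<Prod>l\<in>J. A l (\<pi> l))))"
    using J by (intro sum.cong) (auto simp: permutes_not_in)
  finally show ?thesis by (simp add: det_on_def sum_distrib_left)
qed

text \<open>Induction by the Schur complement, which inherits the lower bound.\<close>

lemma det_on_positive_definite_ge: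
  assumes "finite I" "m > 0"
    and "\<And>i j. i \<in> I \<Longrightarrow> j \<in> I \<Longrightarrow> A i j = A j i"
    and "\<And>x. m * (\<Sum>i\<in>I. (x i)\<^sup>2) \<le> (\<Sum>i\<in>I. \<Sum>j\<in>I. A i j * x i * x j)"
  shows "m ^ card I \<le> det_on I A"
  using assms(1,3,4)
proof (induction I arbitrary: A rule: finite_induct)
  case empty
  then show ?case by (simp add: det_on_def)
next
  case (insert k J)
  note sym = insert.prems(1) and pos = insert.prems(2)
  have split: "(\<Sum>i\<in>insert k J. \<Sum>j\<in>insert k J. A i j * x i * x j) =
      A k k * (x k)\<^sup>2 + 2 * x k * (\<Sum>j\<in>J. A k j * x j) + (\<Sum>i\<in>J. \<Sum>j\<in>J. A i j * x i * x j)" for x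
  proof -
    have "(\<Sum>i\<in>J. A i k * x i * x k) = x k * (\<Sum>j\<in>J. A k j * x j)"
      unfolding sum_distrib_left using sym insert.hyps by (intro sum.cong) auto
    moreover have "(\<Sum>j\<in>J. A k j * x k * x j) = x k * (\<Sum>j\<in>J. A k j * x j)"
      unfolding sum_distrib_left by (intro sum.cong) auto
    ultimately show ?thesis using insert.hyps
      by (simp add: sum.distrib power2_eq_square algebra_simps)
  qed
  define a where "a = A k k"
  have "m * (\<Sum>i\<in>insert k J. (if i = k then 1 else 0 :: real)\<^sup>2) \<le> a"
  proof -
    have z: "(\<Sum>j\<in>J. f j * (if j = k then 1 else 0 :: real)) = 0" for f :: "'a \<Rightarrow> real"
      using insert.hyps by (intro sum.neutral) auto
    show ?thesis
      using pos[of "\<lambda>i. if i = k then 1 else 0"] unfolding split z by (simp add: a_def z)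
  qed
  moreover have "(\<Sum>i\<in>insert k J. (if i = k then 1 else 0 :: real)\<^sup>2) = 1"
    using insert.hyps by (subst sum.insert) (auto intro!: sum.neutral)
  ultimately have a: "m \<le> a" "a > 0" using \<open>m > 0\<close> by auto
  \<comment> \<open>Gaussian elimination of column k. On J the result is the Schur complement of the
    pivot a.\<close>
  define A' where "A' = (\<lambda>i. if i \<in> J then (\<lambda>j. A i j + (- A i k / a) * A k j) else A i)"
  have "m ^ card J \<le> det_on J A'"
  proof (rule insert.IH)
    show "A' i j = A' j i" if "i \<in> J" "j \<in> J" for i j
      using that sym[of i j] sym[of i k] sym[of j k] by (simp add: A'_def)
    show "m * (\<Sum>i\<in>J. (x i)\<^sup>2) \<le> (\<Sum>i\<in>J. \<Sum>j\<in>J. A' i j * x i * x j)" for x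
    proof -
      define s where "s = (\<Sum>j\<in>J. A k j * x j)"
      \<comment> \<open>The value \<open>- s / a\<close> minimizes the form in coordinate k; at the
        minimum the form of A equals that of the Schur complement, which therefore keeps the bound
        m.\<close>
      define y where "y = x(k := - s / a)"
      have xy: "(\<Sum>j\<in>J. A k j * y j) = s" "(\<Sum>i\<in>J. \<Sum>j\<in>J. A i j * y i * y j) = (\<Sum>i\<in>J. \<Sum>j\<in>J. A i j * x i * x j)"
        "(\<Sum>i\<in>J. (y i)\<^sup>2) = (\<Sum>i\<in>J. (x i)\<^sup>2)" "y k = - s / a"
        unfolding s_def y_def using insert.hyps by (auto intro!: sum.cong)
      have "(\<Sum>i\<in>J. \<Sum>j\<in>J. A' i j * x i * x j) =
          (\<Sum>i\<in>J. \<Sum>j\<in>J. A i j * x i * x j) - (\<Sum>i\<in>J. \<Sum>j\<in>J. A k i * x i * (A k j * x j)) / a"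
        unfolding sum_divide_distrib sum_subtractf[symmetric] A'_def
        using sym insert.hyps a by (intro sum.cong refl) (auto simp: field_simps)
      also have "(\<Sum>i\<in>J. \<Sum>j\<in>J. A k i * x i * (A k j * x j)) = s * s"
        by (simp add: s_def sum_product)
      finally have q: "(\<Sum>i\<in>J. \<Sum>j\<in>J. A' i j * x i * x j) = (\<Sum>i\<in>J. \<Sum>j\<in>J. A i j * x i * x j) - s * s / a" .
      have "m * (\<Sum>i\<in>J. (x i)\<^sup>2) \<le> m * (\<Sum>i\<in>insert k J. (y i)\<^sup>2)"
        using insert.hyps \<open>m > 0\<close> by (intro mult_left_mono) (auto simp: xy)
      also have "\<dots> \<le> a * (y k)\<^sup>2 + 2 * y k * s + (\<Sum>i\<in>J. \<Sum>j\<in>J. A i j * x i * x j)"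
        using pos[of y] unfolding split xy(1,2) a_def .
      also have "\<dots> = (\<Sum>i\<in>J. \<Sum>j\<in>J. A' i j * x i * x j)"
        unfolding q xy(4) using a by (simp add: field_simps power2_eq_square)
      finally show ?thesis .
    qed
  qed
  have "det_on (insert k J) A = det_on (insert k J) A'"
    unfolding A'_def using insert.hyps by (intro det_on_add_row_multiples[symmetric]) auto
  also have "\<dots> = A' k k * det_on J A'"
  proof (rule det_on_insert_zero_column)
    show "A' l k = 0" if "l \<in> J" for l using that a by (simp add: A'_def a_def)
  qed (use insert.hyps in auto)
  also have "A' k k = a" using insert.hyps by (simp add: A'_def a_def)
  finally have "det_on (insert k J) A = a * det_on J A'" .
  moreover have "m * m ^ card J \<le> a * det_on J A'"
    using a \<open>m > 0\<close> \<open>m ^ card J \<le> det_on J A'\<close> by (intro mult_mono) auto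
  ultimately show ?case using insert.hyps by simp
qed

section \<open>The Riesz representative for an inner product comparable to the Euclidean one\<close>

locale inner_form =
  fixes W :: "'e::euclidean_space set" and B :: "'e set" and g :: "'e \<Rightarrow> 'e \<Rightarrow> real" and \<Lambda> :: real
  assumes B: "B \<subseteq> W" "pairwise orthogonal B" "\<And>b. b \<in> B \<Longrightarrow> norm b = 1" "span B = W"
    and bilin: "bilinear g" and sym: "\<And>x y. g x y = g y x"
    and Lam: "1 \<le> \<Lambda>"
    and low: "\<And>x. x \<in> W \<Longrightarrow> (norm x)\<^sup>2 / \<Lambda>\<^sup>2 \<le> g x x"
    and up: "\<And>x. x \<in> W \<Longrightarrow> g x x \<le> \<Lambda>\<^sup>2 * (norm x)\<^sup>2"
begin

lemma subspace_W: "subspace W" using B(4) subspace_span by metis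

lemma finite_B: "finite B"
  using B by (intro independent_imp_finite pairwise_orthogonal_independent) force+

lemma inner_B: "b \<in> B \<Longrightarrow> c \<in> B \<Longrightarrow> b \<bullet> c = (if b = c then 1 else 0)"
  using B(2) B(3)[of b] by (auto simp: pairwise_def orthogonal_def norm_eq_1)

lemma inner_sum_B: "b \<in> B \<Longrightarrow> (\<Sum>c\<in>B. r c *\<^sub>R c) \<bullet> b = r b"
  using finite_B by (simp add: inner_sum_left inner_B if_distrib sum.delta cong: if_cong)

lemma repr_B: assumes "x \<in> W" shows "(\<Sum>b\<in>B. (x \<bullet> b) *\<^sub>R b) = x"
proof -
  obtain c where c: "x = (\<Sum>b\<in>B. c b *\<^sub>R b)" using span_finite[OF finite_B] assms B(4) by auto
  have "(\<Sum>b\<in>B. (x \<bullet> b) *\<^sub>R b) = (\<Sum>b\<in>B. c b *\<^sub>R b)"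
    by (rule sum.cong) (auto simp: c inner_sum_B)
  then show ?thesis using c by simp
qed

lemma sum_B_in_W: "(\<Sum>b\<in>B. r b *\<^sub>R b) \<in> W"
  using B(1) subspace_W by (auto intro!: subspace_sum subspace_mul)

lemmas g_simps = bilinear_ladd[OF bilin] bilinear_radd[OF bilin] bilinear_lmul[OF bilin] bilinear_rmul[OF bilin]
  bilinear_lzero[OF bilin] bilinear_rzero[OF bilin] bilinear_lsub[OF bilin] bilinear_rsub[OF bilin]
  bilinear_lneg[OF bilin] bilinear_rneg[OF bilin]

lemma g_sum_right: "g x (\<Sum>b\<in>F. r b *\<^sub>R b) = (\<Sum>b\<in>F. r b * g x b)"
proof -
  have "linear (g x)" using bilin by (simp add: bilinear_def)
  then show ?thesis by (simp add: linear_sum linear_cmul)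
qed

lemma g_sum_left: "g (\<Sum>b\<in>F. r b *\<^sub>R b) x = (\<Sum>b\<in>F. r b * g b x)"
  by (subst sym, subst g_sum_right) (simp add: sym)

lemma g_nonneg: "x \<in> W \<Longrightarrow> 0 \<le> g x x"
  by (rule order_trans[OF _ low]) auto

lemma Cauchy_Schwarz_g:
  assumes x: "x \<in> W" and y: "y \<in> W"
  shows "\<bar>g x y\<bar> \<le> sqrt (g x x) * sqrt (g y y)"
proof -
  have q: "0 \<le> g x x - 2 * t * g x y + t\<^sup>2 * g y y" for t
  proof -
    have "0 \<le> g (x - t *\<^sub>R y) (x - t *\<^sub>R y)"
      using x y subspace_W by (intro g_nonneg subspace_diff subspace_mul)
    then show ?thesis by (simp add: g_simps power2_eq_square algebra_simps sym[of y x])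
  qed
  have "(g x y)\<^sup>2 \<le> g x x * g y y"
  proof (cases "g y y = 0")
    case True
    then have "norm y = 0" using low[OF y] Lam by (simp add: divide_le_0_iff power2_eq_square mult_le_0_iff)
    then show ?thesis by (simp add: g_simps)
  next
    case False
    then have "g y y > 0" using g_nonneg[OF y] by simp
    then show ?thesis using q[of "g x y / g y y"] by (simp add: field_simps power2_eq_square)
  qed
  then have "sqrt ((g x y)\<^sup>2) \<le> sqrt (g x x * g y y)" by (rule real_sqrt_le_mono)
  then show ?thesis by (simp add: real_sqrt_mult)
qed

text \<open>Euclidean gradient descent for half of \<open>g x x\<close> minus the functional with
  values \<open>d b\<close> on the frame. If G represents \<open>g z\<close>, the bounds
  \<open>norm G \<le> \<Lambda>\<^sup>2 * norm z\<close> and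
  \<open>G \<bullet> z \<ge> (norm z)\<^sup>2 / \<Lambda>\<^sup>2\<close> give for step size t the
  squared contraction factor
  \<open>1 - 2 * t / \<Lambda>\<^sup>2 + t\<^sup>2 * \<Lambda> ^ 4\<close>, which is smallest at
  \<open>1 / \<Lambda> ^ 6\<close>.\<close>

definition gstep :: "('e \<Rightarrow> real) \<Rightarrow> 'e \<Rightarrow> 'e" where
  "gstep d x = x - (1 / \<Lambda> ^ 6) *\<^sub>R (\<Sum>b\<in>B. (g x b - d b) *\<^sub>R b)"

lemma gstep_contraction:
  assumes x: "x \<in> W" and y: "y \<in> W"
  shows "dist (gstep d x) (gstep d y) \<le> sqrt (1 - 1 / \<Lambda> ^ 8) * dist x y"
proof -
  define z where "z = x - y"
  \<comment> \<open>The vector of W that represents the functional \<open>g z\<close> in the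
    Euclidean inner product.\<close>
  define G where "G = (\<Sum>b\<in>B. g z b *\<^sub>R b)"
  have z: "z \<in> W" using x y subspace_W by (simp add: z_def subspace_diff)
  have G: "G \<in> W" unfolding G_def by (rule sum_B_in_W)
  have Gi: "G \<bullet> w = g z w" if "w \<in> W" for w
  proof -
    have "G \<bullet> w = (\<Sum>b\<in>B. g z b * (w \<bullet> b))" by (simp add: G_def inner_sum_left) (simp add: inner_commute)
    also have "\<dots> = g z (\<Sum>b\<in>B. (w \<bullet> b) *\<^sub>R b)" by (simp add: g_sum_right mult.commute)
    finally show ?thesis using repr_B[OF that] by simp
  qed
  have L0: "0 < \<Lambda>" using Lam by simp
  have sq: "sqrt (g w w) \<le> \<Lambda> * norm w" if "w \<in> W" for w
    using real_sqrt_le_mono[OF up[OF that]] L0 by (simp add: real_sqrt_mult)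
  have "(norm G)\<^sup>2 = g z G" using Gi[OF G] by (simp add: power2_norm_eq_inner)
  also have "\<dots> \<le> sqrt (g z z) * sqrt (g G G)" using Cauchy_Schwarz_g[OF z G] by simp
  also have "\<dots> \<le> (\<Lambda> * norm z) * (\<Lambda> * norm G)"
    using L0 g_nonneg[OF z] g_nonneg[OF G] by (intro mult_mono sq z G) auto
  finally have "norm G * norm G \<le> (\<Lambda>\<^sup>2 * norm z) * norm G" by (simp add: power2_eq_square ac_simps)
  then have Gn: "norm G \<le> \<Lambda>\<^sup>2 * norm z"
    by (cases "norm G = 0") (auto simp: mult_le_cancel_right)
  then have Gn2: "(norm G)\<^sup>2 \<le> \<Lambda> ^ 4 * (norm z)\<^sup>2"
    using power_mono[OF Gn, of 2] by (simp add: power_mult_distrib)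
  define \<tau> where "\<tau> = 1 / \<Lambda> ^ 6"
  have s: "(\<Sum>b\<in>B. (g x b - d b) *\<^sub>R b) - (\<Sum>b\<in>B. (g y b - d b) *\<^sub>R b) = G"
    unfolding G_def sum_subtractf[symmetric] scaleR_diff_left[symmetric] z_def
    by (intro sum.cong refl) (simp add: bilinear_lsub[OF bilin])
  have "gstep d x - gstep d y = z - \<tau> *\<^sub>R G"
    unfolding s[symmetric] by (simp add: gstep_def z_def \<tau>_def scaleR_diff_right)
  then have "(dist (gstep d x) (gstep d y))\<^sup>2 = (norm (z - \<tau> *\<^sub>R G))\<^sup>2" by (simp add: dist_norm)
  also have "\<dots> = (z - \<tau> *\<^sub>R G) \<bullet> (z - \<tau> *\<^sub>R G)" by (rule power2_norm_eq_inner)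
  also have "\<dots> = z \<bullet> z - 2 * \<tau> * (G \<bullet> z) + \<tau> * \<tau> * (G \<bullet> G)"
    by (simp add: inner_diff_left inner_diff_right inner_commute[of z G] algebra_simps)
  also have "\<dots> = (norm z)\<^sup>2 - 2 * \<tau> * g z z + \<tau>\<^sup>2 * (norm G)\<^sup>2"
    unfolding Gi[OF z] power2_norm_eq_inner by (simp add: power2_eq_square)
  also have "\<dots> \<le> (norm z)\<^sup>2 - 2 * \<tau> * ((norm z)\<^sup>2 / \<Lambda>\<^sup>2) + \<tau>\<^sup>2 * (\<Lambda> ^ 4 * (norm z)\<^sup>2)"
    using low[OF z] Gn2 L0 by (intro add_mono diff_mono mult_left_mono) (auto simp: \<tau>_def)
  also have "\<dots> = (1 - 1 / \<Lambda> ^ 8) * (norm z)\<^sup>2"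
  proof -
    have "\<tau>\<^sup>2 * \<Lambda> ^ 4 = 1 / \<Lambda> ^ 8" "\<tau> / \<Lambda>\<^sup>2 = 1 / \<Lambda> ^ 8" using L0 by (simp_all add: \<tau>_def field_simps power_numeral_reduce)
    moreover have "(norm z)\<^sup>2 - 2 * \<tau> * ((norm z)\<^sup>2 / \<Lambda>\<^sup>2) + \<tau>\<^sup>2 * (\<Lambda> ^ 4 * (norm z)\<^sup>2) =
        (1 - 2 * (\<tau> / \<Lambda>\<^sup>2) + \<tau>\<^sup>2 * \<Lambda> ^ 4) * (norm z)\<^sup>2" by (simp add: algebra_simps)
    ultimately show ?thesis by simp
  qed
  finally have "sqrt ((dist (gstep d x) (gstep d y))\<^sup>2) \<le> sqrt ((1 - 1 / \<Lambda> ^ 8) * (norm z)\<^sup>2)"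
    by (rule real_sqrt_le_mono)
  then show ?thesis by (simp add: real_sqrt_mult z_def dist_norm)
qed

lemma gstep_in_W: "x \<in> W \<Longrightarrow> gstep d x \<in> W"
  unfolding gstep_def using subspace_W by (intro subspace_diff subspace_mul sum_B_in_W)

text \<open>The Riesz representative as the limit of a gradient descent, which shows that it depends
  measurably on parameters.\<close>

lemma riesz_gstep:
  obtains \<xi> where "\<xi> \<in> W" "\<And>b. b \<in> B \<Longrightarrow> g \<xi> b = d b" "(\<lambda>k. (gstep d ^^ k) 0) \<longlonglongrightarrow> \<xi>"
proof -
  define c where "c = sqrt (1 - 1 / \<Lambda> ^ 8)"
  have "\<Lambda> ^ 8 \<ge> 1" using Lam by simp
  then have "0 \<le> 1 - 1 / \<Lambda> ^ 8" "1 - 1 / \<Lambda> ^ 8 < 1" using Lam by (auto simp: field_simps)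
  then have c: "0 \<le> c" "c < 1" using real_sqrt_lt_1_iff by (auto simp: c_def)
  have contr: "dist (gstep d x) (gstep d y) \<le> c * dist x y" if "x \<in> W" "y \<in> W" for x y
    using gstep_contraction[OF that] by (simp add: c_def)
  have "\<exists>!x\<in>W. gstep d x = x"
  proof (rule Banach_fix)
    show "complete W" using closed_subspace[OF subspace_W] by (simp add: complete_eq_closed)
    show "W \<noteq> {}" using subspace_W subspace_0 by blast
  qed (use c gstep_in_W contr in auto)
  then obtain \<xi> where \<xi>: "\<xi> \<in> W" "gstep d \<xi> = \<xi>" by blast
  have "(1 / \<Lambda> ^ 6) *\<^sub>R (\<Sum>b\<in>B. (g \<xi> b - d b) *\<^sub>R b) = 0" using \<xi>(2) by (simp add: gstep_def)
  then have "(\<Sum>b\<in>B. (g \<xi> b - d b) *\<^sub>R b) = 0" using Lam by simp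
  then have eq: "g \<xi> b = d b" if "b \<in> B" for b
    using inner_sum_B[OF that, of "\<lambda>b. g \<xi> b - d b"] by simp
  have it: "(gstep d ^^ k) 0 \<in> W \<and> dist ((gstep d ^^ k) 0) \<xi> \<le> c ^ k * dist 0 \<xi>" for k
  proof (induction k)
    case 0 show ?case using subspace_W by (simp add: subspace_0)
  next
    case (Suc k)
    have "dist (gstep d ((gstep d ^^ k) 0)) (gstep d \<xi>) \<le> c * dist ((gstep d ^^ k) 0) \<xi>"
      using Suc \<xi> contr by blast
    also have "\<dots> \<le> c * (c ^ k * dist 0 \<xi>)" using Suc c by (intro mult_left_mono) auto
    finally show ?case using Suc \<xi>(2) gstep_in_W by (simp add: mult.assoc)
  qed
  have "(\<lambda>k. (gstep d ^^ k) 0) \<longlonglongrightarrow> \<xi>"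
  proof (subst tendsto_dist_iff, rule tendsto_sandwich[OF _ _ tendsto_const])
    show "(\<lambda>k. c ^ k * dist 0 \<xi>) \<longlonglongrightarrow> 0" using c by (intro tendsto_mult_left_zero LIMSEQ_realpow_zero)
  qed (use it in auto)
  with that \<xi>(1) eq show thesis by blast
qed

lemma riesz_unique:
  assumes "\<xi> \<in> W" "\<xi>' \<in> W" "\<And>b. b \<in> B \<Longrightarrow> g \<xi> b = g \<xi>' b"
  shows "\<xi> = \<xi>'"
proof -
  let ?z = "\<xi> - \<xi>'"
  have z: "?z \<in> W" using assms subspace_W by (simp add: subspace_diff)
  have "g ?z ?z = g ?z (\<Sum>b\<in>B. (?z \<bullet> b) *\<^sub>R b)" using repr_B[OF z] by simp
  also have "\<dots> = 0" using assms by (simp add: g_sum_right g_simps)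
  finally have "(norm ?z)\<^sup>2 / \<Lambda>\<^sup>2 \<le> 0" using low[OF z] by simp
  then show ?thesis using Lam by (simp add: divide_le_0_iff power2_eq_square mult_le_0_iff)
qed

text \<open>The Gram matrix of an orthonormal basis inherits the lower bound of the form. This is
  what keeps the volume density away from zero.\<close>

lemma det_on_ge: "(1 / \<Lambda>\<^sup>2) ^ card B \<le> det_on B g"
proof (rule det_on_positive_definite_ge)
  fix x :: "'e \<Rightarrow> real"
  let ?v = "\<Sum>b\<in>B. x b *\<^sub>R b"
  have "(norm ?v)\<^sup>2 = (\<Sum>b\<in>B. x b * (?v \<bullet> b))"
    by (simp only: power2_norm_eq_inner inner_sum_right[of _ _ B] inner_scaleR_right)
  also have "\<dots> = (\<Sum>i\<in>B. (x i)\<^sup>2)" by (rule sum.cong) (auto simp: inner_sum_B power2_eq_square)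
  finally have n: "(norm ?v)\<^sup>2 = (\<Sum>i\<in>B. (x i)\<^sup>2)" .
  have "g ?v ?v = (\<Sum>i\<in>B. \<Sum>j\<in>B. g i j * x i * x j)"
    unfolding g_sum_left sum_distrib_left unfolding g_sum_right sum_distrib_left
    by (intro sum.cong refl) (simp add: ac_simps)
  then show "1 / \<Lambda>\<^sup>2 * (\<Sum>i\<in>B. (x i)\<^sup>2) \<le> (\<Sum>i\<in>B. \<Sum>j\<in>B. g i j * x i * x j)"
    using low[OF sum_B_in_W, of x] n by simp
qed (use finite_B sym Lam in auto)

end

section \<open>Triangulations\<close>

text \<open>Formulated for bare distance functions because barycentric coordinates are compared by
  \<open>bary_dist\<close>, which is not the \<open>dist\<close> of a type. The radius is shrunk so
  that f stays in the region where g is Lipschitz.\<close>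

lemma loc_lipschitz_compose:
  assumes f: "loc_lipschitz S d d' f" and g: "loc_lipschitz T d' d'' g" and fS: "f ` S \<subseteq> T"
    and d: "\<And>x y. 0 \<le> d x y" and d': "\<And>x y. 0 \<le> d' x y" and d0: "\<And>x. x \<in> S \<Longrightarrow> d x x = 0"
  shows "loc_lipschitz S d d'' (g \<circ> f)"
  unfolding loc_lipschitz_def
proof
  fix x assume x: "x \<in> S"
  obtain r L where r: "r > 0" "\<And>y z. y \<in> S \<Longrightarrow> z \<in> S \<Longrightarrow> d x y < r \<Longrightarrow> d x z < r \<Longrightarrow> d' (f y) (f z) \<le> L * d y z"
    using f x unfolding loc_lipschitz_def by metis
  obtain r' L' where r': "r' > 0" "\<And>y z. y \<in> T \<Longrightarrow> z \<in> T \<Longrightarrow> d' (f x) y < r' \<Longrightarrow> d' (f x) z < r' \<Longrightarrow> d'' (g y) (g z) \<le> L' * d' y z"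
    using g x fS unfolding loc_lipschitz_def by (metis image_subset_iff)
  define L1 where "L1 = max 1 L"
  define L2 where "L2 = max 0 L'"
  define r'' where "r'' = min r (r' / L1)"
  have L1: "L1 > 0" "L \<le> L1" by (auto simp: L1_def)
  have r0: "0 < r''" using r r' L1 by (auto simp: r''_def)
  have b: "d' (f y) (f z) \<le> L1 * d y z" if "y \<in> S" "z \<in> S" "d x y < r''" "d x z < r''" for y z
  proof -
    have "d' (f y) (f z) \<le> L * d y z" using that by (intro r(2)) (auto simp: r''_def)
    also have "\<dots> \<le> L1 * d y z" using L1 d by (intro mult_right_mono) auto
    finally show ?thesis .
  qed
  have sm: "d' (f x) (f y) < r'" if "y \<in> S" "d x y < r''" for y
  proof -
    have "d' (f x) (f y) \<le> L1 * d x y" using b[OF x that(1)] that r0 d0[OF x] by simp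
    also have "\<dots> < L1 * (r' / L1)" using that L1 by (intro mult_strict_left_mono) (auto simp: r''_def)
    finally show ?thesis using L1 by simp
  qed
  have "d'' ((g \<circ> f) y) ((g \<circ> f) z) \<le> (L2 * L1) * d y z" if yz: "y \<in> S" "z \<in> S" "d x y < r''" "d x z < r''" for y z
  proof -
    have "d'' (g (f y)) (g (f z)) \<le> L' * d' (f y) (f z)"
      using yz sm fS by (intro r'(2)) auto
    also have "\<dots> \<le> L2 * d' (f y) (f z)" using d' by (intro mult_right_mono) (auto simp: L2_def)
    also have "\<dots> \<le> L2 * (L1 * d y z)" using b[OF yz] by (intro mult_left_mono) (auto simp: L2_def)
    finally show ?thesis by (simp add: mult.assoc)
  qed
  then show "\<exists>r>0. \<exists>L. \<forall>y\<in>S. \<forall>z\<in>S. d x y < r \<and> d x z < r \<longrightarrow> d'' ((g \<circ> f) y) ((g \<circ> f) z) \<le> L * d y z"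
    using r0 by blast
qed

lemma loc_lipschitz_continuous_on:
  fixes f :: "'p::metric_space \<Rightarrow> 'q::metric_space"
  assumes "loc_lipschitz S dist dist f"
  shows "continuous_on S f"
  unfolding continuous_on_iff
proof (intro ballI allI impI)
  fix x and e :: real assume x: "x \<in> S" and e: "e > 0"
  obtain r L where r: "r > 0" "\<And>y z. y \<in> S \<Longrightarrow> z \<in> S \<Longrightarrow> dist x y < r \<Longrightarrow> dist x z < r \<Longrightarrow> dist (f y) (f z) \<le> L * dist y z"
    using assms x unfolding loc_lipschitz_def by metis
  define d where "d = min r (e / (\<bar>L\<bar> + 1))"
  have "d > 0" using r e by (auto simp: d_def)
  moreover have "dist (f y) (f x) < e" if "y \<in> S" "dist y x < d" for y
  proof -
    have "dist (f y) (f x) \<le> L * dist y x"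
      using that x r(1) by (intro r(2)) (auto simp: d_def dist_commute)
    also have "\<dots> \<le> (\<bar>L\<bar> + 1) * dist y x" by (intro mult_right_mono) auto
    also have "\<dots> < (\<bar>L\<bar> + 1) * (e / (\<bar>L\<bar> + 1))"
      using that by (intro mult_strict_left_mono) (auto simp: d_def)
    finally show ?thesis by simp
  qed
  ultimately show "\<exists>d>0. \<forall>x'\<in>S. dist x' x < d \<longrightarrow> dist (f x') (f x) < e" by blast
qed

lemma affine_hull_add_direction:
  assumes "w \<in> span {p - q | p q. p \<in> T \<and> q \<in> T}" "y \<in> affine hull T"
  shows "y + w \<in> affine hull T"
  using assms
proof (induction arbitrary: y rule: span_induct_alt)
  case (step c x w)
  then obtain p q where x: "x = p - q" "p \<in> T" "q \<in> T" by blast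
  have "(y + w) + c *\<^sub>R (p - q) \<in> affine hull T"
    using step x by (intro mem_affine_3_minus) (auto intro: hull_inc)
  then show ?case by (simp add: x algebra_simps)
qed simp

lemma convex_hull_diff_in_directions:
  assumes "y \<in> convex hull T" "z \<in> convex hull T"
  shows "y - z \<in> span {p - q | p q. p \<in> T \<and> q \<in> T}" (is "_ \<in> span ?D")
proof -
  have a: "y - q \<in> span ?D" if "q \<in> T" "y \<in> convex hull T" for q y
  proof -
    have "convex {y. y - q \<in> span ?D}"
    proof (rule convexI, simp)
      fix x y :: 'a and u v :: real assume "x - q \<in> span ?D" "y - q \<in> span ?D" and uv: "u + v = 1"
      then have "u *\<^sub>R (x - q) + v *\<^sub>R (y - q) \<in> span ?D" by (intro span_add span_scale)
      also have "u *\<^sub>R (x - q) + v *\<^sub>R (y - q) = u *\<^sub>R x + v *\<^sub>R y - (u + v) *\<^sub>R q" by (simp add: algebra_simps)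
      finally show "u *\<^sub>R x + v *\<^sub>R y - q \<in> span ?D" using uv by simp
    qed
    moreover have "T \<subseteq> {y. y - q \<in> span ?D}" using that(1) by (auto intro!: span_base)
    ultimately have "convex hull T \<subseteq> {y. y - q \<in> span ?D}" by (rule hull_minimal[rotated])
    then show ?thesis using that(2) by blast
  qed
  have "T \<noteq> {}" using assms by auto
  then obtain q where q: "q \<in> T" by blast
  have "(y - q) - (z - q) \<in> span ?D" by (rule span_diff[OF a[OF q assms(1)] a[OF q assms(2)]])
  then show ?thesis by simp
qed

lemma compact_closure_subset:
  fixes A :: "'a::t2_space set"
  assumes "A \<subseteq> C" "compact C"
  shows "compact (closure A)"
  using compact_Int_closed[OF assms(2) closed_closure[of A]] closure_minimal[OF assms(1) compact_imp_closed[OF assms(2)]]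
  by (simp add: Int_absorb1)

locale lip_poly =
  fixes X :: "('v, 'e::euclidean_space, 'a::metric_space) rpoly"
  assumes lipschitz_poly: "lipschitz_polyhedron X"
begin

abbreviation "P \<equiv> embed X ` space_of X"

lemma connected_UNIV: "connected (UNIV :: 'a set)"
  and lf: "lf_complex (simplices X)"
  and triang_homeo: "lipschitz_homeo (space_of X) bary_dist (UNIV :: 'a set) dist (triang X)"
  and embed_homeo: "lipschitz_homeo (space_of X) bary_dist P dist (embed X)"
  and closed_P: "closed P"
  using lipschitz_poly by (auto simp: lipschitz_polyhedron_def)

lemma finite_simplex: "s \<in> simplices X \<Longrightarrow> finite s"
  and simplex_nonempty: "s \<in> simplices X \<Longrightarrow> s \<noteq> {}"
  and face: "s \<in> simplices X \<Longrightarrow> t \<subseteq> s \<Longrightarrow> t \<noteq> {} \<Longrightarrow> t \<in> simplices X"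
  and countable_simplices: "countable (simplices X)"
  and finite_star: "finite {s \<in> simplices X. v \<in> s}"
  using lf unfolding lf_complex_def by blast+

lemma bij_triang: "bij_betw (triang X) (space_of X) UNIV"
  and bij_embed: "bij_betw (embed X) (space_of X) P"
  using triang_homeo embed_homeo by (auto simp: lipschitz_homeo_def)

lemma inj_embed: "inj_on (embed X) (space_of X)"
  using bij_embed by (rule bij_betw_imp_inj_on)

lemma inv_embed [simp]: "\<alpha> \<in> space_of X \<Longrightarrow> inv_into (space_of X) (embed X) (embed X \<alpha>) = \<alpha>"
  using inj_embed by (rule inv_into_f_f)

lemma bary_in [simp]: "bary X x \<in> space_of X"
  and triang_bary [simp]: "triang X (bary X x) = x"
  using bij_triang unfolding bary_def bij_betw_def
  by (metis UNIV_I inv_into_into, metis UNIV_I f_inv_into_f)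

lemma bary_triang [simp]: "\<alpha> \<in> space_of X \<Longrightarrow> bary X (triang X \<alpha>) = \<alpha>"
  unfolding bary_def using bij_betw_imp_inj_on[OF bij_triang] by (rule inv_into_f_f)

lemma chart_flat [simp]: "chart X (flat X x) = x"
  by (simp add: chart_def flat_def)

lemma chart_embed [simp]: "\<alpha> \<in> space_of X \<Longrightarrow> chart X (embed X \<alpha>) = triang X \<alpha>"
  by (simp add: chart_def)

lemma flat_chart [simp]: "y \<in> P \<Longrightarrow> flat X (chart X y) = y"
  by (auto simp: flat_def)

lemma bary_dist_nonneg: "0 \<le> bary_dist \<alpha> \<beta>"
  unfolding bary_dist_def by (auto intro: sum_nonneg)

lemma space_ofD:
  assumes "\<alpha> \<in> space_of X"
  shows "0 \<le> \<alpha> v" "supp \<alpha> \<in> simplices X" "finite (supp \<alpha>)" "(\<Sum>v\<in>supp \<alpha>. \<alpha> v) = 1"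
  using assms finite_simplex by (auto simp: space_of_def geom_space_def)

lemma simplex_at_in [simp]: "simplex_at X x \<in> simplices X"
  unfolding simplex_at_def by (intro space_ofD(2)) simp

text \<open>Makes every barycentric coordinate continuous on the space; the openness of stars and of
  the open maximal cells rests on this.\<close>

lemma coordinate_le_bary_dist:
  assumes "\<alpha> \<in> space_of X" "\<beta> \<in> space_of X"
  shows "\<bar>\<alpha> v - \<beta> v\<bar> \<le> bary_dist \<alpha> \<beta>"
proof (cases "v \<in> supp \<alpha> \<union> supp \<beta>")
  case True
  have "(\<alpha> v - \<beta> v)\<^sup>2 \<le> (\<Sum>v\<in>supp \<alpha> \<union> supp \<beta>. (\<alpha> v - \<beta> v)\<^sup>2)"
    using True assms space_ofD by (intro member_le_sum) auto
  then have "sqrt ((\<alpha> v - \<beta> v)\<^sup>2) \<le> bary_dist \<alpha> \<beta>" unfolding bary_dist_def by (rule real_sqrt_le_mono)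
  then show ?thesis by simp
qed (simp add: supp_def bary_dist_nonneg)

lemma loc_lipschitz_chart: "loc_lipschitz P dist dist (chart X)"
proof -
  have "loc_lipschitz P dist dist (triang X \<circ> inv_into (space_of X) (embed X))"
    by (rule loc_lipschitz_compose[where T = "space_of X" and d' = bary_dist])
      (use triang_homeo embed_homeo in \<open>auto simp: lipschitz_homeo_def bary_dist_nonneg\<close>)
  then show ?thesis by (simp add: chart_def[abs_def] o_def)
qed

lemma continuous_chart: "continuous_on P (chart X)"
  using loc_lipschitz_chart by (rule loc_lipschitz_continuous_on)

lemma continuous_flat: "continuous_on A (flat X)"
proof -
  have "loc_lipschitz UNIV dist dist (embed X \<circ> inv_into (space_of X) (triang X))"
    by (rule loc_lipschitz_compose[where T = "space_of X" and d' = bary_dist])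
      (use triang_homeo embed_homeo bij_triang in \<open>auto simp: lipschitz_homeo_def bary_dist_nonneg bij_betw_def intro: inv_into_into\<close>)
  then have "continuous_on UNIV (flat X)"
    by (intro loc_lipschitz_continuous_on) (simp add: flat_def[abs_def] bary_def[abs_def] o_def)
  then show ?thesis by (rule continuous_on_subset) simp
qed

lemma continuous_bary: "continuous_on UNIV (\<lambda>x. bary X x v)"
proof -
  have "loc_lipschitz UNIV dist dist (\<lambda>x. bary X x v)"
    unfolding loc_lipschitz_def
  proof
    fix x :: 'a
    have "loc_lipschitz UNIV dist bary_dist (bary X)"
      using triang_homeo by (simp add: lipschitz_homeo_def bary_def[abs_def])
    then obtain r L where "r > 0" "\<And>y z. dist x y < r \<Longrightarrow> dist x z < r \<Longrightarrow> bary_dist (bary X y) (bary X z) \<le> L * dist y z"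
      unfolding loc_lipschitz_def by (metis UNIV_I)
    then show "\<exists>r>0. \<exists>L. \<forall>y\<in>UNIV. \<forall>z\<in>UNIV. dist x y < r \<and> dist x z < r \<longrightarrow> dist (bary X y v) (bary X z v) \<le> L * dist y z"
      using coordinate_le_bary_dist[of "bary X y" "bary X z" v for y z] unfolding dist_real_def
      by (meson bary_in order_trans)
  qed
  then show ?thesis by (rule loc_lipschitz_continuous_on)
qed

lemma open_bary_pos: "open {x. 0 < bary X x v}"
  using continuous_bary by (intro open_Collect_less) auto

lemma embed_eq:
  assumes "\<alpha> \<in> space_of X" "supp \<alpha> \<subseteq> s" "finite s"
  shows "embed X \<alpha> = (\<Sum>v\<in>s. \<alpha> v *\<^sub>R vpos X v)" "(\<Sum>v\<in>s. \<alpha> v) = 1"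
proof -
  show "embed X \<alpha> = (\<Sum>v\<in>s. \<alpha> v *\<^sub>R vpos X v)"
    unfolding embed_def using assms by (intro sum.mono_neutral_left) (auto simp: supp_def)
  have "(\<Sum>v\<in>s. \<alpha> v) = (\<Sum>v\<in>supp \<alpha>. \<alpha> v)"
    using assms by (intro sum.mono_neutral_right) (auto simp: supp_def)
  then show "(\<Sum>v\<in>s. \<alpha> v) = 1" using space_ofD[OF assms(1)] by simp
qed

lemma space_ofI:
  assumes s: "s \<in> simplices X" and "\<And>v. 0 \<le> \<alpha> v" "\<And>v. v \<notin> s \<Longrightarrow> \<alpha> v = 0" "(\<Sum>v\<in>s. \<alpha> v) = 1"
  shows "\<alpha> \<in> space_of X" "supp \<alpha> \<subseteq> s"
proof -
  show ss: "supp \<alpha> \<subseteq> s" using assms(3) by (auto simp: supp_def)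
  have eq: "(\<Sum>v\<in>supp \<alpha>. \<alpha> v) = (\<Sum>v\<in>s. \<alpha> v)"
    using ss finite_simplex[OF s] by (intro sum.mono_neutral_left) (auto simp: supp_def)
  then have "supp \<alpha> \<noteq> {}" using assms(4) by auto
  then have "supp \<alpha> \<in> simplices X" using face[OF s ss] by simp
  then show "\<alpha> \<in> space_of X" using assms eq by (simp add: space_of_def geom_space_def)
qed

text \<open>A vertex is the image of the point mass \<delta>, and the embedding separates point
  masses.\<close>

lemma vpos_inj:
  assumes s: "s \<in> simplices X"
  shows "inj_on (vpos X) s"
proof (rule inj_onI)
  fix v w assume vw: "v \<in> s" "w \<in> s" "vpos X v = vpos X w"
  define \<delta> where "\<delta> u = (\<lambda>x. if x = u then 1 else 0 :: real)" for u :: 'v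
  have d: "\<delta> u \<in> space_of X" "embed X (\<delta> u) = vpos X u" if "u \<in> s" for u
  proof -
    have "{u} \<in> simplices X" using face[OF s, of "{u}"] that by simp
    from space_ofI[OF this, of "\<delta> u"] show "\<delta> u \<in> space_of X" by (auto simp: \<delta>_def)
    have "supp (\<delta> u) = {u}" by (auto simp: supp_def \<delta>_def)
    then show "embed X (\<delta> u) = vpos X u" by (simp add: embed_def \<delta>_def)
  qed
  have "\<delta> v = \<delta> w" using inj_onD[OF inj_embed, of "\<delta> v" "\<delta> w"] d vw by simp
  then show "v = w" by (metis \<delta>_def zero_neq_one)
qed

lemma flat_cell_eq:
  assumes s: "s \<in> simplices X"
  shows "flat_cell X s = embed X ` {\<alpha> \<in> space_of X. supp \<alpha> \<subseteq> s}"
proof (intro equalityI subsetI)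
  have fs: "finite s" using finite_simplex[OF s] .
  fix y assume "y \<in> flat_cell X s"
  then obtain u where u: "\<And>x. x \<in> vpos X ` s \<Longrightarrow> 0 \<le> u x" "sum u (vpos X ` s) = 1" "(\<Sum>x\<in>vpos X ` s. u x *\<^sub>R x) = y"
    unfolding flat_cell_def convex_hull_finite[OF finite_imageI[OF fs]] by blast
  define \<alpha> where "\<alpha> v = (if v \<in> s then u (vpos X v) else 0)" for v
  have "(\<Sum>v\<in>s. \<alpha> v) = 1" using u(2) by (simp add: sum.reindex[OF vpos_inj[OF s]] \<alpha>_def)
  then have a: "\<alpha> \<in> space_of X" "supp \<alpha> \<subseteq> s"
    using space_ofI[OF s, of \<alpha>] u(1) by (auto simp: \<alpha>_def)
  have "embed X \<alpha> = y" using u(3) by (simp add: embed_eq(1)[OF a fs] sum.reindex[OF vpos_inj[OF s]] \<alpha>_def)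
  then show "y \<in> embed X ` {\<alpha> \<in> space_of X. supp \<alpha> \<subseteq> s}" using a by blast
next
  have fs: "finite s" using finite_simplex[OF s] .
  fix y assume "y \<in> embed X ` {\<alpha> \<in> space_of X. supp \<alpha> \<subseteq> s}"
  then obtain \<alpha> where a: "\<alpha> \<in> space_of X" "supp \<alpha> \<subseteq> s" "y = embed X \<alpha>" by blast
  show "y \<in> flat_cell X s"
    unfolding a(3) embed_eq(1)[OF a(1,2) fs] flat_cell_def
    using embed_eq(2)[OF a(1,2) fs] space_ofD(1)[OF a(1)] fs
    by (intro convex_sum) (auto intro: hull_inc)
qed

lemma flat_cell_subset: "s \<in> simplices X \<Longrightarrow> flat_cell X s \<subseteq> P"
  by (auto simp: flat_cell_eq)

lemma cell_eq: "s \<in> simplices X \<Longrightarrow> cell X s = chart X ` flat_cell X s"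
  by (auto simp: flat_cell_eq cell_def image_image intro!: image_cong)

lemma mem_cell: "s \<in> simplices X \<Longrightarrow> x \<in> cell X s \<longleftrightarrow> simplex_at X x \<subseteq> s"
  unfolding cell_def simplex_at_def by (auto intro!: image_eqI[of _ _ "bary X x"])

lemma compact_flat_cell: "s \<in> simplices X \<Longrightarrow> compact (flat_cell X s)"
  unfolding flat_cell_def by (intro finite_imp_compact_convex_hull finite_imageI finite_simplex)

lemma convex_flat_cell: "convex (flat_cell X s)"
  by (simp add: flat_cell_def)

lemma compact_cell: "s \<in> simplices X \<Longrightarrow> compact (cell X s)"
  unfolding cell_eq
  by (intro compact_continuous_image compact_flat_cell continuous_on_subset[OF continuous_chart] flat_cell_subset)

text \<open>A dependence c among the vertices would give two points with the same image: the
  barycentre of s and its displacement along c. Injectivity of the embedding forbids this.\<close>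

lemma affine_independent_vertices:
  assumes s: "s \<in> simplices X"
  shows "\<not> affine_dependent (vpos X ` s)"
proof
  have fs: "finite s" using finite_simplex[OF s] .
  assume "affine_dependent (vpos X ` s)"
  then obtain U where U: "sum U (vpos X ` s) = 0" "\<exists>v\<in>vpos X ` s. U v \<noteq> 0" "(\<Sum>v\<in>vpos X ` s. U v *\<^sub>R v) = 0"
    using affine_dependent_explicit_finite[of "vpos X ` s"] fs by auto
  define c where "c v = U (vpos X v)" for v
  have c: "(\<Sum>v\<in>s. c v) = 0" "\<exists>v\<in>s. c v \<noteq> 0" "(\<Sum>v\<in>s. c v *\<^sub>R vpos X v) = 0"
    using U by (auto simp: sum.reindex[OF vpos_inj[OF s]] c_def)
  define m where "m = real (card s)"
  have m: "m > 0" using fs simplex_nonempty[OF s] by (simp add: m_def card_gt_0_iff)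
  \<comment> \<open>Positive and a bound for every coefficient, so a displacement by
    \<open>c v / (C * m)\<close> keeps the coordinates, which start at 1 / m, nonnegative.\<close>
  define C where "C = (\<Sum>v\<in>s. \<bar>c v\<bar>) + 1"
  have C: "C > 0" "\<bar>c v\<bar> \<le> C" if "v \<in> s" for v
    using member_le_sum[of v s "\<lambda>v. \<bar>c v\<bar>"] fs that by (auto simp: C_def intro: add_nonneg_pos sum_nonneg)
  have C0: "C > 0" by (auto simp: C_def intro: add_nonneg_pos sum_nonneg)
  define \<alpha> where "\<alpha> t v = (if v \<in> s then 1 / m + t * c v / (C * m) else 0)" for t v
  have a: "\<alpha> t \<in> space_of X" "supp (\<alpha> t) \<subseteq> s" if "t \<in> {0, 1}" for t
  proof -
    have "0 \<le> \<alpha> t v" for v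
      using C(2)[of v] C0 m that by (auto simp: \<alpha>_def field_simps abs_le_iff)
    moreover have "(\<Sum>v\<in>s. \<alpha> t v) = 1"
      using m c(1) by (simp add: \<alpha>_def sum.distrib m_def[symmetric] sum_divide_distrib[symmetric] sum_distrib_left[symmetric])
    ultimately show "\<alpha> t \<in> space_of X" "supp (\<alpha> t) \<subseteq> s" using space_ofI[OF s, of "\<alpha> t"] by (auto simp: \<alpha>_def)
  qed
  have "embed X (\<alpha> 1) = (\<Sum>v\<in>s. (1 / m) *\<^sub>R vpos X v + (1 / (C * m)) *\<^sub>R (c v *\<^sub>R vpos X v))"
    by (subst embed_eq(1)[OF a fs]) (auto simp: \<alpha>_def algebra_simps intro!: sum.cong)
  also have "\<dots> = (\<Sum>v\<in>s. (1 / m) *\<^sub>R vpos X v)"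
    by (simp only: sum.distrib scaleR_sum_right[symmetric] c(3) scaleR_zero_right add_0_right)
  also have "\<dots> = embed X (\<alpha> 0)"
    by (subst embed_eq(1)[OF a fs]) (auto simp: \<alpha>_def intro!: sum.cong)
  finally have "\<alpha> 1 = \<alpha> 0" using inj_onD[OF inj_embed] a by simp
  moreover obtain v where "v \<in> s" "c v \<noteq> 0" using c(2) by blast
  ultimately show False using C0 m by (auto simp: \<alpha>_def fun_eq_iff dest!: spec[of _ v])
qed

abbreviation open_flat_cell :: "'v set \<Rightarrow> 'e set" where
  "open_flat_cell s \<equiv> rel_interior (flat_cell X s)"

text \<open>With affinely independent vertices, the relative interior consists of the convex
  combinations with positive weights. This ties the relative interiors of convex geometry to the
  combinatorial \<open>simplex_at\<close>.\<close>

lemma open_flat_cell_eq: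
  assumes s: "s \<in> simplices X"
  shows "open_flat_cell s = flat X ` {x. simplex_at X x = s}"
proof (intro equalityI subsetI)
  have fs: "finite s" using finite_simplex[OF s] .
  note ri = rel_interior_convex_hull_explicit[OF affine_independent_vertices[OF s]]
  {
    fix y assume y: "y \<in> open_flat_cell s"
    then obtain u where u: "\<And>x. x \<in> vpos X ` s \<Longrightarrow> 0 < u x" "sum u (vpos X ` s) = 1" "(\<Sum>x\<in>vpos X ` s. u x *\<^sub>R x) = y"
      unfolding flat_cell_def ri by blast
    define \<alpha> where "\<alpha> v = (if v \<in> s then u (vpos X v) else 0)" for v
    have "(\<Sum>v\<in>s. \<alpha> v) = 1" using u(2) by (simp add: sum.reindex[OF vpos_inj[OF s]] \<alpha>_def)
    then have a: "\<alpha> \<in> space_of X" "supp \<alpha> \<subseteq> s"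
      using space_ofI[OF s, of \<alpha>] u(1) by (auto simp: \<alpha>_def less_imp_le)
    have "embed X \<alpha> = y" using u(3) by (simp add: embed_eq(1)[OF a fs] sum.reindex[OF vpos_inj[OF s]] \<alpha>_def)
    moreover have "supp \<alpha> = s" using u(1) by (force simp: supp_def \<alpha>_def)
    ultimately show "y \<in> flat X ` {x. simplex_at X x = s}"
      using a by (intro image_eqI[of _ _ "triang X \<alpha>"]) (auto simp: flat_def simplex_at_def)
  }
  {
    fix y assume "y \<in> flat X ` {x. simplex_at X x = s}"
    then obtain x where x: "y = flat X x" "supp (bary X x) = s" by (auto simp: simplex_at_def)
    define u where "u p = bary X x (inv_into s (vpos X) p)" for p
    have uv: "u (vpos X v) = bary X x v" if "v \<in> s" for v
      using that vpos_inj[OF s] by (simp add: u_def)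
    have pos: "0 < bary X x v" if "v \<in> s" for v
      using that x(2) space_ofD(1)[OF bary_in, of x v] by (auto simp: supp_def less_le)
    show "y \<in> open_flat_cell s"
      unfolding flat_cell_def ri
    proof (intro CollectI exI[of _ u] conjI)
      show "\<forall>x\<in>vpos X ` s. 0 < u x" using uv pos by auto
      show "sum u (vpos X ` s) = 1"
        using embed_eq(2)[OF bary_in[of x] _ fs] x(2) by (simp add: sum.reindex[OF vpos_inj[OF s]] uv)
      show "(\<Sum>x\<in>vpos X ` s. u x *\<^sub>R x) = y"
        using embed_eq(1)[OF bary_in[of x] _ fs] x by (simp add: sum.reindex[OF vpos_inj[OF s]] uv flat_def)
    qed
  }
qed

lemma open_flat_cell_subset: "open_flat_cell s \<subseteq> flat_cell X s"
  by (rule rel_interior_subset)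

lemma simplex_at_chart [simp]:
  assumes "s \<in> simplices X" "y \<in> open_flat_cell s"
  shows "simplex_at X (chart X y) = s"
  using assms by (auto simp: open_flat_cell_eq)

lemma max_simplex: "s \<in> max_simplices X \<Longrightarrow> s \<in> simplices X"
  by (simp add: max_simplices_def)

lemma countable_max: "countable (max_simplices X)"
  using countable_simplices by (rule countable_subset[rotated]) (auto simp: max_simplices_def)

abbreviation open_cell :: "'v set \<Rightarrow> 'a set" where
  "open_cell s \<equiv> {x. simplex_at X x = s}"

lemma open_star: "open {x. t \<subseteq> simplex_at X x}" if "finite t"
proof -
  have "v \<in> simplex_at X x \<longleftrightarrow> 0 < bary X x v" for v x
    using space_ofD(1)[OF bary_in, of x v] by (auto simp: simplex_at_def supp_def)
  then have "{x. t \<subseteq> simplex_at X x} = (\<Inter>v\<in>t. {x. 0 < bary X x v})" by auto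
  then show ?thesis using that by (auto intro!: open_INT open_bary_pos)
qed

text \<open>Nothing larger lies above a maximal simplex. As a star, its open cell is open in the
  space.\<close>

lemma open_cell_eq_star:
  assumes "s \<in> max_simplices X" shows "open_cell s = {x. s \<subseteq> simplex_at X x}"
  using assms unfolding max_simplices_def by auto

lemma open_open_cell: "s \<in> max_simplices X \<Longrightarrow> open (open_cell s)"
  using open_star[of s] by (simp add: open_cell_eq_star finite_simplex max_simplex)

lemma open_cell_eq: "s \<in> simplices X \<Longrightarrow> open_cell s = chart X ` open_flat_cell s"
  by (auto simp: open_flat_cell_eq image_iff)

lemma open_cell_subset: "s \<in> simplices X \<Longrightarrow> open_cell s \<subseteq> cell X s"
  by (auto simp: mem_cell)

lemma ex_max_simplex:
  assumes t: "t \<in> simplices X"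
  obtains s where "s \<in> max_simplices X" "t \<subseteq> s"
proof -
  obtain v where v: "v \<in> t" using simplex_nonempty[OF t] by blast
  let ?S = "{s \<in> simplices X. t \<subseteq> s}"
  have "finite ?S" using finite_star[of v] by (rule finite_subset[rotated]) (use v in auto)
  moreover have "t \<in> ?S" using t by simp
  ultimately have "\<exists>m\<in>?S. t \<subseteq> m \<and> (\<forall>b\<in>?S. m \<subseteq> b \<longrightarrow> m = b)"
    by (rule finite_has_maximal2)
  then obtain s where s: "s \<in> ?S" "t \<subseteq> s" "\<And>u. u \<in> ?S \<Longrightarrow> s \<subseteq> u \<Longrightarrow> s = u"
    by metis
  have "s \<in> max_simplices X"
    unfolding max_simplices_def
  proof (intro CollectI conjI ballI impI)
    show "s \<in> simplices X" using s by simp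
    fix u assume "u \<in> simplices X" "s \<subseteq> u"
    then show "u = s" using s(2) s(3)[of u] by auto
  qed
  then show thesis using that s by blast
qed

section \<open>Relatively compact domains\<close>

lemma rel_compact_open_cell:
  assumes s: "s \<in> max_simplices X"
  shows "rel_compact_domain (open_cell s)"
  unfolding rel_compact_domain_def
proof (intro conjI)
  have s': "s \<in> simplices X" using max_simplex[OF s] .
  show "open (open_cell s)" using open_open_cell[OF s] .
  show "connected (open_cell s)" unfolding open_cell_eq[OF s']
    using open_flat_cell_subset flat_cell_subset[OF s']
    by (intro connected_continuous_image continuous_on_subset[OF continuous_chart] convex_connected convex_rel_interior convex_flat_cell) auto
  show "compact (closure (open_cell s))"
    using open_cell_subset[OF s'] compact_cell[OF s'] by (rule compact_closure_subset)
qed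

text \<open>In the Euclidean picture the set is star-shaped about x: the segment towards y stays in
  the closed simplex of y, and its points keep all vertices of the simplex of x in their support.
  Local finiteness puts the star inside finitely many compact cells.\<close>

lemma rel_compact_star:
  "rel_compact_domain {y. simplex_at X x \<subseteq> simplex_at X y}" (is "rel_compact_domain ?S")
  unfolding rel_compact_domain_def
proof (intro conjI)
  let ?t = "simplex_at X x"
  show "open ?S" by (intro open_star finite_simplex simplex_at_in)
  have seg: "chart X p \<in> ?S \<and> p \<in> P" if y: "y \<in> ?S" and p: "p \<in> closed_segment (flat X x) (flat X y)" for y p
  proof -
    obtain t where t: "0 \<le> t" "t \<le> 1" "p = (1 - t) *\<^sub>R flat X x + t *\<^sub>R flat X y"
      using p by (auto simp: in_segment)
    let ?s = "simplex_at X y"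
    have fs: "finite ?s" by (intro finite_simplex simplex_at_in)
    have sx: "supp (bary X x) \<subseteq> ?s" and sy: "supp (bary X y) \<subseteq> ?s" using y by (auto simp: simplex_at_def)
    define c where "c v = (1 - t) * bary X x v + t * bary X y v" for v
    have c: "c \<in> space_of X" "supp c \<subseteq> ?s"
    proof -
      have "(\<Sum>v\<in>?s. c v) = (1 - t) * (\<Sum>v\<in>?s. bary X x v) + t * (\<Sum>v\<in>?s. bary X y v)"
        by (simp add: c_def sum.distrib sum_distrib_left)
      then have "(\<Sum>v\<in>?s. c v) = 1"
        using embed_eq(2)[OF bary_in sx fs] embed_eq(2)[OF bary_in sy fs] by simp
      moreover have "0 \<le> c v" for v using t space_ofD(1)[OF bary_in] by (simp add: c_def)
      moreover have "c v = 0" if "v \<notin> ?s" for v 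
      proof -
        have "bary X x v = 0" "bary X y v = 0" using sx sy that unfolding supp_def by blast+
        then show ?thesis by (simp add: c_def)
      qed
      ultimately show "c \<in> space_of X" "supp c \<subseteq> ?s" using space_ofI[of ?s c] by auto
    qed
    have "p = embed X c"
      unfolding t(3) flat_def embed_eq(1)[OF bary_in sx fs] embed_eq(1)[OF bary_in sy fs] embed_eq(1)[OF c fs]
      by (simp add: c_def scaleR_sum_right sum.distrib[symmetric] scaleR_add_left)
    moreover have "v \<in> supp c" if "v \<in> ?t" for v
    proof -
      have "0 < bary X x v" using that space_ofD(1)[OF bary_in, of x v] by (auto simp: simplex_at_def supp_def less_le)
      moreover have "0 < bary X y v" using that y space_ofD(1)[OF bary_in, of y v] by (auto simp: simplex_at_def supp_def less_le)
      ultimately have "0 < c v" using t by (cases "t = 1") (auto simp: c_def intro!: add_pos_nonneg)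
      then show ?thesis by (simp add: supp_def)
    qed
    ultimately show ?thesis using c(1) by (auto simp: simplex_at_def)
  qed
  have S_eq: "?S = \<Union> ((\<lambda>y. chart X ` closed_segment (flat X x) (flat X y)) ` ?S)"
  proof (intro equalityI subsetI)
    fix y assume "y \<in> ?S"
    then show "y \<in> \<Union> ((\<lambda>y. chart X ` closed_segment (flat X x) (flat X y)) ` ?S)"
      by (intro UN_I[of y]) (auto intro!: image_eqI[of _ _ "flat X y"])
  qed (use seg in blast)
  show "connected ?S"
  proof (subst S_eq, rule connected_Union)
    fix A assume "A \<in> (\<lambda>y. chart X ` closed_segment (flat X x) (flat X y)) ` ?S"
    then obtain y where y: "y \<in> ?S" "A = chart X ` closed_segment (flat X x) (flat X y)" by blast
    show "connected A" unfolding y(2)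
      by (intro connected_continuous_image continuous_on_subset[OF continuous_chart] connected_segment) (use seg[OF y(1)] in blast)
  next
    have "x \<in> \<Inter> ((\<lambda>y. chart X ` closed_segment (flat X x) (flat X y)) ` ?S)"
      by (auto intro!: image_eqI[of _ _ "flat X x"])
    then show "\<Inter> ((\<lambda>y. chart X ` closed_segment (flat X x) (flat X y)) ` ?S) \<noteq> {}" by blast
  qed
  obtain v where v: "v \<in> ?t" using simplex_nonempty[OF simplex_at_in] by blast
  have "?S \<subseteq> (\<Union>s\<in>{s \<in> simplices X. v \<in> s}. cell X s)"
  proof
    fix y assume "y \<in> ?S"
    then show "y \<in> (\<Union>s\<in>{s \<in> simplices X. v \<in> s}. cell X s)"
      using v by (intro UN_I[of "simplex_at X y"]) (auto simp: mem_cell)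
  qed
  moreover have "compact (\<Union>s\<in>{s \<in> simplices X. v \<in> s}. cell X s)"
    using finite_star by (intro compact_UN compact_cell) auto
  ultimately show "compact (closure ?S)" by (rule compact_closure_subset)
qed

lemma rel_compact_domain_Un:
  assumes "rel_compact_domain U" "rel_compact_domain V" "U \<inter> V \<noteq> {}"
  shows "rel_compact_domain (U \<union> V)"
  using assms unfolding rel_compact_domain_def by (auto intro: connected_Un simp: compact_Un)

text \<open>Lying in a common relatively compact domain is a transitive relation with open classes,
  since every point has its star; a connected space has only one class.\<close>

lemma ex_rel_compact_domain_pair:
  fixes x y :: 'a
  shows "\<exists>U. rel_compact_domain U \<and> x \<in> U \<and> y \<in> U"
proof -
  define R where "R x = {y. \<exists>U. rel_compact_domain U \<and> x \<in> U \<and> y \<in> U}" for x :: 'a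
  have trans: "z \<in> R x" if yz: "y \<in> R x" "z \<in> R y" for x y z
  proof -
    obtain U V where U: "rel_compact_domain U" "x \<in> U" "y \<in> U" and V: "rel_compact_domain V" "y \<in> V" "z \<in> V"
      using yz unfolding R_def by blast
    have "rel_compact_domain (U \<union> V)" using U V by (intro rel_compact_domain_Un) auto
    then show ?thesis unfolding R_def using U V by blast
  qed
  have star: "\<exists>U. rel_compact_domain U \<and> y \<in> U" for y :: 'a
    using rel_compact_star[of y] by blast
  have "y \<in> R x"
  proof (rule connected_equivalence_relation[OF connected_UNIV UNIV_I UNIV_I, of "\<lambda>x y. y \<in> R x" x y])
    fix a :: 'a
    obtain U where U: "rel_compact_domain U" "a \<in> U" using star by blast
    then have "open U" "\<forall>x\<in>U. x \<in> R a" unfolding R_def by (simp add: rel_compact_domain_def, blast)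
    then show "\<exists>T. openin (top_of_set UNIV) T \<and> a \<in> T \<and> (\<forall>x\<in>T. x \<in> R a)"
      using U(2) by (intro exI[of _ U]) auto
  qed (use trans in \<open>auto simp: R_def\<close>)
  then show ?thesis by (auto simp: R_def)
qed

text \<open>Local Sobolev approximation is available on connected domains, so a mere neighbourhood
  of C does not suffice. The domains covering C all pass through one point x, hence finite unions of
  them stay connected.\<close>

lemma ex_rel_compact_domain:
  fixes C :: "'a set"
  assumes "compact C"
  obtains U where "rel_compact_domain U" "C \<subseteq> U"
proof (cases "C = {}")
  case True
  then show thesis using that[of "{}"] by (simp add: rel_compact_domain_def)
next
  case False
  then obtain x where "x \<in> C" by blast
  obtain U where U: "\<And>y. rel_compact_domain (U y) \<and> x \<in> U y \<and> y \<in> U y"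
    using ex_rel_compact_domain_pair[of x] by metis
  have "C \<subseteq> (\<Union>y\<in>C. U y)" using U by blast
  then obtain F where F: "F \<subseteq> C" "finite F" "C \<subseteq> (\<Union>y\<in>F. U y)"
    using compactE_image[OF assms, of C U] U unfolding rel_compact_domain_def by metis
  have "F \<noteq> {}" using F \<open>x \<in> C\<close> by auto
  with F(2) have "rel_compact_domain (\<Union>y\<in>F. U y) \<and> x \<in> (\<Union>y\<in>F. U y)"
  proof (induction F rule: finite_ne_induct)
    case (singleton y) then show ?case using U by simp
  next
    case (insert y F)
    then have "rel_compact_domain (U y \<union> (\<Union>y\<in>F. U y))"
      using U by (intro rel_compact_domain_Un) blast+
    then show ?case using insert by simp
  qed
  then show thesis using that F(3) by blast
qed

text \<open>Every point of the open star around a shares a closed maximal cell with a. Constancy on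
  cells is thus local constancy, and connectedness does the rest.\<close>

lemma constant_if_constant_on_cells:
  assumes "\<And>s. s \<in> max_simplices X \<Longrightarrow> f constant_on cell X s"
  shows "f constant_on UNIV"
proof -
  have eq: "f y = f x" if "simplex_at X x \<subseteq> simplex_at X y" for x y
  proof -
    obtain s where s: "s \<in> max_simplices X" "simplex_at X y \<subseteq> s" using ex_max_simplex[OF simplex_at_in] by blast
    then have "x \<in> cell X s" "y \<in> cell X s" using that max_simplex by (auto simp: mem_cell)
    then show ?thesis using assms[OF s(1)] by (auto simp: constant_on_def)
  qed
  show ?thesis
  proof (rule locally_constant_imp_constant[OF connected_UNIV])
    fix a :: 'a
    let ?T = "{y. simplex_at X a \<subseteq> simplex_at X y}"
    have "open ?T" by (intro open_star finite_simplex simplex_at_in)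
    then have "openin (top_of_set UNIV) ?T" by simp
    moreover have "\<forall>x\<in>?T. f x = f a" using eq by blast
    ultimately show "\<exists>T. openin (top_of_set UNIV) T \<and> a \<in> T \<and> (\<forall>x\<in>T. f x = f a)" by blast
  qed
qed

end

section \<open>Lebesgue measure on a simplex\<close>

lemma measurable_completion_AE_cong:
  assumes f: "f \<in> measurable (completion M) N" and g: "g \<in> space M \<rightarrow> space N"
    and eq: "AE x in completion M. f x = g x"
  shows "g \<in> measurable (completion M) N"
proof (rule measurableI)
  show "g x \<in> space N" if "x \<in> space (completion M)" for x using g that by auto
  fix A assume A: "A \<in> sets N"
  show "g -` A \<inter> space (completion M) \<in> sets (completion M)"
  proof (rule completion.in_sets_AE)
    show "f -` A \<inter> space (completion M) \<in> sets (completion M)" using measurable_sets[OF f A] .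
    show "AE x in completion M. (x \<in> f -` A \<inter> space (completion M)) = (x \<in> g -` A \<inter> space (completion M))"
      using eq by eventually_elim auto
  qed auto
qed

text \<open>Both sides agree on boxes, where each side length scales by the modulus of t, and boxes
  determine the product measure. The shifts give translation invariance, the common factor gives the
  behaviour of null sets under homotheties.\<close>

lemma PiM_lborel_affine:
  fixes a :: "'i \<Rightarrow> real"
  assumes B: "finite B" and t: "t \<noteq> 0" and A: "A \<in> sets (\<Pi>\<^sub>M b\<in>B. lborel)"
  defines "\<phi> \<equiv> \<lambda>c. \<lambda>b\<in>B. a b + t * c b"
  shows "emeasure (\<Pi>\<^sub>M b\<in>B. lborel) A =
    ennreal (\<bar>t\<bar> ^ card B) * emeasure (\<Pi>\<^sub>M b\<in>B. lborel) (\<phi> -` A \<inter> space (\<Pi>\<^sub>M b\<in>B. lborel))"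
proof -
  interpret product_sigma_finite "\<lambda>b::'i. lborel :: real measure" ..
  let ?L = "\<Pi>\<^sub>M b\<in>B. lborel :: real measure"
  have phi [measurable]: "\<phi> \<in> measurable ?L ?L"
    unfolding \<phi>_def by (rule measurable_restrict) simp
  define N where "N = density (distr ?L ?L \<phi>) (\<lambda>_. ennreal (\<bar>t\<bar> ^ card B))"
  have em: "emeasure N A = ennreal (\<bar>t\<bar> ^ card B) * emeasure ?L (\<phi> -` A \<inter> space ?L)" if "A \<in> sets ?L" for A
    using that unfolding N_def by (subst emeasure_density) (auto simp: nn_integral_cmult_indicator emeasure_distr)
  have "N = ?L"
  proof (rule PiM_eqI[OF B])
    show "sets N = sets ?L" by (simp add: N_def)
    fix A :: "'i \<Rightarrow> real set" assume A: "\<And>b. b \<in> B \<Longrightarrow> A b \<in> sets lborel"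
    have PA: "Pi\<^sub>E B A \<in> sets ?L" using A B by (intro sets_PiM_I_finite) auto
    let ?A = "\<lambda>b. (\<lambda>x. a b + t * x) -` A b"
    have mA: "?A b \<in> sets lborel" if "b \<in> B" for b
      using A[OF that] measurable_sets[of "\<lambda>x. a b + t * x" borel borel "A b"] by simp
    have pre: "\<phi> -` (Pi\<^sub>E B A) \<inter> space ?L = Pi\<^sub>E B ?A"
      by (auto simp: \<phi>_def space_PiM PiE_iff)
    have one: "emeasure lborel (A b) = ennreal \<bar>t\<bar> * emeasure lborel (?A b)" if "b \<in> B" for b
      using A[OF that] by (subst lborel_real_affine[OF t, of "a b"])
        (simp add: emeasure_density nn_integral_cmult_indicator emeasure_distr)
    have "emeasure N (Pi\<^sub>E B A) = ennreal (\<bar>t\<bar> ^ card B) * (\<Prod>b\<in>B. emeasure lborel (?A b))"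
      unfolding em[OF PA] pre using mA B by (subst emeasure_PiM) auto
    also have "\<dots> = (\<Prod>b\<in>B. emeasure lborel (A b))"
      using B by (simp add: one prod.distrib ennreal_power)
    finally show "emeasure N (Pi\<^sub>E B A) = (\<Prod>b\<in>B. emeasure lborel (A b))" .
  qed
  then show ?thesis using em[OF A] by simp
qed

text \<open>The measure underlying \<open>simplex_lebesgue\<close> before restriction and
  completion. It lives on the whole affine subspace, and only there is it invariant under
  translations.\<close>

definition coord_lebesgue :: "'e::euclidean_space \<Rightarrow> 'e set \<Rightarrow> 'e measure" where
  "coord_lebesgue p B = distr (\<Pi>\<^sub>M b\<in>B. (lborel :: real measure)) borel (\<lambda>c. p + (\<Sum>b\<in>B. c b *\<^sub>R b))"

locale frame_measure =
  fixes p :: "'e::euclidean_space" and B W :: "'e set"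
  assumes B: "B \<subseteq> W" "pairwise orthogonal B" "\<And>b. b \<in> B \<Longrightarrow> norm b = 1" "span B = W"
begin

abbreviation "L \<equiv> \<Pi>\<^sub>M b\<in>B. (lborel :: real measure)"
abbreviation "\<phi> c \<equiv> p + (\<Sum>b\<in>B. c b *\<^sub>R b)"
abbreviation "M \<equiv> coord_lebesgue p B"

lemma subspace_W: "subspace W" using B(4) subspace_span by metis

lemma finite_B: "finite B"
  using B by (intro independent_imp_finite pairwise_orthogonal_independent) force+

lemma inner_B: "b \<in> B \<Longrightarrow> c \<in> B \<Longrightarrow> b \<bullet> c = (if b = c then 1 else 0)"
  using B(2) B(3)[of b] by (auto simp: pairwise_def orthogonal_def norm_eq_1)

lemma inner_sum_B: "b \<in> B \<Longrightarrow> (\<Sum>c\<in>B. r c *\<^sub>R c) \<bullet> b = r b"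
  using finite_B by (simp add: inner_sum_left inner_B if_distrib sum.delta cong: if_cong)

lemma repr_B: assumes "x \<in> W" shows "(\<Sum>b\<in>B. (x \<bullet> b) *\<^sub>R b) = x"
proof -
  obtain c where c: "x = (\<Sum>b\<in>B. c b *\<^sub>R b)" using span_finite[OF finite_B] assms B(4) by auto
  have "(\<Sum>b\<in>B. (x \<bullet> b) *\<^sub>R b) = (\<Sum>b\<in>B. c b *\<^sub>R b)"
    by (rule sum.cong) (auto simp: c inner_sum_B)
  then show ?thesis using c by simp
qed

lemma phi_measurable [measurable]: "\<phi> \<in> measurable L borel"
  by measurable

lemma sets_M [simp, measurable_cong]: "sets M = sets borel"
  and space_M [simp]: "space M = UNIV"
  by (simp_all add: coord_lebesgue_def)

lemma emeasure_M: "A \<in> sets borel \<Longrightarrow> emeasure M A = emeasure L (\<phi> -` A \<inter> space L)"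
  by (simp add: coord_lebesgue_def emeasure_distr)

lemma emeasure_M_homothety:
  assumes A: "A \<in> sets borel" and t: "t \<noteq> 0" and w: "w \<in> W"
  shows "emeasure M A = ennreal (\<bar>t\<bar> ^ card B) * emeasure M ((\<lambda>x. p + w + t *\<^sub>R (x - p)) -` A)"
proof -
  define \<psi> where "\<psi> = (\<lambda>c. \<lambda>b\<in>B. w \<bullet> b + t * c b)"
  have "\<phi> (\<psi> c) = p + w + t *\<^sub>R (\<phi> c - p)" for c
  proof -
    have "(\<Sum>b\<in>B. \<psi> c b *\<^sub>R b) = (\<Sum>b\<in>B. (w \<bullet> b) *\<^sub>R b) + t *\<^sub>R (\<Sum>b\<in>B. c b *\<^sub>R b)"
      by (simp add: \<psi>_def scaleR_add_left sum.distrib scaleR_sum_right)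
    then show ?thesis using repr_B[OF w] by simp
  qed
  then have "\<psi> -` (\<phi> -` A \<inter> space L) \<inter> space L = \<phi> -` ((\<lambda>x. p + w + t *\<^sub>R (x - p)) -` A) \<inter> space L"
    by (auto simp: space_PiM \<psi>_def add.assoc)
  moreover have "\<phi> -` A \<inter> space L \<in> sets L" using A by (rule measurable_sets[OF phi_measurable])
  moreover have "(\<lambda>x. p + w + t *\<^sub>R (x - p)) -` A \<in> sets borel"
    using A measurable_sets[of "\<lambda>x. p + w + t *\<^sub>R (x - p)" borel borel A] by simp
  ultimately show ?thesis
    using PiM_lborel_affine[OF finite_B t, of "\<phi> -` A \<inter> space L" "\<lambda>b. w \<bullet> b"] A
    by (simp add: emeasure_M \<psi>_def)
qed

lemma null_sets_homothety:
  assumes N: "N \<in> null_sets M" and t: "t \<noteq> 0" and q: "q - p \<in> W"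
  shows "(\<lambda>x. q + t *\<^sub>R (x - q)) -` N \<in> null_sets M"
proof -
  \<comment> \<open>A homothety about q is the one about p with the same ratio, followed by the
    translation by this vector.\<close>
  have w: "(1 - t) *\<^sub>R (q - p) \<in> W" using q subspace_W by (simp add: subspace_mul)
  have eq: "q + t *\<^sub>R (x - q) = p + (1 - t) *\<^sub>R (q - p) + t *\<^sub>R (x - p)" for x by (simp add: algebra_simps)
  have A: "N \<in> sets borel" using N by auto
  have "emeasure M N = ennreal (\<bar>t\<bar> ^ card B) * emeasure M ((\<lambda>x. q + t *\<^sub>R (x - q)) -` N)"
    unfolding eq by (rule emeasure_M_homothety[OF A t w])
  moreover have "(\<lambda>x. q + t *\<^sub>R (x - q)) -` N \<in> sets borel"
    using A measurable_sets[of "\<lambda>x. q + t *\<^sub>R (x - q)" borel borel N] by simp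
  ultimately show ?thesis using N t by (auto simp: null_sets_def)
qed

sublocale invariant_measure M W
proof
  show "sets M = sets borel" "subspace W" using subspace_W by simp_all
  fix w assume w: "w \<in> W"
  show "distr M borel (\<lambda>x. x + w) = M"
  proof (rule measure_eqI)
    fix A assume "A \<in> sets (distr M borel (\<lambda>x. x + w))"
    then have A: "A \<in> sets borel" by simp
    have "(\<lambda>x. p + w + 1 *\<^sub>R (x - p)) = (\<lambda>x. x + w)" by (simp add: fun_eq_iff)
    with emeasure_M_homothety[OF A one_neq_zero w] show "emeasure (distr M borel (\<lambda>x. x + w)) A = emeasure M A"
      using A by (simp add: emeasure_distr)
  qed simp
next
  fix A :: "'e set" assume A: "bounded A" "A \<in> sets borel"
  obtain R where R: "\<And>y. y \<in> A \<Longrightarrow> norm y \<le> R" using A(1) by (auto simp: bounded_iff)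
  define r where "r = R + norm p"
  interpret product_sigma_finite "\<lambda>b::'e. lborel :: real measure" ..
  have "emeasure M A = emeasure L (\<phi> -` A \<inter> space L)" by (rule emeasure_M[OF A(2)])
  also have "\<dots> \<le> emeasure L (\<Pi>\<^sub>E b\<in>B. {-r..r})"
  proof (rule emeasure_mono)
    show "\<phi> -` A \<inter> space L \<subseteq> (\<Pi>\<^sub>E b\<in>B. {-r..r})"
    proof
      fix c assume c: "c \<in> \<phi> -` A \<inter> space L"
      have "\<bar>c b\<bar> \<le> r" if "b \<in> B" for b
      proof -
        have "c b = (\<phi> c - p) \<bullet> b" using inner_sum_B[OF that, of c] by simp
        also have "\<bar>\<dots>\<bar> \<le> norm (\<phi> c - p) * norm b" by (rule Cauchy_Schwarz_ineq2)
        also have "\<dots> = norm (\<phi> c - p)" using B(3)[OF that] by simp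
        also have "\<dots> \<le> norm (\<phi> c) + norm p" by (rule norm_triangle_ineq4)
        also have "\<dots> \<le> r" using R[of "\<phi> c"] c by (simp add: r_def)
        finally show ?thesis .
      qed
      then show "c \<in> (\<Pi>\<^sub>E b\<in>B. {-r..r})" using c by (auto simp: space_PiM PiE_iff abs_le_iff minus_le_iff)
    qed
  qed (use finite_B in \<open>auto intro!: sets_PiM_I_finite\<close>)
  also have "\<dots> = (\<Prod>b\<in>B. emeasure lborel {-r..r})"
    using finite_B by (subst emeasure_PiM) auto
  also have "\<dots> < \<infinity>" by (cases "r \<ge> 0") (auto simp: ennreal_power less_top[symmetric] power_eq_top_ennreal)
  finally show "emeasure M A < \<infinity>" .
qed

lemma AE_in_affine: "AE x in M. x - p \<in> W"
proof -
  have "closed W" using closed_subspace[OF subspace_W] .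
  then have [measurable]: "W \<in> sets borel" by (rule borel_closed)
  have "AE c in L. \<phi> c - p \<in> W"
    using B(1) subspace_W by (intro AE_I2) (auto intro!: subspace_sum subspace_mul)
  then show ?thesis unfolding coord_lebesgue_def by (subst AE_distr_iff) auto
qed

end

context lip_poly
begin

lemma frame_props:
  "frame X s \<subseteq> directions X s" "pairwise orthogonal (frame X s)"
  "\<And>b. b \<in> frame X s \<Longrightarrow> norm b = 1" "span (frame X s) = directions X s"
proof -
  have W: "subspace (directions X s)" by (simp add: directions_def)
  obtain B where "B \<subseteq> directions X s" "pairwise orthogonal B" "\<And>b. b \<in> B \<Longrightarrow> norm b = 1"
    "independent B" "card B = dim (directions X s)" "span B = directions X s"
    by (rule orthonormal_basis_subspace[OF W]) (rule that)
  then have "\<exists>B. B \<subseteq> directions X s \<and> pairwise orthogonal B \<and> (\<forall>b\<in>B. norm b = 1) \<and> span B = directions X s"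
    by blast
  from someI_ex[OF this, folded frame_def]
  show "frame X s \<subseteq> directions X s" "pairwise orthogonal (frame X s)"
    "\<And>b. b \<in> frame X s \<Longrightarrow> norm b = 1" "span (frame X s) = directions X s" by blast+
qed

abbreviation "cm s \<equiv> coord_lebesgue (origin X s) (frame X s)"

sublocale cm: frame_measure "origin X s" "frame X s" "directions X s" for s
  by (unfold_locales) (use frame_props in blast)+

lemma origin_in: "s \<in> simplices X \<Longrightarrow> origin X s \<in> flat_cell X s"
  unfolding origin_def flat_cell_def using simplex_nonempty by (intro hull_inc imageI) (simp add: some_in_eq)

lemma directions_eq: "directions X s = span {p - q | p q. p \<in> vpos X ` s \<and> q \<in> vpos X ` s}"
  unfolding directions_def by (rule arg_cong[of _ _ span]) blast

lemma flat_cell_diff: "y \<in> flat_cell X s \<Longrightarrow> z \<in> flat_cell X s \<Longrightarrow> y - z \<in> directions X s"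
  unfolding directions_eq flat_cell_def by (rule convex_hull_diff_in_directions)

lemma affine_hull_cell_add: "y \<in> affine hull (flat_cell X s) \<Longrightarrow> w \<in> directions X s \<Longrightarrow> y + w \<in> affine hull (flat_cell X s)"
  unfolding directions_eq flat_cell_def affine_hull_convex_hull by (rule affine_hull_add_direction)

lemma open_flat_cell_ball:
  assumes "y \<in> open_flat_cell s"
  obtains r where "r > 0" "\<And>w. w \<in> directions X s \<Longrightarrow> norm w < r \<Longrightarrow> y + w \<in> open_flat_cell s"
proof -
  have "openin (top_of_set (affine hull flat_cell X s)) (open_flat_cell s)"
    by (rule openin_rel_interior)
  then obtain T where T: "open T" "open_flat_cell s = affine hull flat_cell X s \<inter> T" by (auto simp: openin_open)
  obtain r where r: "r > 0" "ball y r \<subseteq> T" using assms T openE by blast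
  have "y + w \<in> open_flat_cell s" if "w \<in> directions X s" "norm w < r" for w
  proof -
    have "y + w \<in> affine hull flat_cell X s"
      using assms T(2) by (intro affine_hull_cell_add that) auto
    moreover have "y + w \<in> T" using r(2) that(2) by (auto simp: dist_norm)
    ultimately show ?thesis using T(2) by blast
  qed
  with r(1) that show thesis by blast
qed

lemma borel_flat_cell [measurable]: "s \<in> simplices X \<Longrightarrow> flat_cell X s \<in> sets borel"
  by (intro borel_closed compact_imp_closed compact_flat_cell)

lemma borel_open_flat_cell [measurable]: "open_flat_cell s \<in> sets borel"
proof -
  have "openin (top_of_set (affine hull flat_cell X s)) (open_flat_cell s)"
    by (rule openin_rel_interior)
  then obtain T where "open T" "open_flat_cell s = affine hull flat_cell X s \<inter> T" by (auto simp: openin_open)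
  then show ?thesis by (auto intro!: sets.Int borel_closed)
qed

text \<open>A line in the direction of an edge ending in v meets the opposite face at most once: two
  meetings would make the edge parallel to the face and put v into its affine hull. Integration
  along such lines shows that the face is null.\<close>

lemma face_null:
  assumes s: "s \<in> simplices X" and v: "v \<in> s"
  shows "convex hull (vpos X ` (s - {v})) \<in> null_sets (cm s)"
proof (cases "s = {v}")
  case False
  then obtain u where u: "u \<in> s" "u \<noteq> v" using v by blast
  let ?F = "vpos X ` (s - {v})"
  have fin: "finite ?F" using finite_simplex[OF s] by simp
  define w where "w = vpos X v - vpos X u"
  have w: "w \<in> directions X s" unfolding w_def directions_def using u v by (intro span_base) blast
  show ?thesis
  proof (rule cm.null_set_along_lines[OF w])
    show "convex hull ?F \<in> sets borel"
      by (intro borel_closed compact_imp_closed finite_imp_compact_convex_hull fin)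
    fix x
    let ?T = "{t. x + t *\<^sub>R w \<in> convex hull ?F}"
    have "t = t'" if "t \<in> ?T" "t' \<in> ?T" for t t'
    proof (rule ccontr)
      assume "t \<noteq> t'"
      have "(x + t *\<^sub>R w) - (x + t' *\<^sub>R w) \<in> span {p - q | p q. p \<in> ?F \<and> q \<in> ?F}"
        using that by (intro convex_hull_diff_in_directions) auto
      from span_scale[OF this, of "1 / (t - t')"]
      have "(1 / (t - t')) *\<^sub>R ((x + t *\<^sub>R w) - (x + t' *\<^sub>R w)) \<in> span {p - q | p q. p \<in> ?F \<and> q \<in> ?F}" .
      also have "(1 / (t - t')) *\<^sub>R ((x + t *\<^sub>R w) - (x + t' *\<^sub>R w)) = w"
        using \<open>t \<noteq> t'\<close> by (simp add: scaleR_diff_left[symmetric])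
      finally have "w \<in> span {p - q | p q. p \<in> ?F \<and> q \<in> ?F}" .
      moreover have "vpos X u \<in> affine hull ?F" using u by (intro hull_inc) auto
      ultimately have "vpos X u + w \<in> affine hull ?F" by (rule affine_hull_add_direction)
      then have "vpos X v \<in> affine hull ?F" by (simp add: w_def)
      also have "?F = vpos X ` s - {vpos X v}" using vpos_inj[OF s] v by (auto dest: inj_onD)
      finally show False using affine_independent_vertices[OF s] v unfolding affine_dependent_def by blast
    qed
    then have "\<exists>a. ?T \<subseteq> {a}" by (cases "?T = {}") blast+
    then obtain a where "?T \<subseteq> {a}" by blast
    moreover have "AE t in lborel. t \<noteq> a" by (rule AE_lborel_singleton)
    ultimately show "AE t in lborel. x + t *\<^sub>R w \<notin> convex hull ?F" by (auto elim!: eventually_mono)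
  qed
qed simp

text \<open>Off the relative interior some vertex has coordinate 0, which places the point in one of
  finitely many null faces.\<close>

lemma AE_open_flat_cell:
  assumes s: "s \<in> simplices X"
  shows "AE y in cm s. y \<in> flat_cell X s \<longrightarrow> y \<in> open_flat_cell s"
proof (rule AE_I')
  show "(\<Union>v\<in>s. convex hull (vpos X ` (s - {v}))) \<in> null_sets (cm s)"
    using finite_simplex[OF s] face_null[OF s] by (intro null_sets_UN' countable_finite) auto
  show "{y \<in> space (cm s). \<not> (y \<in> flat_cell X s \<longrightarrow> y \<in> open_flat_cell s)} \<subseteq> (\<Union>v\<in>s. convex hull (vpos X ` (s - {v})))"
  proof
    fix y assume "y \<in> {y \<in> space (cm s). \<not> (y \<in> flat_cell X s \<longrightarrow> y \<in> open_flat_cell s)}"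
    then have y: "y \<in> flat_cell X s" "y \<notin> open_flat_cell s" by auto
    obtain a where a: "a \<in> space_of X" "supp a \<subseteq> s" "y = embed X a" using y(1) by (auto simp: flat_cell_eq[OF s])
    have "supp a \<noteq> s"
    proof
      assume "supp a = s"
      then have "y \<in> open_flat_cell s" unfolding open_flat_cell_eq[OF s] using a
        by (intro image_eqI[of _ _ "triang X a"]) (auto simp: flat_def simplex_at_def)
      with y(2) show False ..
    qed
    then obtain v where v: "v \<in> s" "supp a \<subseteq> s - {v}" using a(2) by blast
    have "supp a \<noteq> {}" using simplex_nonempty[OF space_ofD(2)[OF a(1)]] .
    then have "s - {v} \<in> simplices X" using face[OF s, of "s - {v}"] v by blast
    from flat_cell_eq[OF this] have "y \<in> flat_cell X (s - {v})" using a v by blast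
    then show "y \<in> (\<Union>v\<in>s. convex hull (vpos X ` (s - {v})))" using v(1) by (auto simp: flat_cell_def)
  qed
qed

abbreviation "sl s \<equiv> simplex_lebesgue X s"
abbreviation "rs s \<equiv> restrict_space (cm s) (flat_cell X s)"

lemma simplex_lebesgue_eq: "sl s = completion (rs s)"
  by (simp add: simplex_lebesgue_def coord_lebesgue_def)

lemma space_sl [simp]: "space (sl s) = flat_cell X s"
  by (simp add: simplex_lebesgue_eq space_restrict_space)

text \<open>Removes completion, restriction and the boundary of the simplex at once: later
  statements about almost every point concern a Borel measure on the ambient space and points of the
  open cell.\<close>

lemma AE_sl:
  assumes s: "s \<in> simplices X"
  shows "(AE y in sl s. Q y) \<longleftrightarrow> (AE y in cm s. y \<in> open_flat_cell s \<longrightarrow> Q y)"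
proof -
  have "(AE y in sl s. Q y) \<longleftrightarrow> (AE y in cm s. y \<in> flat_cell X s \<longrightarrow> Q y)"
    unfolding simplex_lebesgue_eq AE_completion_iff using s by (subst AE_restrict_space_iff) auto
  also have "\<dots> \<longleftrightarrow> (AE y in cm s. y \<in> open_flat_cell s \<longrightarrow> Q y)"
    using AE_open_flat_cell[OF s] open_flat_cell_subset[of s] by (auto elim!: eventually_elim2)
  finally show ?thesis .
qed

lemma sets_rs: "sets (rs s) = sets (restrict_space borel (flat_cell X s))"
  by (rule sets_restrict_space_cong) simp

lemma chart_measurable:
  assumes s: "s \<in> simplices X"
  shows "chart X \<in> measurable (rs s) borel" "chart X \<in> measurable (sl s) borel"
proof -
  have "chart X \<in> measurable (restrict_space borel (flat_cell X s)) borel"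
    by (intro borel_measurable_continuous_on_restrict continuous_on_subset[OF continuous_chart] flat_cell_subset s)
  then show "chart X \<in> measurable (rs s) borel" by (simp cong: measurable_cong_sets add: sets_rs)
  then show "chart X \<in> measurable (sl s) borel" unfolding simplex_lebesgue_eq by (rule measurable_completion)
qed

lemma flat_measurable [measurable]: "flat X \<in> borel_measurable borel"
  by (intro borel_measurable_continuous_onI continuous_flat)

end

section \<open>The volume measure\<close>

locale riem_poly = lip_poly X for X :: "('v, 'e::euclidean_space, 'a::metric_space) rpoly" +
  assumes riemannian: "riemannian_polyhedron X"
begin

lemma ex_Lambda:
  "\<exists>\<Lambda>\<ge>1. \<forall>s\<in>max_simplices X. AE y in cm s. y \<in> open_flat_cell s \<longrightarrow>
     inner_form (directions X s) (frame X s) (gform X s y) \<Lambda>"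
proof -
  obtain L where L: "L > 0" "\<And>s. s \<in> max_simplices X \<Longrightarrow> AE y in sl s.
        bilinear (gform X s y) \<and> (\<forall>\<xi> \<eta>. gform X s y \<xi> \<eta> = gform X s y \<eta> \<xi>) \<and>
        (\<forall>\<xi>\<in>directions X s. (norm \<xi>)\<^sup>2 / L\<^sup>2 \<le> gform X s y \<xi> \<xi> \<and> gform X s y \<xi> \<xi> \<le> L\<^sup>2 * (norm \<xi>)\<^sup>2)"
    using riemannian unfolding riemannian_polyhedron_def by blast
  \<comment> \<open>Enlarging the constant weakens both bounds; a constant at least 1 puts the
    contraction factor of \<open>gstep\<close> into [0, 1).\<close>
  define \<Lambda> where "\<Lambda> = max 1 L"
  have Lam: "1 \<le> \<Lambda>" "L\<^sup>2 \<le> \<Lambda>\<^sup>2" using L(1) by (auto simp: \<Lambda>_def intro: power_mono)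
  have "AE y in cm s. y \<in> open_flat_cell s \<longrightarrow> inner_form (directions X s) (frame X s) (gform X s y) \<Lambda>"
    if s: "s \<in> max_simplices X" for s
    using L(2)[OF s] unfolding AE_sl[OF max_simplex[OF s]]
  proof eventually_elim
    case (elim y)
    show ?case
    proof
      assume "y \<in> open_flat_cell s"
      note E = elim[rule_format, OF this]
      show "inner_form (directions X s) (frame X s) (gform X s y) \<Lambda>"
      proof
        fix x assume x: "x \<in> directions X s"
        have "(norm x)\<^sup>2 / \<Lambda>\<^sup>2 \<le> (norm x)\<^sup>2 / L\<^sup>2" using Lam L(1) by (intro divide_left_mono) auto
        then show "(norm x)\<^sup>2 / \<Lambda>\<^sup>2 \<le> gform X s y x x" using E x by force
        have "L\<^sup>2 * (norm x)\<^sup>2 \<le> \<Lambda>\<^sup>2 * (norm x)\<^sup>2" using Lam by (intro mult_right_mono) auto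
        then show "gform X s y x x \<le> \<Lambda>\<^sup>2 * (norm x)\<^sup>2" using E x by force
      qed (use E Lam(1) frame_props in blast)+
    qed
  qed
  then show ?thesis using Lam(1) by blast
qed

definition Lam :: real where
  "Lam = (SOME \<Lambda>. \<Lambda> \<ge> 1 \<and> (\<forall>s\<in>max_simplices X. AE y in cm s. y \<in> open_flat_cell s \<longrightarrow>
     inner_form (directions X s) (frame X s) (gform X s y) \<Lambda>))"

lemma Lam_ge_1: "1 \<le> Lam"
  and AE_inner_form: "s \<in> max_simplices X \<Longrightarrow> AE y in cm s. y \<in> open_flat_cell s \<longrightarrow>
     inner_form (directions X s) (frame X s) (gform X s y) Lam"
  using someI_ex[OF ex_Lambda, folded Lam_def] by blast+

lemma gform_measurable:
  "s \<in> max_simplices X \<Longrightarrow> \<xi> \<in> directions X s \<Longrightarrow> \<eta> \<in> directions X s \<Longrightarrow>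
    (\<lambda>y. gform X s y \<xi> \<eta>) \<in> borel_measurable (sl s)"
  using riemannian unfolding riemannian_polyhedron_def by blast

abbreviation "dens s y \<equiv> ennreal (sqrt (det_on (frame X s) (gform X s y)))"

lemma dens_measurable:
  assumes s: "s \<in> max_simplices X"
  shows "dens s \<in> borel_measurable (sl s)"
proof -
  have "(\<lambda>y. det_on (frame X s) (gform X s y)) \<in> borel_measurable (sl s)"
    unfolding det_on_def
  proof (intro borel_measurable_sum borel_measurable_times borel_measurable_const borel_measurable_prod)
    fix \<pi> i assume p: "\<pi> \<in> {\<pi>. \<pi> permutes frame X s}" and i: "i \<in> frame X s"
    then have "\<pi> i \<in> frame X s" by (simp add: permutes_in_image)
    then show "(\<lambda>y. gform X s y i (\<pi> i)) \<in> borel_measurable (sl s)"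
      using i frame_props(1) s by (intro gform_measurable) auto
  qed
  then show ?thesis by measurable
qed

definition dens_min :: "'v set \<Rightarrow> real" where
  "dens_min s = sqrt ((1 / Lam\<^sup>2) ^ card (frame X s))"

lemma dens_min_pos: "0 < dens_min s"
  using Lam_ge_1 by (simp add: dens_min_def)

lemma AE_dens:
  assumes s: "s \<in> max_simplices X"
  shows "AE y in sl s. ennreal (dens_min s) \<le> dens s y"
  unfolding AE_sl[OF max_simplex[OF s]] using AE_inner_form[OF s]
proof eventually_elim
  case (elim y)
  show ?case
  proof
    assume "y \<in> open_flat_cell s"
    then interpret inner_form "directions X s" "frame X s" "gform X s y" Lam using elim by blast
    show "ennreal (dens_min s) \<le> dens s y" unfolding dens_min_def using det_on_ge by (intro ennreal_leI real_sqrt_le_mono)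
  qed
qed

definition cell_vol :: "'v set \<Rightarrow> 'a measure" where
  "cell_vol s = distr (density (sl s) (dens s)) borel (chart X)"

lemma sets_cell_vol [simp]: "sets (cell_vol s) = sets borel"
  by (simp add: cell_vol_def)

lemma nn_integral_cell_vol:
  assumes s: "s \<in> max_simplices X" and f: "f \<in> borel_measurable borel"
  shows "(\<integral>\<^sup>+ x. f x \<partial>cell_vol s) = (\<integral>\<^sup>+ y. f (chart X y) * dens s y \<partial>sl s)"
proof -
  note ch = chart_measurable(2)[OF max_simplex[OF s]]
  have "(\<integral>\<^sup>+ x. f x \<partial>cell_vol s) = (\<integral>\<^sup>+ y. f (chart X y) \<partial>density (sl s) (dens s))"
    unfolding cell_vol_def using ch f by (subst nn_integral_distr) auto
  also have "\<dots> = (\<integral>\<^sup>+ y. dens s y * f (chart X y) \<partial>sl s)"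
    by (rule nn_integral_density[OF dens_measurable[OF s]]) (rule measurable_compose[OF ch f])
  finally show ?thesis by (simp add: mult.commute)
qed

lemma emeasure_cell_vol:
  assumes s: "s \<in> max_simplices X" and A: "A \<in> sets borel"
  shows "emeasure (cell_vol s) A = (\<integral>\<^sup>+ y. indicator A (chart X y) * dens s y \<partial>sl s)"
  using nn_integral_cell_vol[OF s, of "indicator A"] A by simp

definition bvol :: "'a measure" where
  "bvol = measure_of UNIV (sets borel)
     (\<lambda>A. \<integral>\<^sup>+ s. (\<integral>\<^sup>+ y. indicator A (chart X y) * dens s y \<partial>sl s) \<partial>count_space (max_simplices X))"

lemma vol_eq: "vol X = completion bvol"
  by (simp add: vol_def bvol_def)

lemma AE_vol_bvol: "(AE x in vol X. Q x) \<longleftrightarrow> (AE x in bvol. Q x)"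
  unfolding vol_eq by (rule AE_completion_iff)

lemma sets_bvol [simp, measurable_cong]: "sets bvol = sets borel"
  unfolding bvol_def using sets.sets_measure_of_eq[of "borel :: 'a measure"] by (simp only: space_borel)

lemma space_bvol [simp]: "space bvol = UNIV"
  using sets_eq_imp_space_eq[OF sets_bvol] by simp

lemma space_vol [simp]: "space (vol X) = UNIV"
  by (simp add: vol_eq)

text \<open>\<open>measure_of\<close> yields the prescribed values only once countable additivity is
  known. It follows by interchanging the sum over the sets with the integral over the
  simplexes.\<close>

lemma emeasure_bvol:
  assumes A: "A \<in> sets borel"
  shows "emeasure bvol A = (\<integral>\<^sup>+ s. emeasure (cell_vol s) A \<partial>count_space (max_simplices X))"
proof -
  let ?m = "\<lambda>A. \<integral>\<^sup>+ s. (\<integral>\<^sup>+ y. indicator A (chart X y) * dens s y \<partial>sl s) \<partial>count_space (max_simplices X)"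
  have m: "?m A = (\<integral>\<^sup>+ s. emeasure (cell_vol s) A \<partial>count_space (max_simplices X))" if "A \<in> sets borel" for A
    using emeasure_cell_vol[OF _ that] by (intro nn_integral_cong) simp
  have "emeasure bvol A = ?m A"
  proof (rule emeasure_measure_of[OF bvol_def])
    show "positive (sets bvol) ?m" by (simp add: positive_def)
    show "countably_additive (sets bvol) ?m"
    proof (rule countably_additiveI)
      fix A :: "nat \<Rightarrow> 'a set" assume A: "range A \<subseteq> sets bvol" "disjoint_family A" "(\<Union>i. A i) \<in> sets bvol"
      have Ai: "A i \<in> sets borel" for i using A(1) by auto
      have "(\<Sum>i. ?m (A i)) = (\<Sum>i. \<integral>\<^sup>+ s. emeasure (cell_vol s) (A i) \<partial>count_space (max_simplices X))"
        by (simp only: m[OF Ai])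
      also have "\<dots> = (\<integral>\<^sup>+ s. (\<Sum>i. emeasure (cell_vol s) (A i)) \<partial>count_space (max_simplices X))"
        by (rule nn_integral_suminf[symmetric]) simp
      also have "\<dots> = (\<integral>\<^sup>+ s. emeasure (cell_vol s) (\<Union>i. A i) \<partial>count_space (max_simplices X))"
        using A by (intro nn_integral_cong suminf_emeasure) (auto simp: image_subset_iff)
      also have "\<dots> = ?m (\<Union>i. A i)" using A(3) by (intro m[symmetric]) simp
      finally show "(\<Sum>i. ?m (A i)) = ?m (\<Union>i. A i)" .
    qed
  qed (use A in auto)
  then show ?thesis using m[OF A] by simp
qed

lemma cell_vol_le_bvol:
  assumes s: "s \<in> max_simplices X"
  shows "cell_vol s \<le> bvol"
proof (subst le_measure)
  show "sets (cell_vol s) = sets bvol" by simp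
  show "\<forall>A\<in>sets (cell_vol s). emeasure (cell_vol s) A \<le> emeasure bvol A"
  proof
    fix A assume "A \<in> sets (cell_vol s)"
    then have A: "A \<in> sets borel" by simp
    have "emeasure (cell_vol s) A = (\<integral>\<^sup>+ t. emeasure (cell_vol t) A * indicator {s} t \<partial>count_space (max_simplices X))"
      using s by (subst nn_integral_indicator_singleton) auto
    also have "\<dots> \<le> emeasure bvol A" unfolding emeasure_bvol[OF A]
      by (intro nn_integral_mono) (auto split: split_indicator)
    finally show "emeasure (cell_vol s) A \<le> emeasure bvol A" .
  qed
qed

text \<open>The density is bounded below by a positive constant almost everywhere, so it creates no
  new null sets.\<close>

lemma null_cell_vol_iff:
  assumes s: "s \<in> max_simplices X" and N: "N \<in> sets borel"
  shows "emeasure (cell_vol s) N = 0 \<longleftrightarrow> (AE y in sl s. chart X y \<notin> N)"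
proof -
  note ch = chart_measurable(2)[OF max_simplex[OF s]]
  have [measurable]: "(\<lambda>y. indicator N (chart X y) :: ennreal) \<in> borel_measurable (sl s)"
    by (rule measurable_compose[OF ch]) (use N in simp)
  note [measurable] = dens_measurable[OF s]
  have "emeasure (cell_vol s) N = 0 \<longleftrightarrow> (AE y in sl s. indicator N (chart X y) * dens s y = 0)"
    unfolding emeasure_cell_vol[OF s N] by (rule nn_integral_0_iff_AE) measurable
  also have "\<dots> \<longleftrightarrow> (AE y in sl s. chart X y \<notin> N)"
  proof -
    have "AE y in sl s. dens s y \<noteq> 0"
      using AE_dens[OF s]
    proof eventually_elim
      case (elim y)
      then show ?case using dens_min_pos[of s] by (metis ennreal_less_zero_iff leD)
    qed
    then show ?thesis by (auto elim!: eventually_elim2 split: split_indicator_asm)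
  qed
  finally show ?thesis .
qed

lemma null_bvol_iff:
  assumes N: "N \<in> sets borel"
  shows "N \<in> null_sets bvol \<longleftrightarrow> (\<forall>s\<in>max_simplices X. AE y in sl s. chart X y \<notin> N)"
proof -
  have "N \<in> null_sets bvol \<longleftrightarrow> emeasure bvol N = 0" using N by (simp add: null_sets_def)
  also have "\<dots> \<longleftrightarrow> (\<forall>s\<in>max_simplices X. emeasure (cell_vol s) N = 0)"
    unfolding emeasure_bvol[OF N] by (subst nn_integral_0_iff_AE) (auto simp: AE_count_space)
  finally show ?thesis using null_cell_vol_iff[OF _ N] by simp
qed

lemma open_cell_borel [measurable]: "s \<in> max_simplices X \<Longrightarrow> open_cell s \<in> sets borel"
  by (intro borel_open open_open_cell)

text \<open>For the direction from the cells to the space, the exceptional sets of the cells are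
  transported back by \<open>flat\<close>; countability of the complex keeps their union
  null.\<close>

lemma AE_vol_iff:
  "(AE x in vol X. Q x) \<longleftrightarrow> (\<forall>s\<in>max_simplices X. AE y in cm s. y \<in> open_flat_cell s \<longrightarrow> Q (chart X y))"
proof
  assume "AE x in vol X. Q x"
  then have "AE x in bvol. Q x" unfolding AE_vol_bvol .
  then obtain N where N: "N \<in> null_sets bvol" "{x. \<not> Q x} \<subseteq> N"
    unfolding eventually_ae_filter by auto
  show "\<forall>s\<in>max_simplices X. AE y in cm s. y \<in> open_flat_cell s \<longrightarrow> Q (chart X y)"
  proof
    fix s assume s: "s \<in> max_simplices X"
    have "AE y in sl s. chart X y \<notin> N" using N(1) null_bvol_iff[of N] s by auto
    then have "AE y in sl s. Q (chart X y)" using N(2) by (auto elim!: eventually_mono)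
    then show "AE y in cm s. y \<in> open_flat_cell s \<longrightarrow> Q (chart X y)" using AE_sl[OF max_simplex[OF s]] by simp
  qed
next
  assume R: "\<forall>s\<in>max_simplices X. AE y in cm s. y \<in> open_flat_cell s \<longrightarrow> Q (chart X y)"
  have "\<exists>N\<in>null_sets (cm s). {y. \<not> (y \<in> open_flat_cell s \<longrightarrow> Q (chart X y))} \<subseteq> N" if "s \<in> max_simplices X" for s
  proof -
    from R that have "AE y in cm s. y \<in> open_flat_cell s \<longrightarrow> Q (chart X y)" by blast
    then show ?thesis unfolding eventually_ae_filter by auto
  qed
  then obtain N where N: "\<And>s. s \<in> max_simplices X \<Longrightarrow> N s \<in> null_sets (cm s)"
    "\<And>s. s \<in> max_simplices X \<Longrightarrow> {y. \<not> (y \<in> open_flat_cell s \<longrightarrow> Q (chart X y))} \<subseteq> N s" by metis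
  \<comment> \<open>Points outside all open maximal cells are included as well, since the hypothesis
    on the cells says nothing about them.\<close>
  define Z where "Z = (- (\<Union>s\<in>max_simplices X. open_cell s)) \<union> (\<Union>s\<in>max_simplices X. open_cell s \<inter> flat X -` N s)"
  have Nb: "N s \<in> sets borel" if "s \<in> max_simplices X" for s using N(1)[OF that] by (auto dest: null_setsD2)
  have Zb: "Z \<in> sets borel"
  proof -
    have A: "open_cell s \<inter> flat X -` N s \<in> sets borel" if s: "s \<in> max_simplices X" for s
      using measurable_sets[OF flat_measurable Nb[OF s]] open_cell_borel[OF s] by simp
    have "(\<Union>s\<in>max_simplices X. open_cell s \<inter> flat X -` N s) \<in> sets borel"
      by (rule sets.countable_UN'[OF countable_max]) (use A in blast)
    moreover have "(\<Union>s\<in>max_simplices X. open_cell s) \<in> sets borel"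
      by (intro borel_open open_UN ballI open_open_cell)
    ultimately show ?thesis unfolding Z_def by (intro sets.Un borel_comp)
  qed
  have "Z \<in> null_sets bvol"
    unfolding null_bvol_iff[OF Zb]
  proof
    fix s assume s: "s \<in> max_simplices X"
    show "AE y in sl s. chart X y \<notin> Z"
      unfolding AE_sl[OF max_simplex[OF s]]
    proof (rule AE_I'[OF N(1)[OF s]], rule subsetI)
      fix y assume "y \<in> {y \<in> space (cm s). \<not> (y \<in> open_flat_cell s \<longrightarrow> chart X y \<notin> Z)}"
      then have y: "y \<in> open_flat_cell s" "chart X y \<in> Z" by auto
      have "simplex_at X (chart X y) = s" using y(1) max_simplex[OF s] by simp
      moreover have "flat X (chart X y) = y"
        using y(1) flat_cell_subset[OF max_simplex[OF s]] open_flat_cell_subset[of s] by (intro flat_chart) blast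
      ultimately show "y \<in> N s" using y(2) s unfolding Z_def by auto
    qed
  qed
  moreover have "{x. \<not> Q x} \<subseteq> Z"
  proof
    fix x assume x: "x \<in> {x. \<not> Q x}"
    show "x \<in> Z"
    proof (cases "simplex_at X x \<in> max_simplices X")
      case True
      let ?s = "simplex_at X x"
      have "flat X x \<in> open_flat_cell ?s" unfolding open_flat_cell_eq[OF simplex_at_in] by auto
      then have "flat X x \<in> N ?s" using N(2)[OF True] x by auto
      then show ?thesis using True by (auto simp: Z_def)
    qed (auto simp: Z_def)
  qed
  ultimately have "AE x in bvol. Q x" by (intro AE_I') auto
  then show "AE x in vol X. Q x" unfolding AE_vol_bvol .
qed

lemma AE_vol_iff_sl:
  "(AE x in vol X. Q x) \<longleftrightarrow> (\<forall>s\<in>max_simplices X. AE y in sl s. Q (chart X y))"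
  unfolding AE_vol_iff using AE_sl[OF max_simplex] by simp

lemma measurable_sl_AE_cong:
  assumes "f \<in> borel_measurable (sl s)" "AE y in sl s. f y = g y"
  shows "g \<in> borel_measurable (sl s)"
  using measurable_completion_AE_cong[of f "rs s" borel g] assms unfolding simplex_lebesgue_eq by simp

text \<open>For the direction from the cells to the space, Borel versions on the countably many open
  cells are glued to a Borel function H with value 0 elsewhere. It agrees with F almost everywhere,
  and completeness absorbs the difference.\<close>

lemma vol_measurable_iff_real:
  fixes F :: "'a \<Rightarrow> real"
  shows "F \<in> borel_measurable (vol X) \<longleftrightarrow>
    (\<forall>s\<in>max_simplices X. (\<lambda>y. F (chart X y)) \<in> borel_measurable (sl s))"
proof
  assume "F \<in> borel_measurable (vol X)"
  then obtain G where G: "G \<in> borel_measurable bvol" "AE x in bvol. F x = G x"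
    unfolding vol_eq using completion_ex_borel_measurable_real by blast
  have "AE x in vol X. F x = G x" using G(2) unfolding AE_vol_bvol .
  then have ae: "AE y in sl s. F (chart X y) = G (chart X y)" if "s \<in> max_simplices X" for s
    using that unfolding AE_vol_iff_sl by blast
  show "\<forall>s\<in>max_simplices X. (\<lambda>y. F (chart X y)) \<in> borel_measurable (sl s)"
  proof
    fix s assume s: "s \<in> max_simplices X"
    have "G \<in> borel_measurable borel" using G(1) by simp
    then have "(\<lambda>y. G (chart X y)) \<in> borel_measurable (rs s)"
      using chart_measurable(1)[OF max_simplex[OF s]] by (rule measurable_compose[rotated])
    then have "(\<lambda>y. G (chart X y)) \<in> borel_measurable (sl s)"
      unfolding simplex_lebesgue_eq by (rule measurable_completion)
    moreover have "AE y in sl s. G (chart X y) = F (chart X y)" using ae[OF s] by eventually_elim simp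
    ultimately show "(\<lambda>y. F (chart X y)) \<in> borel_measurable (sl s)" by (rule measurable_sl_AE_cong)
  qed
next
  assume R: "\<forall>s\<in>max_simplices X. (\<lambda>y. F (chart X y)) \<in> borel_measurable (sl s)"
  then have "\<exists>G. G \<in> borel_measurable (rs s) \<and> (AE y in rs s. F (chart X y) = G y)" if "s \<in> max_simplices X" for s
    using that completion_ex_borel_measurable_real[of "\<lambda>y. F (chart X y)" "rs s"] by (auto simp: simplex_lebesgue_eq)
  then obtain G where G: "\<And>s. s \<in> max_simplices X \<Longrightarrow> G s \<in> borel_measurable (rs s)"
    "\<And>s. s \<in> max_simplices X \<Longrightarrow> AE y in rs s. F (chart X y) = G s y" by metis
  define H where "H x = (if simplex_at X x \<in> max_simplices X then G (simplex_at X x) (flat X x) else 0)" for x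
  have "H \<in> borel_measurable borel"
  proof (rule measurable_piecewise_restrict)
    let ?C = "insert (- (\<Union>s\<in>max_simplices X. open_cell s)) (open_cell ` max_simplices X)"
    show "countable ?C" using countable_max by simp
    show "space borel \<subseteq> \<Union> ?C" by auto
    fix \<Omega> assume "\<Omega> \<in> ?C"
    then consider "\<Omega> = - (\<Union>s\<in>max_simplices X. open_cell s)" | s where "s \<in> max_simplices X" "\<Omega> = open_cell s" by auto
    then show "\<Omega> \<inter> space borel \<in> sets borel"
    proof cases
      case 1 show ?thesis unfolding 1
        using open_open_cell by (auto intro!: borel_closed)
    qed (simp add: open_cell_borel)
    from \<open>\<Omega> \<in> ?C\<close> consider "\<Omega> = - (\<Union>s\<in>max_simplices X. open_cell s)" | s where "s \<in> max_simplices X" "\<Omega> = open_cell s" by auto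
    then show "H \<in> borel_measurable (restrict_space borel \<Omega>)"
    proof cases
      case 1
      have "(\<lambda>x. 0) \<in> borel_measurable (restrict_space borel \<Omega>)" by simp
      then show ?thesis by (rule measurable_cong[THEN iffD1, rotated]) (auto simp: H_def space_restrict_space 1)
    next
      case (2 s)
      have "flat X \<in> measurable (restrict_space borel \<Omega>) (rs s)"
      proof (rule measurable_restrict_space2)
        show "flat X \<in> measurable (restrict_space borel \<Omega>) (cm s)"
          by (rule measurable_restrict_space1) simp
        show "flat X \<in> space (restrict_space borel \<Omega>) \<rightarrow> flat_cell X s"
          using open_flat_cell_subset[of s] open_flat_cell_eq[OF max_simplex[OF 2(1)]] by (auto simp: space_restrict_space 2)
      qed
      from measurable_compose[OF this G(1)[OF 2(1)]]
      show ?thesis by (rule measurable_cong[THEN iffD1, rotated]) (auto simp: H_def space_restrict_space 2)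
    qed
  qed
  then have "H \<in> borel_measurable bvol" by simp
  then have H: "H \<in> borel_measurable (completion bvol)" by (rule measurable_completion)
  have eq: "AE x in vol X. H x = F x"
    unfolding AE_vol_iff
  proof
    fix s assume s: "s \<in> max_simplices X"
    have "AE y in sl s. F (chart X y) = G s y" using G(2)[OF s] unfolding simplex_lebesgue_eq AE_completion_iff .
    then have "AE y in cm s. y \<in> open_flat_cell s \<longrightarrow> F (chart X y) = G s y" unfolding AE_sl[OF max_simplex[OF s]] .
    then show "AE y in cm s. y \<in> open_flat_cell s \<longrightarrow> H (chart X y) = F (chart X y)"
    proof eventually_elim
      case (elim y)
      show ?case
      proof
        assume y: "y \<in> open_flat_cell s"
        then have "flat X (chart X y) = y"
          using flat_cell_subset[OF max_simplex[OF s]] open_flat_cell_subset[of s] by (intro flat_chart) blast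
        then show "H (chart X y) = F (chart X y)" using y s elim max_simplex[OF s] by (simp add: H_def)
      qed
    qed
  qed
  show "F \<in> borel_measurable (vol X)"
    unfolding vol_eq by (rule measurable_completion_AE_cong[OF H _ eq[unfolded vol_eq]]) simp
qed

lemma vol_measurable_iff:
  fixes F :: "'a \<Rightarrow> 'b::euclidean_space"
  shows "F \<in> borel_measurable (vol X) \<longleftrightarrow>
    (\<forall>s\<in>max_simplices X. (\<lambda>y. F (chart X y)) \<in> borel_measurable (sl s))"
  unfolding borel_measurable_euclidean_space[where f = F] borel_measurable_euclidean_space[where f = "\<lambda>y. F (chart X y)"]
    vol_measurable_iff_real by blast

text \<open>Carries smallness of an integral against the volume over to the Euclidean measure on the
  cell.\<close>

lemma nn_integral_vol_ge:
  fixes F :: "'a \<Rightarrow> ennreal"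
  assumes s: "s \<in> max_simplices X" and F: "F \<in> borel_measurable (vol X)"
  shows "ennreal (dens_min s) * (\<integral>\<^sup>+ y. indicator (open_flat_cell s) y * F (chart X y) \<partial>cm s) \<le> (\<integral>\<^sup>+ x. F x \<partial>vol X)"
proof -
  obtain G where G: "G \<in> borel_measurable bvol" "AE x in bvol. F x = G x"
    using F completion_ex_borel_measurable unfolding vol_eq by blast
  have Gb: "G \<in> borel_measurable borel" using G(1) by simp
  note ch = chart_measurable(1)[OF max_simplex[OF s]]
  have [measurable]: "(\<lambda>y. G (chart X y)) \<in> borel_measurable (rs s)" by (rule measurable_compose[OF ch Gb])
  have "AE x in vol X. F x = G x" using G(2) unfolding AE_vol_bvol .
  then have ae: "AE y in cm s. y \<in> open_flat_cell s \<longrightarrow> F (chart X y) = G (chart X y)" using s unfolding AE_vol_iff by blast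
  have "(\<integral>\<^sup>+ y. indicator (open_flat_cell s) y * F (chart X y) \<partial>cm s) \<le> (\<integral>\<^sup>+ y. G (chart X y) * indicator (flat_cell X s) y \<partial>cm s)"
    using open_flat_cell_subset[of s] by (intro nn_integral_mono_AE, use ae in eventually_elim) (auto split: split_indicator)
  also have "\<dots> = (\<integral>\<^sup>+ y. G (chart X y) \<partial>rs s)"
    using max_simplex[OF s] by (subst nn_integral_restrict_space) auto
  also have "ennreal (dens_min s) * \<dots> = (\<integral>\<^sup>+ y. ennreal (dens_min s) * G (chart X y) \<partial>rs s)"
    by (rule nn_integral_cmult[symmetric]) measurable
  also have "\<dots> = (\<integral>\<^sup>+ y. ennreal (dens_min s) * G (chart X y) \<partial>sl s)"
    by (simp add: simplex_lebesgue_eq nn_integral_completion)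
  also have "\<dots> \<le> (\<integral>\<^sup>+ y. G (chart X y) * dens s y \<partial>sl s)"
    by (intro nn_integral_mono_AE, use AE_dens[OF s] in eventually_elim) (subst mult.commute, rule mult_left_mono, auto)
  also have "\<dots> = (\<integral>\<^sup>+ x. G x \<partial>cell_vol s)" by (rule nn_integral_cell_vol[OF s Gb, symmetric])
  also have "\<dots> \<le> (\<integral>\<^sup>+ x. G x \<partial>bvol)"
    by (rule nn_integral_mono_measure[OF _ cell_vol_le_bvol[OF s]]) simp
  also have "\<dots> = (\<integral>\<^sup>+ x. F x \<partial>bvol)" using G(2) by (intro nn_integral_cong_AE) auto
  also have "\<dots> = (\<integral>\<^sup>+ x. F x \<partial>vol X)" by (simp add: vol_eq nn_integral_completion)
  finally show ?thesis by (simp add: mult_left_mono)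
qed

text \<open>Measurability of the metric is given for fixed directions only, so the inner product is
  expanded in the frame of each simplex.\<close>

lemma ginner_measurable:
  assumes V: "V \<in> borel_measurable (vol X)" "AE x in vol X. V x \<in> directions X (simplex_at X x)"
    and V': "V' \<in> borel_measurable (vol X)" "AE x in vol X. V' x \<in> directions X (simplex_at X x)"
  shows "(\<lambda>x. ginner X x (V x) (V' x)) \<in> borel_measurable (vol X)"
  unfolding vol_measurable_iff_real
proof
  fix s assume s: "s \<in> max_simplices X"
  let ?F = "frame X s"
  have [measurable]: "(\<lambda>y. V (chart X y)) \<in> borel_measurable (sl s)" "(\<lambda>y. V' (chart X y)) \<in> borel_measurable (sl s)"
    using V(1) V'(1) s by (auto simp: vol_measurable_iff)
  have g [measurable]: "(\<lambda>y. gform X s y b b') \<in> borel_measurable (sl s)" if "b \<in> ?F" "b' \<in> ?F" for b b'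
    using that frame_props(1)[of s] by (intro gform_measurable s) auto
  let ?G = "\<lambda>y. \<Sum>b\<in>?F. \<Sum>b'\<in>?F. (V (chart X y) \<bullet> b) * ((V' (chart X y) \<bullet> b') * gform X s y b b')"
  have "?G \<in> borel_measurable (sl s)"
    by (intro borel_measurable_sum borel_measurable_times borel_measurable_inner g) auto
  moreover have "AE y in sl s. ?G y = ginner X (chart X y) (V (chart X y)) (V' (chart X y))"
    unfolding AE_sl[OF max_simplex[OF s]]
    using AE_inner_form[OF s] V(2)[unfolded AE_vol_iff, rule_format, OF s] V'(2)[unfolded AE_vol_iff, rule_format, OF s]
  proof eventually_elim
    case (elim y)
    show ?case
    proof
      assume y: "y \<in> open_flat_cell s"
      interpret inner_form "directions X s" "frame X s" "gform X s y" Lam using elim y by blast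
      have fy: "flat X (chart X y) = y"
        using y flat_cell_subset[OF max_simplex[OF s]] open_flat_cell_subset[of s] by (intro flat_chart) blast
      have sy: "simplex_at X (chart X y) = s" using y max_simplex[OF s] by simp
      have d: "V (chart X y) \<in> directions X s" "V' (chart X y) \<in> directions X s" using elim(2,3) y sy by auto
      have "ginner X (chart X y) (V (chart X y)) (V' (chart X y)) =
        gform X s y (\<Sum>b\<in>?F. (V (chart X y) \<bullet> b) *\<^sub>R b) (\<Sum>b\<in>?F. (V' (chart X y) \<bullet> b) *\<^sub>R b)"
        unfolding ginner_def fy sy using d by (simp add: repr_B)
      also have "\<dots> = ?G y" unfolding g_sum_left unfolding g_sum_right by (simp add: sum_distrib_left)
      finally show "?G y = ginner X (chart X y) (V (chart X y)) (V' (chart X y))" by simp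
    qed
  qed
  ultimately show "(\<lambda>y. ginner X (chart X y) (V (chart X y)) (V' (chart X y))) \<in> borel_measurable (sl s)"
    by (rule measurable_sl_AE_cong)
qed

end

section \<open>The intrinsic distance\<close>

text \<open>McShane's formula for the largest extension with the same constant. It makes a function
  that is Lipschitz only near a point of a cell accessible to \<open>rademacher\<close>.\<close>

lemma lipschitz_extension_real:
  fixes f :: "'x::metric_space \<Rightarrow> real"
  assumes f: "L-lipschitz_on S f" and S: "S \<noteq> {}"
  obtains h where "L-lipschitz_on UNIV h" "\<And>x. x \<in> S \<Longrightarrow> h x = f x"
proof -
  have L: "0 \<le> L" using f by (rule lipschitz_on_nonneg)
  have fl: "f y \<le> f z + L * dist y z" if "y \<in> S" "z \<in> S" for y z
    using lipschitz_onD[OF f that] by (simp add: dist_real_def)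
  obtain z0 where z0: "z0 \<in> S" using S by blast
  define h where "h x = (INF y\<in>S. f y + L * dist x y)" for x
  have bdd: "bdd_below ((\<lambda>y. f y + L * dist x y) ` S)" for x
  proof (rule bdd_belowI2[of _ "f z0 - L * dist x z0"])
    fix y assume "y \<in> S"
    have "L * dist z0 y \<le> L * (dist x z0 + dist x y)"
      using L by (intro mult_left_mono) (auto simp: dist_triangle3)
    then show "f z0 - L * dist x z0 \<le> f y + L * dist x y"
      using fl[OF z0 \<open>y \<in> S\<close>] by (simp add: algebra_simps)
  qed
  have half: "h x \<le> h x' + L * dist x x'" for x x'
  proof -
    have "h x - L * dist x x' \<le> h x'" unfolding h_def[of x']
    proof (rule cINF_greatest[OF S])
      fix y assume "y \<in> S"
      have "h x \<le> f y + L * dist x y" unfolding h_def by (rule cINF_lower[OF bdd \<open>y \<in> S\<close>])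
      also have "L * dist x y \<le> L * (dist x x' + dist x' y)" using L by (intro mult_left_mono dist_triangle) auto
      finally show "h x - L * dist x x' \<le> f y + L * dist x' y" by (simp add: algebra_simps)
    qed
    then show ?thesis by simp
  qed
  have "L-lipschitz_on UNIV h"
    using half L by (intro lipschitz_onI) (auto simp: dist_real_def abs_le_iff dist_commute algebra_simps, metis add.commute dist_commute half)
  moreover have "h x = f x" if "x \<in> S" for x
  proof (rule antisym)
    show "h x \<le> f x" unfolding h_def by (rule order_trans[OF cINF_lower[OF bdd that]]) simp
    show "f x \<le> h x" unfolding h_def using fl[OF that] by (intro cINF_greatest S) 
  qed
  ultimately show thesis by (rule that)
qed

lemma has_derivative_directional:
  fixes f :: "'e::real_normed_vector \<Rightarrow> real"
  assumes D: "(f has_derivative D) (at y within S)" and r: "r > 0" and S: "\<And>t. \<bar>t\<bar> < r \<Longrightarrow> y + t *\<^sub>R w \<in> S"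
  shows "((\<lambda>t. (f (y + t *\<^sub>R w) - f y) / t) \<longlongrightarrow> D w) (at 0)"
proof -
  interpret D: bounded_linear D using D by (rule has_derivative_bounded_linear)
  have sub: "(\<lambda>t. y + t *\<^sub>R w) ` {-r<..<r} \<subseteq> S" using S by auto
  have 1: "((\<lambda>t. y + t *\<^sub>R w) has_derivative (\<lambda>t. t *\<^sub>R w)) (at 0 within {-r<..<r})"
    by (auto intro!: derivative_eq_intros)
  have 2: "(f has_derivative D) (at (y + 0 *\<^sub>R w) within (\<lambda>t. y + t *\<^sub>R w) ` {-r<..<r})"
    using has_derivative_subset[OF D sub] by simp
  have "((\<lambda>t. f (y + t *\<^sub>R w)) has_derivative (\<lambda>t. D (t *\<^sub>R w))) (at 0 within {-r<..<r})"
    by (rule has_derivative_in_compose[OF 1 2])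
  moreover have "at (0::real) within {-r<..<r} = at 0" using r by (intro at_within_open) auto
  moreover have "(\<lambda>t. D (t *\<^sub>R w)) = (*) (D w)" by (simp add: D.scaleR fun_eq_iff)
  ultimately have "((\<lambda>t. f (y + t *\<^sub>R w)) has_field_derivative D w) (at 0)"
    by (simp add: has_field_derivative_def)
  then show ?thesis by (simp add: DERIV_def)
qed

text \<open>Were a ball null, its dilations about q would be null as well, and with them the whole
  space; but the product of Lebesgue measures is not zero.\<close>

lemma (in frame_measure) emeasure_ball_pos:
  assumes q: "q - p \<in> W" and d: "d > 0"
  shows "emeasure M (ball q d) \<noteq> 0"
proof
  assume 0: "emeasure M (ball q d) = 0"
  have "ball q (d * real (Suc n)) \<in> null_sets M" for n
  proof -
    have "(\<lambda>x. q + (1 / real (Suc n)) *\<^sub>R (x - q)) -` ball q d \<in> null_sets M"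
      using 0 by (intro null_sets_homothety q) (auto simp: null_sets_def)
    also have "(\<lambda>x. q + (1 / real (Suc n)) *\<^sub>R (x - q)) -` ball q d = ball q (d * real (Suc n))"

    proof -
      have e: "dist q (q + (1 / real (Suc n)) *\<^sub>R (x - q)) = dist q x / real (Suc n)" for x
      proof -
        have "dist q (q + (1 / real (Suc n)) *\<^sub>R (x - q)) = norm ((1 / real (Suc n)) *\<^sub>R (x - q))"
          by (simp only: dist_norm diff_add_eq_diff_diff_swap diff_self) (simp add: norm_minus_commute)
        then show ?thesis by (simp add: dist_norm norm_minus_commute)
      qed
      show ?thesis unfolding set_eq_iff vimage_eq mem_ball e by (simp add: pos_divide_less_eq del: of_nat_Suc)
    qed
    finally show ?thesis .
  qed
  then have "(\<Union>n. ball q (d * real (Suc n))) \<in> null_sets M" by blast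
  moreover have "(\<Union>n. ball q (d * real (Suc n))) = UNIV"
  proof -
    have "\<exists>n. dist q x < d * real (Suc n)" for x
    proof -
      obtain n where "dist q x / d < real n" using reals_Archimedean2 by blast
      then have "dist q x < d * real n" using d by (simp add: field_simps)
      also have "\<dots> \<le> d * real (Suc n)" using d by simp
      finally show ?thesis by blast
    qed
    then show ?thesis by auto
  qed
  ultimately have "emeasure M UNIV = 0" by (simp add: null_sets_def)
  interpret product_sigma_finite "\<lambda>b::'e. lborel :: real measure" ..
  have "emeasure L (space L) = emeasure M UNIV" by (subst emeasure_M) auto
  also have "space L = (\<Pi>\<^sub>E b\<in>B. UNIV)" by (simp add: space_PiM)
  also have "emeasure L (\<Pi>\<^sub>E b\<in>B. UNIV) = (\<Prod>b\<in>B. emeasure lborel (UNIV :: real set))"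
    using finite_B by (intro emeasure_PiM) auto
  finally show False using \<open>emeasure M UNIV = 0\<close> finite_B by (simp add: prod_zero_iff)
qed

text \<open>For fixed t \<noteq> 0 the bad z form the preimage of N under a homothety about q, which
  is null. Fubini exchanges the two quantifiers.\<close>

lemma (in frame_measure) AE_segment_avoids:
  assumes N: "N \<in> null_sets M" and q: "q - p \<in> W"
  shows "AE z in M. AE t in lborel. t \<noteq> 0 \<longrightarrow> q + t *\<^sub>R (z - q) \<notin> N"
proof -
  interpret pair_sigma_finite M "lborel :: real measure" ..
  have Nb [measurable]: "N \<in> sets borel" using N by auto
  have "AE t in lborel. AE z in M. t \<noteq> 0 \<longrightarrow> q + t *\<^sub>R (z - q) \<notin> N"
  proof (rule AE_I2)
    fix t :: real
    show "AE z in M. t \<noteq> 0 \<longrightarrow> q + t *\<^sub>R (z - q) \<notin> N"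
    proof (cases "t = 0")
      case False
      from null_sets_homothety[OF N this q] show ?thesis by (rule AE_I') auto
    qed simp
  qed
  moreover have "{x \<in> space (M \<Otimes>\<^sub>M lborel). snd x \<noteq> 0 \<longrightarrow> q + snd x *\<^sub>R (fst x - q) \<notin> N} \<in> sets (M \<Otimes>\<^sub>M lborel)"
  proof -
    let ?f = "\<lambda>x::'e \<times> real. q + snd x *\<^sub>R (fst x - q)"
    have "?f \<in> borel_measurable borel" by (intro borel_measurable_continuous_onI continuous_intros)
    then have "?f -` (- N) \<in> sets borel" using Nb measurable_sets[of ?f borel borel "- N"] by simp
    moreover have "{x::'e \<times> real. snd x = 0} \<in> sets borel" by (intro borel_closed closed_Collect_eq continuous_intros)
    ultimately have "{x. snd x = 0} \<union> ?f -` (- N) \<in> sets borel" by (intro sets.Un)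
    also have "{x. snd x = 0} \<union> ?f -` (- N) = {x \<in> space (M \<Otimes>\<^sub>M lborel). snd x \<noteq> 0 \<longrightarrow> ?f x \<notin> N}"
      by (auto simp: space_pair_measure)
    also have "sets (borel :: ('e \<times> real) measure) = sets (M \<Otimes>\<^sub>M lborel)"
      using sets_pair_measure_cong[OF sets_M sets_lborel, symmetric] by (simp only: borel_prod)
    finally show ?thesis .
  qed
  ultimately show ?thesis by (subst AE_commute)
qed

context riem_poly
begin

lemma flat_chart_open [simp]:
  assumes "s \<in> simplices X" "y \<in> open_flat_cell s"
  shows "flat X (chart X y) = y"
  using assms flat_cell_subset open_flat_cell_subset by (intro flat_chart) blast

lemma open_flat_cell_minus_origin:
  assumes "s \<in> simplices X" "y \<in> open_flat_cell s"
  shows "y - origin X s \<in> directions X s"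
  using assms open_flat_cell_subset origin_in by (intro flat_cell_diff) auto

text \<open>On a compact cell the local Lipschitz property becomes global; the singleton
  \<open>{0::real}\<close> is a dummy time domain.\<close>

lemma lipschitz_chart_cell:
  assumes s: "s \<in> simplices X"
  obtains L where "L-lipschitz_on (flat_cell X s) (chart X)"
proof -
  have "local_lipschitz {0::real} (flat_cell X s) (\<lambda>_. chart X)"
  proof (rule local_lipschitzI)
    fix t :: real and x assume x: "x \<in> flat_cell X s"
    then have "x \<in> P" using flat_cell_subset[OF s] by blast
    then obtain r L where r: "r > 0" "\<And>y z. y \<in> P \<Longrightarrow> z \<in> P \<Longrightarrow> dist x y < r \<Longrightarrow> dist x z < r \<Longrightarrow> dist (chart X y) (chart X z) \<le> L * dist y z"
      using loc_lipschitz_chart unfolding loc_lipschitz_def by metis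
    have "(max L 0)-lipschitz_on (cball x (r/2) \<inter> flat_cell X s) (chart X)"
    proof (rule lipschitz_onI)
      fix y z assume "y \<in> cball x (r/2) \<inter> flat_cell X s" "z \<in> cball x (r/2) \<inter> flat_cell X s"
      then have "dist (chart X y) (chart X z) \<le> L * dist y z"
        using r(1) flat_cell_subset[OF s] by (intro r(2)) auto
      also have "\<dots> \<le> max L 0 * dist y z" by (intro mult_right_mono) auto
      finally show "dist (chart X y) (chart X z) \<le> max L 0 * dist y z" .
    qed simp
    then show "\<exists>u>0. \<exists>L. \<forall>t\<in>cball t u \<inter> {0}. L-lipschitz_on (cball x u \<inter> flat_cell X s) (chart X)"
      using r(1) by (intro exI[of _ "r/2"]) auto
  qed
  then obtain L where "\<And>t. t \<in> {0::real} \<Longrightarrow> L-lipschitz_on (flat_cell X s) (chart X)"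
    by (rule local_lipschitz_compact_implies_lipschitz) (auto simp: compact_flat_cell s)
  then show thesis using that by blast
qed

text \<open>A null set is avoided by a random detour: replace the segment from \<open>q\<^sub>1\<close> to \<open>q\<^sub>2\<close> by the broken
  line through almost any \<open>z\<close> near \<open>q\<^sub>1\<close>.\<close>

lemma gdist_le:
  assumes s: "s \<in> max_simplices X" and q1: "q1 \<in> open_flat_cell s" and q2: "q2 \<in> open_flat_cell s"
    and ne: "q1 \<noteq> q2"
    and ball: "\<And>w. w \<in> directions X s \<Longrightarrow> norm w < dist q1 q2 \<Longrightarrow> q1 + w \<in> open_flat_cell s"
  shows "gdist X (chart X q1) (chart X q2) \<le> ennreal (4 * Lam * dist q1 q2)"
  unfolding gdist_def
proof (rule SUP_least)
  note s' = max_simplex[OF s]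
  let ?W = "directions X s" and ?M = "cm s" and ?o = "origin X s" and ?O = "open_flat_cell s"
  define d where "d = dist q1 q2"
  have d: "d > 0" using ne by (simp add: d_def)
  fix Z assume Z: "Z \<in> null_sets (vol X)"
  then have "AE x in vol X. x \<notin> Z" by (rule AE_not_in)
  then have "AE y in ?M. y \<in> ?O \<longrightarrow> chart X y \<notin> Z" using s unfolding AE_vol_iff by blast
  with AE_inner_form[OF s] have "AE y in ?M. y \<in> ?O \<longrightarrow>
      inner_form ?W (frame X s) (gform X s y) Lam \<and> chart X y \<notin> Z"
    by eventually_elim simp
  \<comment> \<open>N collects both kinds of bad points, those charted into Z and those where the
    metric is not pinched: off N the curve avoids Z and its speed is under control.\<close>
  then obtain N where N: "N \<in> null_sets ?M"
    "{y. \<not> (y \<in> ?O \<longrightarrow> inner_form ?W (frame X s) (gform X s y) Lam \<and> chart X y \<notin> Z)} \<subseteq> N"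
    unfolding eventually_ae_filter by auto
  have Nb [measurable]: "N \<in> sets borel" using N(1) by auto
  have qo: "q1 - ?o \<in> ?W" "q2 - ?o \<in> ?W" using open_flat_cell_minus_origin[OF s'] q1 q2 by auto
  have "AE z in ?M. (z - ?o \<in> ?W) \<and> (AE t in lborel. t \<noteq> 0 \<longrightarrow> q1 + t *\<^sub>R (z - q1) \<notin> N) \<and>
      (AE t in lborel. t \<noteq> 0 \<longrightarrow> q2 + t *\<^sub>R (z - q2) \<notin> N)"
    using cm.AE_in_affine cm.AE_segment_avoids[OF N(1) qo(1)] cm.AE_segment_avoids[OF N(1) qo(2)]
    by eventually_elim simp
  moreover have "\<not> (AE z in ?M. z \<notin> ball q1 d)"
  proof
    assume "AE z in ?M. z \<notin> ball q1 d"
    then have "emeasure ?M (ball q1 d) = 0" by (subst (asm) AE_iff_measurable[of "ball q1 d"]) auto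
    then show False using cm.emeasure_ball_pos[OF qo(1) d] by simp
  qed
  \<comment> \<open>Almost every z is suitable and the ball has positive measure, so it contains a
    suitable z.\<close>
  ultimately have "\<exists>z. z \<in> ball q1 d \<and> z - ?o \<in> ?W \<and> (AE t in lborel. t \<noteq> 0 \<longrightarrow> q1 + t *\<^sub>R (z - q1) \<notin> N) \<and>
      (AE t in lborel. t \<noteq> 0 \<longrightarrow> q2 + t *\<^sub>R (z - q2) \<notin> N)"
    by (smt (verit, best) eventually_mono)
  then obtain z where z: "z \<in> ball q1 d" "z - ?o \<in> ?W"
    and av1: "AE t in lborel. t \<noteq> 0 \<longrightarrow> q1 + t *\<^sub>R (z - q1) \<notin> N"
    and av2: "AE t in lborel. t \<noteq> 0 \<longrightarrow> q2 + t *\<^sub>R (z - q2) \<notin> N" by blast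
  have W: "subspace ?W" by (rule cm.subspace_W)
  have zq: "z - q1 \<in> ?W" "q2 - z \<in> ?W"
    using subspace_diff[OF W z(2) qo(1)] subspace_diff[OF W qo(2) z(2)] by (simp_all add: algebra_simps)
  \<comment> \<open>The longer half of the detour has length at most 2 d and is traversed in time
    1/2: this is the 4 in the statement.\<close>
  have zn: "norm (z - q1) \<le> d" "norm (q2 - z) \<le> 2 * d"
  proof -
    show 1: "norm (z - q1) \<le> d" using z(1) by (simp add: dist_norm norm_minus_commute)
    have "norm (q2 - z) \<le> norm (q2 - q1) + norm (q1 - z)" by (rule norm_triangle_ineq[of "q2 - q1" "q1 - z", simplified])
    then show "norm (q2 - z) \<le> 2 * d" using 1 by (simp add: d_def dist_norm norm_minus_commute)
  qed
  have zO: "z \<in> ?O" using ball[OF zq(1)] z(1) by (simp add: d_def dist_norm norm_minus_commute)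
  have cO: "convex ?O" by (intro convex_rel_interior convex_flat_cell)
  \<comment> \<open>The curve reaches z at time 1/2. It is written with \<open>min\<close> and
    \<open>max\<close> rather than by cases, so that one Lipschitz estimate covers the
    corner.\<close>
  define c where "c t = q1 + (2 * min t (1/2)) *\<^sub>R (z - q1) + (2 * max 0 (t - 1/2)) *\<^sub>R (q2 - z)" for t
  have c1: "c t = q1 + (2 * t) *\<^sub>R (z - q1)" if "t \<le> 1/2" for t using that by (simp add: c_def)
  have c2: "c t = q2 + (2 - 2 * t) *\<^sub>R (z - q2)" if "t \<ge> 1/2" for t
    using that by (simp add: c_def min_def max_def algebra_simps) (simp add: scaleR_2 algebra_simps)
  have cmem: "c t \<in> ?O" if "t \<in> {0..1}" for t
  proof (cases "t \<le> 1/2")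
    case True
    have "(1 - 2 * t) *\<^sub>R q1 + (2 * t) *\<^sub>R z \<in> ?O"
      using that True by (intro convexD[OF cO q1 zO]) auto
    also have "(1 - 2 * t) *\<^sub>R q1 + (2 * t) *\<^sub>R z = c t" unfolding c1[OF True] by (simp add: algebra_simps)
    finally show ?thesis .
  next
    case False
    have "(1 - (2 - 2 * t)) *\<^sub>R q2 + (2 - 2 * t) *\<^sub>R z \<in> ?O"
      using that False by (intro convexD[OF cO q2 zO]) auto
    also have "(1 - (2 - 2 * t)) *\<^sub>R q2 + (2 - 2 * t) *\<^sub>R z = c t"
      using False by (subst c2) (auto simp: algebra_simps scaleR_2)
    finally show ?thesis .
  qed
  define \<gamma> where "\<gamma> t = chart X (c t)" for t
  have lipc: "(2 * norm (z - q1) + 2 * norm (q2 - z))-lipschitz_on {0..1} c"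
  proof (rule lipschitz_onI)
    fix t u :: real
    have "c t - c u = (2 * (min t (1/2) - min u (1/2))) *\<^sub>R (z - q1) + (2 * (max 0 (t - 1/2) - max 0 (u - 1/2))) *\<^sub>R (q2 - z)"
      by (simp add: c_def algebra_simps)
    then have "norm (c t - c u) \<le> \<bar>2 * (min t (1/2) - min u (1/2))\<bar> * norm (z - q1) + \<bar>2 * (max 0 (t - 1/2) - max 0 (u - 1/2))\<bar> * norm (q2 - z)"
      by (metis norm_scaleR norm_triangle_ineq)
    also have "\<dots> \<le> (2 * \<bar>t - u\<bar>) * norm (z - q1) + (2 * \<bar>t - u\<bar>) * norm (q2 - z)"
      by (intro add_mono mult_right_mono) (auto simp: min_def max_def abs_if)
    finally show "dist (c t) (c u) \<le> (2 * norm (z - q1) + 2 * norm (q2 - z)) * dist t u"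
      by (simp add: dist_norm dist_real_def algebra_simps)
  qed simp
  obtain K where K: "K-lipschitz_on (flat_cell X s) (chart X)" using lipschitz_chart_cell[OF s'] by blast
  have "c ` {0..1} \<subseteq> flat_cell X s" using cmem open_flat_cell_subset[of s] by blast
  from lipschitz_on_compose[OF lipc lipschitz_on_subset[OF K this]]
  have lipg: "\<exists>L. L-lipschitz_on {0..1} \<gamma>" unfolding \<gamma>_def o_def by blast
  have ends: "\<gamma> 0 = chart X q1" "\<gamma> 1 = chart X q2"
    using c1[of 0] c2[of 1] by (simp_all add: \<gamma>_def)
  have avoid: "AE t in lebesgue. t \<in> {0..1} \<longrightarrow> t \<notin> {0, 1/2, 1} \<and> c t \<notin> N"
  proof -
    \<comment> \<open>Both halves are affine reparametrizations of the segments from q1 and q2 to z;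
      the form \<open>0 + 2 * t\<close> matches the affine substitution rule.\<close>
    have "AE t in lborel. 0 + 2 * t \<noteq> 0 \<longrightarrow> q1 + (0 + 2 * t) *\<^sub>R (z - q1) \<notin> N"
      by (rule AE_borel_affine[OF _ _ av1]) auto
    moreover have "AE t in lborel. 2 + (-2) * t \<noteq> 0 \<longrightarrow> q2 + (2 + (-2) * t) *\<^sub>R (z - q2) \<notin> N"
      by (rule AE_borel_affine[OF _ _ av2]) auto
    moreover have "AE t in lborel. t \<noteq> (0::real)" "AE t in lborel. t \<noteq> (1::real)" "AE t in lborel. t \<noteq> (1/2::real)"
      by (rule AE_lborel_singleton)+
    ultimately have "AE t in lborel. t \<in> {0..1} \<longrightarrow> t \<notin> {0, 1/2, 1} \<and> c t \<notin> N"
    proof eventually_elim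
      case (elim t)
      then show ?case using c1[of t] c2[of t] by (cases "t \<le> 1/2") auto
    qed
    then show ?thesis by (rule AE_completion)
  qed
  have good: "chart X (c t) \<notin> Z \<and> inner_form ?W (frame X s) (gform X s (c t)) Lam"
    if "t \<in> {0..1}" "c t \<notin> N" for t
    using cmem[OF that(1)] that(2) N(2) by blast
  have nullZ: "{t \<in> {0..1}. \<gamma> t \<in> Z} \<in> null_sets lebesgue"
  proof -
    have "AE t in lebesgue. \<not> (t \<in> {0..1} \<and> \<gamma> t \<in> Z)"
      using avoid by eventually_elim (use good in \<open>auto simp: \<gamma>_def\<close>)
    then have "{t \<in> space lebesgue. \<not> \<not> (t \<in> {0..1} \<and> \<gamma> t \<in> Z)} \<in> null_sets lebesgue"
      unfolding completion.AE_iff_null_sets .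
    also have "{t \<in> space lebesgue. \<not> \<not> (t \<in> {0..1} \<and> \<gamma> t \<in> Z)} = {t \<in> {0..1}. \<gamma> t \<in> Z}" by auto
    finally show ?thesis .
  qed
  have deriv: "vector_derivative (\<lambda>\<tau>. flat X (\<gamma> \<tau>)) (at t) \<in> {2 *\<^sub>R (z - q1), 2 *\<^sub>R (q2 - z)}"
    if t: "t \<in> {0..1}" "t \<notin> {0, 1/2, 1}" for t
  proof (cases "t < 1/2")
    case True
    have "((\<lambda>\<tau>. flat X (\<gamma> \<tau>)) has_vector_derivative 2 *\<^sub>R (z - q1)) (at t)"
    proof (rule has_vector_derivative_transform_within_open[where S = "{0<..<1/2}"])
      show "((\<lambda>\<tau>. q1 + (2 * \<tau>) *\<^sub>R (z - q1)) has_vector_derivative 2 *\<^sub>R (z - q1)) (at t)"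
        by (auto intro!: derivative_eq_intros simp: has_vector_derivative_def)
      fix \<tau> :: real assume \<tau>: "\<tau> \<in> {0<..<1/2}"
      then show "q1 + (2 * \<tau>) *\<^sub>R (z - q1) = flat X (\<gamma> \<tau>)"
        using flat_chart_open[OF s' cmem[of \<tau>]] c1[of \<tau>] by (simp add: \<gamma>_def)
    qed (use True t in auto)
    then show ?thesis by (simp add: vector_derivative_at)
  next
    case False
    have "((\<lambda>\<tau>. flat X (\<gamma> \<tau>)) has_vector_derivative 2 *\<^sub>R (q2 - z)) (at t)"
    proof (rule has_vector_derivative_transform_within_open[where S = "{1/2<..<1}"])
      show "((\<lambda>\<tau>. q2 + (2 - 2 * \<tau>) *\<^sub>R (z - q2)) has_vector_derivative 2 *\<^sub>R (q2 - z)) (at t)"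
        by (auto intro!: derivative_eq_intros simp: has_vector_derivative_def algebra_simps)
      fix \<tau> :: real assume \<tau>: "\<tau> \<in> {1/2<..<1}"
      then show "q2 + (2 - 2 * \<tau>) *\<^sub>R (z - q2) = flat X (\<gamma> \<tau>)"
        using flat_chart_open[OF s' cmem[of \<tau>]] c2[of \<tau>] by (simp add: \<gamma>_def)
    qed (use False t in auto)
    then show ?thesis by (simp add: vector_derivative_at)
  qed
  have speed: "gnorm X (\<gamma> t) (vector_derivative (\<lambda>\<tau>. flat X (\<gamma> \<tau>)) (at t)) \<le> 4 * Lam * d"
    if t: "t \<in> {0..1}" "t \<notin> {0, 1/2, 1}" "c t \<notin> N" for t
  proof -
    interpret inner_form ?W "frame X s" "gform X s (c t)" Lam using good[OF t(1,3)] by blast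
    define v where "v = vector_derivative (\<lambda>\<tau>. flat X (\<gamma> \<tau>)) (at t)"
    have v: "v \<in> ?W" "norm v \<le> 4 * d"
      using deriv[OF t(1,2)] zq zn d W by (auto simp: v_def subspace_mul)
    have "gnorm X (\<gamma> t) v = sqrt (gform X s (c t) v v)"
      by (simp add: gnorm_def ginner_def \<gamma>_def flat_chart_open[OF s' cmem[OF t(1)]] simplex_at_chart[OF s' cmem[OF t(1)]])
    also have "\<dots> \<le> sqrt (Lam\<^sup>2 * (norm v)\<^sup>2)" by (intro real_sqrt_le_mono up v)
    also have "\<dots> = Lam * norm v" using Lam_ge_1 by (simp add: real_sqrt_mult)
    also have "\<dots> \<le> Lam * (4 * d)" using v Lam_ge_1 by (intro mult_left_mono) auto
    finally show ?thesis by (simp add: v_def ac_simps)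
  qed
  have "glength X \<gamma> \<le> (\<integral>\<^sup>+ t. indicator {0..1::real} t * ennreal (4 * Lam * d) \<partial>lebesgue)"
    unfolding glength_def
  proof (rule nn_integral_mono_AE)
    show "AE t in lebesgue. indicator {0..1} t * ennreal (gnorm X (\<gamma> t) (vector_derivative (\<lambda>\<tau>. flat X (\<gamma> \<tau>)) (at t))) \<le>
        indicator {0..1} t * ennreal (4 * Lam * d)"
      using avoid
    proof eventually_elim
      case (elim t)
      then show ?case using speed[of t] by (auto split: split_indicator intro: ennreal_leI)
    qed
  qed
  also have "\<dots> = (\<integral>\<^sup>+ t. indicator {0..1::real} t * ennreal (4 * Lam * d) \<partial>lborel)"
    by (rule nn_integral_completion)
  also have "\<dots> = ennreal (4 * Lam * d)"
    by (simp add: nn_integral_multc)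
  finally have len: "glength X \<gamma> \<le> ennreal (4 * Lam * d)" .
  have "(INF \<gamma> \<in> {\<gamma>. (\<exists>L. L-lipschitz_on {0..1} \<gamma>) \<and> \<gamma> 0 = chart X q1 \<and> \<gamma> 1 = chart X q2 \<and>
                     {t\<in>{0..1}. \<gamma> t \<in> Z} \<in> null_sets lebesgue}. glength X \<gamma>) \<le> glength X \<gamma>"
    by (rule INF_lower) (use lipg ends nullZ in blast)
  also note len
  finally show "(INF \<gamma> \<in> {\<gamma>. (\<exists>L. L-lipschitz_on {0..1} \<gamma>) \<and> \<gamma> 0 = chart X q1 \<and> \<gamma> 1 = chart X q2 \<and>
                     {t\<in>{0..1}. \<gamma> t \<in> Z} \<in> null_sets lebesgue}. glength X \<gamma>) \<le> ennreal (4 * Lam * dist q1 q2)"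
    by (simp add: d_def)
qed

end

section \<open>Gradients of Lipschitz functions\<close>

context riem_poly
begin

definition dom_cell :: "'v set \<Rightarrow> 'a set \<Rightarrow> 'e set" where
  "dom_cell s U = {y \<in> open_flat_cell s. chart X y \<in> U}"

lemma dom_cell_ball:
  assumes s: "s \<in> simplices X" and U: "open U" and y: "y \<in> dom_cell s U"
  obtains r where "r > 0" "\<And>w. w \<in> directions X s \<Longrightarrow> norm w < r \<Longrightarrow> y + w \<in> dom_cell s U"
proof -
  have yO: "y \<in> open_flat_cell s" and yU: "chart X y \<in> U" using y by (auto simp: dom_cell_def)
  obtain r1 where r1: "r1 > 0" "\<And>w. w \<in> directions X s \<Longrightarrow> norm w < r1 \<Longrightarrow> y + w \<in> open_flat_cell s"
    using open_flat_cell_ball[OF yO] by blast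
  have "continuous_on (flat_cell X s) (chart X)"
    by (intro continuous_on_subset[OF continuous_chart] flat_cell_subset s)
  moreover obtain e where e: "e > 0" "ball (chart X y) e \<subseteq> U" using openE[OF U yU] by blast
  moreover have "y \<in> flat_cell X s" using yO open_flat_cell_subset by blast
  ultimately obtain r2 where r2: "r2 > 0" "\<And>z. z \<in> flat_cell X s \<Longrightarrow> dist z y < r2 \<Longrightarrow> dist (chart X z) (chart X y) < e"
    unfolding continuous_on_iff by metis
  have "y + w \<in> dom_cell s U" if w: "w \<in> directions X s" "norm w < min r1 r2" for w
  proof -
    have O: "y + w \<in> open_flat_cell s" using r1(2)[OF w(1)] w(2) by simp
    then have "dist (chart X (y + w)) (chart X y) < e"
      using w(2) open_flat_cell_subset by (intro r2(2)) (auto simp: dist_norm)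
    then show ?thesis using O e(2) by (auto simp: dom_cell_def dist_commute)
  qed
  with r1(1) r2(1) show thesis by (intro that[of "min r1 r2"]) auto
qed

lemma borel_dom_cell:
  assumes s: "s \<in> simplices X" and U: "open U"
  shows "dom_cell s U \<in> sets borel"
proof -
  have "openin (top_of_set P) (P \<inter> chart X -` U)"
    using continuous_openin_preimage_gen[OF continuous_chart U] .
  then obtain T where T: "open T" "P \<inter> chart X -` U = P \<inter> T" by (auto simp: openin_open)
  have "dom_cell s U = open_flat_cell s \<inter> T"
    using T(2) open_flat_cell_subset flat_cell_subset[OF s] unfolding dom_cell_def by blast
  then show ?thesis using T(1) by simp
qed

text \<open>\<open>gdist_le\<close> wants the ball about one of the two points, with their distance
  as radius, inside the cell. Points within r / 4 of p are less than r / 2 apart, and r / 4 + r / 2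
  < r.\<close>

lemma g_lipschitz_ball:
  assumes s: "s \<in> max_simplices X" and u: "g_lipschitz_on X U u"
    and r: "r > 0" "\<And>w. w \<in> directions X s \<Longrightarrow> norm w < r \<Longrightarrow> p + w \<in> dom_cell s U"
  shows "\<exists>L. L-lipschitz_on {p + w | w. w \<in> directions X s \<and> norm w < r / 4} (\<lambda>y. u (chart X y))"
proof -
  have W: "subspace (directions X s)" by (rule cm.subspace_W)
  obtain K where K: "K \<ge> 0" "\<And>x y. x \<in> U \<Longrightarrow> y \<in> U \<Longrightarrow> ennreal \<bar>u x - u y\<bar> \<le> ennreal K * gdist X x y"
    using u unfolding g_lipschitz_on_def by blast
  have L0: "0 \<le> K * (4 * Lam)" using K(1) Lam_ge_1 by simp
  have "(K * (4 * Lam))-lipschitz_on {p + w | w. w \<in> directions X s \<and> norm w < r / 4} (\<lambda>y. u (chart X y))"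
  proof (rule lipschitz_onI[OF _ L0])
    fix y z assume "y \<in> {p + w | w. w \<in> directions X s \<and> norm w < r / 4}" "z \<in> {p + w | w. w \<in> directions X s \<and> norm w < r / 4}"
    then obtain w w' where w: "y = p + w" "w \<in> directions X s" "norm w < r / 4"
      and w': "z = p + w'" "w' \<in> directions X s" "norm w' < r / 4" by blast
    show "dist (u (chart X y)) (u (chart X z)) \<le> K * (4 * Lam) * dist y z"
    proof (cases "y = z")
      case False
      have yz: "y \<in> dom_cell s U" "z \<in> dom_cell s U" using r w w' by auto
      have d: "dist y z < r / 2" using norm_triangle_ineq4[of w w'] w w' by (simp add: dist_norm)
      have g: "gdist X (chart X y) (chart X z) \<le> ennreal (4 * Lam * dist y z)"
      proof (rule gdist_le[OF s])
        show "y \<in> open_flat_cell s" "z \<in> open_flat_cell s" using yz by (auto simp: dom_cell_def)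
        fix v assume v: "v \<in> directions X s" "norm v < dist y z"
        have "norm (w + v) < r" using norm_triangle_ineq[of w v] w(3) v(2) d r(1) by linarith
        then have "p + (w + v) \<in> dom_cell s U" using r(2) subspace_add[OF W w(2) v(1)] by blast
        then show "y + v \<in> open_flat_cell s" by (simp add: w(1) dom_cell_def add.assoc)
      qed (rule False)
      have "ennreal \<bar>u (chart X y) - u (chart X z)\<bar> \<le> ennreal K * gdist X (chart X y) (chart X z)"
        using yz by (intro K(2)) (auto simp: dom_cell_def)
      also have "\<dots> \<le> ennreal K * ennreal (4 * Lam * dist y z)" by (intro mult_left_mono g) auto
      also have "\<dots> = ennreal (K * (4 * Lam) * dist y z)"
        using K(1) Lam_ge_1 by (simp add: ennreal_mult[symmetric] mult.assoc)
      finally show ?thesis using L0 by (simp add: dist_real_def ennreal_le_iff)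
    qed simp
  qed
  then show ?thesis by blast
qed

lemma g_lipschitz_local:
  assumes s: "s \<in> max_simplices X" and U: "open U" and u: "g_lipschitz_on X U u" and p: "p \<in> dom_cell s U"
  shows "\<exists>r>0. (\<forall>w\<in>directions X s. norm w < r \<longrightarrow> p + w \<in> dom_cell s U) \<and>
    (\<exists>L. L-lipschitz_on {p + w | w. w \<in> directions X s \<and> norm w < r} (\<lambda>y. u (chart X y)))"
proof -
  obtain r where r: "r > 0" "\<And>w. w \<in> directions X s \<Longrightarrow> norm w < r \<Longrightarrow> p + w \<in> dom_cell s U"
    using dom_cell_ball[OF max_simplex[OF s] U p] by blast
  from g_lipschitz_ball[OF s u this]
  have "\<exists>L. L-lipschitz_on {p + w | w. w \<in> directions X s \<and> norm w < r / 4} (\<lambda>y. u (chart X y))" .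
  moreover have "p + w \<in> dom_cell s U" if "w \<in> directions X s" "norm w < r / 4" for w
    using that r(1) by (intro r(2)) auto
  ultimately show ?thesis using r(1) by (intro exI[of _ "r / 4"]) simp
qed

lemma at_within_cell:
  assumes s: "s \<in> simplices X" and D: "(f has_derivative D) (at y within {p + w | w. w \<in> directions X s \<and> norm w < r})"
    and y: "y \<in> flat_cell X s" "y \<in> ball p r" "y - p \<in> directions X s"
  shows "(f has_derivative D) (at y within flat_cell X s)"
proof -
  have W: "subspace (directions X s)" by (rule cm.subspace_W)
  have "flat_cell X s \<inter> ball p r \<subseteq> {p + w | w. w \<in> directions X s \<and> norm w < r}"
  proof
    fix z assume z: "z \<in> flat_cell X s \<inter> ball p r"
    have "z - y \<in> directions X s" using z y(1) by (intro flat_cell_diff) auto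
    from subspace_add[OF W this y(3)] have "z - p \<in> directions X s" by simp
    then show "z \<in> {p + w | w. w \<in> directions X s \<and> norm w < r}"
      using z by (intro CollectI exI[of _ "z - p"]) (auto simp: dist_norm norm_minus_commute)
  qed
  from has_derivative_subset[OF D this]
  have "(f has_derivative D) (at y within flat_cell X s \<inter> ball p r)" .
  moreover have "at y within flat_cell X s = at y within flat_cell X s \<inter> ball p r"
    by (rule at_within_nhd[of y "ball p r"]) (use y(2) in auto)
  ultimately show ?thesis by simp
qed

text \<open>Near each point u is Lipschitz in Euclidean coordinates and has a global extension to
  which Rademacher's theorem applies; the Lindelof property leaves countably many such
  neighbourhoods.\<close>

lemma AE_differentiable:
  assumes s: "s \<in> max_simplices X" and U: "open U" and u: "g_lipschitz_on X U u"
  shows "AE y in cm s. y \<in> dom_cell s U \<longrightarrow>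
    (\<exists>D. ((\<lambda>y. u (chart X y)) has_derivative D) (at y within flat_cell X s))"
proof -
  note s' = max_simplex[OF s]
  let ?W = "directions X s"
  let ?f = "\<lambda>y. u (chart X y)"
  have W: "subspace ?W" by (rule cm.subspace_W)
  let ?Q = "\<lambda>y. \<exists>D. (?f has_derivative D) (at y within flat_cell X s)"
  have "\<exists>r>0. (\<forall>w\<in>?W. norm w < r \<longrightarrow> p + w \<in> dom_cell s U) \<and>
      (\<exists>L. L-lipschitz_on {p + w | w. w \<in> ?W \<and> norm w < r} ?f)" if "p \<in> dom_cell s U" for p
    using g_lipschitz_local[OF s U u that] .
  then have "\<forall>p. \<exists>r. p \<in> dom_cell s U \<longrightarrow> r > 0 \<and> (\<forall>w\<in>?W. norm w < r \<longrightarrow> p + w \<in> dom_cell s U) \<and>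
      (\<exists>L. L-lipschitz_on {p + w | w. w \<in> ?W \<and> norm w < r} ?f)" by blast
  then obtain r where "\<forall>p. p \<in> dom_cell s U \<longrightarrow> r p > 0 \<and> (\<forall>w\<in>?W. norm w < r p \<longrightarrow> p + w \<in> dom_cell s U) \<and>
      (\<exists>L. L-lipschitz_on {p + w | w. w \<in> ?W \<and> norm w < r p} ?f)" by (rule choice[THEN exE])
  then have r: "\<And>p. p \<in> dom_cell s U \<Longrightarrow> r p > 0"
    "\<And>p w. p \<in> dom_cell s U \<Longrightarrow> w \<in> ?W \<Longrightarrow> norm w < r p \<Longrightarrow> p + w \<in> dom_cell s U"
    "\<And>p. p \<in> dom_cell s U \<Longrightarrow> \<exists>L. L-lipschitz_on {p + w | w. w \<in> ?W \<and> norm w < r p} ?f"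
    by auto
  have loc: "AE y in cm s. y \<in> dom_cell s U \<and> y \<in> ball p (r p) \<longrightarrow> ?Q y" if p: "p \<in> dom_cell s U" for p
  proof -
    let ?S = "{p + w | w. w \<in> ?W \<and> norm w < r p}"
    obtain L where L: "L-lipschitz_on ?S ?f" using r(3)[OF p] by blast
    have "p + 0 \<in> ?S" using r(1)[OF p] subspace_0[OF W] by (intro CollectI exI[of _ 0]) auto
    then have "?S \<noteq> {}" by blast
    obtain h where h: "L-lipschitz_on UNIV h" "\<forall>y\<in>?S. h y = ?f y"
      by (rule lipschitz_extension_real[OF L \<open>?S \<noteq> {}\<close>], rule that, assumption, blast)
    have pO: "p \<in> open_flat_cell s" using p by (simp add: dom_cell_def)
    show ?thesis
      using cm.rademacher[OF h(1), of s]
    proof eventually_elim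
      case (elim y)
      then obtain D where D: "(h has_derivative D) (at y within {y + w | w. w \<in> ?W})" by blast
      show ?case
      proof
        assume y: "y \<in> dom_cell s U \<and> y \<in> ball p (r p)"
        then have yO: "y \<in> open_flat_cell s" by (simp add: dom_cell_def)
        have yp: "y - p \<in> ?W"
          using yO pO open_flat_cell_subset by (intro flat_cell_diff) auto
        have "?S \<subseteq> {y + w | w. w \<in> ?W}"
        proof
          fix z assume "z \<in> ?S"
          then obtain w where w: "z = p + w" "w \<in> ?W" by blast
          have "w - (y - p) \<in> ?W" using W w(2) yp by (rule subspace_diff)
          then show "z \<in> {y + w | w. w \<in> ?W}" by (intro CollectI exI[of _ "w - (y - p)"]) (simp add: w)
        qed
        from has_derivative_subset[OF D this] have "(h has_derivative D) (at y within ?S)" .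
        moreover have yS: "y \<in> ?S"
          using y yp by (intro CollectI exI[of _ "y - p"]) (auto simp: dist_norm norm_minus_commute)
        ultimately have "(?f has_derivative D) (at y within ?S)"
          by (rule has_derivative_transform[rotated 2]) (use h(2) in auto)
        from at_within_cell[OF s' this _ _ yp] have "(?f has_derivative D) (at y within flat_cell X s)"
          using y yO open_flat_cell_subset by blast
        then show "?Q y" by blast
      qed
    qed
  qed
  obtain F where F: "F \<subseteq> (\<lambda>p. ball p (r p)) ` dom_cell s U" "countable F" "\<Union>F = (\<Union>p\<in>dom_cell s U. ball p (r p))"
    using Lindelof[of "(\<lambda>p. ball p (r p)) ` dom_cell s U"] by blast
  obtain C where C: "C \<subseteq> dom_cell s U" "countable C" "F = (\<lambda>p. ball p (r p)) ` C"
    using F(1,2) countable_subset_image by metis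
  have "AE y in cm s. \<forall>p\<in>C. y \<in> dom_cell s U \<and> y \<in> ball p (r p) \<longrightarrow> ?Q y"
    using loc C(1) by (subst AE_ball_countable[OF C(2)]) blast
  then show ?thesis
  proof eventually_elim
    case (elim y)
    show ?case
    proof
      assume y: "y \<in> dom_cell s U"
      then have "y \<in> (\<Union>p\<in>dom_cell s U. ball p (r p))" using r(1) by (intro UN_I[of y]) auto
      then have "y \<in> (\<Union>p\<in>C. ball p (r p))" unfolding F(3)[unfolded C(3), symmetric] .
      then obtain p where "p \<in> C" "y \<in> ball p (r p)" by blast
      then show "?Q y" using elim y by blast
    qed
  qed
qed

lemma has_rgrad_iff:
  assumes s: "s \<in> max_simplices X" and y: "y \<in> open_flat_cell s"
  shows "has_rgrad X u (chart X y) \<xi> \<longleftrightarrow> \<xi> \<in> directions X s \<and>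
     (\<exists>D. ((\<lambda>y. u (chart X y)) has_derivative D) (at y within flat_cell X s) \<and>
          (\<forall>\<eta>\<in>directions X s. gform X s y \<xi> \<eta> = D \<eta>))"
  using s by (simp add: has_rgrad_def ginner_def flat_chart_open[OF max_simplex[OF s] y] simplex_at_chart[OF max_simplex[OF s] y])

lemma cell_line:
  assumes y: "y \<in> open_flat_cell s" and w: "w \<in> directions X s"
  obtains r where "r > 0" "\<And>t. \<bar>t\<bar> < r \<Longrightarrow> y + t *\<^sub>R w \<in> flat_cell X s"
proof -
  have W: "subspace (directions X s)" by (rule cm.subspace_W)
  obtain r where r: "r > 0" "\<And>w. w \<in> directions X s \<Longrightarrow> norm w < r \<Longrightarrow> y + w \<in> open_flat_cell s"
    using open_flat_cell_ball[OF y] by blast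
  have "y + t *\<^sub>R w \<in> flat_cell X s" if t: "\<bar>t\<bar> < r / (norm w + 1)" for t
  proof -
    have "\<bar>t\<bar> * (norm w + 1) < r" using t by (simp add: pos_less_divide_eq add_nonneg_pos)
    then have "norm (t *\<^sub>R w) < r" by (simp add: distrib_left)
    then show ?thesis using r(2)[of "t *\<^sub>R w"] subspace_mul[OF W w] open_flat_cell_subset by blast
  qed
  moreover have "r / (norm w + 1) > 0" using r(1) by (simp add: add_nonneg_pos)
  ultimately show thesis by (rule that[rotated])
qed

lemma has_rgrad_directional:
  assumes s: "s \<in> max_simplices X" and y: "y \<in> open_flat_cell s" and g: "has_rgrad X u (chart X y) \<xi>"
    and w: "w \<in> directions X s"
  shows "((\<lambda>t. (u (chart X (y + t *\<^sub>R w)) - u (chart X y)) / t) \<longlongrightarrow> gform X s y \<xi> w) (at 0)"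
proof -
  obtain D where D: "((\<lambda>y. u (chart X y)) has_derivative D) (at y within flat_cell X s)"
    "\<forall>\<eta>\<in>directions X s. gform X s y \<xi> \<eta> = D \<eta>"
    using g unfolding has_rgrad_iff[OF s y] by blast
  obtain r where r: "r > 0" "\<And>t. \<bar>t\<bar> < r \<Longrightarrow> y + t *\<^sub>R w \<in> flat_cell X s" using cell_line[OF y w] by blast
  from has_derivative_directional[OF D(1) r] show ?thesis using D(2) w by simp
qed

text \<open>Directional limits fix the inner products with the frame, and these fix the vector
  because the form is positive definite. This justifies the description operator in
  \<open>rgrad\<close>.\<close>

lemma has_rgrad_unique:
  assumes s: "s \<in> max_simplices X" and y: "y \<in> open_flat_cell s"
    and i: "inner_form (directions X s) (frame X s) (gform X s y) Lam"
    and g: "has_rgrad X u (chart X y) \<xi>" "has_rgrad X u (chart X y) \<xi>'"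
  shows "\<xi> = \<xi>'"
proof -
  interpret inner_form "directions X s" "frame X s" "gform X s y" Lam by (rule i)
  show ?thesis
  proof (rule riesz_unique)
    show "\<xi> \<in> directions X s" "\<xi>' \<in> directions X s" using g unfolding has_rgrad_iff[OF s y] by auto
    fix b assume "b \<in> frame X s"
    then have b: "b \<in> directions X s" using frame_props(1) by blast
    from has_rgrad_directional[OF s y g(1) b] has_rgrad_directional[OF s y g(2) b]
    show "gform X s y \<xi> b = gform X s y \<xi>' b" by (rule tendsto_unique[rotated]) simp
  qed
qed

lemma rgrad_eqI:
  assumes "s \<in> max_simplices X" "y \<in> open_flat_cell s"
    "inner_form (directions X s) (frame X s) (gform X s y) Lam" "has_rgrad X u (chart X y) \<xi>"
  shows "rgrad X u (chart X y) = \<xi>"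
  unfolding rgrad_def using has_rgrad_unique[OF assms(1-3)] assms(4) by blast

lemma has_rgrad_ex:
  assumes s: "s \<in> max_simplices X" and y: "y \<in> open_flat_cell s"
    and i: "inner_form (directions X s) (frame X s) (gform X s y) Lam"
    and D: "((\<lambda>y. u (chart X y)) has_derivative D) (at y within flat_cell X s)"
  shows "\<exists>\<xi>. has_rgrad X u (chart X y) \<xi>"
proof -
  interpret inner_form "directions X s" "frame X s" "gform X s y" Lam by (rule i)
  interpret D: bounded_linear D using D by (rule has_derivative_bounded_linear)
  obtain \<xi> where \<xi>: "\<xi> \<in> directions X s" "\<And>b. b \<in> frame X s \<Longrightarrow> gform X s y \<xi> b = D b"
    using riesz_gstep[of D] by blast
  have "gform X s y \<xi> \<eta> = D \<eta>" if "\<eta> \<in> directions X s" for \<eta>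
  proof -
    have "gform X s y \<xi> \<eta> = gform X s y \<xi> (\<Sum>b\<in>frame X s. (\<eta> \<bullet> b) *\<^sub>R b)" using repr_B[OF that] by simp
    also have "\<dots> = D (\<Sum>b\<in>frame X s. (\<eta> \<bullet> b) *\<^sub>R b)"
      unfolding g_sum_right D.sum using \<xi>(2) by (intro sum.cong) (auto simp: D.scaleR)
    finally show ?thesis using repr_B[OF that] by simp
  qed
  then show ?thesis unfolding has_rgrad_iff[OF s y] using \<xi>(1) D by blast
qed

lemma AE_has_rgrad:
  assumes U: "open U" and u: "g_lipschitz_on X U u"
  shows "AE x in vol X. x \<in> U \<longrightarrow> has_rgrad X u x (rgrad X u x)"
  unfolding AE_vol_iff
proof
  fix s assume s: "s \<in> max_simplices X"
  show "AE y in cm s. y \<in> open_flat_cell s \<longrightarrow> chart X y \<in> U \<longrightarrow> has_rgrad X u (chart X y) (rgrad X u (chart X y))"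
    using AE_inner_form[OF s] AE_differentiable[OF s U u]
  proof eventually_elim
    case (elim y)
    show ?case
    proof (intro impI)
      assume y: "y \<in> open_flat_cell s" "chart X y \<in> U"
      then have i: "inner_form (directions X s) (frame X s) (gform X s y) Lam" using elim by blast
      obtain D where "((\<lambda>y. u (chart X y)) has_derivative D) (at y within flat_cell X s)"
        using elim(2) y by (auto simp: dom_cell_def)
      then obtain \<xi> where "has_rgrad X u (chart X y) \<xi>" using has_rgrad_ex[OF s y(1) i] by blast
      then show "has_rgrad X u (chart X y) (rgrad X u (chart X y))"
        using rgrad_eqI[OF s y(1) i] by simp
    qed
  qed
qed

text \<open>Extension by 0 turns difference quotients into Borel functions on the whole Euclidean
  space, although \<open>y + t *\<^sub>R b\<close> may leave the cell.\<close>

definition dfun :: "'v set \<Rightarrow> 'a set \<Rightarrow> ('a \<Rightarrow> real) \<Rightarrow> 'e \<Rightarrow> real" where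
  "dfun s U u y = (if y \<in> dom_cell s U then u (chart X y) else 0)"

lemma borel_dfun:
  assumes s: "s \<in> max_simplices X" and U: "open U" and u: "g_lipschitz_on X U u"
  shows "dfun s U u \<in> borel_measurable borel"
proof -
  note s' = max_simplex[OF s]
  have "continuous_on (dom_cell s U) (\<lambda>y. u (chart X y))"
    unfolding continuous_on_iff
  proof (intro ballI allI impI)
    fix y and e :: real assume y: "y \<in> dom_cell s U" and e: "e > 0"
    obtain r L where r: "r > 0" "L-lipschitz_on {y + w | w. w \<in> directions X s \<and> norm w < r} (\<lambda>y. u (chart X y))"
      using g_lipschitz_local[OF s U u y] by blast
    have L: "L \<ge> 0" using r(2) by (rule lipschitz_on_nonneg)
    have "dist (u (chart X z)) (u (chart X y)) < e" if z: "z \<in> dom_cell s U" "dist z y < min r (e / (L + 1))" for z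
    proof -
      have "z - y \<in> directions X s"
        using z(1) y open_flat_cell_subset by (intro flat_cell_diff) (auto simp: dom_cell_def)
      then have zS: "z \<in> {y + w | w. w \<in> directions X s \<and> norm w < r}"
        using z(2) by (intro CollectI exI[of _ "z - y"]) (auto simp: dist_norm)
      have yS: "y \<in> {y + w | w. w \<in> directions X s \<and> norm w < r}"
        using r(1) subspace_0[OF cm.subspace_W] by (intro CollectI exI[of _ 0]) auto
      have "dist (u (chart X z)) (u (chart X y)) \<le> L * dist z y" by (rule lipschitz_onD[OF r(2) zS yS])
      also have "\<dots> \<le> (L + 1) * dist z y" by (intro mult_right_mono) auto
      also have "\<dots> < (L + 1) * (e / (L + 1))" using z(2) L by (intro mult_strict_left_mono) auto
      finally show ?thesis using L by simp
    qed
    then show "\<exists>d>0. \<forall>z\<in>dom_cell s U. dist z y < d \<longrightarrow> dist (u (chart X z)) (u (chart X y)) < e"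
      using r(1) e L by (intro exI[of _ "min r (e / (L + 1))"]) auto
  qed
  then have "(\<lambda>y. indicator (dom_cell s U) y *\<^sub>R u (chart X y)) \<in> borel_measurable borel"
    by (rule borel_measurable_continuous_on_indicator[OF borel_dom_cell[OF s' U]])
  then show ?thesis by (rule measurable_cong[THEN iffD1, rotated]) (auto simp: dfun_def)
qed

lemma borel_to_sl:
  assumes "f \<in> borel_measurable borel"
  shows "f \<in> borel_measurable (sl s)"
  unfolding simplex_lebesgue_eq
  by (intro measurable_completion measurable_restrict_space1) (use assms in \<open>simp cong: measurable_cong_sets\<close>)

lemma g_lipschitz_measurable:
  assumes U: "open U" and u: "g_lipschitz_on X U u"
  shows "(\<lambda>x. if x \<in> U then u x else 0) \<in> borel_measurable (vol X)"
  unfolding vol_measurable_iff_real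
proof
  fix s assume s: "s \<in> max_simplices X"
  show "(\<lambda>y. if chart X y \<in> U then u (chart X y) else 0) \<in> borel_measurable (sl s)"
  proof (rule measurable_sl_AE_cong)
    show "dfun s U u \<in> borel_measurable (sl s)" by (rule borel_to_sl[OF borel_dfun[OF s U u]])
    show "AE y in sl s. dfun s U u y = (if chart X y \<in> U then u (chart X y) else 0)"
      unfolding AE_sl[OF max_simplex[OF s]] by (rule AE_I2) (auto simp: dfun_def dom_cell_def)
  qed
qed

text \<open>The iterates of \<open>gstep\<close> from 0, with the metric evaluated on frame vectors
  alone: measurability in y is known for fixed directions, not for the moving iterate.\<close>

primrec descent :: "'v set \<Rightarrow> ('e \<Rightarrow> 'e \<Rightarrow> real) \<Rightarrow> nat \<Rightarrow> 'e \<Rightarrow> 'e" where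
  "descent s d 0 y = 0"
| "descent s d (Suc k) y = descent s d k y -
    (1 / Lam ^ 6) *\<^sub>R (\<Sum>b\<in>frame X s. ((\<Sum>c\<in>frame X s. (descent s d k y \<bullet> c) * gform X s y c b) - d b y) *\<^sub>R b)"

text \<open>The gradient is the limit of the \<open>descent\<close> iterates, whose data are limits
  of difference quotients along the frame. All of these are measurable, and completeness absorbs the
  null set where the identification fails.\<close>

lemma rgrad_measurable:
  assumes U: "open U" and u: "g_lipschitz_on X U u"
  shows "(\<lambda>x. if x \<in> U then rgrad X u x else 0) \<in> borel_measurable (vol X)"
  unfolding vol_measurable_iff
proof
  fix s assume s: "s \<in> max_simplices X"
  note s' = max_simplex[OF s]
  let ?W = "directions X s" and ?F = "frame X s"
  define d where "d b y = lim (\<lambda>n. (dfun s U u (y + (1 / real (Suc n)) *\<^sub>R b) - dfun s U u y) / (1 / real (Suc n)))" for b y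
  have d_meas: "d b \<in> borel_measurable (sl s)" for b
  proof (rule borel_to_sl)
    note [measurable] = borel_dfun[OF s U u]
    show "d b \<in> borel_measurable borel" unfolding d_def[abs_def] by measurable
  qed
  have desc_meas: "descent s d k \<in> borel_measurable (sl s)" for k
  proof (induction k)
    case (Suc k)
    have "(\<lambda>y. descent s d k y - (1 / Lam ^ 6) *\<^sub>R (\<Sum>b\<in>?F. ((\<Sum>c\<in>?F. (descent s d k y \<bullet> c) * gform X s y c b) - d b y) *\<^sub>R b))
        \<in> borel_measurable (sl s)"
      using frame_props(1)[of s]
      by (intro borel_measurable_diff borel_measurable_scaleR borel_measurable_const borel_measurable_sum
          borel_measurable_times borel_measurable_inner gform_measurable s Suc d_meas) auto
    then show ?case by simp
  qed simp
  define G where "G y = (if y \<in> dom_cell s U then lim (\<lambda>k. descent s d k y) else 0)" for y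
  have "G \<in> borel_measurable (sl s)"
  proof -
    have [measurable]: "(\<lambda>y. lim (\<lambda>k. descent s d k y)) \<in> borel_measurable (sl s)"
      by (rule borel_measurable_lim_metric) (rule desc_meas)
    have "(indicator (dom_cell s U) :: 'e \<Rightarrow> real) \<in> borel_measurable (sl s)"
      by (rule borel_to_sl) (use borel_dom_cell[OF s' U] in simp)
    then have "(\<lambda>y. (indicator (dom_cell s U) y :: real) *\<^sub>R lim (\<lambda>k. descent s d k y)) \<in> borel_measurable (sl s)" by measurable
    then show ?thesis by (rule measurable_cong[THEN iffD1, rotated]) (auto simp: G_def)
  qed
  moreover have "AE y in sl s. G y = (if chart X y \<in> U then rgrad X u (chart X y) else 0)"
    unfolding AE_sl[OF s'] using AE_inner_form[OF s] AE_has_rgrad[OF U u, unfolded AE_vol_iff, rule_format, OF s]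
  proof eventually_elim
    case (elim y)
    show ?case
    proof
      assume yO: "y \<in> open_flat_cell s"
      show "G y = (if chart X y \<in> U then rgrad X u (chart X y) else 0)"
      proof (cases "chart X y \<in> U")
        case True
        then have y: "y \<in> dom_cell s U" using yO by (simp add: dom_cell_def)
        interpret inner_form ?W ?F "gform X s y" Lam using elim(1) yO by blast
        have rg: "has_rgrad X u (chart X y) (rgrad X u (chart X y))" using elim(2) yO True by blast
        let ?\<xi> = "rgrad X u (chart X y)"
        have xiW: "?\<xi> \<in> ?W" using rg unfolding has_rgrad_iff[OF s yO] by blast
        have db: "d b y = gform X s y ?\<xi> b" if b: "b \<in> ?F" for b
        proof -
          have bW: "b \<in> ?W" using b frame_props(1) by blast
          obtain r where r: "r > 0" "\<And>w. w \<in> ?W \<Longrightarrow> norm w < r \<Longrightarrow> y + w \<in> dom_cell s U"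
            using dom_cell_ball[OF s' U y] by blast
          have lim0: "filterlim (\<lambda>n. 1 / real (Suc n)) (at 0) sequentially"
            using LIMSEQ_inverse_real_of_nat by (auto simp: filterlim_at inverse_eq_divide)
          have "(\<lambda>n. (u (chart X (y + (1 / real (Suc n)) *\<^sub>R b)) - u (chart X y)) / (1 / real (Suc n))) \<longlonglongrightarrow> gform X s y ?\<xi> b"
            by (rule filterlim_compose[OF has_rgrad_directional[OF s yO rg bW] lim0])
          moreover have "eventually (\<lambda>n. 1 / real (Suc n) < r) sequentially"
            using LIMSEQ_inverse_real_of_nat r(1) by (auto simp: inverse_eq_divide intro: order_tendstoD)
          then have "eventually (\<lambda>n. (u (chart X (y + (1 / real (Suc n)) *\<^sub>R b)) - u (chart X y)) / (1 / real (Suc n)) =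
              (dfun s U u (y + (1 / real (Suc n)) *\<^sub>R b) - dfun s U u y) / (1 / real (Suc n))) sequentially"
          proof eventually_elim
            case (elim n)
            have "y + (1 / real (Suc n)) *\<^sub>R b \<in> dom_cell s U"
              using elim frame_props(3)[OF b] subspace_mul[OF subspace_W bW] by (intro r(2)) auto
            then show ?case using y by (simp add: dfun_def)
          qed
          ultimately have "(\<lambda>n. (dfun s U u (y + (1 / real (Suc n)) *\<^sub>R b) - dfun s U u y) / (1 / real (Suc n))) \<longlonglongrightarrow> gform X s y ?\<xi> b"
            by (rule Lim_transform_eventually)
          then show ?thesis unfolding d_def by (rule limI)
        qed
        let ?d = "\<lambda>b. d b y"
        obtain \<xi> where xi: "\<xi> \<in> ?W" "\<And>b. b \<in> ?F \<Longrightarrow> gform X s y \<xi> b = ?d b" "(\<lambda>k. (gstep ?d ^^ k) 0) \<longlonglongrightarrow> \<xi>"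
          using riesz_gstep[of ?d] by blast
        have "\<xi> = ?\<xi>" using xi(1) xiW xi(2) db by (intro riesz_unique) auto
        have "descent s d k y = (gstep ?d ^^ k) 0 \<and> (gstep ?d ^^ k) 0 \<in> ?W" for k
        proof (induction k)
          case 0 show ?case using subspace_W by (simp add: subspace_0)
        next
          case (Suc k)
          let ?x = "(gstep ?d ^^ k) 0"
          have dk: "descent s d k y = ?x" "?x \<in> ?W" using Suc by auto
          have e: "gform X s y ?x b = (\<Sum>c\<in>?F. (?x \<bullet> c) * gform X s y c b)" for b
          proof -
            have "gform X s y ?x b = gform X s y (\<Sum>c\<in>?F. (?x \<bullet> c) *\<^sub>R c) b" using repr_B[OF dk(2)] by simp
            then show ?thesis by (simp only: g_sum_left)
          qed
          have "descent s d (Suc k) y = gstep ?d ?x"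
            by (simp only: descent.simps dk(1) gstep_def e)
          then show ?case using gstep_in_W[OF dk(2)] by simp
        qed
        then have "lim (\<lambda>k. descent s d k y) = \<xi>" using xi(3) by (simp add: limI)
        then show ?thesis using y True \<open>\<xi> = ?\<xi>\<close> by (simp add: G_def)
      qed (simp add: G_def dom_cell_def)
    qed
  qed
  ultimately show "(\<lambda>y. if chart X y \<in> U then rgrad X u (chart X y) else 0) \<in> borel_measurable (sl s)"
    by (rule measurable_sl_AE_cong)
qed

end

section \<open>The energy estimate\<close>

text \<open>Both functions are applied to approximants without a priori bounds.
  \<open>cutoff\<close> produces values in [0, 1] and preserves zeros; \<open>damp\<close> has
  values in [0, 4], since the shift 2 exceeds pi / 2. Both are 1-Lipschitz. As \<open>damp'\<close>
  is positive everywhere, the limit of the weighted energies still detects the gradient.\<close>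

definition cutoff :: "real \<Rightarrow> real" where "cutoff t = t\<^sup>2 / (1 + t\<^sup>2)"
definition cutoff' :: "real \<Rightarrow> real" where "cutoff' t = 2 * t / (1 + t\<^sup>2)\<^sup>2"
definition damp :: "real \<Rightarrow> real" where "damp t = arctan t + 2"
definition damp' :: "real \<Rightarrow> real" where "damp' t = 1 / (1 + t\<^sup>2)"

lemma cutoff_deriv: "(cutoff has_real_derivative cutoff' t) (at t)"
proof -
  have "1 + t\<^sup>2 \<noteq> 0" by (metis add_pos_nonneg less_irrefl zero_le_power2 zero_less_one)
  then show ?thesis unfolding cutoff_def[abs_def] cutoff'_def
    by (auto intro!: derivative_eq_intros simp: field_simps power2_eq_square)
qed

lemma damp_deriv: "(damp has_real_derivative damp' t) (at t)"
  unfolding damp_def[abs_def] damp'_def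
  by (auto intro!: derivative_eq_intros simp: inverse_eq_divide)

lemma one_plus_square: "1 \<le> 1 + (t::real)\<^sup>2" "0 < 1 + (t::real)\<^sup>2"
  by (auto intro: add_pos_nonneg)

lemma cutoff_bounds: "0 \<le> cutoff t" "cutoff t \<le> 1" and cutoff_zero [simp]: "cutoff 0 = 0" and cutoff_one: "cutoff 1 = 1/2"
  using one_plus_square[of t] by (auto simp: cutoff_def divide_le_eq_1)

lemma cutoff'_bound: "\<bar>cutoff' t\<bar> \<le> 1"
proof -
  have "0 \<le> (\<bar>t\<bar> - 1)\<^sup>2" by simp
  then have "2 * \<bar>t\<bar> \<le> 1 + t\<^sup>2" by (simp add: power2_diff)
  also have "\<dots> \<le> (1 + t\<^sup>2)\<^sup>2" using one_plus_square[of t] by (simp add: power2_eq_square[of "1 + t\<^sup>2"] mult_le_cancel_left1)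
  finally show ?thesis using one_plus_square[of t] by (simp add: cutoff'_def abs_mult divide_le_eq_1)
qed

lemma damp_bounds: "0 \<le> damp t" "damp t \<le> 4"
  using arctan_lbound[of t] arctan_ubound[of t] pi_less_4 by (auto simp: damp_def)

lemma damp'_bounds: "0 < damp' t" "damp' t \<le> 1"
  using one_plus_square[of t] by (auto simp: damp'_def)

lemma mean_value_bound:
  fixes f :: "real \<Rightarrow> real"
  assumes "\<And>t. (f has_real_derivative f' t) (at t)" "\<And>t. \<bar>f' t\<bar> \<le> 1"
  shows "\<bar>f x - f y\<bar> \<le> \<bar>x - y\<bar>"
proof -
  have "norm (f x - f y) \<le> 1 * norm (x - y)"
    by (rule field_differentiable_bound[of UNIV f f']) (use assms in auto)
  then show ?thesis by simp
qed

lemma cutoff_lipschitz: "\<bar>cutoff x - cutoff y\<bar> \<le> \<bar>x - y\<bar>"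
  by (rule mean_value_bound[OF cutoff_deriv cutoff'_bound])

lemma damp_lipschitz: "\<bar>damp x - damp y\<bar> \<le> \<bar>x - y\<bar>"
  by (rule mean_value_bound[OF damp_deriv]) (use damp'_bounds in \<open>auto simp: less_imp_le\<close>)

text \<open>The sum of all \<open>g m\<close> has a finite integral, so it is finite almost
  everywhere and its terms tend to 0. The summable rate replaces the passage to a
  subsequence.\<close>

lemma AE_tendsto_0_if_summable:
  fixes g :: "nat \<Rightarrow> 'x \<Rightarrow> real"
  assumes g: "\<And>m. g m \<in> borel_measurable M" "\<And>m x. 0 \<le> g m x"
    and e: "\<And>m. (\<integral>\<^sup>+ x. ennreal (g m x) \<partial>M) \<le> ennreal (e m)" "\<And>m. 0 \<le> e m" "summable e"
  shows "AE x in M. (\<lambda>m. g m x) \<longlonglongrightarrow> 0"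
proof -
  have "(\<integral>\<^sup>+ x. (\<Sum>m. ennreal (g m x)) \<partial>M) = (\<Sum>m. \<integral>\<^sup>+ x. ennreal (g m x) \<partial>M)"
    using g by (intro nn_integral_suminf) simp
  also have "\<dots> \<le> (\<Sum>m. ennreal (e m))" using e(1) by (intro suminf_le) auto
  also have "\<dots> = ennreal (\<Sum>m. e m)" using e by (intro suminf_ennreal2) auto
  also have "\<dots> < \<infinity>" by simp
  finally have "(\<integral>\<^sup>+ x. (\<Sum>m. ennreal (g m x)) \<partial>M) \<noteq> \<infinity>" by simp
  then have "AE x in M. (\<Sum>m. ennreal (g m x)) \<noteq> \<infinity>"
    using g(1) by (intro nn_integral_noteq_infinite) auto
  then show ?thesis
  proof eventually_elim
    case (elim x)
    then have "summable (\<lambda>m. g m x)" using g(2) by (intro summable_suminf_not_top) auto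
    then show ?case by (rule summable_LIMSEQ_zero)
  qed
qed

context riem_poly
begin

abbreviation "inner_at x \<equiv> inner_form (directions X (simplex_at X x)) (frame X (simplex_at X x)) (ginner X x) Lam"

lemma ginner_eq: "ginner X x = gform X (simplex_at X x) (flat X x)"
  by (simp add: ginner_def fun_eq_iff)

lemma flat_in_open: "flat X x \<in> open_flat_cell (simplex_at X x)"
  unfolding open_flat_cell_eq[OF simplex_at_in] by auto

lemma AE_inner: "AE x in vol X. simplex_at X x \<in> max_simplices X \<and> inner_at x"
  unfolding AE_vol_iff
proof
  fix s assume s: "s \<in> max_simplices X"
  show "AE y in cm s. y \<in> open_flat_cell s \<longrightarrow> simplex_at X (chart X y) \<in> max_simplices X \<and> inner_at (chart X y)"
    using AE_inner_form[OF s]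
    by eventually_elim (auto simp: ginner_eq flat_chart_open[OF max_simplex[OF s]] simplex_at_chart[OF max_simplex[OF s]] s)
qed

lemma gnorm_square:
  assumes "inner_at x" "v \<in> directions X (simplex_at X x)"
  shows "(gnorm X x v)\<^sup>2 = ginner X x v v"
proof -
  interpret inner_form "directions X (simplex_at X x)" "frame X (simplex_at X x)" "ginner X x" Lam by (rule assms(1))
  show ?thesis using g_nonneg[OF assms(2)] by (simp add: gnorm_def)
qed

lemma gnorm_nonneg: "inner_at x \<Longrightarrow> v \<in> directions X (simplex_at X x) \<Longrightarrow> 0 \<le> gnorm X x v"
  by (simp add: gnorm_def inner_form.g_nonneg)

lemma gnorm_measurable:
  assumes "V \<in> borel_measurable (vol X)" "AE x in vol X. V x \<in> directions X (simplex_at X x)"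
  shows "(\<lambda>x. gnorm X x (V x)) \<in> borel_measurable (vol X)"
  unfolding gnorm_def using ginner_measurable[OF assms assms] by measurable

lemma has_rgrad_in_directions: "has_rgrad X u x \<xi> \<Longrightarrow> \<xi> \<in> directions X (simplex_at X x)"
  by (auto simp: has_rgrad_def Let_def)

lemma subspace_directions: "subspace (directions X s)"
  by (simp add: directions_def)

lemma rgrad_eq:
  assumes "simplex_at X x \<in> max_simplices X" "inner_at x" "has_rgrad X u x \<xi>"
  shows "rgrad X u x = \<xi>"
  using rgrad_eqI[OF assms(1) flat_in_open, of u \<xi>] assms(2,3) by (simp add: ginner_eq)

lemma has_rgrad_product:
  assumes i: "inner_at x" and \<xi>: "has_rgrad X \<phi> x \<xi>" and \<eta>: "has_rgrad X w x \<eta>"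
    and hA: "(A has_real_derivative A') (at (\<phi> x))" and hB: "(B has_real_derivative B') (at (w x))"
  shows "has_rgrad X (\<lambda>x. A (\<phi> x) * B (w x)) x ((B (w x) * A') *\<^sub>R \<xi> + (A (\<phi> x) * B') *\<^sub>R \<eta>)"
proof -
  let ?s = "simplex_at X x" and ?y = "flat X x"
  interpret inner_form "directions X ?s" "frame X ?s" "ginner X x" Lam by (rule i)
  obtain D1 where D1: "((\<lambda>y. \<phi> (chart X y)) has_derivative D1) (at ?y within flat_cell X ?s)"
    "\<forall>v\<in>directions X ?s. ginner X x \<xi> v = D1 v" using \<xi> by (auto simp: has_rgrad_def Let_def)
  obtain D2 where D2: "((\<lambda>y. w (chart X y)) has_derivative D2) (at ?y within flat_cell X ?s)"
    "\<forall>v\<in>directions X ?s. ginner X x \<eta> v = D2 v" using \<eta> by (auto simp: has_rgrad_def Let_def)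
  have A1: "((\<lambda>y. A (\<phi> (chart X y))) has_derivative (\<lambda>v. A' * D1 v)) (at ?y within flat_cell X ?s)"
    using has_derivative_compose[OF D1(1), of A "(*) A'"] hA by (simp add: has_field_derivative_def)
  have B1: "((\<lambda>y. B (w (chart X y))) has_derivative (\<lambda>v. B' * D2 v)) (at ?y within flat_cell X ?s)"
    using has_derivative_compose[OF D2(1), of B "(*) B'"] hB by (simp add: has_field_derivative_def)
  have "((\<lambda>y. A (\<phi> (chart X y)) * B (w (chart X y))) has_derivative
      (\<lambda>v. A (\<phi> x) * (B' * D2 v) + (A' * D1 v) * B (w x))) (at ?y within flat_cell X ?s)"
    using has_derivative_mult[OF A1 B1] by simp
  moreover have "\<forall>v\<in>directions X ?s. ginner X x ((B (w x) * A') *\<^sub>R \<xi> + (A (\<phi> x) * B') *\<^sub>R \<eta>) v =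
      A (\<phi> x) * (B' * D2 v) + (A' * D1 v) * B (w x)"
    using D1(2) D2(2) by (simp add: g_simps)
  moreover have "(B (w x) * A') *\<^sub>R \<xi> + (A (\<phi> x) * B') *\<^sub>R \<eta> \<in> directions X ?s"
    using \<xi> \<eta> by (intro subspace_add subspace_mul subspace_directions) (auto dest: has_rgrad_in_directions)
  ultimately show ?thesis using \<xi> unfolding has_rgrad_def Let_def by blast
qed

text \<open>Serves the points outside U, where nothing is known about w: there the test function
  vanishes on a whole neighbourhood.\<close>

lemma has_rgrad_zero:
  assumes i: "inner_at x" and s: "simplex_at X x \<in> max_simplices X"
    and O: "open O'" "x \<in> O'" and z: "\<And>z. z \<in> O' \<Longrightarrow> u z = 0"
  shows "has_rgrad X u x 0"
proof -
  let ?s = "simplex_at X x" and ?y = "flat X x"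
  interpret inner_form "directions X ?s" "frame X ?s" "ginner X x" Lam by (rule i)
  have c: "continuous_on (flat_cell X ?s) (chart X)"
    by (intro continuous_on_subset[OF continuous_chart] flat_cell_subset simplex_at_in)
  obtain e where e: "e > 0" "ball x e \<subseteq> O'" using openE[OF O] by blast
  have yc: "?y \<in> flat_cell X ?s" using flat_in_open open_flat_cell_subset by blast
  then obtain d where d: "d > 0" "\<And>z. z \<in> flat_cell X ?s \<Longrightarrow> dist z ?y < d \<Longrightarrow> dist (chart X z) (chart X ?y) < e"
    using c e(1) unfolding continuous_on_iff by metis
  have "((\<lambda>y. u (chart X y)) has_derivative (\<lambda>v. 0)) (at ?y within flat_cell X ?s)"
  proof (rule has_derivative_transform_within[OF has_derivative_const d(1) yc])
    fix z assume "z \<in> flat_cell X ?s" "dist z ?y < d"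
    from d(2)[OF this] have "chart X z \<in> O'" using e(2) by (auto simp: dist_commute)
    then show "0 = u (chart X z)" using assms(5) by simp
  qed
  then show ?thesis using s unfolding has_rgrad_def Let_def
    by (auto simp: g_simps intro!: subspace_0 subspace_directions)
qed

lemma zero_outside_support: "x \<notin> closure {x. \<phi> x \<noteq> 0} \<Longrightarrow> \<phi> x = (0::real)"
  using closure_subset[of "{x. \<phi> x \<noteq> 0}"] by auto

text \<open>The function w is Lipschitz on U only. If one of the two points lies outside U, the
  first factor vanishes there and its Lipschitz bound alone suffices. The constants 4 and 1 are the
  bounds of \<open>damp\<close> and \<open>cutoff\<close>.\<close>

lemma test_function_lip_c:
  assumes \<phi>: "\<phi> \<in> lip_c X UNIV" and supp: "closure {x. \<phi> x \<noteq> 0} \<subseteq> U" and w: "g_lipschitz_on X U w"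
  shows "(\<lambda>x. cutoff (\<phi> x) * damp (w x)) \<in> lip_c X UNIV"
proof -
  obtain L1 where L1: "L1 \<ge> 0" "\<And>x y. ennreal \<bar>\<phi> x - \<phi> y\<bar> \<le> ennreal L1 * gdist X x y"
    using \<phi> unfolding lip_c_def g_lipschitz_on_def by blast
  obtain L2 where L2: "L2 \<ge> 0" "\<And>x y. x \<in> U \<Longrightarrow> y \<in> U \<Longrightarrow> ennreal \<bar>w x - w y\<bar> \<le> ennreal L2 * gdist X x y"
    using w unfolding g_lipschitz_on_def by blast
  have out: "\<phi> x = 0" if "x \<notin> U" for x
    using that supp by (intro zero_outside_support) auto
  let ?r = "\<lambda>x. cutoff (\<phi> x) * damp (w x)"
  have cut: "ennreal (4 * \<bar>cutoff (\<phi> x) - cutoff (\<phi> y)\<bar>) \<le> ennreal (4 * L1) * gdist X x y" for x y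
  proof -
    have "ennreal (4 * \<bar>cutoff (\<phi> x) - cutoff (\<phi> y)\<bar>) \<le> ennreal (4 * \<bar>\<phi> x - \<phi> y\<bar>)"
      by (intro ennreal_leI mult_left_mono cutoff_lipschitz) auto
    also have "\<dots> = 4 * ennreal \<bar>\<phi> x - \<phi> y\<bar>" by (simp add: ennreal_mult)
    also have "\<dots> \<le> 4 * (ennreal L1 * gdist X x y)" by (intro mult_left_mono L1) auto
    finally show ?thesis using L1(1) by (simp add: ennreal_mult mult.assoc)
  qed
  have bound: "ennreal \<bar>?r x - ?r y\<bar> \<le> ennreal (4 * L1 + L2) * gdist X x y" for x y
  proof -
    have split: "\<bar>?r x - ?r y\<bar> \<le> 4 * \<bar>cutoff (\<phi> x) - cutoff (\<phi> y)\<bar> + cutoff (\<phi> y) * \<bar>damp (w x) - damp (w y)\<bar>" for x y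
    proof -
      have "?r x - ?r y = damp (w x) * (cutoff (\<phi> x) - cutoff (\<phi> y)) + cutoff (\<phi> y) * (damp (w x) - damp (w y))"
        by (simp add: algebra_simps)
      also have "\<bar>\<dots>\<bar> \<le> \<bar>damp (w x)\<bar> * \<bar>cutoff (\<phi> x) - cutoff (\<phi> y)\<bar> + cutoff (\<phi> y) * \<bar>damp (w x) - damp (w y)\<bar>"
        using abs_triangle_ineq cutoff_bounds(1)[of "\<phi> y"] by (metis abs_mult abs_of_nonneg)
      also have "\<bar>damp (w x)\<bar> * \<bar>cutoff (\<phi> x) - cutoff (\<phi> y)\<bar> \<le> 4 * \<bar>cutoff (\<phi> x) - cutoff (\<phi> y)\<bar>"
        using damp_bounds[of "w x"] by (intro mult_right_mono) auto
      finally show ?thesis by simp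
    qed
    have le: "ennreal (4 * L1) * gdist X x y \<le> ennreal (4 * L1 + L2) * gdist X x y"
      using L2(1) by (intro mult_right_mono ennreal_leI) auto
    consider "x \<in> U" "y \<in> U" | "x \<notin> U" | "y \<notin> U" by blast
    then show ?thesis
    proof cases
      case 1
      have "\<bar>?r x - ?r y\<bar> \<le> 4 * \<bar>cutoff (\<phi> x) - cutoff (\<phi> y)\<bar> + \<bar>w x - w y\<bar>"
        using split[of x y] mult_mono[OF cutoff_bounds(2)[of "\<phi> y"] damp_lipschitz[of "w x" "w y"]] by simp
      then have "ennreal \<bar>?r x - ?r y\<bar> \<le> ennreal (4 * \<bar>cutoff (\<phi> x) - cutoff (\<phi> y)\<bar>) + ennreal \<bar>w x - w y\<bar>"
        by (simp add: ennreal_plus[symmetric] ennreal_leI del: ennreal_plus)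
      also have "\<dots> \<le> ennreal (4 * L1) * gdist X x y + ennreal L2 * gdist X x y"
        by (intro add_mono cut L2 1)
      also have "\<dots> = ennreal (4 * L1 + L2) * gdist X x y"
        using L1(1) L2(1) by (simp add: ennreal_plus distrib_right)
      finally show ?thesis .
    next
      case 2
      then have "?r x = 0" by (simp add: out)
      have "\<bar>?r x - ?r y\<bar> = damp (w y) * \<bar>cutoff (\<phi> x) - cutoff (\<phi> y)\<bar>"
        using 2 cutoff_bounds(1)[of "\<phi> y"] damp_bounds(1)[of "w y"] by (simp add: out abs_mult)
      also have "\<dots> \<le> 4 * \<bar>cutoff (\<phi> x) - cutoff (\<phi> y)\<bar>" using damp_bounds by (intro mult_right_mono) auto
      finally show ?thesis using cut[of x y] le by (meson ennreal_leI order_trans)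
    next
      case 3
      have "\<bar>?r x - ?r y\<bar> = damp (w x) * \<bar>cutoff (\<phi> x) - cutoff (\<phi> y)\<bar>"
        using 3 cutoff_bounds(1)[of "\<phi> x"] damp_bounds(1)[of "w x"] by (simp add: out abs_mult)
      also have "\<dots> \<le> 4 * \<bar>cutoff (\<phi> x) - cutoff (\<phi> y)\<bar>" using damp_bounds by (intro mult_right_mono) auto
      finally show ?thesis using cut[of x y] le by (meson ennreal_leI order_trans)
    qed
  qed
  have sub: "closure {x. ?r x \<noteq> 0} \<subseteq> closure {x. \<phi> x \<noteq> 0}" by (intro closure_mono) auto
  have "g_lipschitz_on X UNIV ?r" unfolding g_lipschitz_on_def
    using bound L1(1) L2(1) by (intro exI[of _ "4 * L1 + L2"]) auto
  moreover have "compact (closure {x. ?r x \<noteq> 0})"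
  proof (rule compact_closure_subset)
    show "{x. ?r x \<noteq> 0} \<subseteq> closure {x. \<phi> x \<noteq> 0}" by (rule subset_trans[OF closure_subset sub])
    show "compact (closure {x. \<phi> x \<noteq> 0})" using \<phi> by (simp add: lip_c_def)
  qed
  ultimately show ?thesis by (simp add: lip_c_def)
qed

text \<open>Test subharmonicity with \<open>cutoff(\<phi>) damp(w)\<close>, where \<open>w\<close> approximates the
  subharmonic function; \<open>damp\<close> is bounded and increasing, so that the energy reappears with a good sign.\<close>

lemma energy_estimate:
  assumes sub: "weakly_subharmonic X f V" and U: "open U"
    and \<phi>: "\<phi> \<in> lip_c X UNIV" and supp: "closure {x. \<phi> x \<noteq> 0} \<subseteq> U" and w: "g_lipschitz_on X U w"
    and V: "V \<in> borel_measurable (vol X)" "AE x in vol X. V x \<in> directions X (simplex_at X x)"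
    and iV: "integrable (vol X) (\<lambda>x. (gnorm X x (V x))\<^sup>2)"
    and i\<phi>: "integrable (vol X) (\<lambda>x. (gnorm X x (rgrad X \<phi> x))\<^sup>2)"
    and iw: "integrable (vol X) (\<lambda>x. indicator U x * (gnorm X x (rgrad X w x - V x))\<^sup>2)"
    and \<delta>: "\<delta> > 0"
  shows "integrable (vol X) (\<lambda>x. indicator U x * (cutoff (\<phi> x) * damp' (w x) * (gnorm X x (V x))\<^sup>2))"
    and "(\<integral>x. indicator U x * (cutoff (\<phi> x) * damp' (w x) * (gnorm X x (V x))\<^sup>2) \<partial>vol X) \<le>
      2 * \<delta> * (\<integral>x. (gnorm X x (V x))\<^sup>2 \<partial>vol X) + 4 / \<delta> * ((\<integral>x. (gnorm X x (rgrad X \<phi> x))\<^sup>2 \<partial>vol X) +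
        (\<integral>x. indicator U x * (gnorm X x (rgrad X w x - V x))\<^sup>2 \<partial>vol X))"
proof -
  let ?r = "\<lambda>x. cutoff (\<phi> x) * damp (w x)"
  let ?K = "\<lambda>x. indicator U x * (cutoff (\<phi> x) * damp' (w x) * (gnorm X x (V x))\<^sup>2)"
  let ?I = "\<lambda>x. ginner X x (V x) (rgrad X ?r x)"
  \<comment> \<open>Majorant of the two cross terms. Young's inequality charges each of them with
    \<delta> times the energy of V, and the rest to the energy of \<phi> and to the approximation
    error of the gradient.\<close>
  let ?R = "\<lambda>x. 2 * \<delta> * (gnorm X x (V x))\<^sup>2 + 4 / \<delta> * ((gnorm X x (rgrad X \<phi> x))\<^sup>2 +
      indicator U x * (gnorm X x (rgrad X w x - V x))\<^sup>2)"
  have r: "?r \<in> lip_c X UNIV" by (rule test_function_lip_c[OF \<phi> supp w])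
  have g\<phi>: "g_lipschitz_on X UNIV \<phi>" and gr: "g_lipschitz_on X UNIV ?r" using \<phi> r by (auto simp: lip_c_def)
  have r_grad: "AE x in vol X. has_rgrad X ?r x (rgrad X ?r x)" using AE_has_rgrad[OF open_UNIV gr] by simp
  have \<phi>_grad: "AE x in vol X. has_rgrad X \<phi> x (rgrad X \<phi> x)" using AE_has_rgrad[OF open_UNIV g\<phi>] by simp
  have iR: "integrable (vol X) ?R" using iV i\<phi> iw by (intro Bochner_Integration.integrable_add integrable_mult_right) auto
  have mI: "?I \<in> borel_measurable (vol X)"
  proof (rule ginner_measurable[OF V])
    show "rgrad X ?r \<in> borel_measurable (vol X)" using rgrad_measurable[OF open_UNIV gr] by simp
    show "AE x in vol X. rgrad X ?r x \<in> directions X (simplex_at X x)"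
      using r_grad by eventually_elim (rule has_rgrad_in_directions)
  qed
  have mK: "?K \<in> borel_measurable (vol X)"
  proof -
    have [measurable]: "\<phi> \<in> borel_measurable (vol X)" using g_lipschitz_measurable[OF open_UNIV g\<phi>] by simp
    have [measurable]: "(\<lambda>x. if x \<in> U then w x else 0) \<in> borel_measurable (vol X)" by (rule g_lipschitz_measurable[OF U w])
    have [measurable]: "(\<lambda>x. gnorm X x (V x)) \<in> borel_measurable (vol X)" by (rule gnorm_measurable[OF V])
    have [measurable]: "U \<in> sets (vol X)" using U by (simp add: vol_eq)
    have "(\<lambda>x. indicator U x * (cutoff (\<phi> x) * damp' (if x \<in> U then w x else 0) * (gnorm X x (V x))\<^sup>2)) \<in> borel_measurable (vol X)"
      unfolding cutoff_def damp'_def by measurable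
    then show ?thesis by (rule measurable_cong[THEN iffD1, rotated]) (auto split: split_indicator)
  qed
  \<comment> \<open>The first estimate expands the inner product of V with the gradient of the test
    function. The second yields integrability of \<open>?I\<close>; without it the integral could be
    0 by convention, and subharmonicity would carry no information.\<close>
  have pw: "AE x in vol X. ?K x \<le> ?I x + ?R x \<and> \<bar>?I x\<bar> \<le> ?R x + (gnorm X x (V x))\<^sup>2"
    using AE_inner V(2) r_grad \<phi>_grad AE_has_rgrad[OF U w]
  proof eventually_elim
    case (elim x)
    let ?W = "directions X (simplex_at X x)"
    interpret inner_form ?W "frame X (simplex_at X x)" "ginner X x" Lam using elim(1) by blast
    note i = elim(1)[THEN conjunct2] and s = elim(1)[THEN conjunct1]
    let ?v = "V x" and ?p = "rgrad X \<phi> x" and ?q = "rgrad X w x"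
    have p: "?p \<in> ?W" using elim(4) by (rule has_rgrad_in_directions)
    let ?nv = "gnorm X x ?v" and ?np = "gnorm X x ?p" and ?ne = "gnorm X x (?q - ?v)"
    have young: "a * b \<le> \<delta> * a\<^sup>2 + 1 / (4 * \<delta>) * b\<^sup>2" for a b :: real
    proof -
      have "0 \<le> (2 * \<delta> * a - b)\<^sup>2 / (4 * \<delta>)" using \<delta> by simp
      also have "\<dots> = \<delta> * a\<^sup>2 + 1 / (4 * \<delta>) * b\<^sup>2 - a * b" using \<delta> by (simp add: power2_eq_square field_simps)
      finally show ?thesis by simp
    qed
    have cs: "\<bar>ginner X x ?v y\<bar> \<le> ?nv * gnorm X x y" if "y \<in> ?W" for y
      using Cauchy_Schwarz_g[OF elim(2) that] by (simp add: gnorm_def)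
    have nonneg: "0 \<le> ?nv\<^sup>2" "0 \<le> ?np\<^sup>2" "0 \<le> ?ne\<^sup>2" by simp_all
    have Rle: "2 * \<delta> * ?nv\<^sup>2 + 4 / \<delta> * ?np\<^sup>2 \<le> ?R x"
      using \<delta> by (auto simp: distrib_left split: split_indicator)
    show ?case
    proof (cases "x \<in> U")
      case False
      have "has_rgrad X ?r x 0"
      proof (rule has_rgrad_zero[OF i s, of "- closure {x. \<phi> x \<noteq> 0}"])
        fix z assume "z \<in> - closure {x. \<phi> x \<noteq> 0}"
        then have "\<phi> z = 0" by (intro zero_outside_support) simp
        then show "?r z = 0" by simp
      qed (use False supp in auto)
      then have "rgrad X ?r x = 0" by (rule rgrad_eq[OF s i])
      then have "?I x = 0" by (simp add: g_simps)
      moreover have "0 \<le> ?R x" using \<delta> by auto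
      ultimately show ?thesis using False nonneg by simp
    next
      case True
      then have q: "has_rgrad X w x ?q" using elim(5) by blast
      then have qW: "?q \<in> ?W" by (rule has_rgrad_in_directions)
      then have eW: "?q - ?v \<in> ?W" using elim(2) by (intro subspace_diff subspace_directions)
      have "has_rgrad X ?r x ((damp (w x) * cutoff' (\<phi> x)) *\<^sub>R ?p + (cutoff (\<phi> x) * damp' (w x)) *\<^sub>R ?q)"
        by (rule has_rgrad_product[OF i elim(4) q cutoff_deriv damp_deriv])
      then have "rgrad X ?r x = (damp (w x) * cutoff' (\<phi> x)) *\<^sub>R ?p + (cutoff (\<phi> x) * damp' (w x)) *\<^sub>R ?q"
        by (rule rgrad_eq[OF s i])
      then have "?I x = damp (w x) * cutoff' (\<phi> x) * ginner X x ?v ?p + cutoff (\<phi> x) * damp' (w x) * ginner X x ?v ?q"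
        by (simp add: g_simps)
      moreover have "ginner X x ?v ?q = ?nv\<^sup>2 + ginner X x ?v (?q - ?v)"
        using gnorm_square[OF i elim(2)] by (simp add: g_simps)
      ultimately have Ix: "?I x = damp (w x) * cutoff' (\<phi> x) * ginner X x ?v ?p +
          cutoff (\<phi> x) * damp' (w x) * ?nv\<^sup>2 + cutoff (\<phi> x) * damp' (w x) * ginner X x ?v (?q - ?v)"
        by (simp add: algebra_simps)
      have n0: "0 \<le> ?nv" "0 \<le> ?np" "0 \<le> ?ne" using gnorm_nonneg[OF i] elim(2) p eW by auto
      have c1: "\<bar>damp (w x) * cutoff' (\<phi> x) * ginner X x ?v ?p\<bar> \<le> \<delta> * ?nv\<^sup>2 + 4 / \<delta> * ?np\<^sup>2"
      proof -
        have "\<bar>damp (w x) * cutoff' (\<phi> x) * ginner X x ?v ?p\<bar> = \<bar>damp (w x)\<bar> * \<bar>cutoff' (\<phi> x)\<bar> * \<bar>ginner X x ?v ?p\<bar>"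
          by (simp add: abs_mult)
        also have "\<dots> \<le> 4 * 1 * (?nv * ?np)"
          using damp_bounds[of "w x"] cutoff'_bound[of "\<phi> x"] cs[OF p] by (intro mult_mono) auto
        also have "\<dots> = ?nv * (4 * ?np)" by simp
        also have "\<dots> \<le> \<delta> * ?nv\<^sup>2 + 1 / (4 * \<delta>) * (4 * ?np)\<^sup>2" by (rule young)
        also have "1 / (4 * \<delta>) * (4 * ?np)\<^sup>2 = 4 / \<delta> * ?np\<^sup>2" using \<delta> by (simp add: power2_eq_square field_simps)
        finally show ?thesis .
      qed
      have cd: "0 \<le> cutoff (\<phi> x) * damp' (w x)" "cutoff (\<phi> x) * damp' (w x) \<le> 1"
        using cutoff_bounds[of "\<phi> x"] damp'_bounds[of "w x"] by (auto intro: mult_le_one)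
      have c2: "\<bar>cutoff (\<phi> x) * damp' (w x) * ginner X x ?v (?q - ?v)\<bar> \<le> \<delta> * ?nv\<^sup>2 + 4 / \<delta> * ?ne\<^sup>2"
      proof -
        have "\<bar>cutoff (\<phi> x) * damp' (w x) * ginner X x ?v (?q - ?v)\<bar> = (cutoff (\<phi> x) * damp' (w x)) * \<bar>ginner X x ?v (?q - ?v)\<bar>"
          by (simp only: abs_mult[of "cutoff (\<phi> x) * damp' (w x)"] abs_of_nonneg[OF cd(1)])
        also have "\<dots> \<le> 1 * (?nv * ?ne)" using cd cs[OF eW] by (intro mult_mono) auto
        also have "\<dots> \<le> \<delta> * ?nv\<^sup>2 + 1 / (4 * \<delta>) * ?ne\<^sup>2" using young by simp
        \<comment> \<open>Deliberately coarse, to share the coefficient 4 / \<delta> with the other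
          cross term, where the bound 4 of \<open>damp\<close> produces it.\<close>
        also have "1 / (4 * \<delta>) * ?ne\<^sup>2 \<le> 4 / \<delta> * ?ne\<^sup>2" using \<delta> by (intro mult_right_mono) (auto simp: field_simps)
        finally show ?thesis by simp
      qed
      have Rx: "?R x = (\<delta> * ?nv\<^sup>2 + 4 / \<delta> * ?np\<^sup>2) + (\<delta> * ?nv\<^sup>2 + 4 / \<delta> * ?ne\<^sup>2)" using True by (simp add: algebra_simps)
      have Kx: "?K x = cutoff (\<phi> x) * damp' (w x) * ?nv\<^sup>2" using True by simp
      have Kb: "0 \<le> cutoff (\<phi> x) * damp' (w x) * ?nv\<^sup>2" "cutoff (\<phi> x) * damp' (w x) * ?nv\<^sup>2 \<le> ?nv\<^sup>2"
        using cd nonneg(1) by (auto intro: mult_left_le_one_le)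
      show ?thesis unfolding Rx Kx Ix using c1 c2 Kb by (auto simp: abs_le_iff)
    qed
  qed
  have iI: "integrable (vol X) ?I"
  proof (rule Bochner_Integration.integrable_bound[OF Bochner_Integration.integrable_add[OF iR iV] mI])
    show "AE x in vol X. norm (?I x) \<le> norm (?R x + (gnorm X x (V x))\<^sup>2)"
      using pw by eventually_elim auto
  qed
  show iK: "integrable (vol X) ?K"
  proof (rule Bochner_Integration.integrable_bound[OF iV mK], rule AE_I2)
    fix x
    have "0 \<le> cutoff (\<phi> x) * damp' (w x)" "cutoff (\<phi> x) * damp' (w x) \<le> 1"
      using cutoff_bounds[of "\<phi> x"] damp'_bounds[of "w x"] by (auto intro: mult_le_one)
    then show "norm (?K x) \<le> norm ((gnorm X x (V x))\<^sup>2)"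
      by (auto simp: abs_mult split: split_indicator intro!: mult_left_le_one_le)
  qed
  have rnn: "\<forall>x. 0 \<le> ?r x" using cutoff_bounds(1) damp_bounds(1) by simp
  have I0: "(\<integral>x. ?I x \<partial>vol X) \<le> 0" 
    using mp[OF bspec[OF conjunct2[OF sub[unfolded weakly_subharmonic_def]] r] rnn] .
  have "(\<integral>x. ?K x \<partial>vol X) \<le> (\<integral>x. ?I x + ?R x \<partial>vol X)"
    using pw by (intro integral_mono_AE iK Bochner_Integration.integrable_add iI iR) auto
  also have "\<dots> = (\<integral>x. ?I x \<partial>vol X) + (\<integral>x. ?R x \<partial>vol X)" using iI iR by (rule Bochner_Integration.integral_add)
  also have "\<dots> \<le> (\<integral>x. ?R x \<partial>vol X)" using I0 by simp
  also have "\<dots> = 2 * \<delta> * (\<integral>x. (gnorm X x (V x))\<^sup>2 \<partial>vol X) + 4 / \<delta> * ((\<integral>x. (gnorm X x (rgrad X \<phi> x))\<^sup>2 \<partial>vol X) +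
        (\<integral>x. indicator U x * (gnorm X x (rgrad X w x - V x))\<^sup>2 \<partial>vol X))"
    using iV i\<phi> iw by simp
  finally show "(\<integral>x. ?K x \<partial>vol X) \<le> 2 * \<delta> * (\<integral>x. (gnorm X x (V x))\<^sup>2 \<partial>vol X) + 4 / \<delta> * ((\<integral>x. (gnorm X x (rgrad X \<phi> x))\<^sup>2 \<partial>vol X) +
        (\<integral>x. indicator U x * (gnorm X x (rgrad X w x - V x))\<^sup>2 \<partial>vol X))" .
qed

end

section \<open>From vanishing capacity to vanishing gradient\<close>

lemma nn_integral_double_add:
  assumes "F \<in> borel_measurable M" "G \<in> borel_measurable M"
  shows "(\<integral>\<^sup>+ x. 2 * F x + 2 * G x \<partial>M) = 2 * (\<integral>\<^sup>+ x. F x \<partial>M) + 2 * (\<integral>\<^sup>+ x. G x \<partial>M)"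
  using assms by (simp add: nn_integral_add nn_integral_cmult)

context riem_poly
begin

lemma rgrad_measurable_on:
  assumes U: "open U" and w: "g_lipschitz_on X U w" and V: "V \<in> borel_measurable (vol X)"
    "AE x in vol X. V x \<in> directions X (simplex_at X x)"
  shows "(\<lambda>x. indicator U x * (gnorm X x (rgrad X w x - V x))\<^sup>2 :: real) \<in> borel_measurable (vol X)"
proof -
  let ?Y = "\<lambda>x. (if x \<in> U then rgrad X w x else 0) - V x"
  have [measurable]: "U \<in> sets (vol X)" using U by (simp add: vol_eq)
  have "?Y \<in> borel_measurable (vol X)"
    using rgrad_measurable[OF U w] V(1) by (rule borel_measurable_diff)
  moreover have "AE x in vol X. ?Y x \<in> directions X (simplex_at X x)"
    using AE_has_rgrad[OF U w] V(2)
  proof eventually_elim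
    case (elim x)
    then show ?case
      by (intro subspace_diff subspace_directions) (auto intro: has_rgrad_in_directions subspace_0[OF subspace_directions])
  qed
  ultimately have [measurable]: "(\<lambda>x. gnorm X x (?Y x)) \<in> borel_measurable (vol X)" by (rule gnorm_measurable)
  have "(\<lambda>x. indicator U x * (gnorm X x (?Y x))\<^sup>2 :: real) \<in> borel_measurable (vol X)" by measurable
  then show ?thesis by (rule measurable_cong[THEN iffD1, rotated]) (auto split: split_indicator)
qed

lemma sobolev_limit_approx:
  assumes "sobolev_limit X U F u V" "e > 0"
  shows "\<exists>w\<in>F. (\<integral>\<^sup>+ x. indicator U x * ennreal ((w x - u x)\<^sup>2 + (gnorm X x (rgrad X w x - V x))\<^sup>2) \<partial>vol X) < ennreal e"
proof -
  obtain w where w: "\<And>k::nat. w k \<in> F"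
    "(\<lambda>k. \<integral>\<^sup>+ x. indicator U x * ennreal ((w k x - u x)\<^sup>2 + (gnorm X x (rgrad X (w k) x - V x))\<^sup>2) \<partial>vol X) \<longlonglongrightarrow> 0"
    using assms(1) unfolding sobolev_limit_def by blast
  have "0 < ennreal e" using assms(2) by simp
  from order_tendstoD(2)[OF w(2) this] obtain k where
    "(\<integral>\<^sup>+ x. indicator U x * ennreal ((w k x - u x)\<^sup>2 + (gnorm X x (rgrad X (w k) x - V x))\<^sup>2) \<partial>vol X) < ennreal e"
    by (auto simp: eventually_sequentially)
  then show ?thesis using w(1) by blast
qed

text \<open>The right side exceeds the left by the square of the norm of
  \<open>(v - w) - w\<close>.\<close>

lemma gnorm_square_triangle:
  assumes i: "inner_at x" and v: "v \<in> directions X (simplex_at X x)" and w: "w \<in> directions X (simplex_at X x)"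
  shows "(gnorm X x v)\<^sup>2 \<le> 2 * (gnorm X x (v - w))\<^sup>2 + 2 * (gnorm X x w)\<^sup>2"
proof -
  interpret inner_form "directions X (simplex_at X x)" "frame X (simplex_at X x)" "ginner X x" Lam by (rule i)
  have d: "v - w \<in> directions X (simplex_at X x)" using v w by (intro subspace_diff subspace_directions)
  then have d2: "(v - w) - w \<in> directions X (simplex_at X x)" by (rule subspace_diff[OF subspace_directions _ w])
  have "0 \<le> ginner X x ((v - w) - w) ((v - w) - w)" by (rule g_nonneg[OF d2])
  then show ?thesis
    unfolding gnorm_square[OF i v] gnorm_square[OF i d] gnorm_square[OF i w]
    by (simp add: g_simps sym[of w v])
qed

text \<open>The competitor for the capacity belongs to a completion and need not be Lipschitz. An
  approximant in \<open>lip_c\<close> takes its place; being 1 on D survives only in mean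
  square.\<close>

lemma capacity_test_function:
  assumes par: "two_parabolic X UNIV" and D: "compact D" and e: "e > 0"
  shows "\<exists>\<phi>\<in>lip_c X UNIV. (\<integral>\<^sup>+ x. indicator D x * ennreal ((\<phi> x - 1)\<^sup>2) \<partial>vol X) \<le> ennreal e \<and>
    (\<integral>\<^sup>+ x. ennreal ((gnorm X x (rgrad X \<phi> x))\<^sup>2) \<partial>vol X) \<le> ennreal e"
proof -
  have "cap X D UNIV = 0" using par D by (simp add: two_parabolic_def)
  \<comment> \<open>One quarter of e bounds the energy of the competitor, another the approximation
    error; the triangle inequality for squares doubles both.\<close>
  moreover have "0 < ennreal (e / 4)" using e by simp
  ultimately have "cap X D UNIV < ennreal (e / 4)" by simp
  then obtain u V N where u: "W12_0_grad X UNIV u V" "(\<integral>\<^sup>+ x. indicator UNIV x * ennreal ((gnorm X x (V x))\<^sup>2) \<partial>vol X) < ennreal (e / 4)"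
    and N: "open N" "D \<subseteq> N" "AE x in vol X. x \<in> N \<longrightarrow> u x = 1"
    unfolding cap_def INF_less_iff by auto
  have sob: "sobolev_limit X UNIV (lip_c X UNIV) u V" using u(1) by (simp add: W12_0_grad_def)
  then have m: "u \<in> borel_measurable (vol X)" "V \<in> borel_measurable (vol X)"
    and V: "AE x in vol X. V x \<in> directions X (simplex_at X x)"
    using measurable_cong_sets[of "restrict_space (vol X) UNIV" "vol X" borel borel]
    by (auto simp: sobolev_limit_def sets_restrict_space)
  have "e / 4 > 0" using e by simp
  from sobolev_limit_approx[OF sob this] obtain \<phi> where \<phi>: "\<phi> \<in> lip_c X UNIV"
    "(\<integral>\<^sup>+ x. indicator UNIV x * ennreal ((\<phi> x - u x)\<^sup>2 + (gnorm X x (rgrad X \<phi> x - V x))\<^sup>2) \<partial>vol X) < ennreal (e / 4)" by blast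
  let ?d = "\<lambda>x. (\<phi> x - u x)\<^sup>2 + (gnorm X x (rgrad X \<phi> x - V x))\<^sup>2"
  have g: "g_lipschitz_on X UNIV \<phi>" using \<phi>(1) by (simp add: lip_c_def)
  have [measurable]: "\<phi> \<in> borel_measurable (vol X)" using g_lipschitz_measurable[OF open_UNIV g] by simp
  have [measurable]: "(\<lambda>x. (gnorm X x (rgrad X \<phi> x - V x))\<^sup>2) \<in> borel_measurable (vol X)"
    using rgrad_measurable_on[OF open_UNIV g m(2) V] by simp
  note [measurable] = m(1) gnorm_measurable[OF m(2) V]
  have d: "(\<integral>\<^sup>+ x. ennreal (?d x) \<partial>vol X) \<le> ennreal (e / 4)" and v: "(\<integral>\<^sup>+ x. ennreal ((gnorm X x (V x))\<^sup>2) \<partial>vol X) \<le> ennreal (e / 4)"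
    using \<phi>(2) u(2) by simp_all
  have "(\<integral>\<^sup>+ x. indicator D x * ennreal ((\<phi> x - 1)\<^sup>2) \<partial>vol X) \<le> (\<integral>\<^sup>+ x. ennreal (?d x) \<partial>vol X)"
  proof (rule nn_integral_mono_AE)
    show "AE x in vol X. indicator D x * ennreal ((\<phi> x - 1)\<^sup>2) \<le> ennreal (?d x)"
      using N(3) by eventually_elim (use N(2) in \<open>auto split: split_indicator intro!: ennreal_leI\<close>)
  qed
  also have "\<dots> \<le> ennreal e" using d by (rule order_trans) (use e in \<open>auto intro: ennreal_leI\<close>)
  finally have 1: "(\<integral>\<^sup>+ x. indicator D x * ennreal ((\<phi> x - 1)\<^sup>2) \<partial>vol X) \<le> ennreal e" .
  have "(\<integral>\<^sup>+ x. ennreal ((gnorm X x (rgrad X \<phi> x))\<^sup>2) \<partial>vol X) \<le>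
      (\<integral>\<^sup>+ x. 2 * ennreal (?d x) + 2 * ennreal ((gnorm X x (V x))\<^sup>2) \<partial>vol X)"
  proof (rule nn_integral_mono_AE)
    show "AE x in vol X. ennreal ((gnorm X x (rgrad X \<phi> x))\<^sup>2) \<le> 2 * ennreal (?d x) + 2 * ennreal ((gnorm X x (V x))\<^sup>2)"
      using AE_inner V AE_has_rgrad[OF open_UNIV g]
    proof eventually_elim
      case (elim x)
      then have "(gnorm X x (rgrad X \<phi> x))\<^sup>2 \<le> 2 * (gnorm X x (rgrad X \<phi> x - V x))\<^sup>2 + 2 * (gnorm X x (V x))\<^sup>2"
        by (intro gnorm_square_triangle) (auto dest: has_rgrad_in_directions)
      also have "\<dots> \<le> 2 * ?d x + 2 * (gnorm X x (V x))\<^sup>2" by simp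
      finally have "ennreal ((gnorm X x (rgrad X \<phi> x))\<^sup>2) \<le> ennreal (2 * ?d x + 2 * (gnorm X x (V x))\<^sup>2)" by (rule ennreal_leI)
      also have "\<dots> = 2 * ennreal (?d x) + 2 * ennreal ((gnorm X x (V x))\<^sup>2)"
        by (subst ennreal_plus) (simp_all add: ennreal_mult)
      finally show ?case .
    qed
  qed
  also have "\<dots> = 2 * (\<integral>\<^sup>+ x. ennreal (?d x) \<partial>vol X) + 2 * (\<integral>\<^sup>+ x. ennreal ((gnorm X x (V x))\<^sup>2) \<partial>vol X)"
    by (rule nn_integral_double_add) measurable
  also have "\<dots> \<le> 2 * ennreal (e / 4) + 2 * ennreal (e / 4)" using d v by (intro add_mono mult_left_mono) auto
  also have "\<dots> = ennreal (2 * (e / 4) + 2 * (e / 4))"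
  proof -
    have "ennreal (2 * (e / 4)) = ennreal 2 * ennreal (e / 4)" using e by (intro ennreal_mult) auto
    moreover have "ennreal (2 * (e / 4) + 2 * (e / 4)) = ennreal (2 * (e / 4)) + ennreal (2 * (e / 4))"
      using e by (intro ennreal_plus) auto
    ultimately show ?thesis by (simp only: ennreal_numeral)
  qed
  also have "2 * (e / 4) + 2 * (e / 4) = e" by simp
  finally show ?thesis using 1 \<phi>(1) by blast
qed

text \<open>Almost everywhere on D the cutoffs tend to 1 and the approximants to f, so the
  integrands of \<open>energy_estimate\<close> tend to \<open>cutoff 1 * damp' (f x)\<close> times
  the squared norm of the gradient. Their integrals are summable, so the limit is 0, while both
  factors in front of the norm are positive.\<close>

lemma gradient_zero_on_cell:
  assumes par: "two_parabolic X UNIV" and grad: "W12_loc_grad X f V" and sub: "weakly_subharmonic X f V"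
    and V: "V \<in> borel_measurable (vol X)" "AE x in vol X. V x \<in> directions X (simplex_at X x)"
    and iV: "integrable (vol X) (\<lambda>x. (gnorm X x (V x))\<^sup>2)"
    and D: "compact D"
  shows "AE x in vol X. x \<in> D \<longrightarrow> gnorm X x (V x) = 0"
proof -
  have Db: "D \<in> sets (vol X)" using D by (simp add: vol_eq borel_compact)
  have fm: "f \<in> borel_measurable (vol X)" using grad by (simp add: W12_loc_grad_def W12_loc_def L2_loc_def)
  \<comment> \<open>With the Young weight 2^-m both \<delta> and e / \<delta> equal 2^-m, so the
    bound from \<open>energy_estimate\<close> is summable.\<close>
  define e where "e m = (1 / 4 :: real) ^ m" for m
  have e: "e m > 0" for m by (simp add: e_def)
  have se: "summable e" unfolding e_def by (rule summable_geometric) simp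
  have "\<forall>m. \<exists>\<phi>. \<phi> \<in> lip_c X UNIV \<and> (\<integral>\<^sup>+ x. indicator D x * ennreal ((\<phi> x - 1)\<^sup>2) \<partial>vol X) \<le> ennreal (e m) \<and>
    (\<integral>\<^sup>+ x. ennreal ((gnorm X x (rgrad X \<phi> x))\<^sup>2) \<partial>vol X) \<le> ennreal (e m)"
    by (intro allI) (rule capacity_test_function[OF par D e, unfolded Bex_def])
  from choice[OF this] obtain \<phi> where "\<forall>m. \<phi> m \<in> lip_c X UNIV \<and>
    (\<integral>\<^sup>+ x. indicator D x * ennreal ((\<phi> m x - 1)\<^sup>2) \<partial>vol X) \<le> ennreal (e m) \<and>
    (\<integral>\<^sup>+ x. ennreal ((gnorm X x (rgrad X (\<phi> m) x))\<^sup>2) \<partial>vol X) \<le> ennreal (e m)" by (rule exE)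
  then have \<phi>: "\<And>m. \<phi> m \<in> lip_c X UNIV"
    "\<And>m. (\<integral>\<^sup>+ x. indicator D x * ennreal ((\<phi> m x - 1)\<^sup>2) \<partial>vol X) \<le> ennreal (e m)"
    "\<And>m. (\<integral>\<^sup>+ x. ennreal ((gnorm X x (rgrad X (\<phi> m) x))\<^sup>2) \<partial>vol X) \<le> ennreal (e m)"
    by simp_all
  \<comment> \<open>U has to contain the support of \<phi>, so that the test function is Lipschitz,
    and D, where w is to converge to f.\<close>
  have "\<exists>U. rel_compact_domain U \<and> closure {x. \<phi> m x \<noteq> 0} \<union> D \<subseteq> U" for m
  proof -
    have "compact (closure {x. \<phi> m x \<noteq> 0} \<union> D)" using \<phi>(1)[of m] D by (auto simp: lip_c_def intro: compact_Un)
    then show ?thesis by (rule ex_rel_compact_domain) blast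
  qed
  from choice[OF allI[OF this]] obtain U
    where "\<forall>m. rel_compact_domain (U m) \<and> closure {x. \<phi> m x \<noteq> 0} \<union> D \<subseteq> U m" by (rule exE)
  then have U: "\<And>m. rel_compact_domain (U m)" "\<And>m. closure {x. \<phi> m x \<noteq> 0} \<union> D \<subseteq> U m" by blast+
  have Uo: "open (U m)" for m using U(1) by (simp add: rel_compact_domain_def)
  have "sobolev_limit X (U m) (lip_finite X (U m)) f V" for m
    using grad U(1)[of m] by (simp add: W12_loc_grad_def W12_grad_def)
  then have "\<forall>m. \<exists>w. w \<in> lip_finite X (U m) \<and> (\<integral>\<^sup>+ x. indicator (U m) x * ennreal ((w x - f x)\<^sup>2 +
      (gnorm X x (rgrad X w x - V x))\<^sup>2) \<partial>vol X) < ennreal (e m)"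
    by (intro allI) (rule sobolev_limit_approx[OF _ e, unfolded Bex_def])
  from choice[OF this] obtain w where "\<forall>m. w m \<in> lip_finite X (U m) \<and>
    (\<integral>\<^sup>+ x. indicator (U m) x * ennreal ((w m x - f x)\<^sup>2 + (gnorm X x (rgrad X (w m) x - V x))\<^sup>2) \<partial>vol X) < ennreal (e m)"
    by (rule exE)
  then have w: "\<And>m. w m \<in> lip_finite X (U m)"
    "\<And>m. (\<integral>\<^sup>+ x. indicator (U m) x * ennreal ((w m x - f x)\<^sup>2 + (gnorm X x (rgrad X (w m) x - V x))\<^sup>2) \<partial>vol X) < ennreal (e m)"
    by simp_all
  have gw: "g_lipschitz_on X (U m) (w m)" and g\<phi>: "g_lipschitz_on X UNIV (\<phi> m)" for m
    using w(1)[of m] \<phi>(1)[of m] by (auto simp: lip_finite_def lip_c_def)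
  have m\<phi> [measurable]: "\<phi> m \<in> borel_measurable (vol X)" for m using g_lipschitz_measurable[OF open_UNIV g\<phi>] by simp
  have mw [measurable]: "(\<lambda>x. if x \<in> U m then w m x else 0) \<in> borel_measurable (vol X)" for m
    by (rule g_lipschitz_measurable[OF Uo gw])
  note [measurable] = Db fm
  have conv\<phi>: "AE x in vol X. (\<lambda>m. indicator D x * (\<phi> m x - 1)\<^sup>2 :: real) \<longlonglongrightarrow> 0"
  proof (rule AE_tendsto_0_if_summable[OF _ _ _ _ se])
    fix m
    have "(\<integral>\<^sup>+ x. ennreal (indicator D x * (\<phi> m x - 1)\<^sup>2) \<partial>vol X) = (\<integral>\<^sup>+ x. indicator D x * ennreal ((\<phi> m x - 1)\<^sup>2) \<partial>vol X)"
      by (intro nn_integral_cong) (auto split: split_indicator)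
    then show "(\<integral>\<^sup>+ x. ennreal (indicator D x * (\<phi> m x - 1)\<^sup>2) \<partial>vol X) \<le> ennreal (e m)" using \<phi>(2) by simp
  qed (auto simp: less_imp_le[OF e])
  have convw: "AE x in vol X. (\<lambda>m. indicator D x * ((if x \<in> U m then w m x else 0) - f x)\<^sup>2 :: real) \<longlonglongrightarrow> 0"
  proof (rule AE_tendsto_0_if_summable[OF _ _ _ _ se])
    fix m
    have "(\<integral>\<^sup>+ x. ennreal (indicator D x * ((if x \<in> U m then w m x else 0) - f x)\<^sup>2) \<partial>vol X) \<le>
        (\<integral>\<^sup>+ x. indicator (U m) x * ennreal ((w m x - f x)\<^sup>2 + (gnorm X x (rgrad X (w m) x - V x))\<^sup>2) \<partial>vol X)"
      using U(2)[of m] by (intro nn_integral_mono) (auto split: split_indicator intro!: ennreal_leI)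
    then show "(\<integral>\<^sup>+ x. ennreal (indicator D x * ((if x \<in> U m then w m x else 0) - f x)\<^sup>2) \<partial>vol X) \<le> ennreal (e m)"
      using w(2)[of m] by simp
  qed (auto simp: less_imp_le[OF e])
  let ?K = "\<lambda>m x. indicator (U m) x * (cutoff (\<phi> m x) * damp' (w m x) * (gnorm X x (V x))\<^sup>2)"
  define E where "E = (\<integral>x. (gnorm X x (V x))\<^sup>2 \<partial>vol X)"
  have E0: "0 \<le> E" unfolding E_def by simp
  have K: "integrable (vol X) (?K m) \<and> (\<integral>x. ?K m x \<partial>vol X) \<le> (2 * E + 8) * (1 / 2) ^ m" for m
  proof -
    have V\<phi>: "(\<lambda>x. (gnorm X x (rgrad X (\<phi> m) x))\<^sup>2) \<in> borel_measurable (vol X)"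
      using rgrad_measurable_on[OF open_UNIV g\<phi>[of m], of "\<lambda>x. 0"] subspace_0[OF subspace_directions] by simp
    have i\<phi>: "integrable (vol X) (\<lambda>x. (gnorm X x (rgrad X (\<phi> m) x))\<^sup>2)"
      using \<phi>(3)[of m] by (intro integrableI_nonneg V\<phi>) (auto intro: le_less_trans)
    have "(\<integral>x. (gnorm X x (rgrad X (\<phi> m) x))\<^sup>2 \<partial>vol X) \<le> e m"
      using \<phi>(3)[of m] e[of m] V\<phi> by (subst integral_eq_nn_integral) (auto intro: enn2real_leI)
    note b\<phi> = this
    let ?g = "\<lambda>x. indicator (U m) x * (gnorm X x (rgrad X (w m) x - V x))\<^sup>2 :: real"
    have Vw: "?g \<in> borel_measurable (vol X)" by (rule rgrad_measurable_on[OF Uo gw V])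
    have "(\<integral>\<^sup>+ x. ennreal (?g x) \<partial>vol X) \<le> (\<integral>\<^sup>+ x. indicator (U m) x * ennreal ((w m x - f x)\<^sup>2 + (gnorm X x (rgrad X (w m) x - V x))\<^sup>2) \<partial>vol X)"
      by (intro nn_integral_mono) (auto split: split_indicator intro!: ennreal_leI)
    also have "\<dots> \<le> ennreal (e m)" using w(2)[of m] by simp
    finally have ng: "(\<integral>\<^sup>+ x. ennreal (?g x) \<partial>vol X) \<le> ennreal (e m)" .
    have iw: "integrable (vol X) ?g"
      using ng by (intro integrableI_nonneg Vw) (auto intro: le_less_trans)
    have bw: "(\<integral>x. ?g x \<partial>vol X) \<le> e m"
      using ng e[of m] Vw by (subst integral_eq_nn_integral) (auto intro: enn2real_leI)
    have supp: "closure {x. \<phi> m x \<noteq> 0} \<subseteq> U m" using U(2) by blast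
    define \<delta> where "\<delta> = (1 / 2 :: real) ^ m"
    have \<delta>: "\<delta> > 0" by (simp add: \<delta>_def)
    note est = energy_estimate[OF sub Uo \<phi>(1) supp gw V iV i\<phi> iw \<delta>]
    have "(\<integral>x. ?K m x \<partial>vol X) \<le> 2 * \<delta> * E + 4 / \<delta> * (e m + e m)"
      using est(2) b\<phi> bw \<delta> unfolding E_def[symmetric]
      by (smt (verit, best) divide_nonneg_pos mult_left_mono)
    also have "e m = \<delta> * \<delta>" by (simp add: e_def \<delta>_def power_mult_distrib[symmetric])
    also have "2 * \<delta> * E + 4 / \<delta> * (\<delta> * \<delta> + \<delta> * \<delta>) = (2 * E + 8) * \<delta>" using \<delta> by (simp add: field_simps)
    finally show ?thesis using est(1) by (simp add: \<delta>_def)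
  qed
  have K0: "0 \<le> ?K m x" for m x
    using cutoff_bounds(1)[of "\<phi> m x"] damp'_bounds(1)[of "w m x"] by (auto split: split_indicator)
  have convK: "AE x in vol X. (\<lambda>m. ?K m x) \<longlonglongrightarrow> 0"
  proof (rule AE_tendsto_0_if_summable[where e = "\<lambda>m. (2 * E + 8) * (1 / 2) ^ m"])
    fix m
    show "?K m \<in> borel_measurable (vol X)" using K[of m] by blast
    show "(\<integral>\<^sup>+ x. ennreal (?K m x) \<partial>vol X) \<le> ennreal ((2 * E + 8) * (1 / 2) ^ m)"
      using K[of m] K0[of m] by (subst nn_integral_eq_integral) (auto intro: ennreal_leI)
    show "summable (\<lambda>m. (2 * E + 8) * (1 / 2) ^ m)" by (intro summable_mult summable_geometric) simp
  qed (use E0 K0 in auto)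
  show ?thesis
    using conv\<phi> convw convK
  proof eventually_elim
    case (elim x)
    show ?case
    proof
      assume x: "x \<in> D"
      then have xU: "x \<in> U m" for m using U(2) by blast
      have sq: "h \<longlonglongrightarrow> c" if "(\<lambda>m. (h m - c)\<^sup>2) \<longlonglongrightarrow> 0" for h :: "nat \<Rightarrow> real" and c
      proof -
        have "(\<lambda>m. sqrt ((h m - c)\<^sup>2)) \<longlonglongrightarrow> sqrt 0" by (intro tendsto_real_sqrt that)
        then show ?thesis by (simp add: tendsto_rabs_zero_iff LIM_zero_iff)
      qed
      have l1: "(\<lambda>m. \<phi> m x) \<longlonglongrightarrow> 1" by (rule sq) (use elim(1) x in simp)
      have l2: "(\<lambda>m. w m x) \<longlonglongrightarrow> f x" by (rule sq) (use elim(2) x xU in simp)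
      have ne: "1 + t\<^sup>2 \<noteq> 0" for t :: real using one_plus_square(2)[of t] by simp
      have "(\<lambda>m. cutoff (\<phi> m x) * damp' (w m x) * (gnorm X x (V x))\<^sup>2) \<longlonglongrightarrow> cutoff 1 * damp' (f x) * (gnorm X x (V x))\<^sup>2"
        unfolding cutoff_def damp'_def by (intro tendsto_intros l1 l2 ne)
      moreover have "(\<lambda>m. cutoff (\<phi> m x) * damp' (w m x) * (gnorm X x (V x))\<^sup>2) \<longlonglongrightarrow> 0"
        using elim(3) xU by simp
      ultimately have "cutoff 1 * damp' (f x) * (gnorm X x (V x))\<^sup>2 = 0" by (rule LIMSEQ_unique)
      then show "gnorm X x (V x) = 0" using damp'_bounds(1)[of "f x"] by (simp add: cutoff_one)
    qed
  qed
qed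

lemma W12_loc_grad_directions:
  assumes grad: "W12_loc_grad X f V"
  shows "AE x in vol X. V x \<in> directions X (simplex_at X x)"
proof -
  have "AE x in vol X. x \<in> open_cell s \<longrightarrow> V x \<in> directions X (simplex_at X x)" if "s \<in> max_simplices X" for s
    using grad rel_compact_open_cell[OF that] unfolding W12_loc_grad_def W12_grad_def sobolev_limit_def by blast
  then have "AE x in vol X. \<forall>s\<in>max_simplices X. x \<in> open_cell s \<longrightarrow> V x \<in> directions X (simplex_at X x)"
    by (subst AE_ball_countable[OF countable_max]) blast
  with AE_inner show ?thesis by eventually_elim auto
qed

lemma gradient_zero:
  assumes par: "two_parabolic X UNIV" and grad: "W12_loc_grad X f V" and sub: "weakly_subharmonic X f V"
    and L2: "Lp_norm_pow X 2 V < \<infinity>"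
  shows "AE x in vol X. V x = 0"
proof -
  have V: "V \<in> borel_measurable (vol X)" using grad by (simp add: W12_loc_grad_def)
  note Vd = W12_loc_grad_directions[OF grad]
  have mg: "(\<lambda>x. gnorm X x (V x)) \<in> borel_measurable (vol X)" by (rule gnorm_measurable[OF V Vd])
  have iV: "integrable (vol X) (\<lambda>x. (gnorm X x (V x))\<^sup>2)"
  proof (rule integrableI_nonneg)
    show "(\<lambda>x. (gnorm X x (V x))\<^sup>2) \<in> borel_measurable (vol X)" using mg by measurable
    have "(\<integral>\<^sup>+ x. ennreal ((gnorm X x (V x))\<^sup>2) \<partial>vol X) = Lp_norm_pow X 2 V"
      unfolding Lp_norm_pow_def
    proof (rule nn_integral_cong_AE)
      show "AE x in vol X. ennreal ((gnorm X x (V x))\<^sup>2) = ennreal (gnorm X x (V x) powr 2)"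
        using AE_inner Vd
      proof eventually_elim
        case (elim x)
        then have "0 \<le> gnorm X x (V x)" by (intro gnorm_nonneg) auto
        then show ?case by (cases "gnorm X x (V x) = 0") auto
      qed
    qed
    then show "(\<integral>\<^sup>+ x. ennreal ((gnorm X x (V x))\<^sup>2) \<partial>vol X) < \<infinity>" using L2 by simp
  qed auto
  \<comment> \<open>The compact cells are countable in number and cover the space, so one null set
    serves for all of them.\<close>
  have "AE x in vol X. \<forall>s\<in>max_simplices X. x \<in> cell X s \<longrightarrow> gnorm X x (V x) = 0"
    using gradient_zero_on_cell[OF par grad sub V Vd iV compact_cell[OF max_simplex]]
    by (subst AE_ball_countable[OF countable_max]) blast
  with AE_inner Vd show ?thesis
  proof eventually_elim
    case (elim x)
    have i: "inner_at x" using elim(1) by blast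
    interpret inner_form "directions X (simplex_at X x)" "frame X (simplex_at X x)" "ginner X x" Lam by (rule i)
    have "x \<in> cell X (simplex_at X x)" by (simp add: mem_cell)
    then have "gnorm X x (V x) = 0" using elim(1,3) by blast
    then have "ginner X x (V x) (V x) = 0" using gnorm_square[OF i elim(2)] by simp
    then have "(norm (V x))\<^sup>2 / Lam\<^sup>2 \<le> 0" using low[OF elim(2)] by simp
    then show ?case using Lam by (simp add: divide_le_0_iff power2_eq_square mult_le_0_iff)
  qed
qed

end

section \<open>Functions with vanishing gradient\<close>

text \<open>A substitute for the fundamental theorem of calculus along lines. The increment is
  telescoped into n + 1 steps along v / (n + 1). Invariance gives all steps the same bound, which
  adds up to the integral of a difference quotient, and n tends to infinity by dominated
  convergence. The intermediate points account for the larger ball.\<close>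

lemma (in invariant_measure) nn_integral_increment_le:
  fixes h :: "'e \<Rightarrow> real"
  assumes h: "L-lipschitz_on UNIV h" and v: "v \<in> W"
  shows "(\<integral>\<^sup>+ x. indicator (ball p r) x * ennreal \<bar>h (x + v) - h x\<bar> \<partial>M) \<le>
    (\<integral>\<^sup>+ x. indicator (ball p (r + norm v)) x * ennreal \<bar>dderiv h v x\<bar> \<partial>M)"
proof -
  note [measurable] = borel_h[OF h] borel_dderiv[OF h]
  let ?B = "ball p r" and ?B' = "ball p (r + norm v)"
  let ?t = "\<lambda>n. 1 / real (Suc n)"
  have [measurable]: "?B \<in> sets borel" "?B' \<in> sets borel" by simp_all
  have [measurable]: "(\<lambda>x. h (x + a)) \<in> borel_measurable borel" for a
    by (rule measurable_compose[OF _ borel_h[OF h]]) simp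
  have q_meas [measurable]: "(\<lambda>x. dquot h v x (?t n)) \<in> borel_measurable borel" for n
    by (intro borel_measurable_continuous_onI continuous_dquot[OF h])
  have le: "(\<integral>\<^sup>+ x. indicator ?B x * ennreal \<bar>h (x + v) - h x\<bar> \<partial>M) \<le>
      (\<integral>\<^sup>+ x. indicator ?B' x * ennreal \<bar>dquot h v x (?t n)\<bar> \<partial>M)" for n
  proof -
    define t where "t = ?t n"
    have t: "t > 0" "real (Suc n) * t = 1" by (auto simp: t_def)
    define G where "G z = indicator ?B' z * ennreal \<bar>h (z + t *\<^sub>R v) - h z\<bar>" for z
    have G [measurable]: "G \<in> borel_measurable borel" unfolding G_def[abs_def] by measurable
    have jv: "(real j * t) *\<^sub>R v \<in> W" for j using v W by (simp add: subspace_mul)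
    have pw: "indicator ?B x * ennreal \<bar>h (x + v) - h x\<bar> \<le> (\<Sum>j<Suc n. G (x + (real j * t) *\<^sub>R v))" for x
    proof (cases "x \<in> ?B")
      case True
      let ?a = "\<lambda>j. h (x + (real j * t) *\<^sub>R v)"
      have "h (x + v) - h x = ?a (Suc n) - ?a 0" using t(2) by simp
      also have "\<dots> = (\<Sum>j<Suc n. ?a (Suc j) - ?a j)" by (rule sum_lessThan_telescope[symmetric])
      also have "\<bar>\<dots>\<bar> \<le> (\<Sum>j<Suc n. \<bar>?a (Suc j) - ?a j\<bar>)" by (rule sum_abs)
      finally have "ennreal \<bar>h (x + v) - h x\<bar> \<le> ennreal (\<Sum>j<Suc n. \<bar>?a (Suc j) - ?a j\<bar>)" by (rule ennreal_leI)
      also have "\<dots> = (\<Sum>j<Suc n. ennreal \<bar>?a (Suc j) - ?a j\<bar>)" by (rule sum_ennreal[symmetric]) simp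
      also have "\<dots> = (\<Sum>j<Suc n. G (x + (real j * t) *\<^sub>R v))"
      proof (rule sum.cong[OF refl])
        fix j assume "j \<in> {..<Suc n}"
        then have "real j * t \<le> real (Suc n) * t" using t(1) by (intro mult_right_mono) auto
        then have "real j * t \<le> 1" unfolding t(2) .
        then have "(real j * t) * norm v \<le> 1 * norm v" by (rule mult_right_mono) simp
        moreover have "0 \<le> real j * t" using t(1) by simp
        ultimately have "norm ((real j * t) *\<^sub>R v) \<le> norm v" by (simp only: norm_scaleR abs_of_nonneg mult_1)
        then have "x + (real j * t) *\<^sub>R v \<in> ?B'"
          using True norm_triangle_ineq4[of "p - x" "(real j * t) *\<^sub>R v"] by (simp add: dist_norm diff_diff_eq)
        moreover have "x + (real (Suc j) * t) *\<^sub>R v = x + (real j * t) *\<^sub>R v + t *\<^sub>R v"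
          by (simp add: algebra_simps)
        ultimately show "ennreal \<bar>?a (Suc j) - ?a j\<bar> = G (x + (real j * t) *\<^sub>R v)"
          by (simp add: G_def add.assoc)
      qed
      finally show ?thesis using True by simp
    qed simp
    have "(\<integral>\<^sup>+ x. indicator ?B x * ennreal \<bar>h (x + v) - h x\<bar> \<partial>M) \<le> (\<integral>\<^sup>+ x. (\<Sum>j<Suc n. G (x + (real j * t) *\<^sub>R v)) \<partial>M)"
      by (intro nn_integral_mono pw)
    also have "\<dots> = (\<Sum>j<Suc n. \<integral>\<^sup>+ x. G (x + (real j * t) *\<^sub>R v) \<partial>M)"
      by (rule nn_integral_sum) measurable
    also have "\<dots> = (\<Sum>j<Suc n. \<integral>\<^sup>+ x. G x \<partial>M)"
      by (intro sum.cong refl nn_integral_translate jv G)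
    also have "\<dots> = (\<integral>\<^sup>+ x. ennreal (real (Suc n)) * G x \<partial>M)"
      by (subst nn_integral_cmult) (auto simp: ennreal_of_nat_eq_real_of_nat simp del: of_nat_Suc)
    also have "\<dots> = (\<integral>\<^sup>+ x. indicator ?B' x * ennreal \<bar>dquot h v x (?t n)\<bar> \<partial>M)"
    proof (rule nn_integral_cong)
      fix x
      have "\<bar>dquot h v x (?t n)\<bar> = real (Suc n) * \<bar>h (x + t *\<^sub>R v) - h x\<bar>"
        by (simp add: dquot_def t_def abs_mult del: of_nat_Suc)
      then show "ennreal (real (Suc n)) * G x = indicator ?B' x * ennreal \<bar>dquot h v x (?t n)\<bar>"
        by (simp add: G_def ennreal_mult ac_simps del: of_nat_Suc)
    qed
    finally show ?thesis .
  qed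
  have "(\<lambda>n. \<integral>\<^sup>+ x. indicator ?B' x * ennreal \<bar>dquot h v x (?t n)\<bar> \<partial>M) \<longlonglongrightarrow>
      (\<integral>\<^sup>+ x. indicator ?B' x * ennreal \<bar>dderiv h v x\<bar> \<partial>M)"
  proof (rule nn_integral_dominated_convergence[where w = "\<lambda>x. indicator ?B' x * ennreal (L * norm v)"])
    show "AE x in M. indicator ?B' x * ennreal \<bar>dquot h v x (?t n)\<bar> \<le> indicator ?B' x * ennreal (L * norm v)" for n
      using dquot_bound[OF h] by (intro AE_I2 mult_left_mono ennreal_leI) auto
    show "(\<integral>\<^sup>+ x. indicator ?B' x * ennreal (L * norm v) \<partial>M) < \<infinity>"
      using finite_bounded[of ?B'] by (simp add: nn_integral_multc sets_M ennreal_mult_less_top)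
    show "AE x in M. (\<lambda>n. indicator ?B' x * ennreal \<bar>dquot h v x (?t n)\<bar>) \<longlonglongrightarrow> indicator ?B' x * ennreal \<bar>dderiv h v x\<bar>"
      using AE_dgood[OF h v]
    proof eventually_elim
      case (elim x)
      have "(\<lambda>n. ennreal \<bar>dquot h v x (?t n)\<bar>) \<longlonglongrightarrow> ennreal \<bar>dderiv h v x\<bar>"
        by (intro tendsto_ennrealI tendsto_rabs dderiv_seq[OF h elim])
      then show ?case by (cases "x \<in> ?B'") auto
    qed
  qed measurable
  then show ?thesis using le by (intro LIMSEQ_le_const) auto
qed

context riem_poly
begin

text \<open>F is measurable only for the completed volume, whereas the Euclidean measure of the cell
  lives on the Borel sets; splitting integrals there requires a Borel representative q.\<close>

lemma borel_version_on_cell: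
  fixes F :: "'a \<Rightarrow> ennreal"
  assumes s: "s \<in> max_simplices X" and F: "F \<in> borel_measurable (vol X)"
  shows "\<exists>q\<in>borel_measurable borel. (AE y in cm s. y \<in> open_flat_cell s \<longrightarrow> F (chart X y) = q y) \<and>
    ennreal (dens_min s) * (\<integral>\<^sup>+ y. indicator (open_flat_cell s) y * q y \<partial>cm s) \<le> (\<integral>\<^sup>+ x. F x \<partial>vol X)"
proof -
  obtain G where G: "G \<in> borel_measurable bvol" "AE x in bvol. F x = G x"
    using F completion_ex_borel_measurable unfolding vol_eq by blast
  have Gb: "G \<in> borel_measurable borel" using G(1) by simp
  have ch: "chart X \<in> measurable (restrict_space borel (flat_cell X s)) borel"
    using chart_measurable(1)[OF max_simplex[OF s]] measurable_cong_sets[OF sets_rs refl] by blast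
  have "AE x in vol X. F x = G x" using G(2) unfolding AE_vol_bvol .
  then have ae: "AE y in cm s. y \<in> open_flat_cell s \<longrightarrow> F (chart X y) = G (chart X y)" using s unfolding AE_vol_iff by blast
  define q where "q y = (if y \<in> flat_cell X s then G (chart X y) else 0)" for y
  have q: "q \<in> borel_measurable borel"
    unfolding q_def[abs_def] using borel_flat_cell[OF max_simplex[OF s]] measurable_compose[OF ch Gb]
    by (subst measurable_If_restrict_space_iff) auto
  have eq: "AE y in cm s. y \<in> open_flat_cell s \<longrightarrow> F (chart X y) = q y"
    using ae by eventually_elim (use open_flat_cell_subset[of s] in \<open>auto simp: q_def\<close>)
  then have "(\<integral>\<^sup>+ y. indicator (open_flat_cell s) y * q y \<partial>cm s) = (\<integral>\<^sup>+ y. indicator (open_flat_cell s) y * F (chart X y) \<partial>cm s)"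
    by (intro nn_integral_cong_AE) (auto elim!: eventually_mono split: split_indicator)
  then show ?thesis using q eq nn_integral_vol_ge[OF s F] by auto
qed

text \<open>Trades mean-square closeness of approximants for closeness in the mean on sets of finite
  measure, with \<eta> at choice.\<close>

lemma abs_le_eta: "\<eta> > 0 \<Longrightarrow> \<bar>a\<bar> \<le> \<eta> + a\<^sup>2 / \<eta>" for a \<eta> :: real
proof -
  assume \<eta>: "\<eta> > 0"
  have "0 \<le> (\<bar>a\<bar> - \<eta>)\<^sup>2" by simp
  then have "2 * (\<bar>a\<bar> * \<eta>) \<le> a\<^sup>2 + \<eta>\<^sup>2" by (simp add: power2_diff)
  then have "\<bar>a\<bar> * \<eta> \<le> \<eta>\<^sup>2 + a\<^sup>2" using \<eta> mult_nonneg_nonneg[of "\<bar>a\<bar>" \<eta>] by linarith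
  then show ?thesis using \<eta> by (simp add: field_simps power2_eq_square)
qed

text \<open>For a small direction v, an approximant of f with small gradient has a small increment
  along v in the mean, by \<open>nn_integral_increment_le\<close>. Hence the increment of f itself
  has mean 0 on a ball, and continuity turns equality almost everywhere into equality at p.\<close>

lemma zero_gradient_locally_constant:
  assumes s: "s \<in> max_simplices X" and f: "continuous_on UNIV f" and grad: "W12_grad X (open_cell s) f V"
    and V0: "AE x in vol X. V x = 0" and Vm: "V \<in> borel_measurable (vol X)" and p: "p \<in> open_flat_cell s"
  shows "\<exists>r>0. \<forall>v\<in>directions X s. norm v < r \<longrightarrow> p + v \<in> open_flat_cell s \<and> f (chart X (p + v)) = f (chart X p)"
proof -
  note s' = max_simplex[OF s]
  let ?W = "directions X s" and ?O = "open_flat_cell s" and ?U = "open_cell s" and ?M = "cm s"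
  have W: "subspace ?W" by (rule subspace_directions)
  have Uo: "open ?U" by (rule open_open_cell[OF s])
  have dom: "dom_cell s ?U = ?O" using simplex_at_chart[OF s'] by (auto simp: dom_cell_def)
  obtain R where R: "R > 0" "\<And>w. w \<in> ?W \<Longrightarrow> norm w < R \<Longrightarrow> p + w \<in> ?O" using open_flat_cell_ball[OF p] by blast
  \<comment> \<open>The extension h agrees with w only within R / 4 of p. Points of
    \<open>?B'\<close> are within 2 r of p, and difference quotients along v need a further r: hence
    the 3. The 4 comes from \<open>g_lipschitz_ball\<close>.\<close>
  define r where "r = R / 4 / 3"
  have r: "r > 0" "3 * r = R / 4" using R(1) by (auto simp: r_def)
  let ?S = "{p + w | w. w \<in> ?W \<and> norm w < R / 4}"
  have po: "p - origin X s \<in> ?W" by (rule open_flat_cell_minus_origin[OF s' p])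
  define F where "F y = (if y \<in> ?O then f (chart X y) else 0)" for y
  have contF: "continuous_on ?O (\<lambda>y. f (chart X y))"
    using open_flat_cell_subset[of s] flat_cell_subset[OF s']
    by (intro continuous_on_compose2[OF f] continuous_on_subset[OF continuous_chart]) auto
  have F [measurable]: "F \<in> borel_measurable borel"
  proof -
    have "(\<lambda>y. indicator ?O y *\<^sub>R f (chart X y)) \<in> borel_measurable borel"
      by (rule borel_measurable_continuous_on_indicator[OF borel_open_flat_cell contF])
    then show ?thesis by (rule measurable_cong[THEN iffD1, rotated]) (auto simp: F_def)
  qed
  have fm [measurable]: "f \<in> borel_measurable (vol X)"
  proof -
    have "f \<in> borel_measurable bvol" using borel_measurable_continuous_onI[OF f] by simp
    then show ?thesis unfolding vol_eq by (rule measurable_completion)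
  qed
  have eq0: "f (chart X (p + v)) = f (chart X p)" if v: "v \<in> ?W" "norm v < r" for v
  proof -
    let ?B = "ball p r" and ?B' = "ball p (r + norm v)"
    define I where "I = (\<integral>\<^sup>+ x. indicator ?B x * ennreal \<bar>F (x + v) - F x\<bar> \<partial>?M)"
    \<comment> \<open>The 2 counts the comparisons of F with h at x and at x + v;
      \<open>Lam * norm v\<close> bounds the derivative of h along v in terms of the gradient, by
      Cauchy-Schwarz.\<close>
    define C where "C = 2 + Lam * norm v"
    have C: "C \<ge> 2" using Lam_ge_1 by (simp add: C_def)
    define \<mu> where "\<mu> = measure ?M ?B'"
    have \<mu>: "emeasure ?M ?B' = ennreal \<mu>" "\<mu> \<ge> 0"
      using cm.finite_bounded[of ?B' s] by (auto simp: \<mu>_def intro!: emeasure_eq_ennreal_measure)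
    have key: "I \<le> ennreal (C * (\<mu> + 1) * \<eta>)" if \<eta>: "\<eta> > 0" for \<eta>
    proof -
      \<comment> \<open>After division by the minimal density the Euclidean integral of the squared
        errors is at most the square of \<eta>, so the term divided by \<eta> is again of order
        \<eta>.\<close>
      define \<epsilon> where "\<epsilon> = \<eta>\<^sup>2 * dens_min s"
      have \<epsilon>: "\<epsilon> > 0" using \<eta> dens_min_pos by (simp add: \<epsilon>_def)
      obtain w where w: "w \<in> lip_finite X ?U"
        "(\<integral>\<^sup>+ x. indicator ?U x * ennreal ((w x - f x)\<^sup>2 + (gnorm X x (rgrad X w x - V x))\<^sup>2) \<partial>vol X) < ennreal \<epsilon>"
        using sobolev_limit_approx[OF grad[unfolded W12_grad_def] \<epsilon>] by blast
      have gw: "g_lipschitz_on X ?U w" using w(1) by (simp add: lip_finite_def)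
      obtain L where L: "L-lipschitz_on ?S (\<lambda>y. w (chart X y))"
        using g_lipschitz_ball[OF s gw R(1), of p] R(2) unfolding dom by blast
      have "p + 0 \<in> ?S" using R(1) subspace_0[OF W] by (intro CollectI exI[of _ 0]) auto
      then have "?S \<noteq> {}" by blast
      obtain h where h: "L-lipschitz_on UNIV h" "\<forall>y\<in>?S. h y = w (chart X y)"
        by (rule lipschitz_extension_real[OF L \<open>?S \<noteq> {}\<close>], rule that, assumption, blast)
      note [measurable] = cm.borel_h[OF h(1)] cm.borel_dderiv[OF h(1)]
      let ?Q = "\<lambda>x. (w x - f x)\<^sup>2 + (gnorm X x (rgrad X w x - V x))\<^sup>2"
      let ?G = "\<lambda>x. indicator ?U x * ennreal (?Q x)"
      have Gm: "?G \<in> borel_measurable (vol X)"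
      proof -
        have Vd: "AE x in vol X. V x \<in> directions X (simplex_at X x)"
          using V0 by eventually_elim (simp add: subspace_0 subspace_directions)
        have [measurable]: "(\<lambda>x. if x \<in> ?U then w x else 0) \<in> borel_measurable (vol X)"
          by (rule g_lipschitz_measurable[OF Uo gw])
        have [measurable]: "(\<lambda>x. indicator ?U x * (gnorm X x (rgrad X w x - V x))\<^sup>2 :: real) \<in> borel_measurable (vol X)"
          by (rule rgrad_measurable_on[OF Uo gw Vm Vd])
        have [measurable]: "?U \<in> sets (vol X)" using Uo by (simp add: vol_eq)
        have "(\<lambda>x. indicator ?U x * ennreal (((if x \<in> ?U then w x else 0) - f x)\<^sup>2 +
            indicator ?U x * (gnorm X x (rgrad X w x - V x))\<^sup>2)) \<in> borel_measurable (vol X)" by measurable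
        then show ?thesis by (rule measurable_cong[THEN iffD1, rotated]) (auto split: split_indicator)
      qed
      obtain q where q [measurable]: "q \<in> borel_measurable borel"
        and q_eq: "AE y in ?M. y \<in> ?O \<longrightarrow> ?G (chart X y) = q y"
        and q_le: "ennreal (dens_min s) * (\<integral>\<^sup>+ y. indicator ?O y * q y \<partial>?M) \<le> (\<integral>\<^sup>+ x. ?G x \<partial>vol X)"
        using borel_version_on_cell[OF s Gm] by blast
      let ?q = "\<lambda>y. indicator ?O y * q y"
      have small: "(\<integral>\<^sup>+ y. ?q y \<partial>?M) \<le> ennreal (\<eta>\<^sup>2)"
      proof -
        have "ennreal (dens_min s) * (\<integral>\<^sup>+ y. ?q y \<partial>?M) \<le> ennreal \<epsilon>"
          using q_le w(2) by (meson less_imp_le order_trans)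
        also have "\<dots> = ennreal (dens_min s) * ennreal (\<eta>\<^sup>2)"
          using dens_min_pos[of s] by (simp add: \<epsilon>_def ennreal_mult[symmetric] mult.commute)
        finally show ?thesis using dens_min_pos[of s] by (simp add: ennreal_mult_le_mult_iff)
      qed
      have inS: "y \<in> ?S \<and> y \<in> ?O" if "y \<in> ball p (3 * r)" "y - p \<in> ?W" for y
      proof -
        have n: "norm (y - p) < R / 4" using that(1) r(2) by (simp add: dist_norm norm_minus_commute)
        then have "y \<in> ?S" using that(2) by (intro CollectI exI[of _ "y - p"]) auto
        moreover have "p + (y - p) \<in> ?O" using n R(1) that(2) by (intro R(2)) auto
        ultimately show ?thesis by simp
      qed
      have pw: "AE y in ?M. indicator ?B' y * (2 * ennreal \<bar>F y - h y\<bar> + ennreal \<bar>cm.dderiv h v y\<bar>) \<le>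
          indicator ?B' y * ennreal (C * \<eta>) + ennreal (C / \<eta>) * ?q y"
        using cm.AE_in_affine AE_inner_form[OF s] V0[unfolded AE_vol_iff, rule_format, OF s]
          AE_has_rgrad[OF Uo gw, unfolded AE_vol_iff, rule_format, OF s] q_eq
      proof eventually_elim
        case (elim y)
        show ?case
        proof (cases "y \<in> ?B'")
          case True
          have yp: "y - p \<in> ?W" using subspace_diff[OF W elim(1) po] by simp
          have y3: "y \<in> ball p (3 * r)" using True v(2) r(1) by simp
          have yS: "y \<in> ?S" and yO: "y \<in> ?O" using inS[OF y3 yp] by auto
          interpret inner_form ?W "frame X s" "gform X s y" Lam using elim(2) yO by blast
          let ?x = "chart X y" and ?\<xi> = "rgrad X w (chart X y)"
          have xU: "?x \<in> ?U" using simplex_at_chart[OF s' yO] by simp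
          have rg: "has_rgrad X w ?x ?\<xi>" using elim(4) yO xU by blast
          have V0y: "V ?x = 0" using elim(3) yO by blast
          have xi: "?\<xi> \<in> ?W" using rg unfolding has_rgrad_iff[OF s yO] by blast
          have hy: "h y = w ?x" using h(2) yS by blast
          \<comment> \<open>Near y the extension h coincides with w along the line in direction v,
            so the gradient of w gives its derivative.\<close>
          have "(cm.dquot h v y \<longlongrightarrow> gform X s y ?\<xi> v) (at 0)"
          proof (rule Lim_transform_eventually[OF has_rgrad_directional[OF s yO rg v(1)]])
            have "cm.dquot h v y t = (w (chart X (y + t *\<^sub>R v)) - w ?x) / t" if t: "\<bar>t\<bar> < 1" for t
            proof -
              have "norm (t *\<^sub>R v) \<le> norm v" using t by (simp add: mult_left_le_one_le)
              then have "y + t *\<^sub>R v \<in> ball p (3 * r)"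
                using True v(2) norm_triangle_ineq4[of "p - y" "t *\<^sub>R v"] by (simp add: dist_norm diff_diff_eq)
              moreover have "(y - p) + t *\<^sub>R v \<in> ?W" by (intro subspace_add subspace_mul W yp v(1))
              ultimately have "y + t *\<^sub>R v \<in> ?S" using inS[of "y + t *\<^sub>R v"] by (simp add: algebra_simps)
              then have "h (y + t *\<^sub>R v) = w (chart X (y + t *\<^sub>R v))" using h(2) by blast
              then show ?thesis by (simp add: cm.dquot_def hy)
            qed
            then show "\<forall>\<^sub>F t in at 0. (w (chart X (y + t *\<^sub>R v)) - w ?x) / t = cm.dquot h v y t"
              unfolding eventually_at by (intro exI[of _ 1]) auto
          qed
          then have "cm.dderiv h v y = gform X s y ?\<xi> v" using cm.dderivI by blast
          also have "\<bar>\<dots>\<bar> \<le> sqrt (gform X s y ?\<xi> ?\<xi>) * sqrt (gform X s y v v)" by (rule Cauchy_Schwarz_g[OF xi v(1)])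
          also have "\<dots> \<le> sqrt (gform X s y ?\<xi> ?\<xi>) * (Lam * norm v)"
            using real_sqrt_le_mono[OF up[OF v(1)]] Lam_ge_1 g_nonneg[OF xi]
            by (intro mult_left_mono) (auto simp: real_sqrt_mult)
          also have "sqrt (gform X s y ?\<xi> ?\<xi>) = gnorm X ?x (?\<xi> - V ?x)"
            by (simp add: V0y gnorm_def ginner_def flat_chart_open[OF s' yO] simplex_at_chart[OF s' yO])
          finally have d: "\<bar>cm.dderiv h v y\<bar> \<le> gnorm X ?x (?\<xi> - V ?x) * (Lam * norm v)" .
          define a where "a = w ?x - f ?x"
          define b where "b = gnorm X ?x (?\<xi> - V ?x)"
          have Fh: "\<bar>F y - h y\<bar> = \<bar>a\<bar>" using yO by (simp add: F_def hy a_def)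
          have "2 * \<bar>F y - h y\<bar> + \<bar>cm.dderiv h v y\<bar> \<le> 2 * (\<eta> + a\<^sup>2 / \<eta>) + (Lam * norm v) * (\<eta> + b\<^sup>2 / \<eta>)"
          proof (intro add_mono)
            show "2 * \<bar>F y - h y\<bar> \<le> 2 * (\<eta> + a\<^sup>2 / \<eta>)" unfolding Fh using abs_le_eta[OF \<eta>, of a] by simp
            have "\<bar>cm.dderiv h v y\<bar> \<le> (Lam * norm v) * b" using d by (simp add: b_def mult.commute)
            also have "\<dots> \<le> (Lam * norm v) * (\<eta> + b\<^sup>2 / \<eta>)"
              using Lam_ge_1 abs_le_eta[OF \<eta>, of b] by (intro mult_left_mono) auto
            finally show "\<bar>cm.dderiv h v y\<bar> \<le> (Lam * norm v) * (\<eta> + b\<^sup>2 / \<eta>)" .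
          qed
          also have "\<dots> \<le> 2 * (\<eta> + (a\<^sup>2 + b\<^sup>2) / \<eta>) + (Lam * norm v) * (\<eta> + (a\<^sup>2 + b\<^sup>2) / \<eta>)"
            using \<eta> Lam_ge_1 by (intro add_mono mult_left_mono divide_right_mono) auto
          also have "\<dots> = C * \<eta> + C / \<eta> * (a\<^sup>2 + b\<^sup>2)" by (simp add: C_def algebra_simps add_divide_distrib)
          finally have "ennreal (2 * \<bar>F y - h y\<bar> + \<bar>cm.dderiv h v y\<bar>) \<le> ennreal (C * \<eta> + C / \<eta> * (a\<^sup>2 + b\<^sup>2))" by (rule ennreal_leI)
          moreover have "ennreal (2 * \<bar>F y - h y\<bar> + \<bar>cm.dderiv h v y\<bar>) = 2 * ennreal \<bar>F y - h y\<bar> + ennreal \<bar>cm.dderiv h v y\<bar>"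
            by (subst ennreal_plus) (simp_all add: ennreal_mult)
          moreover have "ennreal (C * \<eta> + C / \<eta> * (a\<^sup>2 + b\<^sup>2)) = ennreal (C * \<eta>) + ennreal (C / \<eta>) * ennreal (a\<^sup>2 + b\<^sup>2)"
          proof -
            have "ennreal (C / \<eta> * (a\<^sup>2 + b\<^sup>2)) = ennreal (C / \<eta>) * ennreal (a\<^sup>2 + b\<^sup>2)"
              using C \<eta> by (intro ennreal_mult) auto
            moreover have "ennreal (C * \<eta> + C / \<eta> * (a\<^sup>2 + b\<^sup>2)) = ennreal (C * \<eta>) + ennreal (C / \<eta> * (a\<^sup>2 + b\<^sup>2))"
              using C \<eta> by (intro ennreal_plus) auto
            ultimately show ?thesis by simp
          qed
          moreover have "q y = ennreal (a\<^sup>2 + b\<^sup>2)" using elim(5) yO xU by (simp add: a_def b_def)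
          ultimately show ?thesis using True yO by simp
        qed simp
      qed
      \<comment> \<open>The comparison at x + v is taken over the larger ball, so that translation
        invariance turns its integral into that of the comparison at x.\<close>
      have tri: "indicator ?B x * ennreal \<bar>F (x + v) - F x\<bar> \<le>
          indicator ?B' (x + v) * ennreal \<bar>F (x + v) - h (x + v)\<bar> +
          (indicator ?B x * ennreal \<bar>h (x + v) - h x\<bar> + indicator ?B' x * ennreal \<bar>F x - h x\<bar>)" for x
      proof (cases "x \<in> ?B")
        case True
        have xv: "x + v \<in> ?B'" "x \<in> ?B'"
        proof -
          have "norm (p - x) < r" using True by (simp add: dist_norm)
          moreover have "norm (p - (x + v)) \<le> norm (p - x) + norm v"
            using norm_triangle_ineq4[of "p - x" v] by (simp add: diff_diff_eq)
          ultimately have "norm (p - (x + v)) < r + norm v" "norm (p - x) < r + norm v"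
            using norm_ge_zero[of v] by linarith+
          then show "x + v \<in> ?B'" "x \<in> ?B'" by (simp_all add: dist_norm)
        qed
        have "\<bar>F (x + v) - F x\<bar> \<le> \<bar>F (x + v) - h (x + v)\<bar> + (\<bar>h (x + v) - h x\<bar> + \<bar>F x - h x\<bar>)" by linarith
        then have "ennreal \<bar>F (x + v) - F x\<bar> \<le> ennreal (\<bar>F (x + v) - h (x + v)\<bar> + (\<bar>h (x + v) - h x\<bar> + \<bar>F x - h x\<bar>))"
          by (rule ennreal_leI)
        then show ?thesis using True xv by (simp add: ennreal_plus)
      qed simp
      define E where "E = (\<lambda>x. indicator ?B' x * ennreal \<bar>F x - h x\<bar>)"
      define D where "D = (\<lambda>x. indicator ?B x * ennreal \<bar>h (x + v) - h x\<bar>)"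
      define H where "H = (\<lambda>x. indicator ?B' x * ennreal \<bar>cm.dderiv h v x\<bar>)"
      have hv: "(\<lambda>x. h (x + v)) \<in> borel_measurable borel"
        by (rule measurable_compose[OF _ cm.borel_h[OF h(1)]]) simp
      have EB: "E \<in> borel_measurable borel"
        unfolding E_def by (intro borel_measurable_times_ennreal borel_measurable_indicator measurable_compose[OF _ measurable_ennreal]
            borel_measurable_abs borel_measurable_diff F cm.borel_h[OF h(1)]) simp
      have "(\<lambda>x. E (x + v)) \<in> borel_measurable borel" by (rule measurable_compose[OF _ EB]) simp
      moreover have "D \<in> borel_measurable borel"
        unfolding D_def by (intro borel_measurable_times_ennreal borel_measurable_indicator measurable_compose[OF _ measurable_ennreal]
            borel_measurable_abs borel_measurable_diff hv cm.borel_h[OF h(1)]) simp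
      moreover have "H \<in> borel_measurable borel"
        unfolding H_def by (intro borel_measurable_times_ennreal borel_measurable_indicator measurable_compose[OF _ measurable_ennreal]
            borel_measurable_abs cm.borel_dderiv[OF h(1)]) simp
      ultimately have Em: "E \<in> borel_measurable ?M" "(\<lambda>x. E (x + v)) \<in> borel_measurable ?M"
        "D \<in> borel_measurable ?M" "H \<in> borel_measurable ?M"
        using EB by (simp_all add: measurable_cong_sets[OF cm.sets_M refl])
      have DE: "(\<lambda>x. D x + E x) \<in> borel_measurable ?M" "(\<lambda>x. H x + E x) \<in> borel_measurable ?M"
        by (intro borel_measurable_add Em)+
      have "I \<le> (\<integral>\<^sup>+ x. E (x + v) + (D x + E x) \<partial>?M)"
        unfolding I_def E_def D_def by (intro nn_integral_mono tri)
      also have "\<dots> = (\<integral>\<^sup>+ x. E (x + v) \<partial>?M) + ((\<integral>\<^sup>+ x. D x \<partial>?M) + (\<integral>\<^sup>+ x. E x \<partial>?M))"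
        by (simp add: nn_integral_add Em DE)
      also have "(\<integral>\<^sup>+ x. E (x + v) \<partial>?M) = (\<integral>\<^sup>+ x. E x \<partial>?M)"
        by (rule cm.nn_integral_translate[OF v(1) EB])
      also have "(\<integral>\<^sup>+ x. D x \<partial>?M) \<le> (\<integral>\<^sup>+ x. H x \<partial>?M)"
        unfolding D_def H_def by (rule cm.nn_integral_increment_le[OF h(1) v(1)])
      also have "(\<integral>\<^sup>+ x. E x \<partial>?M) + ((\<integral>\<^sup>+ x. H x \<partial>?M) + (\<integral>\<^sup>+ x. E x \<partial>?M)) = (\<integral>\<^sup>+ x. E x + (H x + E x) \<partial>?M)"
        by (simp add: nn_integral_add Em DE)
      also have "\<dots> = (\<integral>\<^sup>+ x. indicator ?B' x * (2 * ennreal \<bar>F x - h x\<bar> + ennreal \<bar>cm.dderiv h v x\<bar>) \<partial>?M)"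
        by (intro nn_integral_cong) (auto simp: E_def H_def mult_2 ac_simps split: split_indicator)
      also have "\<dots> \<le> (\<integral>\<^sup>+ y. indicator ?B' y * ennreal (C * \<eta>) + ennreal (C / \<eta>) * ?q y \<partial>?M)"
        by (rule nn_integral_mono_AE[OF pw])
      also have "\<dots> = ennreal (C * \<eta>) * ennreal \<mu> + ennreal (C / \<eta>) * (\<integral>\<^sup>+ y. ?q y \<partial>?M)"
      proof -
        have "?q \<in> borel_measurable borel"
          by (intro borel_measurable_times_ennreal borel_measurable_indicator borel_open_flat_cell q)
        then have qM: "?q \<in> borel_measurable ?M" by (simp add: measurable_cong_sets[OF cm.sets_M refl])
        have B': "?B' \<in> sets ?M" by (simp add: cm.sets_M)
        have iM: "(\<lambda>y. indicator ?B' y * ennreal (C * \<eta>)) \<in> borel_measurable ?M"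
          by (intro borel_measurable_times_ennreal borel_measurable_indicator B') simp
        have "(\<lambda>y. ennreal (C / \<eta>) * ?q y) \<in> borel_measurable ?M"
          by (intro borel_measurable_times_ennreal qM) simp
        then have "(\<integral>\<^sup>+ y. indicator ?B' y * ennreal (C * \<eta>) + ennreal (C / \<eta>) * ?q y \<partial>?M) =
            (\<integral>\<^sup>+ y. indicator ?B' y * ennreal (C * \<eta>) \<partial>?M) + (\<integral>\<^sup>+ y. ennreal (C / \<eta>) * ?q y \<partial>?M)"
          by (rule nn_integral_add[OF iM])
        also have "(\<integral>\<^sup>+ y. indicator ?B' y * ennreal (C * \<eta>) \<partial>?M) = ennreal (C * \<eta>) * ennreal \<mu>"
          unfolding mult.commute[of "indicator _ _"] using B' by (simp only: nn_integral_cmult_indicator \<mu>(1))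
        also have "(\<integral>\<^sup>+ y. ennreal (C / \<eta>) * ?q y \<partial>?M) = ennreal (C / \<eta>) * (\<integral>\<^sup>+ y. ?q y \<partial>?M)"
          by (rule nn_integral_cmult[OF qM])
        finally show ?thesis .
      qed
      also have "\<dots> \<le> ennreal (C * \<eta>) * ennreal \<mu> + ennreal (C / \<eta>) * ennreal (\<eta>\<^sup>2)"
        by (intro add_left_mono mult_left_mono small) auto
      also have "\<dots> = ennreal (C * \<eta> * \<mu> + C / \<eta> * \<eta>\<^sup>2)"
      proof -
        have "ennreal (C * \<eta> * \<mu> + C / \<eta> * \<eta>\<^sup>2) = ennreal (C * \<eta> * \<mu>) + ennreal (C / \<eta> * \<eta>\<^sup>2)"
          using C \<eta> \<mu>(2) by (intro ennreal_plus mult_nonneg_nonneg divide_nonneg_nonneg) auto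
        also have "ennreal (C * \<eta> * \<mu>) = ennreal (C * \<eta>) * ennreal \<mu>"
          using C \<eta> \<mu>(2) by (intro ennreal_mult mult_nonneg_nonneg) auto
        also have "ennreal (C / \<eta> * \<eta>\<^sup>2) = ennreal (C / \<eta>) * ennreal (\<eta>\<^sup>2)"
          using C \<eta> by (intro ennreal_mult divide_nonneg_nonneg) auto
        finally show ?thesis by simp
      qed
      also have "C * \<eta> * \<mu> + C / \<eta> * \<eta>\<^sup>2 = C * (\<mu> + 1) * \<eta>" using \<eta> by (simp add: power2_eq_square algebra_simps)
      finally show ?thesis by (simp add: add_mono)
    qed
    have "I = 0"
    proof -
      have "(\<lambda>n. ennreal (C * (\<mu> + 1) * (1 / real (Suc n)))) \<longlonglongrightarrow> ennreal (C * (\<mu> + 1) * 0)"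
        using LIMSEQ_inverse_real_of_nat by (intro tendsto_ennrealI tendsto_mult tendsto_const) (simp add: inverse_eq_divide)
      then have "I \<le> ennreal (C * (\<mu> + 1) * 0)"
      proof (rule LIMSEQ_le_const)
        have "I \<le> ennreal (C * (\<mu> + 1) * (1 / real (Suc n)))" for n by (rule key) simp
        then show "\<exists>N. \<forall>n\<ge>N. I \<le> ennreal (C * (\<mu> + 1) * (1 / real (Suc n)))" by blast
      qed
      then show ?thesis by simp
    qed
    then have "AE x in ?M. indicator ?B x * ennreal \<bar>F (x + v) - F x\<bar> = 0"
    proof -
      have "(\<lambda>x. F (x + v)) \<in> borel_measurable borel" by (rule measurable_compose[OF _ F]) simp
      then have "(\<lambda>x. indicator ?B x * ennreal \<bar>F (x + v) - F x\<bar>) \<in> borel_measurable borel"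
        by (intro borel_measurable_times_ennreal borel_measurable_indicator measurable_compose[OF _ measurable_ennreal]
            borel_measurable_abs borel_measurable_diff F) simp_all
      then have "(\<lambda>x. indicator ?B x * ennreal \<bar>F (x + v) - F x\<bar>) \<in> borel_measurable ?M"
        by (simp add: measurable_cong_sets[OF cm.sets_M refl])
      from nn_integral_0_iff_AE[OF this] \<open>I = 0\<close> show ?thesis by (simp add: I_def)
    qed
    then have ae: "AE x in ?M. x \<in> ?B \<longrightarrow> F (x + v) = F x"
      by eventually_elim auto
    show ?thesis
    proof (rule ccontr)
      assume ne: "f (chart X (p + v)) \<noteq> f (chart X p)"
      \<comment> \<open>Half of the supposed jump: values near p and near p + v are then too far
        apart to coincide, although \<open>F (x + v) = F x\<close> holds at almost every x of a ball
        of positive measure.\<close>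
      define d where "d = \<bar>f (chart X (p + v)) - f (chart X p)\<bar> / 2"
      have d: "d > 0" using ne by (simp add: d_def)
      have pvO: "p + v \<in> ?O" using R v r by (intro R(2)) auto
      obtain k1 where k1: "k1 > 0" "\<And>y. y \<in> ?O \<Longrightarrow> dist y p < k1 \<Longrightarrow> dist (f (chart X y)) (f (chart X p)) < d"
        using contF p d unfolding continuous_on_iff by metis
      obtain k2 where k2: "k2 > 0" "\<And>y. y \<in> ?O \<Longrightarrow> dist y (p + v) < k2 \<Longrightarrow> dist (f (chart X y)) (f (chart X (p + v))) < d"
        using contF pvO d unfolding continuous_on_iff by metis
      define k where "k = min r (min k1 k2)"
      have k: "k > 0" using r k1 k2 by (simp add: k_def)
      have "AE x in ?M. x \<notin> ball p k"
        using ae cm.AE_in_affine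
      proof eventually_elim
        case (elim x)
        show ?case
        proof
          assume x: "x \<in> ball p k"
          have xp: "x - p \<in> ?W" using subspace_diff[OF W elim(2) po] by simp
          have n: "norm (x - p) < r" "norm (x - p) < k1" "norm (x - p) < k2"
            using x by (auto simp: k_def dist_norm norm_minus_commute)
          have xO: "x \<in> ?O" using R(2)[OF xp] n(1) r by simp
          have "norm ((x - p) + v) < R" using norm_triangle_ineq[of "x - p" v] n(1) v(2) r by linarith
          then have "p + ((x - p) + v) \<in> ?O" by (intro R(2) subspace_add W xp v(1))
          then have xvO: "x + v \<in> ?O" by simp
          have "dist (f (chart X x)) (f (chart X p)) < d" using k1(2)[OF xO] n(2) by (simp add: dist_norm)
          moreover have "dist (f (chart X (x + v))) (f (chart X (p + v))) < d" using k2(2)[OF xvO] n(3) by (simp add: dist_norm)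
          moreover have "f (chart X (x + v)) = f (chart X x)"
            using elim(1) x xO xvO by (simp add: F_def k_def)
          ultimately have "dist (f (chart X x)) (f (chart X (p + v))) + dist (f (chart X x)) (f (chart X p)) < d + d"
            by (intro add_strict_mono) simp_all
          moreover have "dist (f (chart X (p + v))) (f (chart X p)) = d + d" by (simp add: d_def dist_real_def)
          ultimately show False
            using dist_triangle3[of "f (chart X (p + v))" "f (chart X p)" "f (chart X x)"] by simp
        qed
      qed
      then have "emeasure ?M (ball p k) = 0"
        using AE_iff_measurable[of "ball p k" ?M "\<lambda>x. x \<notin> ball p k"] by (auto simp: cm.sets_M ball_def)
      then show False using cm.emeasure_ball_pos[OF po k] by simp
    qed
  qed
  have "p + v \<in> ?O" if "v \<in> ?W" "norm v < r" for v using that r R(1) by (intro R(2)) auto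
  with eq0 r(1) show ?thesis by blast
qed

text \<open>The open cell is convex, hence connected, and local constancy makes the function
  constant there; continuity extends the value to the closure, which is the whole cell.\<close>

lemma zero_gradient_constant_on_cell:
  assumes s: "s \<in> max_simplices X" and f: "continuous_on UNIV f" and grad: "W12_grad X (open_cell s) f V"
    and V0: "AE x in vol X. V x = 0" and Vm: "V \<in> borel_measurable (vol X)"
  shows "f constant_on cell X s"
proof -
  note s' = max_simplex[OF s]
  let ?g = "\<lambda>y. f (chart X y)"
  have "?g constant_on open_flat_cell s"
  proof (rule locally_constant_imp_constant)
    show "connected (open_flat_cell s)" by (intro convex_connected convex_rel_interior convex_flat_cell)
    fix p assume p: "p \<in> open_flat_cell s"
    obtain r where r: "r > 0" "\<forall>v\<in>directions X s. norm v < r \<longrightarrow> p + v \<in> open_flat_cell s \<and> ?g (p + v) = ?g p"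
      using zero_gradient_locally_constant[OF s f grad V0 Vm p] by blast
    show "\<exists>T. openin (top_of_set (open_flat_cell s)) T \<and> p \<in> T \<and> (\<forall>x\<in>T. ?g x = ?g p)"
    proof (intro exI conjI ballI)
      show "openin (top_of_set (open_flat_cell s)) (open_flat_cell s \<inter> ball p r)" by (rule openin_open_Int) simp
      show "p \<in> open_flat_cell s \<inter> ball p r" using p r(1) by simp
      fix x assume x: "x \<in> open_flat_cell s \<inter> ball p r"
      have "x - p \<in> directions X s" using x p open_flat_cell_subset by (intro flat_cell_diff) auto
      moreover have "norm (x - p) < r" using x by (simp add: dist_norm norm_minus_commute)
      ultimately have "?g (p + (x - p)) = ?g p" using r(2) by blast
      then show "?g x = ?g p" by simp
    qed
  qed
  then obtain c where c: "\<And>y. y \<in> open_flat_cell s \<Longrightarrow> ?g y = c" by (auto simp: constant_on_def)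
  have cl: "closure (open_flat_cell s) = flat_cell X s"
    using convex_closure_rel_interior[OF convex_flat_cell] compact_imp_closed[OF compact_flat_cell[OF s']] by simp
  have "continuous_on (closure (open_flat_cell s)) ?g"
    unfolding cl using flat_cell_subset[OF s']
    by (intro continuous_on_compose2[OF f] continuous_on_subset[OF continuous_chart]) auto
  then have "?g y = c" if "y \<in> flat_cell X s" for y
    using continuous_constant_on_closure[of "open_flat_cell s" ?g c y] c that unfolding cl by blast
  then show ?thesis unfolding constant_on_def cell_eq[OF s'] by auto
qed

end

theorem theorem1p5:
  fixes X :: "('v, 'e::euclidean_space, 'a::metric_space) rpoly"
    and n :: nat and f :: "'a \<Rightarrow> real" and grad_f :: "'a \<Rightarrow> 'e"
  assumes "riemannian_pseudomanifold n X"
    and "boundary X = {}"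
    and "two_parabolic X UNIV"
    and "f \<in> W12_loc X"
    and "W12_loc_grad X f grad_f"
    and "continuous_on UNIV f"
    and "weakly_subharmonic X f grad_f"
    and "Lp_norm_pow X 1 grad_f < \<infinity>"
    and "Lp_norm_pow X 2 grad_f < \<infinity>"
  shows "f constant_on UNIV"
proof -
  have "riemannian_polyhedron X" using assms(1) by (simp add: riemannian_pseudomanifold_def)
  then interpret riem_poly X by unfold_locales (simp_all add: riemannian_polyhedron_def)
  have zero: "AE x in vol X. grad_f x = 0" by (rule gradient_zero[OF assms(3,5,7,9)])
  have meas: "grad_f \<in> borel_measurable (vol X)" using assms(5) by (simp add: W12_loc_grad_def)
  show ?thesis
  proof (rule constant_if_constant_on_cells)
    fix s assume s: "s \<in> max_simplices X"
    have "W12_grad X (open_cell s) f grad_f"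
      using assms(5) rel_compact_open_cell[OF s] by (simp add: W12_loc_grad_def)
    from zero_gradient_constant_on_cell[OF s assms(6) this zero meas] show "f constant_on cell X s" .
  qed
qed

end
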